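(* Assume that $u\in H^l(\Omega)$ is the solution of the problem $-\nabla\cdot(\alpha\nabla u)+\beta\cdot\nabla u+\gamma u=f$ in $\Omega$, $u=0$ on $\partial\Omega$, and let $u_h\in V_h^0$ be the solution of the $C^1$ Petrov-Galerkin method $a(u_h,v_h)=(f,v_h)$ for all $v_h\in W_h$. Then, for every positive integer $r\le\min(l-1,k+1)$, $$\|u-u_h\|_0+h\|u-u_h\|_1+h^2\|u-u_h\|_2\lesssim h^r\|u\|_{r+1}.$$
   Context: $\Omega=(a,b)\times(c,d)$; $\alpha>0$, $\beta=(\beta_1,\beta_2)\in\mathbb R^2$, $\gamma\ge 0$ are constants, $f$ is a given real-valued function. Given $a=x_0<\dots<x_M=b$ and $c=y_0<\dots<y_N=d$, $\mathcal T_h$ is the set of rectangles $\tau_{i,j}=[x_{i-1},x_i]\times[y_{j-1},y_j]$, $1\le i\le M$, $1\le j\le N$; $h$ is the maximal and $h_{\min}$ the minimal edge length; the meshes are quasi-uniform: $h\le C_q h_{\min}$ with a fixed constant $C_q$. $k\ge 3$ is a fixed integer, $\mathbb P_r$ denotes polynomials of degree at most $r$ in one variable and $\mathbb Q_r=\mathbb P_r(x)\otimes\mathbb P_r(y)$. $V_h=\{v\in C^1(\Omega): v|_\tau\in\mathbb Q_k\ \forall\tau\in\mathcal T_h\}$, $V_h^0=\{v\in V_h: v|_{\partial\Omega}=0\}$, $W_h=\{v\in L^2(\Omega): v|_\tau\in\mathbb Q_{k-2}\ \forall\tau\in\mathcal T_h\}$. $(w,v)=\sum_{\tau}\int_\tau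 wv\,dx\,dy$ and $a(w,v)=(-\nabla\cdot(\alpha\nabla w)+\beta\cdot\nabla w+\gamma w,\,v)$, second derivatives being taken elementwise. The scheme is uniquely solvable for sufficiently small $h$, and $h$ is assumed sufficiently small in this sense. $\|\cdot\|_m$ is the $H^m(\Omega)$ norm. $A\lesssim B$ means $A\le CB$ with $C$ independent of the mesh size $h$ (and of $u$). *)

theory Defs
  imports "HOL-Analysis.Analysis"
begin

definition partial_dx :: "(real \<times> real \<Rightarrow> real) \<Rightarrow> real \<times> real \<Rightarrow> real" where
  "partial_dx f p = frechet_derivative f (at p) (1, 0)"

definition partial_dy :: "(real \<times> real \<Rightarrow> real) \<Rightarrow> real \<times> real \<Rightarrow> real" where
  "partial_dy f p = frechet_derivative f (at p) (0, 1)"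

text \<open>The class $C^n(S)$ for an open set $S$.\<close>

primrec cont_diff_on :: "nat \<Rightarrow> (real \<times> real) set \<Rightarrow> (real \<times> real \<Rightarrow> real) \<Rightarrow> bool" where
  "cont_diff_on 0 S f \<longleftrightarrow> continuous_on S f"
| "cont_diff_on (Suc n) S f \<longleftrightarrow>
     (\<forall>p\<in>S. f differentiable (at p)) \<and>
     cont_diff_on n S (partial_dx f) \<and> cont_diff_on n S (partial_dy f)"

definition test_function :: "(real \<times> real) set \<Rightarrow> (real \<times> real \<Rightarrow> real) \<Rightarrow> bool" where
  "test_function \<Omega> \<phi> \<longleftrightarrow>
     (\<forall>n. cont_diff_on n UNIV \<phi>) \<and>
     (\<exists>K. compact K \<and> K \<subseteq> \<Omega> \<and> (\<forall>p. p \<notin> K \<longrightarrow> \<phi> p = 0))"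

text \<open>Elements of $L^2(\Omega)$ and $H^m(\Omega)$ are represented by functions on the whole plane;
  only their values almost everywhere in $\Omega$ matter.\<close>

definition L2 :: "(real \<times> real) set \<Rightarrow> (real \<times> real \<Rightarrow> real) set" where
  "L2 \<Omega> = {u. u \<in> borel_measurable (lebesgue_on \<Omega>) \<and>
              integrable (lebesgue_on \<Omega>) (\<lambda>p. (u p)\<^sup>2)}"

definition has_weak_pd ::
  "(real \<times> real) set \<Rightarrow> nat \<Rightarrow> nat \<Rightarrow> (real \<times> real \<Rightarrow> real) \<Rightarrow> (real \<times> real \<Rightarrow> real) \<Rightarrow> bool" where
  "has_weak_pd \<Omega> i j u g \<longleftrightarrow>
     u \<in> L2 \<Omega> \<and> g \<in> L2 \<Omega> \<and>
     (\<forall>\<phi>. test_function \<Omega> \<phi> \<longrightarrow>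
        (\<integral>p. u p * (partial_dx ^^ i) ((partial_dy ^^ j) \<phi>) p \<partial>lebesgue_on \<Omega>)
          = (-1) ^ (i + j) * (\<integral>p. g p * \<phi> p \<partial>lebesgue_on \<Omega>))"

text \<open>A representative of the weak derivative in $L^2$, unique almost everywhere in $\Omega$ if it
  exists, and unspecified otherwise.\<close>

definition weak_pd ::
  "(real \<times> real) set \<Rightarrow> nat \<Rightarrow> nat \<Rightarrow> (real \<times> real \<Rightarrow> real) \<Rightarrow> (real \<times> real \<Rightarrow> real)" where
  "weak_pd \<Omega> i j u = (SOME g. has_weak_pd \<Omega> i j u g)"

definition sobolev :: "(real \<times> real) set \<Rightarrow> nat \<Rightarrow> (real \<times> real \<Rightarrow> real) set" where
  "sobolev \<Omega> m = {u \<in> L2 \<Omega>. \<forall>i j. i + j \<le> m \<longrightarrow> (\<exists>g. has_weak_pd \<Omega> i j u g)}"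

definition sobolev_norm :: "(real \<times> real) set \<Rightarrow> nat \<Rightarrow> (real \<times> real \<Rightarrow> real) \<Rightarrow> real" where
  "sobolev_norm \<Omega> m u =
     sqrt (\<Sum>(i, j)\<in>{(i, j). i + j \<le> m}. \<integral>p. (weak_pd \<Omega> i j u p)\<^sup>2 \<partial>lebesgue_on \<Omega>)"

text \<open>$H^1_0(\Omega)$: vanishing boundary values in the sense of traces.\<close>

definition sobolev10 :: "(real \<times> real) set \<Rightarrow> (real \<times> real \<Rightarrow> real) set" where
  "sobolev10 \<Omega> = {u \<in> sobolev \<Omega> 1.
     \<forall>\<epsilon>>0. \<exists>\<phi>. test_function \<Omega> \<phi> \<and> sobolev_norm \<Omega> 1 (\<lambda>p. u p - \<phi> p) < \<epsilon>}"

definition rect :: "real \<Rightarrow> real \<Rightarrow> real \<Rightarrow> real \<Rightarrow> (real \<times> real) set" where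
  "rect a b c d = {a<..<b} \<times> {c<..<d}"

text \<open>The operator $w \mapsto -\nabla\cdot(\alpha\nabla w)+\beta\cdot\nabla w+\gamma w$, for a given
  meaning \<open>Dx\<close>, \<open>Dy\<close> of the first order partial derivatives (weak for the continuous problem,
  classical inside each element for the scheme).\<close>

definition elliptic_op ::
  "((real \<times> real \<Rightarrow> real) \<Rightarrow> real \<times> real \<Rightarrow> real) \<Rightarrow> ((real \<times> real \<Rightarrow> real) \<Rightarrow> real \<times> real \<Rightarrow> real) \<Rightarrow>
   real \<Rightarrow> real \<times> real \<Rightarrow> real \<Rightarrow> (real \<times> real \<Rightarrow> real) \<Rightarrow> real \<times> real \<Rightarrow> real" where
  "elliptic_op Dx Dy \<alpha> \<beta> \<gamma> w p =
     - (Dx (\<lambda>q. \<alpha> * Dx w q) p + Dy (\<lambda>q. \<alpha> * Dy w q) p)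
     + (fst \<beta> * Dx w p + snd \<beta> * Dy w p) + \<gamma> * w p"

text \<open>Strong solution; it is meant for \<open>u\<close> in $H^l(\Omega)$ with $l \ge 2$, where all the weak
  derivatives involved exist.\<close>

definition solves_bvp ::
  "(real \<times> real) set \<Rightarrow> real \<Rightarrow> real \<times> real \<Rightarrow> real \<Rightarrow>
   (real \<times> real \<Rightarrow> real) \<Rightarrow> (real \<times> real \<Rightarrow> real) \<Rightarrow> bool" where
  "solves_bvp \<Omega> \<alpha> \<beta> \<gamma> f u \<longleftrightarrow>
     (AE p in lebesgue_on \<Omega>. elliptic_op (weak_pd \<Omega> 1 0) (weak_pd \<Omega> 0 1) \<alpha> \<beta> \<gamma> u p = f p) \<and>
     u \<in> sobolev10 \<Omega>"

text \<open>\<open>Mesh M x N y\<close> has the grid lines \<open>x 0, \<dots>, x M\<close> and \<open>y 0, \<dots>, y N\<close>.\<close>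

datatype mesh = Mesh (nx: nat) (xpt: "nat \<Rightarrow> real") (ny: nat) (ypt: "nat \<Rightarrow> real")

definition mesh_of :: "real \<Rightarrow> real \<Rightarrow> real \<Rightarrow> real \<Rightarrow> mesh \<Rightarrow> bool" where
  "mesh_of a b c d T \<longleftrightarrow>
     xpt T 0 = a \<and> xpt T (nx T) = b \<and> (\<forall>i\<in>{1..nx T}. xpt T (i - 1) < xpt T i) \<and>
     ypt T 0 = c \<and> ypt T (ny T) = d \<and> (\<forall>j\<in>{1..ny T}. ypt T (j - 1) < ypt T j)"

definition cells :: "mesh \<Rightarrow> (real \<times> real) set set" where
  "cells T = {{xpt T (i - 1)..xpt T i} \<times> {ypt T (j - 1)..ypt T j} | i j.
                i \<in> {1..nx T} \<and> j \<in> {1..ny T}}"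

definition edge_lengths :: "mesh \<Rightarrow> real set" where
  "edge_lengths T = (\<lambda>i. xpt T i - xpt T (i - 1)) ` {1..nx T}
                  \<union> (\<lambda>j. ypt T j - ypt T (j - 1)) ` {1..ny T}"

definition mesh_size :: "mesh \<Rightarrow> real" where
  "mesh_size T = Max (edge_lengths T)"

definition min_edge :: "mesh \<Rightarrow> real" where
  "min_edge T = Min (edge_lengths T)"

definition quasi_uniform :: "real \<Rightarrow> mesh \<Rightarrow> bool" where
  "quasi_uniform Cq T \<longleftrightarrow> mesh_size T \<le> Cq * min_edge T"

definition Qpoly :: "nat \<Rightarrow> (real \<times> real \<Rightarrow> real) set" where
  "Qpoly r = {q. \<exists>c :: nat \<Rightarrow> nat \<Rightarrow> real. \<forall>x y. q (x, y) = (\<Sum>i\<le>r. \<Sum>j\<le>r. c i j * x ^ i * y ^ j)}"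

text \<open>The trial functions are genuine functions on the closure of $\Omega$, so they agree with a
  polynomial at every point of each closed element.\<close>

definition Vh :: "(real \<times> real) set \<Rightarrow> mesh \<Rightarrow> nat \<Rightarrow> (real \<times> real \<Rightarrow> real) set" where
  "Vh \<Omega> T k = {v. cont_diff_on 1 \<Omega> v \<and> (\<forall>\<tau>\<in>cells T. \<exists>q\<in>Qpoly k. \<forall>p\<in>\<tau>. v p = q p)}"

definition Vh0 :: "(real \<times> real) set \<Rightarrow> mesh \<Rightarrow> nat \<Rightarrow> (real \<times> real \<Rightarrow> real) set" where
  "Vh0 \<Omega> T k = {v \<in> Vh \<Omega> T k. \<forall>p\<in>frontier \<Omega>. v p = 0}"

text \<open>The test functions may jump across element edges. They are $L^2$ classes, so they agree with
  a polynomial almost everywhere in each element.\<close>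

definition Wh :: "(real \<times> real) set \<Rightarrow> mesh \<Rightarrow> nat \<Rightarrow> (real \<times> real \<Rightarrow> real) set" where
  "Wh \<Omega> T k = {v \<in> L2 \<Omega>. \<forall>\<tau>\<in>cells T. \<exists>q\<in>Qpoly (k - 2). AE p in lebesgue_on \<tau>. v p = q p}"

definition inner_h :: "mesh \<Rightarrow> (real \<times> real \<Rightarrow> real) \<Rightarrow> (real \<times> real \<Rightarrow> real) \<Rightarrow> real" where
  "inner_h T w v = (\<Sum>\<tau>\<in>cells T. \<integral>p. w p * v p \<partial>lebesgue_on \<tau>)"

text \<open>For \<open>w\<close> in \<open>Vh\<close> the classical second derivatives exist in the interior of each element, hence
  almost everywhere.\<close>

definition a_form ::
  "mesh \<Rightarrow> real \<Rightarrow> real \<times> real \<Rightarrow> real \<Rightarrow> (real \<times> real \<Rightarrow> real) \<Rightarrow> (real \<times> real \<Rightarrow> real) \<Rightarrow> real" where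
  "a_form T \<alpha> \<beta> \<gamma> w v = inner_h T (elliptic_op partial_dx partial_dy \<alpha> \<beta> \<gamma> w) v"

definition solves_pg ::
  "(real \<times> real) set \<Rightarrow> mesh \<Rightarrow> nat \<Rightarrow> real \<Rightarrow> real \<times> real \<Rightarrow> real \<Rightarrow>
   (real \<times> real \<Rightarrow> real) \<Rightarrow> (real \<times> real \<Rightarrow> real) \<Rightarrow> bool" where
  "solves_pg \<Omega> T k \<alpha> \<beta> \<gamma> f uh \<longleftrightarrow>
     uh \<in> Vh0 \<Omega> T k \<and> (\<forall>vh\<in>Wh \<Omega> T k. a_form T \<alpha> \<beta> \<gamma> uh vh = inner_h T f vh)"

text \<open>Uniqueness is equality on the closure of $\Omega$, as the values elsewhere are irrelevant.\<close>

definition uniquely_solvable ::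
  "(real \<times> real) set \<Rightarrow> mesh \<Rightarrow> nat \<Rightarrow> real \<Rightarrow> real \<times> real \<Rightarrow> real \<Rightarrow> bool" where
  "uniquely_solvable \<Omega> T k \<alpha> \<beta> \<gamma> \<longleftrightarrow>
     (\<forall>f\<in>L2 \<Omega>. \<exists>uh. solves_pg \<Omega> T k \<alpha> \<beta> \<gamma> f uh \<and>
        (\<forall>wh. solves_pg \<Omega> T k \<alpha> \<beta> \<gamma> f wh \<longrightarrow> (\<forall>p\<in>closure \<Omega>. wh p = uh p)))"

end

theory Submission
 imports Defs "HOL-Computational_Algebra.Polynomial"
begin

text \<open>
  A function $w$ vanishing on the boundary is recovered from $w_{xx}$ or $w_{yy}$ by the Green operators of $v'' = f$
  in one variable, and $V_h^0$ consists of the $w$ whose $z = w_{xxyy}$ lies in $W_h$. Let $P$ be the $L^2$ projection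
  onto $W_h$. For such $w$ the cross term $(P w_{xx}, P w_{yy})$ equals $\|w_{xy}\|^2$, and inverse estimates bound
  $\|w_{xx}\|$ by $\|P w_{xx}\|$; hence $\|P \Delta w\|$ controls all second derivatives. Testing with $P w$ instead
  bounds the first derivatives up to $h |w|_2$, which absorbs the lower order terms on fine meshes. For the remaining
  meshes the number of cells is bounded and unique solvability gives a uniform constant by compactness.
  Comparing $u_h$ with the $w$ given by $z = P u_{xxyy}$ (with $w = 0$ if $r \<le> 2$) yields the $H^2$ bound. The energy
  identity for $u - u_h$ gains one power of $h$, and the discrete solution of the adjoint problem another one.
\<close>


text \<open>The obstacle is that trial and test space differ: a trial function is not in $W_h$, and
  its second derivatives are piecewise polynomials of the right degree in one variable only. What
  helps is the tensor structure of a rectangle: operators acting in different variables commute, and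
  P changes $w_{xx}$ only in $y$. Therefore $u$, $u_h$ and their derivatives are handled as images
  of second or fourth derivatives under bounded kernels, and nearly every estimate is one in a
  single variable, integrated over parallel lines. No elliptic regularity enters. The dual problem
  is posed in the discrete space, where stability itself bounds the second derivatives. The function
  $u_{xxyy}$ takes four of the $r + 1$ derivatives and leaves order $r - 3$ for its projection;
  integrating the projection error back once gains the power that leads to $H^{r-2}$ for second
  derivatives.\<close>

type_synonym fun2 = "real \<times> real => real"

abbreviation "is_borel f \<equiv> f \<in> borel_measurable borel"

section \<open>Square integrable functions and projections\<close>

text \<open>Functions are kept instead of classes, so \<open>nrm\<close> is only a seminorm and many
  identities between operators below hold almost everywhere.\<close>

definition sqint :: "'a measure => ('a => real) set" where
 "sqint M = {f. f \<in> borel_measurable M \<and> integrable M (%x. (f x)\<^sup>2)}"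

definition ip :: "'a measure => ('a => real) => ('a => real) => real" where
 "ip M f g = (LINT x|M. f x*g x)"

definition nrm :: "'a measure => ('a => real) => real" where
 "nrm M f = sqrt (LINT x|M. (f x)\<^sup>2)"

lemma sqint_measurable [measurable_dest]: "f \<in> sqint M ==> f \<in> borel_measurable M"
 by (simp add: sqint_def)

lemma sqintI: "f \<in> borel_measurable M ==> integrable M (%x. (f x)\<^sup>2) ==> f \<in> sqint M"
 by (simp add: sqint_def)

lemma sqint_square: "f \<in> sqint M ==> integrable M (%x. (f x)\<^sup>2)"
 by (simp add: sqint_def)

lemma sqint_mult:
 assumes "f \<in> sqint M" "g \<in> sqint M"
 shows "integrable M (%x. f x*g x)"
proof (rule Bochner_Integration.integrable_bound)
 show "integrable M (%x. (f x)\<^sup>2 + (g x)\<^sup>2)"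
  using assms by (auto intro: sqint_square)
 show "(%x. f x*g x) \<in> borel_measurable M"
  using assms by measurable
 have "\<bar>s*t\<bar> <= s^2 + t^2" for s t :: real
 proof -
  have "0 <= (\<bar>s\<bar> - \<bar>t\<bar>)^2" by simp
  then have "2*(\<bar>s\<bar>*\<bar>t\<bar>) <= s^2 + t^2" by (simp add: power2_diff)
  moreover have "0 <= \<bar>s\<bar>*\<bar>t\<bar>" by simp
  ultimately show ?thesis unfolding abs_mult by linarith
 qed
 then show "AE x in M. norm (f x*g x) <= norm ((f x)\<^sup>2 + (g x)\<^sup>2)"
  by simp
qed

lemma sqint_cmult [intro]: "f \<in> sqint M ==> (%x. c*f x) \<in> sqint M"
 by (auto simp: sqint_def power_mult_distrib)

lemma sqint_add [intro]:
 assumes "f \<in> sqint M" "g \<in> sqint M"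
 shows "(%x. f x + g x) \<in> sqint M"
proof (rule sqintI)
 show "(%x. f x + g x) \<in> borel_measurable M" using assms by measurable
 have "integrable M (%x. (f x)\<^sup>2 + (g x)\<^sup>2 + 2*(f x*g x))"
  by (intro Bochner_Integration.integrable_add integrable_mult_right sqint_square sqint_mult assms)
 then show "integrable M (%x. (f x + g x)\<^sup>2)"
  by (simp add: power2_sum mult.assoc)
qed

lemma sqint_uminus [intro]: "f \<in> sqint M ==> (%x. - f x) \<in> sqint M"
 by (auto simp: sqint_def)

lemma sqint_diff [intro]:
 assumes "f \<in> sqint M" "g \<in> sqint M"
 shows "(%x. f x - g x) \<in> sqint M"
 using sqint_add[OF assms(1) sqint_uminus[OF assms(2)]] by simp

lemma sqint_zero [simp, intro]: "(%x. 0) \<in> sqint M"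
 by (simp add: sqint_def)

lemma sqint_sum [intro]: "(!!i. i \<in> I ==> f i \<in> sqint M) ==> (%x. \<Sum>i\<in>I. f i x) \<in> sqint M"
 by (induction I rule: infinite_finite_induct) auto

lemma sqint_cong_AE:
 assumes "f \<in> sqint M" "g \<in> borel_measurable M" "AE x in M. f x = g x"
 shows "g \<in> sqint M"
proof (rule sqintI[OF assms(2)])
 have "AE x in M. (f x)\<^sup>2 = (g x)\<^sup>2" using assms(3) by eventually_elim simp
 then show "integrable M (%x. (g x)\<^sup>2)"
  using sqint_square[OF assms(1)] assms by (subst integrable_cong_AE[symmetric]) (auto simp: sqint_def)
qed

lemma (in finite_measure) sqint_int:
 assumes "f \<in> sqint M" shows "integrable M f"
proof -
 have "(%x. 1) \<in> sqint M" by (simp add: sqint_def)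
 from sqint_mult[OF assms this] show ?thesis by simp
qed

lemma (in finite_measure) sqint_bounded:
 assumes "f \<in> borel_measurable M" "AE x in M. \<bar>f x\<bar> <= B"
 shows "f \<in> sqint M"
proof (rule sqintI[OF assms(1)])
 have "AE x in M. norm ((f x)\<^sup>2) <= B^2"
  using assms(2) by eventually_elim (simp add: abs_le_square_iff[symmetric])
 then show "integrable M (%x. (f x)\<^sup>2)"
  using assms(1) by (intro integrable_const_bound) auto
qed

lemma ip_commute: "ip M f g = ip M g f"
 by (simp add: ip_def mult.commute)

lemma ip_add_left:
 "f \<in> sqint M ==> g \<in> sqint M ==> h \<in> sqint M ==> ip M (%x. f x + g x) h = ip M f h + ip M g h"
 by (simp add: ip_def distrib_right sqint_mult)

lemma ip_diff_left:
 "f \<in> sqint M ==> g \<in> sqint M ==> h \<in> sqint M ==> ip M (%x. f x - g x) h = ip M f h - ip M g h"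
 by (simp add: ip_def left_diff_distrib sqint_mult)

lemma ip_add_right:
 "f \<in> sqint M ==> g \<in> sqint M ==> h \<in> sqint M ==> ip M h (%x. f x + g x) = ip M h f + ip M h g"
 by (simp add: ip_def distrib_left sqint_mult)

lemma ip_diff_right:
 "f \<in> sqint M ==> g \<in> sqint M ==> h \<in> sqint M ==> ip M h (%x. f x - g x) = ip M h f - ip M h g"
 by (simp add: ip_def right_diff_distrib sqint_mult)

lemma ip_cmult_left: "ip M (%x. c*f x) g = c*ip M f g"
 by (simp add: ip_def mult.assoc)

lemma ip_cmult_right: "ip M f (%x. c*g x) = c*ip M f g"
 by (simp add: ip_def mult.left_commute)

lemma ip_zero_left [simp]: "ip M (%x. 0) g = 0"
 by (simp add: ip_def)

lemma ip_sum_left: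
 assumes "!!i. i \<in> I ==> f i \<in> sqint M" "g \<in> sqint M"
 shows "ip M (%x. \<Sum>i\<in>I. f i x) g = (\<Sum>i\<in>I. ip M (f i) g)"
 unfolding ip_def sum_distrib_right
 by (rule Bochner_Integration.integral_sum) (use assms in "auto intro: sqint_mult")

lemma ip_cong_AE:
 assumes "AE x in M. f x = f' x" "AE x in M. g x = g' x"
  and "f \<in> borel_measurable M" "f' \<in> borel_measurable M"
  and "g \<in> borel_measurable M" "g' \<in> borel_measurable M"
 shows "ip M f g = ip M f' g'"
 unfolding ip_def by (rule integral_cong_AE) (use assms in auto)

lemma nrm_nonneg [simp]: "0 <= nrm M f"
 by (simp add: nrm_def)

lemma nrm_zero [simp]: "nrm M (%x. 0) = 0"
 by (simp add: nrm_def)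

lemma nrm_square: "(nrm M f)\<^sup>2 = ip M f f"
 by (simp add: nrm_def ip_def power2_eq_square)

lemma nrm_square_integral: "(nrm M f)\<^sup>2 = (LINT x|M. (f x)\<^sup>2)"
 by (simp add: nrm_def)

lemma nrm_uminus [simp]: "nrm M (%x. - f x) = nrm M f"
 by (simp add: nrm_def)

lemma nrm_cmult: "nrm M (%x. c*f x) = \<bar>c\<bar>*nrm M f"
 by (simp add: nrm_def power_mult_distrib real_sqrt_mult)

lemma nrm_cong_AE:
 assumes "AE x in M. f x = g x" "f \<in> borel_measurable M" "g \<in> borel_measurable M"
 shows "nrm M f = nrm M g"
 unfolding nrm_def by (rule arg_cong[where f=sqrt], rule integral_cong_AE) (use assms in auto)

lemma ip_Cauchy_Schwarz:
 assumes f: "f \<in> sqint M" and g: "g \<in> sqint M"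
 shows "\<bar>ip M f g\<bar> <= nrm M f*nrm M g"
proof -
 let ?A = "ip M f f" and ?B = "ip M f g" and ?C = "ip M g g"
 \<comment> \<open>The quadratic form in (t, s) given by the squared norm of t f - s g; two choices
   of (t, s) give the claim.\<close>
 have pos: "0 <= t^2 * ?A - 2*t * s * ?B + s^2 * ?C" for s t
 proof -
  have "0 <= (nrm M (%x. t*f x - s*g x))^2" by simp
  also have "... = ip M (%x. t*f x - s*g x) (%x. t*f x - s*g x)"
   by (rule nrm_square)
  also have "... = t*(t * ?A - s * ?B) - s*(t*ip M g f - s * ?C)"
   using f g by (simp add: ip_diff_left ip_diff_right ip_cmult_left ip_cmult_right sqint_cmult
     sqint_diff)
  finally show ?thesis by (simp add: ip_commute[of M g f] algebra_simps power2_eq_square)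
 qed
 have A: "0 <= ?A" and C: "0 <= ?C" by (metis nrm_square zero_le_power2)+
 have "?B^2 <= ?A * ?C"
 proof (cases "?A = 0")
  case True
  have "?B = 0"
  proof (rule ccontr)
   assume "?B \<noteq> 0"
   \<comment> \<open>With \<open>?A = 0\<close> and s = 1 the form is - 2 t \<open>?B\<close> +
     \<open>?C\<close>, and this t gives it the value -1.\<close>
   then show False
    using pos[of "(?C + 1)/(2 * ?B)" 1] True by (simp add: field_simps)
  qed
  then show ?thesis using True by simp
 next
  case False
  with A have "0 < ?A" by simp
  have "0 <= ?A*(?A * ?C - ?B^2)"
   using pos[of ?B ?A] by (simp add: algebra_simps power2_eq_square)
  then show ?thesis using \<open>0 < ?A\<close> by (simp add: zero_le_mult_iff)
 qed
 then have "\<bar>?B\<bar>\<^sup>2 <= (nrm M f*nrm M g)\<^sup>2"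
  by (simp add: power_mult_distrib nrm_square)
 then show ?thesis by (rule power2_le_imp_le) simp
qed

lemma ip_le_nrm: "f \<in> sqint M ==> g \<in> sqint M ==> ip M f g <= nrm M f*nrm M g"
 using ip_Cauchy_Schwarz[of f M g] by linarith

lemma nrm_add_square:
 assumes "f \<in> sqint M" "g \<in> sqint M"
 shows "(nrm M (%x. f x + g x))^2 = (nrm M f)\<^sup>2 + (nrm M g)\<^sup>2 + 2*ip M f g"
 using assms
 by (simp add: nrm_square ip_add_left ip_add_right sqint_add ip_commute[of M g f])

lemma nrm_triangle:
 assumes "f \<in> sqint M" "g \<in> sqint M"
 shows "nrm M (%x. f x + g x) <= nrm M f + nrm M g"
proof (rule power2_le_imp_le)
 show "(nrm M (%x. f x + g x))^2 <= (nrm M f + nrm M g)\<^sup>2"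
  using nrm_add_square[OF assms] ip_le_nrm[OF assms] by (simp add: power2_sum)
qed simp

lemma nrm_diff_triangle:
 assumes "f \<in> sqint M" "g \<in> sqint M"
 shows "nrm M (%x. f x - g x) <= nrm M f + nrm M g"
 using nrm_triangle[OF assms(1) sqint_uminus[OF assms(2)]] by simp

lemma nrm_mono:
 assumes "f \<in> borel_measurable M" "g \<in> sqint M" "AE x in M. \<bar>f x\<bar> <= \<bar>g x\<bar>"
 shows "f \<in> sqint M" "nrm M f <= nrm M g"
proof -
 have le: "AE x in M. (f x)\<^sup>2 <= (g x)\<^sup>2"
  using assms(3) by eventually_elim (simp add: abs_le_square_iff)
 have int: "integrable M (%x. (f x)\<^sup>2)"
  by (rule Bochner_Integration.integrable_bound[OF sqint_square[OF assms(2)]])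
    (use assms(1) le in auto)
 then show "f \<in> sqint M" using assms(1) by (simp add: sqint_def)
 show "nrm M f <= nrm M g"
  unfolding nrm_def
  by (intro real_sqrt_le_mono integral_mono_AE int sqint_square[OF assms(2)] le)
qed

lemma nrm_eq_0_iff:
 assumes "f \<in> sqint M"
 shows "nrm M f = 0 \<longleftrightarrow> (AE x in M. f x = 0)"
 using integral_nonneg_eq_0_iff_AE[OF sqint_square[OF assms]] by (simp add: nrm_def)

section \<open>Orthogonal projection onto the span of a finite orthonormal family\<close>

locale orthonormal_family =
 fixes M :: "'a measure" and J :: "'i set" and e :: "'i => 'a => real"
 assumes finite_J: "finite J"
  and e_sqint [simp]: "!!i. i \<in> J ==> e i \<in> sqint M"
  and ip_e: "!!i j. i \<in> J ==> j \<in> J ==> ip M (e i) (e j) = (if i = j then 1 else 0)"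
begin

definition comb :: "('i => real) => 'a => real" where
 "comb c = (%x. \<Sum>i\<in>J. c i*e i x)"

text \<open>A combination of fixed functions whose coefficients are integrals: arguments that agree
  almost everywhere have projections that agree at every point, and the values on null sets never
  have to be discussed.\<close>

definition proj :: "('a => real) => 'a => real" where
 "proj f = comb (%i. ip M f (e i))"

lemma comb_sqint [simp, intro]: "comb c \<in> sqint M"
 unfolding comb_def by (intro sqint_sum sqint_cmult) simp

lemma proj_sqint [simp, intro]: "proj f \<in> sqint M"
 by (simp add: proj_def)

lemma ip_comb_left: "f \<in> sqint M ==> ip M (comb c) f = (\<Sum>i\<in>J. c i*ip M f (e i))"
 unfolding comb_def by (subst ip_sum_left) (auto simp: ip_cmult_left ip_commute)

lemma ip_comb_e: "j \<in> J ==> ip M (comb c) (e j) = c j"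
 using finite_J by (simp add: ip_comb_left ip_e if_distrib sum.delta cong: if_cong)

lemma proj_comb: "proj (comb c) = comb c"
 unfolding proj_def by (simp add: comb_def ip_comb_e[unfolded comb_def])

lemma ip_proj_commute:
 "f \<in> sqint M ==> g \<in> sqint M ==> ip M (proj f) g = ip M f (proj g)"
 using ip_comb_left[of g "%i. ip M f (e i)"] ip_comb_left[of f "%i. ip M g (e i)"]
 by (simp add: proj_def ip_commute[of M f] mult.commute)

lemma proj_idem: "proj (proj f) = proj f"
 unfolding proj_def[of f] by (rule proj_comb)

lemma proj_add: "f \<in> sqint M ==> g \<in> sqint M ==> proj (%x. f x + g x) = (%x. proj f x + proj g x)"
 by (auto simp: proj_def comb_def ip_add_left distrib_right sum.distrib intro!: ext)

lemma proj_diff: "f \<in> sqint M ==> g \<in> sqint M ==> proj (%x. f x - g x) = (%x. proj f x - proj g x)"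
 by (auto simp: proj_def comb_def ip_diff_left left_diff_distrib sum_subtractf intro!: ext)

lemma proj_cmult: "proj (%x. c*f x) = (%x. c*proj f x)"
 by (auto simp: proj_def comb_def ip_cmult_left sum_distrib_left mult.assoc intro!: ext)

lemma proj_cong_AE:
 assumes "AE x in M. f x = g x" "f \<in> borel_measurable M" "g \<in> borel_measurable M"
 shows "proj f = proj g"
proof -
 have "ip M f (e i) = ip M g (e i)" if "i \<in> J" for i
  using assms e_sqint[OF that] by (intro ip_cong_AE) auto
 then show ?thesis by (simp add: proj_def comb_def)
qed

lemma ip_proj_residual:
 "f \<in> sqint M ==> ip M (%x. f x - proj f x) (comb c) = 0"
 using ip_proj_commute[of f "comb c"] by (simp add: ip_diff_left proj_comb)

lemma nrm_proj_le_diff: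
 assumes "f \<in> sqint M"
 shows "nrm M (%x. f x - proj f x) <= nrm M (%x. f x - comb c x)"
proof (rule power2_le_imp_le)
 let ?r = "%x. f x - proj f x" and ?s = "%x. proj f x - comb c x"
 have s: "?s = comb (%i. ip M f (e i) - c i)"
  by (simp add: proj_def comb_def left_diff_distrib sum_subtractf)
 have "(nrm M (%x. ?r x + ?s x))^2 = (nrm M ?r)\<^sup>2 + (nrm M ?s)\<^sup>2 + 2*ip M ?r ?s"
  using assms by (intro nrm_add_square sqint_diff) auto
 moreover have "ip M ?r ?s = 0"
  unfolding s by (rule ip_proj_residual[OF assms])
 ultimately show "(nrm M ?r)\<^sup>2 <= (nrm M (%x. f x - comb c x))^2"
  by simp
qed simp

lemma nrm_residual_le: "f \<in> sqint M ==> nrm M (%x. f x - proj f x) <= nrm M f"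
 using nrm_proj_le_diff[of f "%_. 0"] by (simp add: comb_def)

lemma nrm_proj_le:
 assumes "f \<in> sqint M"
 shows "nrm M (proj f) <= nrm M f"
proof (rule power2_le_imp_le)
 let ?r = "%x. f x - proj f x"
 have "(nrm M (%x. ?r x + proj f x))^2 = (nrm M ?r)\<^sup>2 + (nrm M (proj f))^2 + 2*ip M ?r (proj f)"
  using assms by (intro nrm_add_square sqint_diff) auto
 moreover have "ip M ?r (proj f) = 0"
  unfolding proj_def[of f] by (rule ip_proj_residual[OF assms, unfolded proj_def])
 ultimately show "(nrm M (proj f))^2 <= (nrm M f)\<^sup>2" by simp
qed simp

lemma nrm_comb_square: "(nrm M (comb c))^2 = (\<Sum>i\<in>J. (c i)\<^sup>2)"
 unfolding nrm_square ip_comb_left[OF comb_sqint] by (simp add: ip_comb_e power2_eq_square)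

lemma nrm_proj_square: "(nrm M (proj f))^2 = (\<Sum>i\<in>J. (ip M f (e i))^2)"
 unfolding proj_def by (rule nrm_comb_square)

end

section \<open>Green operators on an interval\<close>

text \<open>Lebesgue measure on (a, b) is carried by the whole line with its Borel sets. One
  function can then be integrated over the interval, a cell or a part of it, and measurability is
  always plain Borel measurability.\<close>

definition mu :: "real => real => real measure" where
 "mu a b = density lborel (%x. ennreal (indicator {a<..<b} x))"

lemma sets_mu [simp, measurable_cong]: "sets (mu a b) = sets borel"
 by (simp add: mu_def)

lemma space_mu [simp]: "space (mu a b) = UNIV"
 by (simp add: mu_def)

lemma fin_mu: "finite_measure (mu a b)"
proof (rule finite_measureI)
 have "emeasure (mu a b) UNIV = emeasure lborel {a<..<b}"
  unfolding mu_def by (subst emeasure_density) (auto simp: ennreal_indicator)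
 then show "emeasure (mu a b) (space (mu a b)) \<noteq> \<infinity>"
  using emeasure_bounded_finite[OF bounded_Ioo, of a b] by simp
qed

interpretation mu: finite_measure "mu a b" for a b
 by (rule fin_mu)

lemma integral_mu:
 fixes f :: "real => real"
 assumes [measurable]: "is_borel f"
 shows "(LINT x|mu a b. f x) = set_lebesgue_integral lborel {a<..<b} f"
 unfolding mu_def set_lebesgue_integral_def by (rule integral_density) auto

lemma integrable_mu:
 fixes f :: "real => real"
 assumes [measurable]: "is_borel f"
 shows "integrable (mu a b) f \<longleftrightarrow> set_integrable lborel {a<..<b} f"
 unfolding mu_def set_integrable_def by (rule integrable_density) auto

lemma integral_mu_const: "a <= b ==> (LINT x|mu a b. c) = (b-a)*(c :: real)"
 by (subst integral_mu) (simp_all add: set_lebesgue_integral_def)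

lemma AE_mu_iff: "(AE x in mu a b. P x) \<longleftrightarrow> (AE x in lborel. a < x \<and> x < b --> P x)"
 unfolding mu_def by (subst AE_density) (auto simp: indicator_def)

lemma AE_mu_Ioo: "AE x in mu a b. a < x \<and> x < b"
 by (simp add: AE_mu_iff)

lemma AE_mu_finite:
 assumes "finite S" "!!x. a < x ==> x < b ==> x \<notin> S ==> P x"
 shows "AE x in mu a b. P x"
proof -
 have "AE x in lborel. x \<notin> S"
  using finite_imp_null_set_lborel[OF assms(1)] by (rule AE_not_in)
 then show ?thesis unfolding AE_mu_iff by eventually_elim (use assms(2) in auto)
qed

section \<open>Integral operators with bounded kernels\<close>

definition bkern :: "(real => real => real) => bool" where
 "bkern K \<longleftrightarrow> (%(x, s). K x s) \<in> borel_measurable (borel \<Otimes>\<^sub>M borel) \<and> (\<exists>B. \<forall>x s. \<bar>K x s\<bar> <= B)"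

text \<open>Antiderivative, Green operator, its derivative and the projection onto piecewise
  polynomials all have this form. Boundedness, symmetry by Fubini and commutation across the two
  variables are thus proved once for all of them.\<close>

definition kop :: "real measure => (real => real => real) => (real => real) => real => real" where
 "kop M K f x = (LINT s|M. K x s*f s)"

lemma bkern_measurable [measurable_dest]:
 "bkern K ==> (%(x, s). K x s) \<in> borel_measurable (borel \<Otimes>\<^sub>M borel)"
 by (simp add: bkern_def)

lemma bkern_row [measurable_dest]: "bkern K ==> is_borel (%s. K x s)"
 using measurable_compose_Pair1[of x borel "%p. case p of (x, s) => K x s" borel borel]
 by (auto simp: bkern_def)

lemma bounded_kernelE:
 assumes "bkern K"
 obtains B where "0 < B" "!!x s. \<bar>K x s\<bar> <= B"
proof -
 obtain B where "!!x s. \<bar>K x s\<bar> <= B" using assms by (auto simp: bkern_def)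
 then have "!!x s. \<bar>K x s\<bar> <= max 1 B" by (simp add: max.coboundedI2)
 then show thesis by (intro that[of "max 1 B"]) auto
qed

context
 fixes M :: "real measure"
 assumes fin: "finite_measure M" and sets_M [simp, measurable_cong]: "sets M = sets borel"
begin

interpretation finite_measure M by (rule fin)

lemma integrable_kmult:
 assumes "bkern K" "integrable M f"
 shows "integrable M (%s. K x s*f s)"
proof -
 obtain B where B: "0 < B" "!!x s. \<bar>K x s\<bar> <= B" by (rule bounded_kernelE[OF assms(1)]) auto
 show ?thesis
 proof (rule Bochner_Integration.integrable_bound)
  show "integrable M (%s. B*f s)" using assms by simp
  show "(%s. K x s*f s) \<in> borel_measurable M" using assms by measurable
  show "AE s in M. norm (K x s*f s) <= norm (B*f s)"
   using B by (auto simp: abs_mult intro!: mult_right_mono AE_I2)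
 qed
qed

lemma integrable_kernel_row: "bkern K ==> integrable M (K x)"
 using integrable_kmult[of K "%_. 1" x] by simp

lemma kop_measurable:
 assumes "bkern K" "f \<in> borel_measurable M"
 shows "is_borel (kop M K f)"
 unfolding kop_def[abs_def]
 by (rule borel_measurable_lebesgue_integral) (use assms in measurable)

lemma kop_bound:
 assumes "bkern K" "integrable M f" "!!s. \<bar>K x s\<bar> <= B"
 shows "\<bar>kop M K f x\<bar> <= B*(LINT s|M. \<bar>f s\<bar>)"
proof -
 have "\<bar>kop M K f x\<bar> <= (LINT s|M. \<bar>K x s*f s\<bar>)"
  unfolding kop_def by (rule integral_abs_bound)
 also have "... <= (LINT s|M. B*\<bar>f s\<bar>)"
  using assms integrable_abs[OF integrable_kmult[OF assms(1,2), of x]]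
  by (intro integral_mono) (auto simp: abs_mult intro!: mult_right_mono)
 finally show ?thesis by simp
qed

lemma kop_integrable:
 assumes "bkern K" "integrable M f" and N: "finite_measure N" "sets N = sets borel"
 shows "integrable N (kop M K f)"
proof -
 interpret N: finite_measure N by (rule N)
 obtain B where B: "0 < B" "!!x s. \<bar>K x s\<bar> <= B" by (rule bounded_kernelE[OF assms(1)]) auto
 have "kop M K f \<in> borel_measurable N"
  using kop_measurable[OF assms(1), of f] assms(2) measurable_cong_sets[OF N(2) refl] by auto
 moreover have "AE x in N. norm (kop M K f x) <= B*(LINT s|M. \<bar>f s\<bar>)"
  using kop_bound[OF assms(1,2)] B by simp
 ultimately show ?thesis by (rule N.integrable_const_bound[rotated])
qed

lemma integrable_mult_kop:
 assumes K: "bkern K" and f: "integrable M f"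
  and N: "sets N = sets borel" and g: "integrable N g"
 shows "integrable N (%x. g x*kop M K f x)"
proof -
 note [measurable_cong] = N
 obtain B where B: "0 < B" "!!x s. \<bar>K x s\<bar> <= B" by (rule bounded_kernelE[OF K]) auto
 have [measurable]: "is_borel (kop M K f)"
  using kop_measurable[OF K, of f] f by auto
 show ?thesis
 proof (rule Bochner_Integration.integrable_bound)
  show "integrable N (%x. (B*(LINT s|M. \<bar>f s\<bar>))*g x)" using g by simp
  show "(%x. g x*kop M K f x) \<in> borel_measurable N" using g by measurable
  have "\<bar>g x\<bar>*\<bar>kop M K f x\<bar> <= \<bar>g x\<bar>*(B*(LINT s|M. \<bar>f s\<bar>))" for x
   using kop_bound[OF K f] B by (intro mult_left_mono) auto
  then show "AE x in N. norm (g x*kop M K f x) <= norm ((B*(LINT s|M. \<bar>f s\<bar>))*g x)"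
   using B by (simp add: abs_mult mult_ac)
 qed
qed

lemma kop_diff:
 "bkern K ==> integrable M f ==> integrable M g ==>
  kop M K (%s. f s - g s) x = kop M K f x - kop M K g x"
 by (simp add: kop_def right_diff_distrib integrable_kmult)

text \<open>The adjoint of a kernel operator has the transposed kernel. Fubini applies since the
  bound of the kernel times |g(x) f(s)| is integrable over the product of two finite
  measures.\<close>

lemma kop_fubini:
 assumes K: "bkern K" and f: "integrable M f"
  and N: "finite_measure N" "sets N = sets borel" and g: "integrable N g"
 shows "(LINT x|N. g x*kop M K f x) = (LINT s|M. f s*kop N (%s x. K x s) g s)"
proof -
 interpret N: finite_measure N by (rule N)
 interpret pair_sigma_finite N M ..
 note [measurable_cong] = N(2)
 obtain B where B: "0 < B" "!!x s. \<bar>K x s\<bar> <= B" by (rule bounded_kernelE[OF K]) auto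
 have [measurable]: "is_borel f" "is_borel g"
  using f g measurable_cong_sets[OF N(2) refl] measurable_cong_sets[OF sets_M refl] by blast+
 have meas: "(%(x, s). g x*(K x s*f s)) \<in> borel_measurable (N \<Otimes>\<^sub>M M)"
  using K by measurable
 have "integrable (N \<Otimes>\<^sub>M M) (%(x, s). g x*(K x s*f s))"
 proof (rule Fubini_integrable[OF meas])
  have "integrable N (%x. B*\<bar>g x\<bar>*(LINT s|M. \<bar>f s\<bar>))" using g by simp
  then show "integrable N (%x. LINT s|M. norm (case (x, s) of (x, s) => g x*(K x s*f s)))"
  proof (rule Bochner_Integration.integrable_bound)
   show "(%x. LINT s|M. norm (case (x, s) of (x, s) => g x*(K x s*f s))) \<in> borel_measurable N"
   proof (rule sigma_finite_measure.borel_measurable_lebesgue_integral)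
    show "sigma_finite_measure M" ..
    show "(%(x, s). norm (case (x, s) of (x, s) => g x*(K x s*f s))) \<in> borel_measurable (N \<Otimes>\<^sub>M M)"
     using meas by (simp add: split_beta')
   qed
   have "(LINT s|M. norm (g x*(K x s*f s))) <= B*\<bar>g x\<bar>*(LINT s|M. \<bar>f s\<bar>)" for x
   proof -
    have "(LINT s|M. norm (g x*(K x s*f s))) = \<bar>g x\<bar>*(LINT s|M. \<bar>K x s*f s\<bar>)"
     by (simp add: abs_mult)
    also have "... <= \<bar>g x\<bar>*(LINT s|M. B*\<bar>f s\<bar>)"
     using f integrable_abs[OF integrable_kmult[OF K f, of x]] B
     by (intro mult_left_mono integral_mono) (auto simp: abs_mult intro!: mult_right_mono)
    finally show ?thesis by (simp add: mult_ac)
   qed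
   then show "AE x in N. norm (LINT s|M. norm (case (x, s) of (x, s) => g x*(K x s*f s)))
     <= norm (B*\<bar>g x\<bar>*(LINT s|M. \<bar>f s\<bar>))"
    by (intro AE_I2) (auto intro: order_trans[OF _ abs_ge_self])
  qed
  show "AE x in N. integrable M (%s. case (x, s) of (x, s) => g x*(K x s*f s))"
   using integrable_kmult[OF K f] by simp
 qed
 then have "(LINT s|M. (LINT x|N. g x*(K x s*f s))) = (LINT x|N. (LINT s|M. g x*(K x s*f s)))"
  by (rule Fubini_integral)
 moreover have "(LINT x|N. g x*(K x s*f s)) = f s*(LINT x|N. K x s*g x)" for s
  unfolding integral_mult_right_zero[symmetric] by (simp add: mult_ac)
 ultimately show ?thesis
  by (simp add: kop_def)
qed

lemma kop_comp:
 assumes "bkern K" "integrable M f"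
  and "finite_measure N" "sets N = sets borel" "bkern L"
 shows "kop N L (kop M K f) x = (LINT s|M. (LINT t|N. L x t*K t s)*f s)"
proof -
 have "integrable N (L x)"
  using Submission.integrable_kernel_row[OF assms(3-5)] .
 from kop_fubini[OF assms(1-4) this] show ?thesis
  by (simp add: kop_def mult_ac)
qed

end

lemma bounded_kernelI:
 assumes "(%(x, s). K x s) \<in> borel_measurable (borel \<Otimes>\<^sub>M borel)" "!!x s. \<bar>K x s\<bar> <= B"
 shows "bkern K"
 using assms unfolding bkern_def by blast

text \<open>The kernel of integration from the left end point, since \<open>mu a b\<close> gives no
  mass to what lies left of a.\<close>

definition Ik :: "real => real => real" where
 "Ik x s = (if s <= x then 1 else 0)"

text \<open>Derivative in \<open>x\<close> of the Green function of $v'' = f$, $v(a) = v(b) = 0$.\<close>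

definition G1k :: "real => real => real => real => real" where
 "G1k a b x s = (if s \<in> {a<..<b} then Ik x s - (b-s)/(b-a) else 0)"

text \<open>The first term integrates f twice from a; the second subtracts the linear function that
  restores the value 0 at b. The cut-off in x keeps the kernel bounded on the whole plane.\<close>

definition Gk :: "real => real => real => real => real" where
 "Gk a b x s = (if x \<in> {a..b} \<and> s \<in> {a<..<b} then (x-s)*Ik x s - (x-a)*(b-s)/(b-a) else 0)"

lemma bkern_Ik [simp]: "bkern Ik"
 by (rule bounded_kernelI[where B=1]) (auto simp: Ik_def)

lemma G1k_bound: "a < b ==> \<bar>G1k a b x s\<bar> <= 1"
 by (auto simp: G1k_def Ik_def field_simps abs_if)

lemma Gk_le:
 assumes "a < b" "x \<in> {a..b}" "s \<in> {a<..<b}" "s <= x"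
 shows "Gk a b x s = - ((b-x)*(s-a)/(b-a))"
 using assms by (simp add: Gk_def Ik_def field_simps)

lemma Gk_gt:
 assumes "a < b" "x \<in> {a..b}" "s \<in> {a<..<b}" "\<not> s <= x"
 shows "Gk a b x s = - ((x-a)*(b-s)/(b-a))"
 using assms by (simp add: Gk_def Ik_def)

lemma Gk_bound: 
 assumes "a < b" shows "\<bar>Gk a b x s\<bar> <= b - a"
proof (cases "x \<in> {a..b} \<and> s \<in> {a<..<b}")
 case True
 have *: "u * v / (b-a) <= b - a" if "0 <= u" "0 <= v" "u <= b - a" "v <= b - a" for u v
  using mult_mono[OF that(3,4)] that assms by (simp add: divide_le_eq)
 have "\<bar>(b-x)*(s-a)/(b-a)\<bar> <= b - a" "\<bar>(x-a)*(b-s)/(b-a)\<bar> <= b - a"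
  using True assms by (auto simp: abs_mult intro!: *)
 then show ?thesis
  using Gk_le[OF assms, of x s] Gk_gt[OF assms, of x s] True by (cases "s <= x") auto
qed (use assms in "auto simp: Gk_def")

lemma bkern_G1k: "a < b ==> bkern (G1k a b)"
 by (rule bounded_kernelI[where B=1], (unfold G1k_def Ik_def, measurable)[1], rule G1k_bound)

lemma bkern_Gk: "a < b ==> bkern (Gk a b)"
 by (rule bounded_kernelI[where B="b - a"], (unfold Gk_def Ik_def, measurable)[1], rule Gk_bound)

abbreviation anti :: "real => real => (real => real) => real => real" where
 "anti a b \<equiv> kop (mu a b) Ik"

abbreviation green :: "real => real => (real => real) => real => real" where
 "green a b \<equiv> kop (mu a b) (Gk a b)"

abbreviation green' :: "real => real => (real => real) => real => real" where
 "green' a b \<equiv> kop (mu a b) (G1k a b)"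

text \<open>Integration by parts without any derivative: off the diagonal the transposed kernel of
  \<open>Ik\<close> is 1 - \<open>Ik\<close>, and Fubini does the rest. All later integrations by
  parts reduce to this one.\<close>

lemma integral_anti_by_parts:
 assumes f: "integrable (mu a b) f" and g: "integrable (mu a b) g"
 shows "(LINT x|mu a b. f x*anti a b g x) + (LINT x|mu a b. g x*anti a b f x)
  = (LINT x|mu a b. f x)*(LINT x|mu a b. g x)"
proof -
 have ant: "integrable (mu a b) (kop (mu a b) K h)" if "bkern K" "integrable (mu a b) h" for K h
  using kop_integrable[OF fin_mu _ that fin_mu] by simp
 have "(LINT x|mu a b. f x*anti a b g x) = (LINT s|mu a b. g s*kop (mu a b) (%s x. Ik x s) f s)"
  by (rule kop_fubini[OF fin_mu]) (use assms fin_mu in auto)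
 moreover have "kop (mu a b) (%s x. Ik x s) f s = (LINT x|mu a b. f x) - anti a b f s" for s
 proof -
  have "AE x in mu a b. Ik x s*f x = f x - Ik s x*f x"
   by (rule AE_mu_finite[of "{s}"]) (auto simp: Ik_def)
  then have "(LINT x|mu a b. Ik x s*f x) = (LINT x|mu a b. f x - Ik s x*f x)"
   using f by (intro integral_cong_AE) (auto simp: Ik_def)
  also have "... = (LINT x|mu a b. f x) - anti a b f s"
   using f integrable_kmult[OF fin_mu _ bkern_Ik f]
   by (simp add: kop_def)
  finally show ?thesis by (simp add: kop_def)
 qed
 moreover have "integrable (mu a b) (%s. g s*anti a b f s)"
  by (rule integrable_mult_kop[OF fin_mu _ bkern_Ik f _ g]) auto
 ultimately show ?thesis
  using g by (simp add: right_diff_distrib)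
qed


lemma integral_mu_Icc:
 assumes "a <= p" "q <= b"
 shows "(LINT x|mu a b. indicator {p..q} x) = (max 0 (q-p) :: real)"
proof -
 have "(LINT x|mu a b. indicator {p..q} x) = (LINT x|lborel. indicator {a<..<b} x*(indicator {p..q} x :: real))"
  by (subst integral_mu) (simp_all add: set_lebesgue_integral_def)
 also have "... = (LINT x|lborel. indicator {p..q} x)"
 proof (rule integral_cong_AE)
  have "AE x in lborel. x \<notin> {a, b}"
   by (rule AE_not_in[OF finite_imp_null_set_lborel]) simp
  then show "AE x in lborel. indicator {a<..<b} x*indicator {p..q} x = (indicator {p..q} x :: real)"
   by eventually_elim (use assms in "auto simp: indicator_def")
 qed auto
 finally show ?thesis by (simp add: max_def)
qed

lemma integrable_kop:
 "bkern K ==> integrable (mu a b) f ==> integrable (mu a' b') (kop (mu a b) K f)"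
 using kop_integrable[OF fin_mu _ _ _ fin_mu] by simp

text \<open>The subtracted constant is the mean of the antiderivative over (a, b), so
  \<open>green'\<close> is the antiderivative of f with mean zero, and its own antiderivative
  returns to 0 at b.\<close>

lemma green'_eq:
 assumes "a < b" "integrable (mu a b) f"
 shows "green' a b f x = anti a b f x - (LINT s|mu a b. (b-s)*f s)/(b-a)"
proof -
 let ?L = "%x s. if s \<in> {a<..<b} then (b-s)/(b-a) else 0"
 have L: "bkern ?L"
  by (rule bounded_kernelI[where B=1]) (use assms in auto)
 have "green' a b f x = (LINT s|mu a b. Ik x s*f s - ?L x s*f s)"
  unfolding kop_def
 proof (rule integral_cong_AE)
  show "AE s in mu a b. G1k a b x s*f s = Ik x s*f s - ?L x s*f s"
   using AE_mu_Ioo[of a b] by eventually_elim (simp add: G1k_def left_diff_distrib)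
 qed (use assms(2) bkern_G1k[OF assms(1)] L bkern_Ik in measurable)
 also have "... = anti a b f x - (LINT s|mu a b. ?L x s*f s)"
  using integrable_kmult[OF fin_mu _ bkern_Ik assms(2)]
   integrable_kmult[OF fin_mu _ L assms(2)]
  by (simp add: kop_def)
 also have "(LINT s|mu a b. ?L x s*f s) = (LINT s|mu a b. (b-s)*f s/(b-a))"
  using assms by (intro integral_cong_AE eventually_mono[OF AE_mu_Ioo]) auto
 finally show ?thesis by simp
qed

text \<open>The identity is checked on kernels: for fixed s, integrating \<open>G1k a b t s\<close>
  over t from a to x amounts to measuring the intervals [s, x] and [a, x].\<close>

lemma anti_green':
 assumes "a < b" "integrable (mu a b) f" "x \<in> {a..b}"
 shows "anti a b (green' a b f) x = green a b f x"
proof -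
 have "anti a b (green' a b f) x = (LINT s|mu a b. (LINT t|mu a b. Ik x t*G1k a b t s)*f s)"
  by (rule kop_comp[OF fin_mu])
    (use assms fin_mu bkern_G1k in auto)
 also have "... = green a b f x"
  unfolding kop_def
 proof (rule integral_cong_AE)
  show "AE s in mu a b. (LINT t|mu a b. Ik x t*G1k a b t s)*f s = Gk a b x s*f s"
   using AE_mu_Ioo[of a b]
  proof eventually_elim
   case (elim s)
   have "(LINT t|mu a b. Ik x t*G1k a b t s)
     = (LINT t|mu a b. indicator {s..x} t - (b-s)/(b-a)*indicator {a..x} t)"
    using elim by (intro integral_cong_AE) (auto simp: Ik_def G1k_def AE_mu_iff indicator_def)
   also have "... = max 0 (x-s) - (b-s)/(b-a)*max 0 (x-a)"
   proof -
    have "integrable (mu a b) (indicator {p..q} :: real => real)" for p q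
     by (rule mu.integrable_const_bound[where B=1]) (auto simp: indicator_def)
    then show ?thesis
     using integral_mu_Icc[of a s x b] integral_mu_Icc[of a a x b] assms elim by simp
   qed
   also have "... = Gk a b x s"
    using assms elim by (auto simp: Gk_def Ik_def)
   finally show ?case by simp
  qed
  show "(%s. (LINT t|mu a b. Ik x t*G1k a b t s)*f s) \<in> borel_measurable (mu a b)"
  proof -
   have [measurable]: "is_borel f" "(%(x, s). G1k a b x s) \<in> borel_measurable (borel \<Otimes>\<^sub>M borel)"
    "is_borel (Ik x)"
    using assms(2) bkern_measurable[OF bkern_G1k[OF assms(1)]]
     bkern_row[OF bkern_Ik] by auto
   show ?thesis by measurable
  qed
  show "(%s. Gk a b x s*f s) \<in> borel_measurable (mu a b)"
   using assms bkern_Gk[OF assms(1)] by measurable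
 qed
 finally show ?thesis .
qed

lemma integral_eq_anti_right: 
 assumes "integrable (mu a b) f" shows "(LINT x|mu a b. f x) = anti a b f b"
 unfolding kop_def
 by (rule integral_cong_AE) (use assms in "auto simp: Ik_def AE_mu_iff")

lemma green_right: "green a b f b = 0"
 unfolding kop_def by (rule integral_eq_zero_AE) (auto simp: Gk_def AE_mu_iff Ik_def field_simps)

lemma integral_green':
 assumes "a < b" "integrable (mu a b) f"
 shows "(LINT x|mu a b. green' a b f x) = 0"
 using integral_eq_anti_right[OF integrable_kop[OF bkern_G1k[OF assms(1)] assms(2), of a b]]
  anti_green'[OF assms, of b] green_right assms(1)
 by simp

lemma AE_anti_green':
 assumes "a < b" "integrable (mu a b) f"
 shows "AE x in mu a b. anti a b (green' a b f) x = green a b f x"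
 using AE_mu_Ioo[of a b] by eventually_elim (use anti_green'[OF assms] in auto)

lemma integral_cong_anti_green':
 assumes "a < b" "integrable (mu a b) f" "integrable (mu a b) g"
 shows "(LINT x|mu a b. g x*green a b f x) = (LINT x|mu a b. g x*anti a b (green' a b f) x)"
proof (rule integral_cong_AE)
 have "integrable (mu a b) (green' a b f)"
  by (rule integrable_kop[OF bkern_G1k]) (use assms in auto)
 then show "(%x. g x*anti a b (green' a b f) x) \<in> borel_measurable (mu a b)"
  using integrable_mult_kop[OF fin_mu _ bkern_Ik _ _ assms(3)] by simp
 show "(%x. g x*green a b f x) \<in> borel_measurable (mu a b)"
  using integrable_mult_kop[OF fin_mu _ bkern_Gk _ _ assms(3)] assms by simp
 show "AE x in mu a b. g x*green a b f x = g x*anti a b (green' a b f) x"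
  using AE_anti_green'[OF assms(1,2)] by eventually_elim simp
qed

text \<open>For functions v, w vanishing at a and b this is $(v'', w) = -(v', w')$. The constant by
  which \<open>green'\<close> differs from \<open>anti\<close> is orthogonal to the other factor,
  which has mean zero.\<close>

lemma integral_green_green':
 assumes ab: "a < b" and f: "integrable (mu a b) f" and g: "integrable (mu a b) g"
 shows "(LINT x|mu a b. f x*green a b g x) = - (LINT x|mu a b. green' a b f x*green' a b g x)"
proof -
 let ?\<kappa> = "(LINT s|mu a b. (b-s)*f s)/(b-a)"
 have G: "integrable (mu a b) (green' a b h)" if "integrable (mu a b) h" for h
  by (rule integrable_kop[OF bkern_G1k]) (use ab that in auto)
 have "(LINT x|mu a b. f x*green a b g x) = (LINT x|mu a b. f x*anti a b (green' a b g) x)"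
  by (rule integral_cong_anti_green') fact+
 also have "... = - (LINT x|mu a b. green' a b g x*anti a b f x)"
  using integral_anti_by_parts[OF f G[OF g]] integral_green'[OF ab g] by simp
 also have "(LINT x|mu a b. green' a b g x*anti a b f x)
   = (LINT x|mu a b. green' a b g x*green' a b f x + green' a b g x * ?\<kappa>)"
  by (simp add: green'_eq[OF ab f] algebra_simps)
 also have "... = (LINT x|mu a b. green' a b g x*green' a b f x)"
  using integral_green'[OF ab g] G[OF g]
   integrable_mult_kop[OF fin_mu _ bkern_G1k[OF ab] f _ G[OF g]]
  by simp
 finally show ?thesis by (simp add: mult.commute)
qed

text \<open>Here $(v', w) = -(v, w')$ for v, w vanishing at both ends. With v = w the integral
  vanishes, which removes convection from the energy identity.\<close>

lemma integral_green'_green: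
 assumes ab: "a < b" and f: "integrable (mu a b) f" and g: "integrable (mu a b) g"
 shows "(LINT x|mu a b. green' a b f x*green a b g x) = - (LINT x|mu a b. green a b f x*green' a b g x)"
proof -
 have G: "integrable (mu a b) (green' a b h)" if "integrable (mu a b) h" for h
  by (rule integrable_kop[OF bkern_G1k]) (use ab that in auto)
 show ?thesis
  using integral_anti_by_parts[OF G[OF f] G[OF g]] integral_green'[OF ab g]
   integral_cong_anti_green'[OF ab g G[OF f]] integral_cong_anti_green'[OF ab f G[OF g]]
  by (simp add: mult.commute)
qed

text \<open>The mean fixes the free constant of an antiderivative. The two assumptions on p are what
  the lemma of du Bois-Reymond and the zero boundary values provide for a first derivative.\<close>

lemma green_unique:
 assumes ab: "a < b" and f: "integrable (mu a b) f" and p: "integrable (mu a b) p"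
  and eq: "AE x in mu a b. p x = c + anti a b f x" and mean: "(LINT x|mu a b. p x) = 0"
 shows "AE x in mu a b. p x = green' a b f x"
  and "!!x. x \<in> {a..b} ==> anti a b p x = green a b f x"
proof -
 let ?\<kappa> = "(LINT s|mu a b. (b-s)*f s)/(b-a)"
 have G: "integrable (mu a b) (green' a b f)"
  by (rule integrable_kop[OF bkern_G1k]) (use ab f in auto)
 have eq': "AE x in mu a b. p x = (c + ?\<kappa>) + green' a b f x"
  using eq by (simp add: green'_eq[OF ab f])
 have "0 = (LINT x|mu a b. (c + ?\<kappa>) + green' a b f x)"
  unfolding mean[symmetric] using eq' p G by (intro integral_cong_AE) auto
 also have "... = (b-a)*(c + ?\<kappa>)"
  using G integral_green'[OF ab f] integral_mu_const[of a b "c + ?\<kappa>"] ab by simp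
 finally have "c + ?\<kappa> = 0" using ab by auto
 then show *: "AE x in mu a b. p x = green' a b f x"
  using eq' by simp
 show "anti a b p x = green a b f x" if "x \<in> {a..b}" for x
 proof -
  have "anti a b p x = anti a b (green' a b f) x"
   unfolding kop_def[of _ Ik]
   using * p G by (intro integral_cong_AE) (auto simp: Ik_def elim!: eventually_mono)
  then show ?thesis using anti_green'[OF ab f that] by simp
 qed
qed

text \<open>The exceptional set S takes the mesh points, at which the second derivative of a trial
  function may jump.\<close>

lemma anti_of_deriv:
 assumes S: "finite S" and f: "integrable (mu a b) f"
  and F: "continuous_on {a..b} F"
  and D: "!!x. x \<in> {a<..<b} - S ==> (F has_real_derivative f x) (at x)"
  and x: "x \<in> {a..b}"
 shows "anti a b f x = F x - F a"
proof -
 have [measurable]: "is_borel f"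
  using f by auto
 have "(f has_integral F x - F a) {a..x}"
  using S x F D
  by (intro fundamental_theorem_of_calculus_interior_strong[of S])
    (auto simp flip: has_real_derivative_iff_has_vector_derivative intro: continuous_on_subset)
 then have 1: "integral {a<..<x} f = F x - F a"
  using integral_open_interval_real[of a x f] by (simp add: integral_unique)
 have "set_integrable lborel {a<..<b} f"
  using f integrable_mu[of f a b] by simp
 then have "set_integrable lborel {a<..<x} f"
  by (rule set_integrable_subset) (use x in auto)
 then have 2: "set_lebesgue_integral lborel {a<..<x} f = integral {a<..<x} f"
  by (rule set_borel_integral_eq_integral)
 have "anti a b f x = set_lebesgue_integral lborel {a<..<b} (%s. Ik x s*f s)"
  unfolding kop_def by (rule integral_mu) (simp add: Ik_def)
 also have "... = set_lebesgue_integral lborel {a<..<x} f"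
  unfolding set_lebesgue_integral_def
 proof (rule integral_cong_AE)
  have "AE s in lborel. s \<notin> {x}" by (rule AE_not_in[OF finite_imp_null_set_lborel]) simp
  then show "AE s in lborel. indicator {a<..<b} s *\<^sub>R (Ik x s*f s) = indicator {a<..<x} s *\<^sub>R f s"
   by eventually_elim (use x in "auto simp: indicator_def Ik_def")
 qed (auto simp: Ik_def)
 finally show ?thesis using 1 2 by simp
qed

section \<open>Operators in one variable on a rectangle\<close>

text \<open>Lebesgue measure on the open rectangle as a product, which gives slices and Fubini
  directly; \<open>leb_integral\<close> later translates from \<open>lebesgue_on\<close>.\<close>

definition rm :: "real => real => real => real => (real \<times> real) measure" where
 "rm a b c d = mu a b \<Otimes>\<^sub>M mu c d"

definition Lx :: "real measure => (real => real => real) => fun2 => fun2" where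
 "Lx m K f = (%p. kop m K (%s. f (s, snd p)) (fst p))"

definition Ly :: "real measure => (real => real => real) => fun2 => fun2" where
 "Ly m K f = (%p. kop m K (%t. f (fst p, t)) (snd p))"

text \<open>Exchange of the coordinates. Facts on operators in y are obtained by applying those in x
  to the swapped rectangle.\<close>

definition sw :: "('a \<times> 'b => real) => 'b \<times> 'a => real" where
 "sw f = (%p. f (snd p, fst p))"

interpretation mu2: pair_sigma_finite "mu a b" "mu c d" for a b c d ..

lemma sets_rm [simp, measurable_cong]: "sets (rm a b c d) = sets borel"
proof -
 have "sets (rm a b c d) = sets (borel \<Otimes>\<^sub>M borel :: (real \<times> real) measure)"
  unfolding rm_def by (rule sets_pair_measure_cong) simp_all
 then show ?thesis unfolding borel_prod .
qed

lemma space_rm [simp]: "space (rm a b c d) = UNIV"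
 by (simp add: rm_def space_pair_measure)

lemma finite_measure_rm: "finite_measure (rm a b c d)"
 unfolding rm_def by (rule finite_measure_pair_measure) (rule fin_mu)+

interpretation rm: finite_measure "rm a b c d" for a b c d
 by (rule finite_measure_rm)

lemma rm_borel: "f \<in> borel_measurable (rm a b c d) \<longleftrightarrow> f \<in> borel_measurable borel"
 by (rule arg_cong[where f="%S. f \<in> S"], rule measurable_cong_sets) simp_all

lemma mu_borel: "f \<in> borel_measurable (mu a b) \<longleftrightarrow> f \<in> borel_measurable borel"
 by (rule arg_cong[where f="%S. f \<in> S"], rule measurable_cong_sets) simp_all

lemma borel_pair [measurable_dest]:
 "f \<in> borel_measurable (borel :: (real \<times> real) measure) ==> f \<in> borel_measurable (borel \<Otimes>\<^sub>M borel)"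
 by (simp add: borel_prod)

lemma sqint_borel: "f \<in> sqint (rm a b c d) ==> is_borel f"
 using sqint_measurable rm_borel by blast

lemma measurable_sw [measurable]:
 fixes f :: "fun2"
 assumes "is_borel f"
 shows "is_borel (sw f)"
proof -
 have [measurable]: "f \<in> borel_measurable (borel \<Otimes>\<^sub>M borel)" using assms by (rule borel_pair)
 have "(%p. f (snd p, fst p)) \<in> borel_measurable (borel \<Otimes>\<^sub>M borel)" by measurable
 then show ?thesis by (simp add: sw_def borel_prod)
qed

lemma sw_sw [simp]: "sw (sw f) = f"
 by (simp add: sw_def)

lemma integral_sw:
 assumes [measurable]: "is_borel f"
 shows "(LINT p|rm c d a b. sw f p) = (LINT p|rm a b c d. f p)"
proof -
 have "integral\<^sup>L (mu c d \<Otimes>\<^sub>M mu a b) (%(x, y). f (y, x)) = integral\<^sup>L (mu a b \<Otimes>\<^sub>M mu c d) f"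
  by (rule mu2.integral_product_swap) (simp add: rm_borel flip: rm_def)
 then show ?thesis by (simp add: rm_def sw_def split_beta')
qed

lemma integrable_sw:
 assumes "integrable (rm a b c d) f" shows "integrable (rm c d a b) (sw f)"
 using mu2.integrable_product_swap[of a b c d f] assms
 by (simp add: rm_def sw_def split_beta')

lemma sqint_sw [intro]:
 assumes "f \<in> sqint (rm a b c d)" shows "sw f \<in> sqint (rm c d a b)"
proof -
 have "is_borel f" using assms by (rule sqint_borel)
 moreover have "integrable (rm c d a b) (%p. (sw f p)\<^sup>2)"
  using integrable_sw[OF sqint_square[OF assms]] by (simp add: sw_def)
 ultimately show ?thesis by (simp add: sqint_def rm_borel)
qed

lemma ip_sw:
 assumes "is_borel f" "is_borel g"
 shows "ip (rm c d a b) (sw f) (sw g) = ip (rm a b c d) f g"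
 using integral_sw[of "%p. f p*g p" c d a b] assms by (simp add: ip_def sw_def)

lemma nrm_sw:
 assumes "is_borel f"
 shows "nrm (rm c d a b) (sw f) = nrm (rm a b c d) f"
 using integral_sw[of "%p. (f p)\<^sup>2" c d a b] assms by (simp add: nrm_def sw_def)

lemma AE_sw:
 assumes "AE p in rm a b c d. P p"
 shows "AE p in rm c d a b. P (snd p, fst p)"
proof -
 have [measurable]: "(%(x, y). (y, x)) \<in> measurable (mu c d \<Otimes>\<^sub>M mu a b) (mu a b \<Otimes>\<^sub>M mu c d)"
  by (rule measurable_pair_swap')
 have "AE p in distr (mu c d \<Otimes>\<^sub>M mu a b) (mu a b \<Otimes>\<^sub>M mu c d) (%(x, y). (y, x)). P p"
  using assms unfolding rm_def by (subst (asm) mu2.distr_pair_swap)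
 from AE_distrD[OF _ this] show ?thesis
  unfolding rm_def by (simp add: split_beta' measurable_pair_swap')
qed

lemma integral_rm_x:
 fixes f :: "fun2"
 assumes "integrable (rm a b c d) f"
 shows "(LINT p|rm a b c d. f p) = (LINT y|mu c d. (LINT x|mu a b. f (x, y)))"
 using mu2.integral_snd[of a b c d "%x y. f (x, y)"] assms by (simp add: rm_def split_beta')

lemma AE_rm_x: 
 assumes "AE p in rm a b c d. P p"
 shows "AE y in mu c d. AE x in mu a b. P (x, y)"
proof -
 have "AE p in rm c d a b. P (snd p, fst p)" by (rule AE_sw[OF assms])
 from mu2.AE_pair[OF this[unfolded rm_def]] show ?thesis by simp
qed

lemma sqint_slice_x:
 assumes f: "f \<in> sqint (rm a b c d)"
 shows "AE y in mu c d. (%x. f (x, y)) \<in> sqint (mu a b)"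
proof -
 have [measurable]: "is_borel f" using f by (rule sqint_borel)
 have "AE y in mu c d. integrable (mu a b) (%x. (f (x, y))^2)"
  using mu2.AE_integrable_snd[of a b c d "%x y. (f (x, y))^2"] sqint_square[OF f]
  by (simp add: rm_def split_beta')
 then show ?thesis
 proof eventually_elim
  case (elim y)
  have "is_borel (%x. f (x, y))" by measurable
  then show ?case using elim by (simp add: sqint_def mu_borel)
 qed
qed

text \<open>Squared norms on the rectangle are integrals of squared norms over horizontal lines.
  Slices are square integrable only for almost every y, hence the implication in the last
  assumption; square integrability of F is itself part of the conclusion.\<close>

lemma sqint_lift_x:
 assumes F: "is_borel F" and f: "f \<in> sqint (rm a b c d)" and C: "0 <= C"
  and le: "AE y in mu c d. (%x. f (x, y)) \<in> sqint (mu a b) --> (%x. F (x, y)) \<in> sqint (mu a b) \<and>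
    nrm (mu a b) (%x. F (x, y)) <= C*nrm (mu a b) (%x. f (x, y))"
 shows "F \<in> sqint (rm a b c d)" and "nrm (rm a b c d) F <= C*nrm (rm a b c d) f"
proof -
 note [measurable] = F
 have [measurable]: "is_borel f" using f by (rule sqint_borel)
 have fint: "integrable (mu c d) (%y. (nrm (mu a b) (%x. f (x, y)))^2)"
  unfolding nrm_square_integral
  using mu2.integrable_snd[of a b c d "%x y. (f (x, y))^2"] sqint_square[OF f]
  by (simp add: rm_def split_beta')
 have le2: "AE y in mu c d. (%x. F (x, y)) \<in> sqint (mu a b) \<and>
   (nrm (mu a b) (%x. F (x, y)))^2 <= C^2*(nrm (mu a b) (%x. f (x, y)))^2"
  using le sqint_slice_x[OF f]
 proof eventually_elim
  case (elim y)
  then show ?case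
   using power_mono[of "nrm (mu a b) (%x. F (x, y))" "C*nrm (mu a b) (%x. f (x, y))" 2]
   by (simp add: power_mult_distrib)
 qed
 have meas: "(%y. (nrm (mu a b) (%x. F (x, y)))^2) \<in> borel_measurable (mu c d)"
  unfolding nrm_square_integral by measurable
 have Fint: "integrable (mu c d) (%y. (nrm (mu a b) (%x. F (x, y)))^2)"
  by (rule Bochner_Integration.integrable_bound[OF integrable_mult_right[OF fint, of "C^2"] meas])
    (use le2 in "auto elim!: eventually_mono")
 have "integrable (mu c d \<Otimes>\<^sub>M mu a b) (%(y, x). (F (x, y))^2)"
 proof (rule mu2.Fubini_integrable)
  show "integrable (mu c d) (%y. LINT x|mu a b. norm (case (y, x) of (y, x) => (F (x, y))^2))"
   using Fint by (simp add: nrm_square_integral)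
  show "AE y in mu c d. integrable (mu a b) (%x. case (y, x) of (y, x) => (F (x, y))^2)"
   using le2 by eventually_elim (simp add: sqint_def)
 qed measurable
 from integrable_sw[OF this[folded rm_def]]
 show *: "F \<in> sqint (rm a b c d)"
  by (simp add: sqint_def rm_borel F sw_def)
 show "nrm (rm a b c d) F <= C*nrm (rm a b c d) f"
 proof (rule power2_le_imp_le)
  have "(nrm (rm a b c d) F)\<^sup>2 = (LINT y|mu c d. (nrm (mu a b) (%x. F (x, y)))^2)"
   unfolding nrm_square_integral by (rule integral_rm_x[OF sqint_square[OF *]])
  also have "... <= (LINT y|mu c d. C^2*(nrm (mu a b) (%x. f (x, y)))^2)"
   by (rule integral_mono_AE) (use Fint fint le2 in "auto elim!: eventually_mono")
  also have "... = C^2*(nrm (rm a b c d) f)\<^sup>2"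
   unfolding nrm_square_integral using integral_rm_x[OF sqint_square[OF f]] by simp
  finally show "(nrm (rm a b c d) F)\<^sup>2 <= (C*nrm (rm a b c d) f)\<^sup>2"
   by (simp add: power_mult_distrib)
 qed (use C in simp)
qed

text \<open>The factor r covers symmetry (1), integration by parts (-1) and orthogonality
  (0).\<close>

lemma ip_lift_x:
 assumes "F \<in> sqint (rm a b c d)" "H \<in> sqint (rm a b c d)" "F' \<in> sqint (rm a b c d)" "H' \<in> sqint (rm a b c d)"
  and eq: "AE y in mu c d. ip (mu a b) (%x. F (x, y)) (%x. H (x, y)) = r*ip (mu a b) (%x. F' (x, y)) (%x. H' (x, y))"
 shows "ip (rm a b c d) F H = r*ip (rm a b c d) F' H'"
proof -
 have [measurable]: "is_borel F" "is_borel H"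
   "is_borel F'" "is_borel H'"
  using assms(1-4) by (auto intro: sqint_borel)
 have "ip (rm a b c d) F H = (LINT y|mu c d. ip (mu a b) (%x. F (x, y)) (%x. H (x, y)))"
  unfolding ip_def by (rule integral_rm_x[OF sqint_mult[OF assms(1,2)]])
 also have "... = (LINT y|mu c d. r*ip (mu a b) (%x. F' (x, y)) (%x. H' (x, y)))"
 proof (rule integral_cong_AE[OF _ _ eq])
  show "(%y. ip (mu a b) (%x. F (x, y)) (%x. H (x, y))) \<in> borel_measurable (mu c d)"
   unfolding ip_def by measurable
  show "(%y. r*ip (mu a b) (%x. F' (x, y)) (%x. H' (x, y))) \<in> borel_measurable (mu c d)"
   unfolding ip_def by measurable
 qed
 also have "... = r*ip (rm a b c d) F' H'"
  unfolding ip_def using integral_rm_x[OF sqint_mult[OF assms(3,4)]] by simp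
 finally show ?thesis .
qed

lemma Ly_sw: "Ly m K f = sw (Lx m K (sw f))"
 by (simp add: Ly_def Lx_def sw_def)

lemma Lx_measurable [measurable]:
 assumes K: "bkern K" and f: "is_borel f"
 shows "is_borel (Lx (mu a b) K f)"
proof -
 note [measurable] = bkern_measurable[OF K] f
 have "(%p. LINT s|mu a b. K (fst p) s*f (s, snd p)) \<in> borel_measurable (borel \<Otimes>\<^sub>M borel)"
  by measurable
 then show ?thesis by (simp add: Lx_def kop_def borel_prod)
qed

lemma Ly_measurable [measurable]:
 "bkern K ==> is_borel f ==> is_borel (Ly (mu c d) K f)"
 unfolding Ly_sw by measurable

text \<open>The kernel bound takes $L^1$ to bounded functions; passing from $L^2$ to $L^1$ and back
  from bounded functions to $L^2$ costs the square root of the length each time.\<close>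

lemma kop_nrm:
 assumes ab: "a <= b" and K: "bkern K" "!!x s. \<bar>K x s\<bar> <= B" and f: "f \<in> sqint (mu a b)"
 shows "kop (mu a b) K f \<in> sqint (mu a b)" "nrm (mu a b) (kop (mu a b) K f) <= B*(b-a)*nrm (mu a b) f"
proof -
 have fi: "integrable (mu a b) f" by (rule mu.sqint_int[OF f])
 have meas: "kop (mu a b) K f \<in> borel_measurable (mu a b)"
  using kop_measurable[OF fin_mu _ K(1)] sqint_measurable[OF f] by (simp add: mu_borel)
 have B: "0 <= B" using K(2)[of 0 0] by linarith
 have one: "(%x. 1 :: real) \<in> sqint (mu a b)" by (rule mu.sqint_bounded[where B=1]) auto
 have n1: "nrm (mu a b) (%x. 1) = sqrt (b-a)"
  using integral_mu_const[OF ab, of 1] by (simp add: nrm_def)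
 have "(%x. \<bar>f x\<bar>) \<in> sqint (mu a b)" "nrm (mu a b) (%x. \<bar>f x\<bar>) = nrm (mu a b) f"
  using f by (auto simp: sqint_def nrm_def)
 then have "(LINT s|mu a b. \<bar>f s\<bar>) <= sqrt (b-a)*nrm (mu a b) f"
  using ip_le_nrm[OF one, of "%x. \<bar>f x\<bar>"] n1 by (simp add: ip_def)
 then have bd: "\<bar>kop (mu a b) K f x\<bar> <= B*(sqrt (b-a)*nrm (mu a b) f)" for x
  using kop_bound[OF fin_mu _ K(1) fi, of x B] K(2) mult_left_mono[OF _ B]
  by (meson order_trans sets_mu)
 show 1: "kop (mu a b) K f \<in> sqint (mu a b)"
  by (rule mu.sqint_bounded[OF meas]) (use bd in auto)
 have "nrm (mu a b) (kop (mu a b) K f) <= nrm (mu a b) (%x. (B*(sqrt (b-a)*nrm (mu a b) f))*1)"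
  by (rule nrm_mono(2)[OF meas sqint_cmult[OF one]]) (use bd B ab in "auto simp: abs_mult")
 also have "... = B*(b-a)*nrm (mu a b) f"
  unfolding nrm_cmult n1 using B ab by (simp add: abs_mult mult_ac)
 finally show "nrm (mu a b) (kop (mu a b) K f) <= B*(b-a)*nrm (mu a b) f" .
qed

lemma Lx_bound:
 assumes "a <= b" "bkern K" "!!x s. \<bar>K x s\<bar> <= B" "f \<in> sqint (rm a b c d)"
 shows "Lx (mu a b) K f \<in> sqint (rm a b c d)"
  "nrm (rm a b c d) (Lx (mu a b) K f) <= B*(b-a)*nrm (rm a b c d) f"
proof -
 have "AE y in mu c d. (%x. f (x, y)) \<in> sqint (mu a b) --> (%x. Lx (mu a b) K f (x, y)) \<in> sqint (mu a b) \<and>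
    nrm (mu a b) (%x. Lx (mu a b) K f (x, y)) <= B*(b-a)*nrm (mu a b) (%x. f (x, y))"
  using kop_nrm[OF assms(1-3)] by (intro AE_I2) (simp add: Lx_def)
 from sqint_lift_x[OF Lx_measurable[OF assms(2) sqint_borel[OF assms(4)]] assms(4) _ this]
 show "Lx (mu a b) K f \<in> sqint (rm a b c d)"
  "nrm (rm a b c d) (Lx (mu a b) K f) <= B*(b-a)*nrm (rm a b c d) f"
  using assms(1) assms(3)[of 0 0] by auto
qed

lemma Lx_sqint:
 assumes "a <= b" "bkern K" "f \<in> sqint (rm a b c d)" 
 shows "Lx (mu a b) K f \<in> sqint (rm a b c d)"
proof -
 obtain B where "0 < B" "!!x s. \<bar>K x s\<bar> <= B" by (rule bounded_kernelE[OF assms(2)]) auto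
 with Lx_bound[OF assms(1,2) _ assms(3)] show ?thesis by auto
qed

lemma Ly_bound:
 assumes "c <= d" "bkern K" "!!x s. \<bar>K x s\<bar> <= B" and f: "f \<in> sqint (rm a b c d)"
 shows "nrm (rm a b c d) (Ly (mu c d) K f) <= B*(d-c)*nrm (rm a b c d) f"
proof -
 have [measurable]: "is_borel f" using f by (rule sqint_borel)
 have "is_borel (Lx (mu c d) K (sw f))"
  using assms(2) by measurable
 then show ?thesis
  using Lx_bound(2)[OF assms(1-3) sqint_sw[OF f]] by (simp add: Ly_sw nrm_sw)
qed

lemma Ly_sqint:
 "c <= d ==> bkern K ==> f \<in> sqint (rm a b c d) ==> Ly (mu c d) K f \<in> sqint (rm a b c d)"
 unfolding Ly_sw by (intro sqint_sw Lx_sqint)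


lemma AE_rm_eqI_y:
 fixes f g :: "fun2"
 assumes f: "is_borel f" and g: "is_borel g"
  and "AE x in mu a b. AE y in mu c d. f (x, y) = g (x, y)"
 shows "AE p in rm a b c d. f p = g p"
proof -
 have "{p \<in> space (mu a b \<Otimes>\<^sub>M mu c d). f p = g p} \<in> sets (mu a b \<Otimes>\<^sub>M mu c d)"
  using f[folded rm_borel[of _ a b c d]] g[folded rm_borel[of _ a b c d]]
  unfolding rm_def[symmetric] by measurable
 from mu2.AE_pair_measure[OF this assms(3)] show ?thesis
  unfolding rm_def .
qed

lemma AE_rm_eqI_x:
 fixes f g :: "fun2"
 assumes f: "is_borel f" and g: "is_borel g"
  and "AE y in mu c d. AE x in mu a b. f (x, y) = g (x, y)"
 shows "AE p in rm a b c d. f p = g p"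
proof -
 have "AE p in rm c d a b. sw f p = sw g p"
  by (rule AE_rm_eqI_y) (use assms in "auto simp: sw_def intro: measurable_sw[unfolded sw_def]")
 from AE_sw[OF this] show ?thesis by (simp add: sw_def)
qed

lemma kop_cong_AE:
 assumes "AE s in mu a b. f s = g s" "is_borel f" "is_borel g" "bkern K"
 shows "kop (mu a b) K f x = kop (mu a b) K g x"
 unfolding kop_def
proof (rule integral_cong_AE)
 note [measurable] = assms(2,3) bkern_row[OF assms(4)]
 show "(%s. K x s*f s) \<in> borel_measurable (mu a b)" "(%s. K x s*g s) \<in> borel_measurable (mu a b)"
  by measurable
qed (use assms(1) in "auto elim!: eventually_mono")

lemma Lx_cong_AE:
 assumes "AE p in rm a b c d. f p = g p"
  and K: "bkern K" and [measurable]: "is_borel f" "is_borel g"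
 shows "AE p in rm a b c d. Lx (mu a b) K f p = Lx (mu a b) K g p"
proof (rule AE_rm_eqI_x)
 show "AE y in mu c d. AE x in mu a b. Lx (mu a b) K f (x, y) = Lx (mu a b) K g (x, y)"
  using AE_rm_x[OF assms(1)]
 proof eventually_elim
  case (elim y)
  have "is_borel (%x. f (x, y))" "is_borel (%x. g (x, y))" by measurable
  from kop_cong_AE[OF elim this K] show ?case by (simp add: Lx_def)
 qed
qed (use K in measurable)

lemma Ly_cong_AE:
 assumes "AE p in rm a b c d. f p = g p"
  and K: "bkern K" and [measurable]: "is_borel f" "is_borel g"
 shows "AE p in rm a b c d. Ly (mu c d) K f p = Ly (mu c d) K g p"
proof -
 have "AE p in rm c d a b. Lx (mu c d) K (sw f) p = Lx (mu c d) K (sw g) p"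
  by (rule Lx_cong_AE) (use AE_sw[OF assms(1)] K in "auto simp: sw_def intro: measurable_sw[unfolded sw_def]")
 from AE_sw[OF this] show ?thesis by (simp add: Ly_sw sw_def)
qed

text \<open>Only almost everywhere: on a line where a slice is not integrable the integral has the
  default value 0 and additivity may fail. Multiplication by a constant has no such
  exception.\<close>

lemma Lx_diff:
 assumes K: "bkern K" and f: "f \<in> sqint (rm a b c d)" and g: "g \<in> sqint (rm a b c d)"
 shows "AE p in rm a b c d. Lx (mu a b) K (%q. f q - g q) p = Lx (mu a b) K f p - Lx (mu a b) K g p"
proof (rule AE_rm_eqI_x)
 note [measurable] = sqint_borel[OF f] sqint_borel[OF g]
 show "is_borel (Lx (mu a b) K (%q. f q - g q))"
  "is_borel (%p. Lx (mu a b) K f p - Lx (mu a b) K g p)" using K by measurable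
 show "AE y in mu c d. AE x in mu a b. Lx (mu a b) K (%q. f q - g q) (x, y)
   = Lx (mu a b) K f (x, y) - Lx (mu a b) K g (x, y)"
  using sqint_slice_x[OF f] sqint_slice_x[OF g]
 proof eventually_elim
  case (elim y)
  then show ?case
   by (simp add: Lx_def kop_diff[OF fin_mu sets_mu K] mu.sqint_int)
 qed
qed

lemma Ly_diff:
 assumes K: "bkern K" and f: "f \<in> sqint (rm a b c d)" and g: "g \<in> sqint (rm a b c d)"
 shows "AE p in rm a b c d. Ly (mu c d) K (%q. f q - g q) p = Ly (mu c d) K f p - Ly (mu c d) K g p"
 using AE_sw[OF Lx_diff[OF K sqint_sw[OF f] sqint_sw[OF g]]] by (simp add: Ly_sw sw_def)

lemma Lx_cmult: "Lx m K (%q. r*f q) = (%p. r*Lx m K f p)"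
 unfolding Lx_def kop_def integral_mult_right_zero[symmetric] by (simp add: mult.left_commute)

lemma Ly_cmult: "Ly m K (%q. r*f q) = (%p. r*Ly m K f p)"
 unfolding Ly_def kop_def integral_mult_right_zero[symmetric] by (simp add: mult.left_commute)

text \<open>At each fixed point both sides are iterated integrals of the integrable function K(x, s)
  L(y, t) f(s, t), so the equality holds everywhere and can be used for rewriting.\<close>

lemma Lx_Ly_commute:
 assumes K: "bkern K" and L: "bkern L" and f: "integrable (rm a b c d) f"
 shows "Lx (mu a b) K (Ly (mu c d) L f) = Ly (mu c d) L (Lx (mu a b) K f)"
proof
 fix p :: "real \<times> real"
 obtain x y where p: "p = (x, y)" by (cases p)
 obtain B where B: "0 < B" "!!x s. \<bar>K x s\<bar> <= B" by (rule bounded_kernelE[OF K]) auto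
 obtain B' where B': "0 < B'" "!!x s. \<bar>L x s\<bar> <= B'" by (rule bounded_kernelE[OF L]) auto
 have "f \<in> borel_measurable (rm a b c d)" using f by auto
 then have [measurable]: "f \<in> borel_measurable (borel \<Otimes>\<^sub>M borel)" by (simp add: rm_borel borel_prod)
 note [measurable] = bkern_row[OF K] bkern_row[OF L]
 have "integrable (rm a b c d) (%q. K x (fst q)*L y (snd q)*f q)"
 proof (rule Bochner_Integration.integrable_bound)
  show "integrable (rm a b c d) (%q. (B*B')*f q)" using f by simp
  have "(%q. K x (fst q)*L y (snd q)*f q) \<in> borel_measurable (mu a b \<Otimes>\<^sub>M mu c d)" by measurable
  then show "(%q. K x (fst q)*L y (snd q)*f q) \<in> borel_measurable (rm a b c d)" by (simp add: rm_def)
  have "\<bar>K x s*L y t\<bar>*r <= (B*B')*r" if "0 <= r" for s t r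
   unfolding abs_mult using B B' that by (intro mult_right_mono mult_mono) auto
  then show "AE q in rm a b c d. norm (K x (fst q)*L y (snd q)*f q) <= norm (B*B'*f q)"
   using B B' by (auto simp: abs_mult)
 qed
 then have "(LINT t|mu c d. (LINT s|mu a b. K x s*L y t*f (s, t))) = (LINT s|mu a b. (LINT t|mu c d. K x s*L y t*f (s, t)))"
  using mu2.Fubini_integral[of a b c d "%s t. K x s*L y t*f (s, t)"]
  by (simp add: rm_def split_beta')
 moreover have "(LINT s|mu a b. K x s*L y t*f (s, t)) = L y t*(LINT s|mu a b. K x s*f (s, t))" for t
  unfolding integral_mult_right_zero[symmetric] by (simp add: mult_ac)
 moreover have "(LINT t|mu c d. K x s*L y t*f (s, t)) = K x s*(LINT t|mu c d. L y t*f (s, t))" for s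
  unfolding integral_mult_right_zero[symmetric] by (simp add: mult_ac)
 ultimately show "Lx (mu a b) K (Ly (mu c d) L f) p = Ly (mu c d) L (Lx (mu a b) K f) p"
  by (simp add: Lx_def Ly_def kop_def p)
qed

abbreviation Gx :: "real => real => fun2 => fun2" where
 "Gx a b \<equiv> Lx (mu a b) (Gk a b)"
abbreviation Gx' :: "real => real => fun2 => fun2" where
 "Gx' a b \<equiv> Lx (mu a b) (G1k a b)"
abbreviation Gy :: "real => real => fun2 => fun2" where
 "Gy c d \<equiv> Ly (mu c d) (Gk c d)"
abbreviation Gy' :: "real => real => fun2 => fun2" where
 "Gy' c d \<equiv> Ly (mu c d) (G1k c d)"

context
 fixes a b c d :: real
 assumes ab: "a < b"
begin

lemma Gx_sqint [intro]: "f \<in> sqint (rm a b c d) ==> Gx a b f \<in> sqint (rm a b c d)"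
 by (rule Lx_sqint) (use ab bkern_Gk in auto)

lemma Gx'_sqint [intro]: "f \<in> sqint (rm a b c d) ==> Gx' a b f \<in> sqint (rm a b c d)"
 by (rule Lx_sqint) (use ab bkern_G1k in auto)

lemma nrm_Gx: "f \<in> sqint (rm a b c d) ==> nrm (rm a b c d) (Gx a b f) <= (b-a)\<^sup>2*nrm (rm a b c d) f"
 using Lx_bound(2)[of a b "Gk a b" "b - a" f c d] ab bkern_Gk Gk_bound
 by (simp add: power2_eq_square)

lemma nrm_Gx': "f \<in> sqint (rm a b c d) ==> nrm (rm a b c d) (Gx' a b f) <= (b-a)*nrm (rm a b c d) f"
 using Lx_bound(2)[of a b "G1k a b" 1 f c d] ab bkern_G1k G1k_bound by simp

lemma ip_Gx_Gx':
 assumes f: "f \<in> sqint (rm a b c d)" and g: "g \<in> sqint (rm a b c d)"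
 shows "ip (rm a b c d) f (Gx a b g) = - ip (rm a b c d) (Gx' a b f) (Gx' a b g)"
proof -
 have "ip (rm a b c d) f (Gx a b g) = -1*ip (rm a b c d) (Gx' a b f) (Gx' a b g)"
 proof (rule ip_lift_x)
  show "AE y in mu c d. ip (mu a b) (%x. f (x, y)) (%x. Gx a b g (x, y))
    = -1*ip (mu a b) (%x. Gx' a b f (x, y)) (%x. Gx' a b g (x, y))"
   using sqint_slice_x[OF f] sqint_slice_x[OF g]
   by eventually_elim (simp add: ip_def Lx_def integral_green_green'[OF ab] mu.sqint_int)
 qed (use f g in auto)
 then show ?thesis by simp
qed

lemma ip_Gx'_Gx:
 assumes f: "f \<in> sqint (rm a b c d)" and g: "g \<in> sqint (rm a b c d)"
 shows "ip (rm a b c d) (Gx' a b f) (Gx a b g) = - ip (rm a b c d) (Gx a b f) (Gx' a b g)"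
proof -
 have "ip (rm a b c d) (Gx' a b f) (Gx a b g) = -1*ip (rm a b c d) (Gx a b f) (Gx' a b g)"
 proof (rule ip_lift_x)
  show "AE y in mu c d. ip (mu a b) (%x. Gx' a b f (x, y)) (%x. Gx a b g (x, y))
    = -1*ip (mu a b) (%x. Gx a b f (x, y)) (%x. Gx' a b g (x, y))"
   using sqint_slice_x[OF f] sqint_slice_x[OF g]
   by eventually_elim (simp add: ip_def Lx_def integral_green'_green[OF ab] mu.sqint_int)
 qed (use f g in auto)
 then show ?thesis by simp
qed

lemma ip_Gx_sym:
 assumes "f \<in> sqint (rm a b c d)" and "g \<in> sqint (rm a b c d)"
 shows "ip (rm a b c d) f (Gx a b g) = ip (rm a b c d) (Gx a b f) g"
 using ip_Gx_Gx'[OF assms] ip_Gx_Gx'[OF assms(2,1)] by (simp add: ip_commute)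

end

context
 fixes a b c d :: real
 assumes cd: "c < d"
begin

lemma Gy_sqint [intro]: "f \<in> sqint (rm a b c d) ==> Gy c d f \<in> sqint (rm a b c d)"
 by (rule Ly_sqint) (use cd bkern_Gk in auto)

lemma Gy'_sqint [intro]: "f \<in> sqint (rm a b c d) ==> Gy' c d f \<in> sqint (rm a b c d)"
 by (rule Ly_sqint) (use cd bkern_G1k in auto)

lemma nrm_Gy: "f \<in> sqint (rm a b c d) ==> nrm (rm a b c d) (Gy c d f) <= (d-c)\<^sup>2*nrm (rm a b c d) f"
 using Ly_bound[of c d "Gk c d" "d - c" f a b] cd bkern_Gk Gk_bound
 by (simp add: power2_eq_square)

lemma nrm_Gy': "f \<in> sqint (rm a b c d) ==> nrm (rm a b c d) (Gy' c d f) <= (d-c)*nrm (rm a b c d) f"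
 using Ly_bound[of c d "G1k c d" 1 f a b] cd bkern_G1k G1k_bound by simp

lemma ip_sw_sqint:
 assumes "f \<in> sqint (rm c d a b)" "g \<in> sqint (rm c d a b)"
 shows "ip (rm a b c d) (sw f) (sw g) = ip (rm c d a b) f g"
 by (rule ip_sw) (use assms sqint_borel in auto)

lemma ip_Gy_Gy':
 assumes f: "f \<in> sqint (rm a b c d)" and g: "g \<in> sqint (rm a b c d)"
 shows "ip (rm a b c d) f (Gy c d g) = - ip (rm a b c d) (Gy' c d f) (Gy' c d g)"
 using ip_Gx_Gx'[OF cd sqint_sw[OF f] sqint_sw[OF g]] 
  ip_sw_sqint[OF sqint_sw[OF f] Gx_sqint[OF cd sqint_sw[OF g]]]
  ip_sw_sqint[OF Gx'_sqint[OF cd sqint_sw[OF f]] Gx'_sqint[OF cd sqint_sw[OF g]]]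
 by (simp add: Ly_sw)

lemma ip_Gy'_Gy:
 assumes f: "f \<in> sqint (rm a b c d)" and g: "g \<in> sqint (rm a b c d)"
 shows "ip (rm a b c d) (Gy' c d f) (Gy c d g) = - ip (rm a b c d) (Gy c d f) (Gy' c d g)"
 using ip_Gx'_Gx[OF cd sqint_sw[OF f] sqint_sw[OF g]] 
  ip_sw_sqint[OF Gx'_sqint[OF cd sqint_sw[OF f]] Gx_sqint[OF cd sqint_sw[OF g]]]
  ip_sw_sqint[OF Gx_sqint[OF cd sqint_sw[OF f]] Gx'_sqint[OF cd sqint_sw[OF g]]]
 by (simp add: Ly_sw)

lemma ip_Gy_sym:
 assumes "f \<in> sqint (rm a b c d)" and "g \<in> sqint (rm a b c d)"
 shows "ip (rm a b c d) f (Gy c d g) = ip (rm a b c d) (Gy c d f) g"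
 using ip_Gy_Gy'[OF assms] ip_Gy_Gy'[OF assms(2,1)] by (simp add: ip_commute)

end

section \<open>Approximation and inverse estimates by polynomials\<close>

lemma poly_measurable [measurable]: "(%x. poly p x) \<in> borel_measurable (borel :: real measure)"
 by (intro borel_measurable_continuous_onI continuous_intros)

lemma bounded_sqint_mu:
 assumes "is_borel f" "!!x. a < x ==> x < b ==> \<bar>f x\<bar> <= B"
 shows "f \<in> sqint (mu a b)"
 by (rule mu.sqint_bounded[where B=B]) (use assms in "auto simp: mu_borel intro: eventually_mono[OF AE_mu_Ioo]")

lemma poly_bounded_Icc: "\<exists>B. \<forall>x. a <= x --> x <= b --> \<bar>poly p x\<bar> <= (B :: real)"
proof -
 have "bounded (poly p ` {a..b})"
  by (intro compact_imp_bounded compact_continuous_image continuous_intros) simp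
 then obtain B where "\<forall>y\<in>poly p ` {a..b}. norm y <= B" by (auto simp: bounded_iff)
 then show ?thesis by (intro exI[of _ B]) auto
qed

lemma poly_sqint [simp, intro]: "(%x. poly p x) \<in> sqint (mu a b)"
proof -
 obtain B where "!!x. a <= x ==> x <= b ==> \<bar>poly p x\<bar> <= B"
  using poly_bounded_Icc by blast
 then show ?thesis by (intro bounded_sqint_mu[where B=B]) auto
qed

lemma AE_mu_ex:
 assumes "a < b" "AE x in mu a b. P x" "finite S"
 shows "\<exists>x. a < x \<and> x < b \<and> x \<notin> S \<and> P x"
proof (rule ccontr)
 assume no: "\<not> ?thesis"
 have "AE x in mu a b. x \<notin> S" by (rule AE_mu_finite[OF assms(3)]) auto
 then have "AE x in mu a b. False"
  using assms(2) AE_mu_Ioo[of a b] by eventually_elim (use no in auto)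
 then have "(LINT x|mu a b. (1 :: real)) = (LINT x|mu a b. 0)"
  by (intro integral_cong_AE) (auto elim: eventually_mono)
 then show False unfolding integral_mu_const[OF less_imp_le[OF assms(1)]] using assms(1) by simp
qed

lemma nrm_poly_pos:
 assumes "a < b" "p \<noteq> 0"
 shows "0 < nrm (mu a b) (%x. poly p x)"
proof -
 have "nrm (mu a b) (%x. poly p x) \<noteq> 0"
 proof
  assume "nrm (mu a b) (%x. poly p x) = 0"
  then have "AE x in mu a b. poly p x = 0" by (simp add: nrm_eq_0_iff)
  from AE_mu_ex[OF assms(1) this poly_roots_finite[OF assms(2)]] show False by auto
 qed
 then show ?thesis using nrm_nonneg[of "mu a b" "%x. poly p x"] by linarith
qed

text \<open>Gram-Schmidt applied to the monomials. The span is described by vanishing coefficients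
  because for n = 0 it has to be {0}, which a condition degree < n cannot express.\<close>

lemma orthonormal_polys_exist:
 "\<exists>L :: nat => real poly. (\<forall>i<n. degree (L i) <= i) \<and>
   (\<forall>i<n. \<forall>j<n. ip (mu 0 1) (%x. poly (L i) x) (%x. poly (L j) x) = (if i = j then 1 else 0)) \<and>
   (\<forall>p. (\<forall>m\<ge>n. coeff p m = 0) --> (\<exists>c. p = (\<Sum>j<n. smult (c j) (L j))))"
proof (induction n)
 case 0
 have "p = 0" if "\<forall>m\<ge>0. coeff p m = 0" for p :: "real poly"
  using that by (simp add: poly_eq_iff)
 then show ?case by auto
next
 case (Suc n)
 then obtain L :: "nat => real poly" where deg: "!!i. i < n ==> degree (L i) <= i"
  and on: "!!i j. i < n ==> j < n ==> ip (mu 0 1) (%x. poly (L i) x) (%x. poly (L j) x) = (if i = j then 1 else 0)"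
  and sp: "!!p. (\<forall>m\<ge>n. coeff p m = 0) ==> \<exists>c. p = (\<Sum>j<n. smult (c j) (L j))"
  by blast
 interpret orthonormal_family "mu 0 1" "{..<n}" "%i x. poly (L i) x"
  by unfold_locales (auto simp: on)
 let ?f = "%x :: real. poly (monom 1 n) x"
 \<comment> \<open>The monomial minus its projection onto the earlier polynomials; it stays monic,
   hence nonzero, and can be normalized.\<close>
 define q where "q = monom 1 n - (\<Sum>j<n. smult (ip (mu 0 1) ?f (%x. poly (L j) x)) (L j))"
 have q_eq: "(%x. poly q x) = (%x. ?f x - proj ?f x)"
  by (simp add: q_def proj_def comb_def poly_sum fun_eq_iff)
 have Lc: "coeff (L j) m = 0" if "j < n" "m \<ge> n" for j m
  using deg[OF that(1)] that by (intro coeff_eq_0) simp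
 have qn: "coeff q n = 1" by (simp add: q_def coeff_sum Lc)
 have qm: "coeff q m = 0" if "m > n" for m using that by (simp add: q_def coeff_sum Lc)
 have q0: "q \<noteq> 0" using qn by auto
 define s where "s = nrm (mu 0 1) (%x. poly q x)"
 have s: "s > 0" unfolding s_def by (rule nrm_poly_pos) (use q0 in auto)
 have qL: "ip (mu 0 1) (%x. poly q x) (%x. poly (L j) x) = 0" if "j < n" for j
 proof -
  have "comb (%i. if i = j then 1 else 0) = (%x. poly (L j) x)"
   using that by (simp add: comb_def fun_eq_iff if_distrib if_distribR sum.delta cong: if_cong)
  then show ?thesis using ip_proj_residual[OF poly_sqint, of "monom 1 n" "%i. if i = j then 1 else 0"]
   by (simp add: q_eq)
 qed
 define L' where "L' = L(n := smult (1 / s) q)"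
 have 1: "degree (L' i) <= i" if "i < Suc n" for i
 proof (cases "i = n")
  case True
  have "degree q <= n" using qm by (intro degree_le) blast
  then show ?thesis using True s by (simp add: L'_def)
 next
  case False
  then show ?thesis using deg[of i] that by (simp add: L'_def)
 qed
 have 2: "ip (mu 0 1) (%x. poly (L' i) x) (%x. poly (L' j) x) = (if i = j then 1 else 0)"
  if "i < Suc n" "j < Suc n" for i j
 proof -
  note ij = that
  have qq: "ip (mu 0 1) (%x. poly q x) (%x. poly q x) = s^2" by (simp add: s_def nrm_square)
  have L'n: "(%x. poly (L' n) x) = (%x. 1 / s*poly q x)" by (simp add: L'_def)
  have L'i: "(%x. poly (L' i) x) = (%x. poly (L i) x)" if "i \<noteq> n" for i using that by (simp add: L'_def)
  consider "i = n" "j = n" | "i = n" "j < n" | "i < n" "j = n" | "i < n" "j < n"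
   using ij by (auto simp: less_Suc_eq)
  then show ?thesis
  proof cases
   case 1
   then show ?thesis using s by (simp only: L'n ip_cmult_left ip_cmult_right qq) (simp add: power2_eq_square)
  next
   case 2
   then show ?thesis by (simp only: L'n L'i[of j] ip_cmult_left qL) simp
  next
   case 3
   then show ?thesis by (simp only: L'n L'i[of i] ip_cmult_right ip_commute[of _ "%x. poly (L i) x"] qL) simp
  next
   case 4
   then show ?thesis using on[of i j] by (simp only: L'i[of i] L'i[of j])
  qed
 qed
 have 3: "\<exists>c. p = (\<Sum>j<Suc n. smult (c j) (L' j))" if "\<forall>m\<ge>Suc n. coeff p m = 0" for p
 proof -
  have "\<forall>m\<ge>n. coeff (p - smult (coeff p n) q) m = 0"
  proof (intro allI impI)
   fix m assume "m \<ge> n"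
   then show "coeff (p - smult (coeff p n) q) m = 0"
    using that qn qm[of m] by (cases "m = n") auto
  qed
  from sp[OF this] obtain c where c: "p - smult (coeff p n) q = (\<Sum>j<n. smult (c j) (L j))" by blast
  have "(\<Sum>j<Suc n. smult ((c(n := coeff p n * s)) j) (L' j)) = (\<Sum>j<n. smult (c j) (L j)) + smult (coeff p n) q"
   using s by (simp add: L'_def)
  also have "... = p" by (simp flip: c)
  finally show ?thesis by (intro exI[of _ "c(n := coeff p n * s)"]) (rule sym)
 qed
 show ?case
  by (rule exI[of _ L'], intro conjI allI impI) (fact 1, fact 2, rule 3, assumption)
qed

definition refpoly :: "nat => nat => real poly" where
 "refpoly n = (SOME L. (\<forall>i<n. degree (L i) <= i) \<and>
   (\<forall>i<n. \<forall>j<n. ip (mu 0 1) (%x. poly (L i) x) (%x. poly (L j) x) = (if i = j then 1 else 0)) \<and>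
   (\<forall>p. (\<forall>m\<ge>n. coeff p m = 0) --> (\<exists>c. p = (\<Sum>j<n. smult (c j) (L j)))))"

lemmas refpoly = someI_ex[OF orthonormal_polys_exist, folded refpoly_def]

lemma degree_refpoly: "i < n ==> degree (refpoly n i) <= i"
 using refpoly[of n, THEN conjunct1] by simp

lemma ip_refpoly: "i < n ==> j < n ==>
  ip (mu 0 1) (%x. poly (refpoly n i) x) (%x. poly (refpoly n j) x) = (if i = j then 1 else 0)"
 using refpoly[of n, THEN conjunct2, THEN conjunct1] by simp

lemma refpoly_span: "(\<forall>m\<ge>n. coeff p m = 0) ==> \<exists>c. p = (\<Sum>j<n. smult (c j) (refpoly n j))"
 using refpoly[of n, THEN conjunct2, THEN conjunct2] by simp

lemma integral_mu_affine:
 fixes f :: "real => real"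
 assumes "u < v" and [measurable]: "is_borel f"
 shows "(LINT x|mu u v. f x) = (v-u)*(LINT t|mu 0 1. f (u + (v-u)*t))"
proof -
 have ind: "indicator {u<..<v} (u + (v-u)*t) = (indicator {0<..<1} t :: real)" for t
 proof -
  have "(v-u)*t < v - u \<longleftrightarrow> t < 1" "0 < (v-u)*t \<longleftrightarrow> 0 < t"
   using assms(1) mult_less_cancel_left_pos[of "v - u" t 1] by (simp_all add: zero_less_mult_iff)
  then have "u + (v-u)*t < v \<longleftrightarrow> t < 1" "u < u + (v-u)*t \<longleftrightarrow> 0 < t" by linarith+
  then show ?thesis by (simp add: indicator_def)
 qed
 have "(LINT x|mu u v. f x) = (LINT x|lborel. indicator {u<..<v} x *\<^sub>R f x)"
  by (simp add: integral_mu set_lebesgue_integral_def)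
 also have "... = \<bar>v - u\<bar> *\<^sub>R (LINT t|lborel. indicator {u<..<v} (u + (v-u)*t) *\<^sub>R f (u + (v-u)*t))"
  by (rule lborel_integral_real_affine) (use assms in auto)
 also have "... = (v-u)*(LINT t|mu 0 1. f (u + (v-u)*t))"
  using assms by (simp add: integral_mu set_lebesgue_integral_def ind)
 finally show ?thesis .
qed

lemma nrm_mu_affine:
 assumes "u < v" "is_borel f"
 shows "nrm (mu u v) f = sqrt (v-u)*nrm (mu 0 1) (%t. f (u + (v-u)*t))"
 unfolding nrm_def using assms by (subst integral_mu_affine) (auto simp: real_sqrt_mult)

lemma pderiv_sum: "pderiv (sum f A) = (\<Sum>x\<in>A. pderiv (f x))"
 using higher_pderiv_sum[of 1 f A] by simp

text \<open>A bound for the norm of differentiation on polynomials of degree below n over (0, 1):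
  each coefficient in the orthonormal basis is at most the norm of the polynomial, and the
  derivatives of the basis are added up.\<close>

definition inv_const :: "nat => real" where
 "inv_const n = (\<Sum>j<n. nrm (mu 0 1) (%x. poly (pderiv (refpoly n j)) x))"

lemma inv_const_nonneg [simp]: "0 <= inv_const n"
 by (simp add: inv_const_def sum_nonneg)

lemma nrm_sum_le:
 assumes "!!i. i \<in> I ==> f i \<in> sqint M"
 shows "nrm M (%x. \<Sum>i\<in>I. f i x) <= (\<Sum>i\<in>I. nrm M (f i))"
 using assms
proof (induction I rule: infinite_finite_induct)
 case (insert i I)
 have "nrm M (%x. f i x + (\<Sum>i\<in>I. f i x)) <= nrm M (f i) + nrm M (%x. \<Sum>i\<in>I. f i x)"
  using insert by (intro nrm_triangle sqint_sum) auto
 then show ?case using insert by simp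
qed simp_all

lemma inverse_estimate_ref:
 assumes "degree p < n"
 shows "nrm (mu 0 1) (%x. poly (pderiv p) x) <= inv_const n*nrm (mu 0 1) (%x. poly p x)"
proof -
 interpret orthonormal_family "mu 0 1" "{..<n}" "%i x. poly (refpoly n i) x"
  by unfold_locales (auto simp: ip_refpoly)
 have "\<forall>m\<ge>n. coeff p m = 0" using assms by (auto intro: coeff_eq_0)
 then obtain c where c: "p = (\<Sum>j<n. smult (c j) (refpoly n j))" using refpoly_span by blast
 have p: "(%x. poly p x) = comb c" by (simp add: c comb_def poly_sum)
 have cj: "\<bar>c j\<bar> <= nrm (mu 0 1) (%x. poly p x)" if "j < n" for j
 proof -
  have "\<bar>c j\<bar>\<^sup>2 <= (\<Sum>i<n. (c i)\<^sup>2)" using member_le_sum[of j "{..<n}" "%i. (c i)\<^sup>2"] that by simp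
  then show ?thesis unfolding p nrm_comb_square[symmetric] by (rule power2_le_imp_le) simp
 qed
 have "nrm (mu 0 1) (%x. poly (pderiv p) x) = nrm (mu 0 1) (%x. \<Sum>j<n. c j*poly (pderiv (refpoly n j)) x)"
  by (subst c) (simp add: pderiv_sum pderiv_smult poly_sum[abs_def])
 also have "... <= (\<Sum>j<n. nrm (mu 0 1) (%x. c j*poly (pderiv (refpoly n j)) x))"
  by (rule nrm_sum_le) auto
 also have "... = (\<Sum>j<n. \<bar>c j\<bar>*nrm (mu 0 1) (%x. poly (pderiv (refpoly n j)) x))"
  by (simp add: nrm_cmult)
 also have "... <= (\<Sum>j<n. nrm (mu 0 1) (%x. poly p x)*nrm (mu 0 1) (%x. poly (pderiv (refpoly n j)) x))"
  by (intro sum_mono mult_right_mono cj) auto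
 finally show ?thesis by (simp add: inv_const_def sum_distrib_left mult.commute)
qed

text \<open>Transport to (0, 1) by an affine map: the chain rule produces 1/(v-u), while the factors
  from the change of variables are equal on both sides.\<close>

lemma inverse_estimate:
 assumes "u < v" "degree p < n"
 shows "nrm (mu u v) (%x. poly (pderiv p) x) <= inv_const n/(v-u)*nrm (mu u v) (%x. poly p x)"
proof -
 let ?h = "v - u"
 let ?q = "pcompose p [:u, ?h:]"
 have deg: "degree ?q < n" using assms by (simp add: degree_pcompose)
 have "pderiv ?q = smult ?h (pcompose (pderiv p) [:u, ?h:])"
  by (simp add: pderiv_pcompose pderiv_pCons)
 then have dq: "(%t. poly (pderiv ?q) t) = (%t. ?h*poly (pderiv p) (u + ?h*t))"
  by (simp add: poly_pcompose mult.commute)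
 have "?h*nrm (mu 0 1) (%t. poly (pderiv p) (u + ?h*t)) <= inv_const n*nrm (mu 0 1) (%t. poly p (u + ?h*t))"
  using inverse_estimate_ref[OF deg] assms(1) unfolding dq nrm_cmult by (simp add: poly_pcompose mult.commute)
 then have "nrm (mu 0 1) (%t. poly (pderiv p) (u + ?h*t)) <= inv_const n / ?h*nrm (mu 0 1) (%t. poly p (u + ?h*t))"
  using assms(1) by (simp add: field_simps)
 from mult_left_mono[OF this real_sqrt_ge_zero[of ?h]] assms(1) show ?thesis
  by (simp add: nrm_mu_affine[OF assms(1) poly_measurable] mult_ac)
qed

lemma pderiv_surj: "\<exists>q. pderiv q = (p :: real poly) \<and> degree q <= Suc (degree p)"
proof -
 define q where "q = (\<Sum>i\<le>degree p. monom (coeff p i/real (Suc i)) (Suc i))"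
 have "pderiv q = (\<Sum>i\<le>degree p. monom (coeff p i) i)"
  by (simp add: q_def pderiv_sum pderiv_monom)
 then have "pderiv q = p" by (simp add: poly_as_sum_of_monoms)
 moreover have "degree q <= Suc (degree p)"
  unfolding q_def by (rule degree_sum_le) (auto intro: order_trans[OF degree_monom_le])
 ultimately show ?thesis by blast
qed

lemma anti_poly:
 assumes "pderiv q = p" "x \<in> {u..v}"
 shows "anti u v (%x. poly p x) x = poly q x - poly q u"
proof (rule anti_of_deriv[OF _ _ _ _ assms(2), of "{}"])
 show "integrable (mu u v) (%x. poly p x)" by (rule mu.sqint_int) simp
 show "(poly q has_real_derivative poly p x) (at x)" for x
  using poly_DERIV[of q x] assms(1) by simp
qed (auto intro!: continuous_intros)

lemma anti_abs_le:
 assumes "integrable (mu u v) f"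
 shows "\<bar>anti u v f x\<bar> <= (LINT s|mu u v. \<bar>f s\<bar>)"
 using kop_bound[OF fin_mu _ bkern_Ik assms, of x 1] by (simp add: Ik_def)

lemma L1_le_nrm:
 assumes "u <= v" "f \<in> sqint (mu u v)"
 shows "(LINT s|mu u v. \<bar>f s\<bar>) <= sqrt (v-u)*nrm (mu u v) f"
proof -
 have one: "(%x. 1 :: real) \<in> sqint (mu u v)" by (rule mu.sqint_bounded[where B=1]) auto
 have n1: "nrm (mu u v) (%x. 1) = sqrt (v-u)"
  using integral_mu_const[OF assms(1), of 1] by (simp add: nrm_def)
 have "(%x. \<bar>f x\<bar>) \<in> sqint (mu u v)" "nrm (mu u v) (%x. \<bar>f x\<bar>) = nrm (mu u v) f"
  using assms by (auto simp: sqint_def nrm_def)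
 then show ?thesis
  using ip_le_nrm[OF one, of "%x. \<bar>f x\<bar>"] n1 by (simp add: ip_def)
qed

text \<open>A pointwise bound by an $L^1$ norm is worth a full factor v-u between $L^2$ norms; this
  is how every local estimate gains its power of the cell length.\<close>

lemma nrm_le_of_L1_bound:
 assumes "u <= v" "f \<in> sqint (mu u v)" "is_borel F" "0 <= \<kappa>"
  and "AE x in mu u v. \<bar>F x\<bar> <= \<kappa>*(LINT s|mu u v. \<bar>f s\<bar>)"
 shows "nrm (mu u v) F <= \<kappa>*(v-u)*nrm (mu u v) f"
proof -
 let ?I = "\<integral>s. \<bar>f s\<bar> \<partial>mu u v"
 have one: "(%x. 1 :: real) \<in> sqint (mu u v)" by (rule mu.sqint_bounded[where B=1]) auto
 have n1: "nrm (mu u v) (%x. 1) = sqrt (v-u)"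
  using integral_mu_const[OF assms(1), of 1] by (simp add: nrm_def)
 have "nrm (mu u v) F <= nrm (mu u v) (%x. (\<kappa> * ?I)*1)"
  by (rule nrm_mono(2)[OF _ sqint_cmult[OF one]]) (use assms in "auto simp: mu_borel elim: eventually_mono")
 also have "... = \<kappa> * sqrt (v-u) * ?I"
  unfolding nrm_cmult n1 using assms(4) by (simp add: abs_mult mult_ac)
 also have "... <= \<kappa> * sqrt (v-u)*(sqrt (v-u)*nrm (mu u v) f)"
  using assms by (intro mult_left_mono L1_le_nrm) auto
 also have "... = \<kappa>*(v-u)*nrm (mu u v) f"
  using assms(1) by (simp add: mult_ac flip: mult.assoc[of "sqrt _" "sqrt _"])
 finally show ?thesis .
qed

text \<open>Approximate the derivative, integrate the approximant and keep the constant of f: each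
  integration gains a factor v-u. Derivatives enter as a chain of antiderivatives up to constants,
  the form in which slices of weak derivatives are available.\<close>

lemma local_poly_approx:
 fixes f :: "nat => real => real"
 assumes ab: "u < v"
  and int: "!!j. j <= Suc m ==> integrable (mu u v) (f j)"
  and chain: "!!j. j <= m ==> \<exists>c. AE x in mu u v. f j x = c + anti u v (f (Suc j)) x"
 shows "\<exists>q. degree q <= m \<and> (AE x in mu u v. \<bar>f 0 x - poly q x\<bar> <= (v-u) ^ m*(LINT s|mu u v. \<bar>f (Suc m) s\<bar>))"
 using int chain
proof (induction m arbitrary: f)
 case 0
 then obtain c where c: "AE x in mu u v. f 0 x = c + anti u v (f (Suc 0)) x" by blast
 then have "AE x in mu u v. \<bar>f 0 x - poly [:c:] x\<bar> <= (v-u) ^ 0*(LINT s|mu u v. \<bar>f (Suc 0) s\<bar>)"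
  by eventually_elim (use anti_abs_le[OF 0(1)[of "Suc 0"]] in simp)
 then show ?case by (intro exI[of _ "[:c:]"]) auto
next
 case (Suc m)
 have "\<exists>q. degree q <= m \<and> (AE x in mu u v. \<bar>f (Suc 0) x - poly q x\<bar> <= (v-u) ^ m*(LINT s|mu u v. \<bar>f (Suc (Suc m)) s\<bar>))"
  using Suc.IH[of "%j. f (Suc j)"] Suc.prems by simp
 then obtain q where q: "degree q <= m"
  and le: "AE x in mu u v. \<bar>f (Suc 0) x - poly q x\<bar> <= (v-u) ^ m*(LINT s|mu u v. \<bar>f (Suc (Suc m)) s\<bar>)"
  by blast
 obtain c where c: "AE x in mu u v. f 0 x = c + anti u v (f (Suc 0)) x"
  using Suc.prems(2)[of 0] by blast
 obtain Q where Q: "pderiv Q = q" "degree Q <= Suc (degree q)" using pderiv_surj by blast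
 \<comment> \<open>The antiderivative of the approximant q that takes the value c at u, so that only
   antiderivatives remain in the difference.\<close>
 let ?r = "Q + [:c - poly Q u:]"
 have f1: "integrable (mu u v) (f (Suc 0))" using Suc.prems(1) by simp
 have qi: "integrable (mu u v) (%x. poly q x)" by (rule mu.sqint_int) simp
 have di: "integrable (mu u v) (%s. f (Suc 0) s - poly q s)" using f1 qi by simp
 let ?B = "(v-u) ^ m*(LINT s|mu u v. \<bar>f (Suc (Suc m)) s\<bar>)"
 have "(LINT s|mu u v. \<bar>f (Suc 0) s - poly q s\<bar>) <= (LINT s|mu u v. ?B)"
  using di le by (intro integral_mono_AE) auto
 also have "... = (v-u) * ?B" by (rule integral_mu_const) (use ab in simp)
 finally have bd: "(LINT s|mu u v. \<bar>f (Suc 0) s - poly q s\<bar>) <= (v-u) * ?B" .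
 have "AE x in mu u v. \<bar>f 0 x - poly ?r x\<bar> <= (v-u) ^ Suc m*(LINT s|mu u v. \<bar>f (Suc (Suc m)) s\<bar>)"
  using c AE_mu_Ioo[of u v]
 proof eventually_elim
  case (elim x)
  have "f 0 x - poly ?r x = anti u v (f (Suc 0)) x - anti u v (%x. poly q x) x"
   using elim anti_poly[OF Q(1), of x u v] by simp
  also have "... = anti u v (%s. f (Suc 0) s - poly q s) x"
   using kop_diff[OF fin_mu sets_mu bkern_Ik f1 qi] by simp
  finally show ?case using anti_abs_le[OF di, of x] bd by (simp add: mult_ac)
 qed
 moreover have "degree ?r <= Suc m"
  using Q(2) q by (intro degree_add_le) auto
 ultimately show ?case by blast
qed

section \<open>Piecewise polynomials on a mesh\<close>

lemma integrable_mu_subset: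
 fixes f :: "real => real"
 assumes "integrable (mu a b) f" "a <= \<alpha>" "\<beta> <= b"
 shows "integrable (mu \<alpha> \<beta>) f"
proof -
 have [measurable]: "is_borel f"
  using assms(1) mu_borel by blast
 have "set_integrable lborel {a<..<b} f" using assms(1) by (simp add: integrable_mu)
 then have "set_integrable lborel {\<alpha><..<\<beta>} f"
  by (rule set_integrable_subset) (use assms in auto)
 then show ?thesis by (simp add: integrable_mu)
qed

lemma sqint_mu_subset:
 assumes "f \<in> sqint (mu a b)" "a <= \<alpha>" "\<beta> <= b"
 shows "f \<in> sqint (mu \<alpha> \<beta>)"
 using assms integrable_mu_subset[OF sqint_square[OF assms(1)] assms(2,3)]
 by (auto simp: sqint_def mu_borel)

lemma AE_mu_subset:
 assumes "AE x in mu a b. P x" "a <= \<alpha>" "\<beta> <= b"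
 shows "AE x in mu \<alpha> \<beta>. P x"
 using assms(1) unfolding AE_mu_iff by eventually_elim (use assms(2,3) in auto)

lemma integral_mu_combine:
 fixes f :: "real => real"
 assumes f: "integrable (mu a c) f" and le: "a <= b" "b <= c"
 shows "(LINT x|mu a c. f x) = (LINT x|mu a b. f x) + (LINT x|mu b c. f x)"
proof -
 have [measurable]: "is_borel f"
  using f mu_borel by blast
 have 1: "set_integrable lborel {a<..<b} f" "set_integrable lborel {b<..<c} f"
  using integrable_mu_subset[OF f] le by (simp_all add: integrable_mu)
 have "(LINT x|mu a c. f x) = (LINT x|lborel. indicator {a<..<b} x*f x + indicator {b<..<c} x*f x)"
  unfolding integral_mu[OF \<open>f \<in> borel_measurable borel\<close>] set_lebesgue_integral_def
 proof (rule integral_cong_AE)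
  have "AE x in lborel. x \<notin> {b}" by (rule AE_not_in[OF finite_imp_null_set_lborel]) simp
  then show "AE x in lborel. indicator {a<..<c} x *\<^sub>R f x = indicator {a<..<b} x*f x + indicator {b<..<c} x*f x"
   by eventually_elim (use le in "auto simp: indicator_def")
 qed auto
 also have "... = (LINT x|mu a b. f x) + (LINT x|mu b c. f x)"
  using 1 by (simp add: integral_mu set_lebesgue_integral_def set_integrable_def)
 finally show ?thesis .
qed

lemma anti_split:
 assumes f: "integrable (mu a b) f" and "a <= \<alpha>" "\<beta> <= b" "x \<in> {\<alpha>..\<beta>}"
 shows "anti a b f x = anti a b f \<alpha> + anti \<alpha> \<beta> f x"
proof -
 have cut: "anti u v f t = (LINT s|mu u t. f s)" if "a <= u" "u <= t" "t <= v" "v <= b" for u v t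
 proof -
  have fi: "integrable (mu u v) f" by (rule integrable_mu_subset[OF f]) (use that in auto)
  have "anti u v f t = (LINT s|mu u t. Ik t s*f s) + (LINT s|mu t v. Ik t s*f s)"
   unfolding kop_def
   by (rule integral_mu_combine) (use that fi integrable_kmult[OF fin_mu _ bkern_Ik fi] in auto)
  moreover have "(LINT s|mu t v. Ik t s*f s) = 0"
   by (rule integral_eq_zero_AE) (auto simp: Ik_def AE_mu_iff)
  moreover have "(LINT s|mu u t. Ik t s*f s) = (LINT s|mu u t. f s)"
  proof (rule integral_cong_AE)
   show "(%s. Ik t s*f s) \<in> borel_measurable (mu u t)" "f \<in> borel_measurable (mu u t)"
    using f bkern_row[OF bkern_Ik] by (auto simp: mu_borel)
  qed (auto simp: Ik_def AE_mu_iff)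
  ultimately show ?thesis by simp
 qed
 have "(LINT s|mu a x. f s) = (LINT s|mu a \<alpha>. f s) + (LINT s|mu \<alpha> x. f s)"
  by (rule integral_mu_combine[OF integrable_mu_subset[OF f]]) (use assms in auto)
 then show ?thesis using cut[of a x b] cut[of a \<alpha> b] cut[of \<alpha> x \<beta>] assms by simp
qed

text \<open>\<open>n\<close> is the number of coefficients per cell, k - 1 in the end: degree below
  n means degree at most k - 2, and integrating twice leads to degree n + 1 = k. \<open>n_ge\<close>
  puts the affine functions among the piecewise polynomials.\<close>

locale mesh1 =
 fixes a b :: real and M :: nat and X :: "nat => real" and n :: nat
 assumes X_0: "X 0 = a" and X_M: "X M = b" and X_less: "!!i. i \<in> {1..M} ==> X (i-1) < X i"
  and ab: "a < b" and n_ge: "2 <= n"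
begin

lemma M_pos: "1 <= M"
 using X_0 X_M ab by (cases "M = 0") auto

lemma X_mono: "i <= j ==> j <= M ==> X i <= X j"
proof (induction j rule: dec_induct)
 case (step j)
 then show ?case using X_less[of "Suc j"] by force
qed simp

abbreviation cell :: "nat => real set" where "cell i \<equiv> {X (i-1)<..<X i}"
abbreviation cmu :: "nat => real measure" where "cmu i \<equiv> mu (X (i-1)) (X i)"

lemma cell_bounds: "i \<in> {1..M} ==> a <= X (i-1)" "i \<in> {1..M} ==> X i <= b"
 using X_mono[of 0 "i - 1"] X_mono[of i M] by (auto simp: X_0 X_M)

lemma cell_unique:
 assumes "i \<in> {1..M}" "i' \<in> {1..M}" "x \<in> cell i" "x \<in> cell i'"
 shows "i = i'"
proof -
 have "False" if "i < i'" "i' \<in> {1..M}" "x \<in> cell i" "x \<in> cell i'" for i i'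
 proof -
  have "X i <= X (i'-1)" by (rule X_mono) (use that in auto)
  then show False using that by simp
 qed
 then show ?thesis using assms by (metis linorder_neqE_nat)
qed

lemma cell_exists:
 assumes "a < x" "x < b" "x \<notin> X ` {..M}"
 shows "\<exists>i\<in>{1..M}. x \<in> cell i"
proof -
 define i where "i = (LEAST i. x < X i)"
 have ex: "x < X M" using assms X_M by simp
 have 1: "x < X i" unfolding i_def by (rule LeastI[of "%i. x < X i", OF ex])
 have 2: "i <= M" unfolding i_def by (rule Least_le) (rule ex)
 have 3: "i \<noteq> 0" using 1 assms X_0 by (metis order.asym)
 have "\<not> x < X (i-1)" using not_less_Least[of "i - 1" "%i. x < X i"] 3 by (simp add: i_def)
 moreover have "x \<noteq> X (i-1)" using assms(3) 2 by (metis atMost_iff diff_le_self image_eqI le_trans)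
 ultimately show ?thesis using 1 2 3 by (intro bexI[of _ i]) auto
qed

lemma AE_cell: "AE x in mu a b. \<exists>i\<in>{1..M}. x \<in> cell i"
 by (rule AE_mu_finite[of "X ` {..M}"]) (use cell_exists in auto)

lemma integral_cells:
 fixes f :: "real => real"
 assumes f: "integrable (mu a b) f"
 shows "(LINT x|mu a b. f x) = (\<Sum>i\<in>{1..M}. LINT x|cmu i. f x)"
proof -
 have "(LINT x|mu a (X m). f x) = (\<Sum>i\<in>{1..m}. LINT x|cmu i. f x)" if "m <= M" for m
  using that
 proof (induction m)
  case 0
  have "AE x in mu a (X 0). f x = 0" by (simp add: X_0 AE_mu_iff)
  then show ?case by (simp add: integral_eq_zero_AE)
 next
  case (Suc m)
  have "(LINT x|mu a (X (Suc m)). f x) = (LINT x|mu a (X m). f x) + (LINT x|mu (X m) (X (Suc m)). f x)"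
   by (rule integral_mu_combine[OF integrable_mu_subset[OF f]])
     (use X_mono[of 0 m] X_mono[of m "Suc m"] X_mono[of "Suc m" M] Suc in "auto simp: X_0 X_M")
  then show ?case using Suc by simp
 qed
 from this[of M] show ?thesis by (simp add: X_M)
qed

lemma sqint_cell: "f \<in> sqint (mu a b) ==> i \<in> {1..M} ==> f \<in> sqint (cmu i)"
 using sqint_mu_subset cell_bounds by blast

lemma nrm_square_cells:
 "f \<in> sqint (mu a b) ==> (nrm (mu a b) f)\<^sup>2 = (\<Sum>i\<in>{1..M}. (nrm (cmu i) f)\<^sup>2)"
 unfolding nrm_square_integral by (rule integral_cells[OF sqint_square])

lemma nrm_le_cells:
 assumes F: "F \<in> sqint (mu a b)" and g: "g \<in> sqint (mu a b)" and C: "0 <= C"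
  and le: "!!i. i \<in> {1..M} ==> nrm (cmu i) F <= C*nrm (cmu i) g"
 shows "nrm (mu a b) F <= C*nrm (mu a b) g"
proof (rule power2_le_imp_le)
 have "(\<Sum>i\<in>{1..M}. (nrm (cmu i) F)\<^sup>2) <= (\<Sum>i\<in>{1..M}. (C*nrm (cmu i) g)\<^sup>2)"
  using le by (intro sum_mono power_mono) auto
 then show "(nrm (mu a b) F)\<^sup>2 <= (C*nrm (mu a b) g)\<^sup>2"
  unfolding nrm_square_cells[OF F] power_mult_distrib nrm_square_cells[OF g] sum_distrib_left .
qed (use C in simp)

text \<open>The reference polynomials carried to the cell by the inverse affine map; the square root
  makes them orthonormal there.\<close>

definition pb :: "nat => nat => real poly" where
 "pb i l = smult (1 / sqrt (X i - X (i-1)))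
   (pcompose (refpoly n l) [:- X (i-1)/(X i - X (i-1)), 1/(X i - X (i-1)):])"

definition e1 :: "nat \<times> nat => real => real" where
 "e1 = (%(i, l) x. indicator (cell i) x*poly (pb i l) x)"

definition J1 :: "(nat \<times> nat) set" where "J1 = {1..M} \<times> {..<n}"

lemma finite_J1 [simp]: "finite J1"
 by (simp add: J1_def)

lemma e1_measurable [measurable]: "is_borel (e1 j)"
proof -
 obtain i l where "j = (i, l)" by (cases j)
 moreover have "is_borel (%x. indicator (cell i) x*poly (pb i l) x)" by measurable
 ultimately show ?thesis by (simp add: e1_def)
qed

lemma e1_in_cell: "i \<in> {1..M} ==> i' \<in> {1..M} ==> x \<in> cell i ==> e1 (i', l) x = (if i' = i then poly (pb i l) x else 0)"
proof (cases "i' = i")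
 assume "i \<in> {1..M}" "i' \<in> {1..M}" "x \<in> cell i" "i' \<noteq> i"
 then have "x \<notin> cell i'" using cell_unique by blast
 then show ?thesis using \<open>i' \<noteq> i\<close> by (simp add: e1_def)
qed (simp add: e1_def)

lemma e1_bounded: "\<exists>B\<ge>0. \<forall>x. \<bar>e1 j x\<bar> <= B"
proof -
 obtain i l where j: "j = (i, l)" by (cases j)
 obtain B where B: "!!x. X (i-1) <= x ==> x <= X i ==> \<bar>poly (pb i l) x\<bar> <= B"
  using poly_bounded_Icc by blast
 then have "\<bar>e1 j x\<bar> <= max 0 B" for x
  unfolding j e1_def by (cases "x \<in> cell i") (auto simp: max.coboundedI2 less_imp_le)
 then show ?thesis by (intro exI[of _ "max 0 B"]) auto
qed

lemma e1_sqint [simp]: "e1 j \<in> sqint (mu u v)"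
proof -
 obtain B where "!!x. \<bar>e1 j x\<bar> <= B" using e1_bounded by blast
 then show ?thesis by (intro bounded_sqint_mu[where B=B]) auto
qed

lemma poly_pb:
 assumes "i \<in> {1..M}"
 shows "poly (pb i l) (X (i-1) + (X i - X (i-1))*t) = 1 / sqrt (X i - X (i-1))*poly (refpoly n l) t"
proof -
 have *: "h \<noteq> 0 ==> - \<alpha>/h + (\<alpha> + h*t)*(1/h) = t" for h \<alpha> :: real
  by (simp add: field_simps)
 have "X i - X (i-1) \<noteq> 0" using X_less[OF assms] by simp
 from *[OF this, of "X (i-1)"]
 have "- X (i-1)/(X i - X (i-1)) + (X (i-1) + (X i - X (i-1))*t)*(1/(X i - X (i-1))) = t" .
 then show ?thesis by (simp add: pb_def poly_pcompose)
qed

lemma ip_e1: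
 assumes j: "j \<in> J1" "j' \<in> J1"
 shows "ip (mu a b) (e1 j) (e1 j') = (if j = j' then 1 else 0)"
proof -
 obtain i l i' l' where jj: "j = (i, l)" "j' = (i', l')" by (cases j, cases j')
 have il: "i \<in> {1..M}" "l < n" "i' \<in> {1..M}" "l' < n" using j jj by (auto simp: J1_def)
 show ?thesis
 proof (cases "i = i'")
  case False
  then have "e1 j x*e1 j' x = 0" for x
   using cell_unique[of i i' x] il by (auto simp: jj e1_def indicator_def)
  then have "(%x. e1 j x*e1 j' x) = (%x. 0)" by blast
  then show ?thesis using False unfolding ip_def by (simp add: jj)
 next
  case True
  have h: "X i - X (i-1) > 0" using X_less il by simp
  have cellint: "(LINT x|cmu m. e1 j x*e1 j' x) = (if m = i then (if l = l' then 1 else 0) else 0)" if m: "m \<in> {1..M}" for m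
  proof (cases "m = i")
   case False
   have "(LINT x|cmu m. e1 j x*e1 j' x) = (LINT x|cmu m. 0)"
   proof (rule integral_cong_AE)
    show "AE x in cmu m. e1 j x*e1 j' x = 0"
     using AE_mu_Ioo[of "X (m-1)" "X m"]
     by eventually_elim (use e1_in_cell[of m i] m il False in "auto simp: jj")
   qed (auto simp: mu_borel)
   then show ?thesis using False by simp
  next
   case m': True
   have "(LINT x|cmu m. e1 j x*e1 j' x) = (LINT x|cmu i. poly (pb i l) x*poly (pb i l') x)"
    unfolding m'
   proof (rule integral_cong_AE)
    show "AE x in cmu i. e1 j x*e1 j' x = poly (pb i l) x*poly (pb i l') x"
     using AE_mu_Ioo[of "X (i-1)" "X i"]
     by eventually_elim (use True in "auto simp: jj e1_def")
   qed (auto simp: mu_borel)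
   also have "... = (X i - X (i-1))*(LINT t|mu 0 1. (1 / sqrt (X i - X (i-1))*poly (refpoly n l) t)*(1 / sqrt (X i - X (i-1))*poly (refpoly n l') t))"
    unfolding poly_pb[OF il(1), symmetric]
    by (rule integral_mu_affine) (use h in "auto intro!: borel_measurable_times")
   also have "... = (X i - X (i-1))*(LINT t|mu 0 1. 1/(X i - X (i-1))*(poly (refpoly n l) t*poly (refpoly n l') t))"
    using h by (simp add: mult_ac flip: mult.assoc[of "sqrt _" "sqrt _"])
   also have "... = (if l = l' then 1 else 0)"
    using h ip_refpoly[of l n l'] il unfolding ip_def by simp
   finally show ?thesis using m' by simp
  qed
  have "ip (mu a b) (e1 j) (e1 j') = (\<Sum>m\<in>{1..M}. LINT x|cmu m. e1 j x*e1 j' x)"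
   unfolding ip_def by (rule integral_cells[OF sqint_mult]) auto
  also have "... = (\<Sum>m\<in>{1..M}. if m = i then (if l = l' then 1 else 0) else 0)"
   by (rule sum.cong[OF refl]) (rule cellint)
  finally show ?thesis using il True by (simp add: jj)
 qed
qed

sublocale on: orthonormal_family "mu a b" J1 e1
 by unfold_locales (auto simp: ip_e1)

definition pwpoly :: "(real => real) => bool" where
 "pwpoly f \<longleftrightarrow> (\<forall>i\<in>{1..M}. \<exists>q. degree q < n \<and> (\<forall>x\<in>cell i. f x = poly q x))"

lemma poly_span_cell:
 assumes i: "i \<in> {1..M}" and q: "degree q < n"
 shows "\<exists>c. \<forall>x. poly q x = (\<Sum>l<n. c l*poly (pb i l) x)"
proof -
 let ?h = "X i - X (i-1)"
 have h: "?h > 0" using X_less[OF i] by simp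
 let ?q = "pcompose q [:X (i-1), ?h:]"
 have "\<forall>m\<ge>n. coeff ?q m = 0" using q h by (auto intro!: coeff_eq_0 simp: degree_pcompose)
 from refpoly_span[OF this] obtain c where c: "?q = (\<Sum>l<n. smult (c l) (refpoly n l))" by blast
 have "poly q x = (\<Sum>l<n. (c l * sqrt ?h)*poly (pb i l) x)" for x
 proof -
  define t where "t = (x - X (i-1)) / ?h"
  have x: "x = X (i-1) + ?h*t" using h by (simp add: t_def)
  have "poly q x = poly ?q t" by (simp add: poly_pcompose x mult.commute)
  also have "... = (\<Sum>l<n. c l*poly (refpoly n l) t)" by (simp only: c poly_sum poly_smult)
  also have "... = (\<Sum>l<n. (c l * sqrt ?h)*poly (pb i l) x)"
   using h unfolding x poly_pb[OF i] by simp
  finally show ?thesis .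
 qed
 then show ?thesis by (intro exI[of _ "%l. c l * sqrt ?h"]) blast
qed

lemma comb_cell: "i \<in> {1..M} ==> x \<in> cell i ==> on.comb c x = (\<Sum>l<n. c (i, l)*poly (pb i l) x)"
proof -
 assume i: "i \<in> {1..M}" and x: "x \<in> cell i"
 have "on.comb c x = (\<Sum>m\<in>{1..M}. \<Sum>l<n. c (m, l)*e1 (m, l) x)"
  unfolding on.comb_def unfolding J1_def by (simp add: sum.cartesian_product split_beta')
 also have "... = (\<Sum>m\<in>{1..M}. if m = i then (\<Sum>l<n. c (i, l)*poly (pb i l) x) else 0)"
  by (rule sum.cong) (use e1_in_cell[OF i _ x] in auto)
 finally show ?thesis using i by simp
qed

lemma pwpoly_comb:
 assumes "pwpoly f"
 shows "\<exists>c. \<forall>i\<in>{1..M}. \<forall>x\<in>cell i. f x = on.comb c x"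
proof -
 have "\<forall>i. \<exists>c. i \<in> {1..M} --> (\<forall>x\<in>cell i. f x = (\<Sum>l<n. c l*poly (pb i l) x))"
 proof
  fix i show "\<exists>c. i \<in> {1..M} --> (\<forall>x\<in>cell i. f x = (\<Sum>l<n. c l*poly (pb i l) x))"
  proof (cases "i \<in> {1..M}")
   case True
   then obtain q where q: "degree q < n" "\<forall>x\<in>cell i. f x = poly q x"
    using assms unfolding pwpoly_def by blast
   then show ?thesis using poly_span_cell[OF True q(1)] by auto
  qed auto
 qed
 then obtain c where c: "!!i x. i \<in> {1..M} ==> x \<in> cell i ==> f x = (\<Sum>l<n. c i l*poly (pb i l) x)"
  by metis
 show ?thesis
  by (rule exI[of _ "%(i, l). c i l"]) (use comb_cell[of _ _ "%(i, l). c i l"] c in simp)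
qed

lemma AE_pwpoly_comb:
 assumes "pwpoly f"
 shows "\<exists>c. (AE x in mu a b. f x = on.comb c x)"
proof -
 obtain c where c: "\<forall>i\<in>{1..M}. \<forall>x\<in>cell i. f x = on.comb c x" using pwpoly_comb[OF assms] by blast
 have "AE x in mu a b. f x = on.comb c x"
  using AE_cell by eventually_elim (use c in blast)
 then show ?thesis by blast
qed

text \<open>The projection written as a kernel, so that it acts along the lines of the rectangle as
  an \<open>Lx\<close> or \<open>Ly\<close> and commutes with operators in the other
  variable.\<close>

definition KP :: "real => real => real" where
 "KP x s = (\<Sum>j\<in>J1. e1 j x*e1 j s)"

lemma bkern_KP: "bkern KP"
proof -
 obtain B where B: "!!j. 0 <= B j" "!!j x. \<bar>e1 j x\<bar> <= B j" using e1_bounded by metis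
 show ?thesis
 proof (rule bounded_kernelI[where B="\<Sum>j\<in>J1. B j*B j"])
  show "(%(x, s). KP x s) \<in> borel_measurable (borel \<Otimes>\<^sub>M borel)"
   unfolding KP_def by measurable
  show "\<bar>KP x s\<bar> <= (\<Sum>j\<in>J1. B j*B j)" for x s
   unfolding KP_def
   by (rule order_trans[OF sum_abs]) (auto simp: abs_mult intro!: sum_mono mult_mono B)
 qed
qed

abbreviation P1 :: "(real => real) => real => real" where "P1 \<equiv> kop (mu a b) KP"

lemma P1_eq: 
 assumes "f \<in> sqint (mu a b)"
 shows "P1 f = on.proj f"
proof
 fix x
 have "P1 f x = (LINT s|mu a b. (\<Sum>j\<in>J1. e1 j x*(f s*e1 j s)))"
  unfolding kop_def KP_def sum_distrib_right by (simp only: mult.assoc mult.commute[of "e1 _ _" "f _"])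
 also have "... = (\<Sum>j\<in>J1. e1 j x*ip (mu a b) f (e1 j))"
  unfolding ip_def using assms
  by (subst Bochner_Integration.integral_sum) (auto intro!: sqint_mult)
 finally show "P1 f x = on.proj f x" by (simp add: on.proj_def on.comb_def mult.commute)
qed

lemma P1_sqint [intro]: "f \<in> sqint (mu a b) ==> P1 f \<in> sqint (mu a b)"
 by (simp add: P1_eq)

lemma nrm_P1_le: "f \<in> sqint (mu a b) ==> nrm (mu a b) (P1 f) <= nrm (mu a b) f"
 by (simp add: P1_eq on.nrm_proj_le)

lemma ip_P1_commute: "f \<in> sqint (mu a b) ==> g \<in> sqint (mu a b) ==> ip (mu a b) (P1 f) g = ip (mu a b) f (P1 g)"
 by (simp add: P1_eq on.ip_proj_commute)

lemma nrm_P1_residual: "f \<in> sqint (mu a b) ==> nrm (mu a b) (%x. f x - P1 f x) <= nrm (mu a b) f"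
 by (simp add: P1_eq on.nrm_residual_le)

lemma P1_pwpoly:
 assumes "f \<in> sqint (mu a b)" "pwpoly f"
 shows "AE x in mu a b. P1 f x = f x"
proof -
 obtain c where c: "AE x in mu a b. f x = on.comb c x" using AE_pwpoly_comb[OF assms(2)] by blast
 have "on.proj f = on.proj (on.comb c)"
  by (rule on.proj_cong_AE[OF c]) (use assms on.comb_sqint sqint_measurable in blast)+
 then have "P1 f = on.comb c" using assms by (simp add: P1_eq on.proj_comb)
 then show ?thesis using c by (auto elim: eventually_mono)
qed

lemma nrm_P1_residual_le:
 assumes "f \<in> sqint (mu a b)" "g \<in> sqint (mu a b)" "pwpoly g"
 shows "nrm (mu a b) (%x. f x - P1 f x) <= nrm (mu a b) (%x. f x - g x)"
proof -
 obtain c where c: "AE x in mu a b. g x = on.comb c x" using AE_pwpoly_comb[OF assms(3)] by blast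
 have "nrm (mu a b) (%x. f x - P1 f x) <= nrm (mu a b) (%x. f x - on.comb c x)"
  by (simp add: P1_eq assms on.nrm_proj_le_diff)
 also have "... = nrm (mu a b) (%x. f x - g x)"
 proof (rule nrm_cong_AE)
  show "AE x in mu a b. f x - on.comb c x = f x - g x" using c by eventually_elim simp
  show "(%x. f x - on.comb c x) \<in> borel_measurable (mu a b)" "(%x. f x - g x) \<in> borel_measurable (mu a b)"
   by (intro sqint_measurable sqint_diff assms on.comb_sqint)+
 qed
 finally show ?thesis .
qed

lemma ip_P1_residual:
 assumes "f \<in> sqint (mu a b)" "g \<in> sqint (mu a b)" "pwpoly g"
 shows "ip (mu a b) (%x. f x - P1 f x) g = 0"
proof -
 have "ip (mu a b) (P1 f) g = ip (mu a b) f (P1 g)" by (rule ip_P1_commute) fact+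
 also have "... = ip (mu a b) f g"
  by (rule ip_cong_AE)
    (use P1_pwpoly[OF assms(2,3)] assms P1_sqint[OF assms(2)] in "auto dest: sqint_measurable")
 finally show ?thesis using assms by (simp add: ip_diff_left P1_sqint)
qed


text \<open>The projection is at least as good as the local approximants glued together. They have
  degree m - 1, which is why m may reach n. A global chain of antiderivatives restricts to each cell
  with a changed constant.\<close>

lemma nrm_P1_residual_chain:
 fixes f :: "nat => real => real"
 assumes m: "m <= n" and H: "!!i. i \<in> {1..M} ==> X i - X (i-1) <= H"
  and f: "!!j. j <= m ==> f j \<in> sqint (mu a b)"
  and chain: "!!j. j < m ==> \<exists>c. AE x in mu a b. f j x = c + anti a b (f (Suc j)) x"
 shows "nrm (mu a b) (%x. f 0 x - P1 (f 0) x) <= H ^ m*nrm (mu a b) (f m)"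
proof (cases m)
 case 0
 then show ?thesis using nrm_P1_residual[of "f 0"] f by simp
next
 case (Suc m')
 have H0: "0 <= H" using H[of 1] X_less[of 1] M_pos by force
 have cl: "\<exists>q. degree q <= m' \<and> (AE x in cmu i. \<bar>f 0 x - poly q x\<bar> <= (X i - X (i-1)) ^ m'*(LINT s|cmu i. \<bar>f (Suc m') s\<bar>))"
  if i: "i \<in> {1..M}" for i
 proof (rule local_poly_approx)
  show "X (i-1) < X i" using X_less[OF i] .
  show "integrable (cmu i) (f j)" if "j <= Suc m'" for j
   by (rule mu.sqint_int) (use f[of j] that Suc sqint_cell[OF _ i] in simp)
  show "\<exists>c. AE x in cmu i. f j x = c + anti (X (i-1)) (X i) (f (Suc j)) x" if j: "j <= m'" for j
  proof -
   obtain c where c: "AE x in mu a b. f j x = c + anti a b (f (Suc j)) x"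
    using chain[of j] j Suc by auto
   have fi: "integrable (mu a b) (f (Suc j))" using f[of "Suc j"] j Suc mu.sqint_int by simp
   have "AE x in cmu i. f j x = (c + anti a b (f (Suc j)) (X (i-1))) + anti (X (i-1)) (X i) (f (Suc j)) x"
    using AE_mu_subset[OF c cell_bounds[OF i]] AE_mu_Ioo[of "X (i-1)" "X i"]
   proof eventually_elim
    case (elim x)
    then show ?case using anti_split[OF fi cell_bounds[OF i], of x] by simp
   qed
   then show ?thesis by blast
  qed
 qed
 define q where "q i = (SOME q. degree q <= m' \<and> (AE x in cmu i. \<bar>f 0 x - poly q x\<bar> <= (X i - X (i-1)) ^ m'*(LINT s|cmu i. \<bar>f (Suc m') s\<bar>)))" for i
 note q_props = someI_ex[OF cl, folded q_def]
 have q: "degree (q i) <= m'" if "i \<in> {1..M}" for i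
  using q_props[OF that] by (rule conjunct1)
 have qle: "AE x in cmu i. \<bar>f 0 x - poly (q i) x\<bar> <= (X i - X (i-1)) ^ m'*(LINT s|cmu i. \<bar>f (Suc m') s\<bar>)" if "i \<in> {1..M}" for i
  using q_props[OF that] by (rule conjunct2)
 define g where "g x = (\<Sum>i\<in>{1..M}. indicator (cell i) x*poly (q i) x)" for x
 have g_cell: "g x = poly (q i) x" if i: "i \<in> {1..M}" and x: "x \<in> cell i" for i x
 proof -
  have "g x = (\<Sum>j\<in>{1..M}. if j = i then poly (q i) x else 0)"
   unfolding g_def
  proof (rule sum.cong[OF refl])
   fix j assume j: "j \<in> {1..M}"
   show "indicator (cell j) x*poly (q j) x = (if j = i then poly (q i) x else 0)"
   proof (cases "j = i")
    case True
    then show ?thesis using x by simp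
   next
    case False
    then have "x \<notin> cell j" using cell_unique[OF i j x] by blast
    then show ?thesis using False by simp
   qed
  qed
  then show ?thesis using i by simp
 qed
 have gm: "is_borel g" unfolding g_def by measurable
 have g_pw: "pwpoly g" unfolding pwpoly_def
 proof
  fix i assume i: "i \<in> {1..M}"
  show "\<exists>q. degree q < n \<and> (\<forall>x\<in>cell i. g x = poly q x)"
   by (rule exI[of _ "q i"]) (use q[OF i] g_cell[OF i] m Suc in auto)
 qed
 have g_sq: "g \<in> sqint (mu a b)"
 proof -
  obtain c where "AE x in mu a b. g x = on.comb c x" using AE_pwpoly_comb[OF g_pw] by blast
  then have "AE x in mu a b. on.comb c x = g x" by eventually_elim simp
  then show ?thesis using sqint_cong_AE[OF on.comb_sqint _] gm by (simp add: mu_borel)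
 qed
 have f0: "f 0 \<in> sqint (mu a b)" and fm: "f (Suc m') \<in> sqint (mu a b)" using f Suc by auto
 have "nrm (mu a b) (%x. f 0 x - P1 (f 0) x) <= nrm (mu a b) (%x. f 0 x - g x)"
  by (rule nrm_P1_residual_le) (use f0 g_sq g_pw in auto)
 also have "... <= H ^ Suc m'*nrm (mu a b) (f (Suc m'))"
 proof (rule nrm_le_cells)
  show "(%x. f 0 x - g x) \<in> sqint (mu a b)" using f0 g_sq by auto
  fix i assume i: "i \<in> {1..M}"
  have h: "0 < X i - X (i-1)" using X_less[OF i] by simp
  have "nrm (cmu i) (%x. f 0 x - g x) <= (X i - X (i-1)) ^ m'*(X i - X (i-1))*nrm (cmu i) (f (Suc m'))"
  proof (rule nrm_le_of_L1_bound)
   show "is_borel (%x. f 0 x - g x)"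
    using sqint_measurable[OF f0] gm by (simp add: mu_borel)
   show "AE x in cmu i. \<bar>f 0 x - g x\<bar> <= (X i - X (i-1)) ^ m'*(LINT s|cmu i. \<bar>f (Suc m') s\<bar>)"
    using qle[OF i] AE_mu_Ioo[of "X (i-1)" "X i"]
    by eventually_elim (use g_cell[OF i] in auto)
  qed (use h sqint_cell[OF fm i] in auto)
  also have "... = (X i - X (i-1)) ^ Suc m'*nrm (cmu i) (f (Suc m'))"
   by (simp add: mult.commute)
  also have "... <= H ^ Suc m'*nrm (cmu i) (f (Suc m'))"
   by (intro mult_right_mono power_mono H i) (use h in auto)
  finally show "nrm (cmu i) (%x. f 0 x - g x) <= H ^ Suc m'*nrm (cmu i) (f (Suc m'))" .
 qed (use fm H0 in auto)
 finally show ?thesis using Suc by simp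
qed

lemma green_sqint: "f \<in> sqint (mu a b) ==> green a b f \<in> sqint (mu a b)"
 using kop_nrm(1)[OF less_imp_le[OF ab] bkern_Gk[OF ab] Gk_bound[OF ab]] .

lemma green'_sqint: "f \<in> sqint (mu a b) ==> green' a b f \<in> sqint (mu a b)"
 using kop_nrm(1)[OF less_imp_le[OF ab] bkern_G1k[OF ab] G1k_bound[OF ab]] .

lemma green_chain:
 assumes "f \<in> sqint (mu a b)"
 shows "AE x in mu a b. green a b f x = 0 + anti a b (green' a b f) x"
  and "AE x in mu a b. green' a b f x = - (LINT s|mu a b. (b-s)*f s)/(b-a) + anti a b f x"
 using AE_anti_green'[OF ab mu.sqint_int[OF assms]] green'_eq[OF ab mu.sqint_int[OF assms]]
 by (auto elim: eventually_mono)

lemma nrm_P1_residual_green: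
 assumes H: "!!i. i \<in> {1..M} ==> X i - X (i-1) <= H" and f: "f \<in> sqint (mu a b)"
 shows "nrm (mu a b) (%x. green a b f x - P1 (green a b f) x) <= H*nrm (mu a b) (green' a b f)"
proof -
 define u where "u = (%j::nat. if j = 0 then green a b f else green' a b f)"
 have "nrm (mu a b) (%x. u 0 x - P1 (u 0) x) <= H ^ 1*nrm (mu a b) (u 1)"
 proof (rule nrm_P1_residual_chain[OF _ H])
  fix j :: nat assume "j < 1"
  then show "\<exists>c. AE x in mu a b. u j x = c + anti a b (u (Suc j)) x"
   using green_chain(1)[OF f] unfolding u_def by (intro exI[of _ 0]) simp
 qed (use n_ge green_sqint[OF f] green'_sqint[OF f] in "auto simp: u_def")
 then show ?thesis by (simp add: u_def)
qed

lemma nrm_P1_residual_green2: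
 assumes H: "!!i. i \<in> {1..M} ==> X i - X (i-1) <= H" and f: "f \<in> sqint (mu a b)"
 shows "nrm (mu a b) (%x. green a b f x - P1 (green a b f) x) <= H^2*nrm (mu a b) f"
proof -
 define u where "u = (%j::nat. if j = 0 then green a b f else if j = 1 then green' a b f else f)"
 have "nrm (mu a b) (%x. u 0 x - P1 (u 0) x) <= H ^ 2*nrm (mu a b) (u 2)"
 proof (rule nrm_P1_residual_chain[OF _ H])
  fix j :: nat assume "j < 2"
  then consider "j = 0" | "j = 1" by linarith
  then show "\<exists>c. AE x in mu a b. u j x = c + anti a b (u (Suc j)) x"
  proof cases
   case 1
   then show ?thesis using green_chain(1)[OF f] unfolding u_def by (intro exI[of _ 0]) simp
  next
   case 2
   then show ?thesis using green_chain(2)[OF f] unfolding u_def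
    by (intro exI[of _ "- (LINT s|mu a b. (b-s)*f s)/(b-a)"]) simp
  qed
 qed (use n_ge green_sqint[OF f] green'_sqint[OF f] f in "auto simp: u_def")
 then show ?thesis by (simp add: u_def)
qed

text \<open>On a cell \<open>green'\<close> of z is a polynomial of degree at most n with derivative
  z, since passing from the global to the local antiderivative only changes the constant. Hence the
  constant with index \<open>Suc n\<close>.\<close>

lemma inverse_green':
 assumes z: "z \<in> sqint (mu a b)" "pwpoly z" and h: "0 < h" "!!i. i \<in> {1..M} ==> h <= X i - X (i-1)"
 shows "nrm (mu a b) z <= inv_const (Suc n)/h*nrm (mu a b) (green' a b z)"
proof (rule nrm_le_cells)
 fix i assume i: "i \<in> {1..M}"
 have zi: "integrable (mu a b) z" by (rule mu.sqint_int) fact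
 obtain q where q: "degree q < n" "\<forall>x\<in>cell i. z x = poly q x"
  using z(2) i unfolding pwpoly_def by blast
 obtain Q where Q: "pderiv Q = q" "degree Q <= Suc (degree q)" using pderiv_surj by blast
 have zq: "AE x in cmu i. z x = poly q x"
  using AE_mu_Ioo[of "X (i-1)" "X i"] by eventually_elim (use q in auto)
 have zm: "is_borel z" using sqint_measurable[OF z(1)] by (simp add: mu_borel)
 let ?\<kappa> = "(LINT s|mu a b. (b-s)*z s)/(b-a)"
 define c where "c = anti a b z (X (i-1)) - ?\<kappa> - poly Q (X (i-1))"
 have Gq: "AE x in cmu i. green' a b z x = poly (Q + [:c:]) x"
  using AE_mu_Ioo[of "X (i-1)" "X i"]
 proof eventually_elim
  case (elim x)
  have "anti (X (i-1)) (X i) z x = anti (X (i-1)) (X i) (%x. poly q x) x"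
   by (rule kop_cong_AE[OF zq]) (use zm in auto)
  also have "... = poly Q x - poly Q (X (i-1))"
   by (rule anti_poly[OF Q(1)]) (use elim in auto)
  finally show ?case
   using anti_split[OF zi cell_bounds[OF i], of x] elim green'_eq[OF ab zi, of x]
   by (simp add: c_def)
 qed
 have hp: "0 < X i - X (i-1)" using X_less[OF i] by simp
 have Gm: "is_borel (green' a b z)"
  using sqint_measurable[OF green'_sqint[OF z(1)]] by (simp add: mu_borel)
 have "nrm (cmu i) z = nrm (cmu i) (%x. poly (pderiv (Q + [:c:])) x)"
  by (rule nrm_cong_AE) (use zq zm Q in "auto simp: mu_borel pderiv_add")
 also have "... <= inv_const (Suc n)/(X i - X (i-1))*nrm (cmu i) (%x. poly (Q + [:c:]) x)"
 proof (rule inverse_estimate)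
  have "degree (Q + [:c:]) <= Suc (degree q)" using Q(2) by (intro degree_add_le) auto
  then show "degree (Q + [:c:]) < Suc n" using q(1) by simp
 qed (use hp in simp)
 also have "nrm (cmu i) (%x. poly (Q + [:c:]) x) = nrm (cmu i) (green' a b z)"
 proof (rule nrm_cong_AE)
  show "AE x in cmu i. poly (Q + [:c:]) x = green' a b z x" using Gq by eventually_elim simp
 qed (use Gm in "auto simp: mu_borel")
 also have "inv_const (Suc n)/(X i - X (i-1))*nrm (cmu i) (green' a b z) <= inv_const (Suc n)/h*nrm (cmu i) (green' a b z)"
  using h(1) h(2)[OF i] by (intro mult_right_mono divide_left_mono) auto
 finally show "nrm (cmu i) z <= inv_const (Suc n)/h*nrm (cmu i) (green' a b z)" .
qed (use z h green'_sqint in auto)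

lemma pwpoly_global: "degree q < n ==> pwpoly (%x. poly q x)"
 unfolding pwpoly_def by blast

text \<open>The residual is orthogonal to b - s, a polynomial of degree 1 < n, and this
  orthogonality is exactly the vanishing of the constant in \<open>green'_eq\<close>.\<close>

lemma green'_residual:
 assumes f: "f \<in> sqint (mu a b)"
 defines "r \<equiv> %x. f x - P1 f x"
 shows "green' a b r x = anti a b r x"
proof -
 have r: "r \<in> sqint (mu a b)" unfolding r_def using f by auto
 have "ip (mu a b) r (%x. poly [:b, -1:] x) = 0"
  unfolding r_def by (rule ip_P1_residual[OF f poly_sqint pwpoly_global]) (use n_ge in simp)
 then have "(LINT s|mu a b. (b-s)*r s) = 0" by (simp add: ip_def mult.commute)
 then show ?thesis using green'_eq[OF ab mu.sqint_int[OF r], of x] by simp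
qed

text \<open>Integrating up to a mesh point is testing with a piecewise constant function, to which
  the residual is orthogonal.\<close>

lemma anti_residual_node:
 assumes f: "f \<in> sqint (mu a b)" and i: "i <= M"
 shows "anti a b (%x. f x - P1 f x) (X i) = 0"
proof -
 let ?r = "%x. f x - P1 f x"
 have pw: "pwpoly (%s. Ik (X i) s)"
  unfolding pwpoly_def
 proof
  fix j assume j: "j \<in> {1..M}"
  have "\<exists>c. \<forall>x\<in>cell j. Ik (X i) x = c"
  proof (cases "j <= i")
   case True
   then have "X j <= X i" using X_mono i by blast
   then show ?thesis by (intro exI[of _ 1]) (auto simp: Ik_def)
  next
   case False
   then have "X i <= X (j-1)" using j by (intro X_mono) auto
   then show ?thesis by (intro exI[of _ 0]) (auto simp: Ik_def)
  qed
  then obtain c where "\<forall>x\<in>cell j. Ik (X i) x = c" by blast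
  then show "\<exists>q. degree q < n \<and> (\<forall>x\<in>cell j. Ik (X i) x = poly q x)"
   using n_ge by (intro exI[of _ "[:c:]"]) auto
 qed
 have "(%s. Ik (X i) s) \<in> sqint (mu a b)"
  by (rule bounded_sqint_mu[where B=1]) (auto simp: Ik_def bkern_row)
 from ip_P1_residual[OF f this pw] show ?thesis by (simp add: ip_def kop_def mult.commute)
qed

text \<open>Since the antiderivative of the residual vanishes at all mesh points, on a cell it only
  sees the residual on that cell. One integration of a projection error therefore gains a power of
  H.\<close>

lemma nrm_anti_residual:
 assumes H: "!!i. i \<in> {1..M} ==> X i - X (i-1) <= H" and f: "f \<in> sqint (mu a b)"
 defines "r \<equiv> %x. f x - P1 f x"
 shows "nrm (mu a b) (anti a b r) <= H*nrm (mu a b) r"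
proof (rule nrm_le_cells)
 have r: "r \<in> sqint (mu a b)" unfolding r_def using f by auto
 have ri: "integrable (mu a b) r" by (rule mu.sqint_int[OF r])
 show as: "anti a b r \<in> sqint (mu a b)"
  by (rule kop_nrm(1)[OF less_imp_le[OF ab] bkern_Ik _ r, of 1]) (auto simp: Ik_def)
 show "r \<in> sqint (mu a b)" by (rule r)
 show "0 <= H" using H[of 1] X_less[of 1] M_pos by force
 fix i assume i: "i \<in> {1..M}"
 have node: "anti a b r (X (i-1)) = 0"
  unfolding r_def by (rule anti_residual_node[OF f]) (use i in auto)
 have hp: "0 < X i - X (i-1)" using X_less[OF i] by simp
 have am: "is_borel (anti a b r)" using sqint_measurable[OF as] by (simp add: mu_borel)
 have "nrm (cmu i) (anti a b r) <= 1*(X i - X (i-1))*nrm (cmu i) r"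
 proof (rule nrm_le_of_L1_bound)
  show "AE x in cmu i. \<bar>anti a b r x\<bar> <= 1*(LINT s|cmu i. \<bar>r s\<bar>)"
   using AE_mu_Ioo[of "X (i-1)" "X i"]
  proof eventually_elim
   case (elim x)
   have "anti a b r x = anti (X (i-1)) (X i) r x"
    using anti_split[OF ri cell_bounds[OF i], of x] elim node by simp
   then show ?case using anti_abs_le[OF integrable_mu_subset[OF ri cell_bounds[OF i]], of x] by simp
  qed
 qed (use hp am sqint_cell[OF r i] in auto)
 also have "... <= H*nrm (cmu i) r" using H[OF i] by (simp add: mult_right_mono)
 finally show "nrm (cmu i) (anti a b r) <= H*nrm (cmu i) r" .
qed

lemma nrm_green'_residual:
 assumes H: "!!i. i \<in> {1..M} ==> X i - X (i-1) <= H" and f: "f \<in> sqint (mu a b)"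
 shows "nrm (mu a b) (green' a b (%x. f x - P1 f x)) <= H*nrm (mu a b) (%x. f x - P1 f x)"
proof -
 have "green' a b (%x. f x - P1 f x) = anti a b (%x. f x - P1 f x)"
  using green'_residual[OF f] by blast
 then show ?thesis using nrm_anti_residual[OF H f] by simp
qed

text \<open>The second integration is bounded by the length b-a only: the single power of H from the
  first one is all that the approximation of $u_{xxyy}$ requires.\<close>

lemma nrm_green_residual:
 assumes H: "!!i. i \<in> {1..M} ==> X i - X (i-1) <= H" and f: "f \<in> sqint (mu a b)"
 shows "nrm (mu a b) (green a b (%x. f x - P1 f x)) <= (b-a)*H*nrm (mu a b) (%x. f x - P1 f x)"
proof -
 let ?r = "%x. f x - P1 f x"
 have r: "?r \<in> sqint (mu a b)" using f by auto
 have "nrm (mu a b) (green a b ?r) = nrm (mu a b) (anti a b (green' a b ?r))"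
 proof (rule nrm_cong_AE)
  show "AE x in mu a b. green a b ?r x = anti a b (green' a b ?r) x"
   using AE_anti_green'[OF ab mu.sqint_int[OF r]] by eventually_elim simp
  show "anti a b (green' a b ?r) \<in> borel_measurable (mu a b)"
   using kop_nrm(1)[OF less_imp_le[OF ab] bkern_Ik _ green'_sqint[OF r], of 1]
   by (auto simp: Ik_def dest: sqint_measurable)
 qed (use green_sqint[OF r] sqint_measurable in auto)
 also have "... <= 1*(b-a)*nrm (mu a b) (green' a b ?r)"
  by (rule kop_nrm(2)[OF less_imp_le[OF ab] bkern_Ik _ green'_sqint[OF r]]) (auto simp: Ik_def)
 also have "... <= 1*(b-a)*(H*nrm (mu a b) ?r)"
  by (rule mult_left_mono[OF nrm_green'_residual[OF H f]]) (use ab in auto)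
 finally show ?thesis by simp
qed

end

section \<open>The projection along one coordinate of the rectangle\<close>

context mesh1
begin

abbreviation Px :: "fun2 => fun2" where "Px \<equiv> Lx (mu a b) KP"

lemma pwpoly_comb_self: "pwpoly (on.comb c)"
 unfolding pwpoly_def
proof
 fix i assume i: "i \<in> {1..M}"
 have deg: "degree (pb i l) < n" if "l < n" for l
  using degree_refpoly[of l n] that unfolding pb_def
  by (intro le_less_trans[OF degree_smult_le]) (auto simp: degree_pcompose intro: le_less_trans[OF mult_le_mono2])
 have "on.comb c x = poly (\<Sum>l<n. smult (c (i, l)) (pb i l)) x" if "x \<in> cell i" for x
  using comb_cell[OF i that] by (simp add: poly_sum)
 moreover have "degree (\<Sum>l<n. smult (c (i, l)) (pb i l)) < n"
  using n_ge deg by (intro degree_sum_less) (auto intro: le_less_trans[OF degree_smult_le])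
 ultimately show "\<exists>q. degree q < n \<and> (\<forall>x\<in>cell i. on.comb c x = poly q x)" by blast
qed

lemma Px_sqint: "f \<in> sqint (rm a b c d) ==> Px f \<in> sqint (rm a b c d)"
 using Lx_sqint ab bkern_KP by auto

lemma Px_measurable: "is_borel f ==> is_borel (Px f)"
 by (rule Lx_measurable[OF bkern_KP])

lemma Px_residual_sqint: "f \<in> sqint (rm a b c d) ==> (%p. f p - Px f p) \<in> sqint (rm a b c d)"
 using Px_sqint by auto

lemma nrm_Px_le:
 assumes f: "f \<in> sqint (rm a b c d)"
 shows "nrm (rm a b c d) (Px f) <= nrm (rm a b c d) f"
proof -
 have "nrm (rm a b c d) (Px f) <= 1*nrm (rm a b c d) f"
  by (rule sqint_lift_x(2)[OF Px_measurable[OF sqint_borel[OF f]] f])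
    (use nrm_P1_le in "auto simp: Lx_def")
 then show ?thesis by simp
qed

lemma lift_x:
 assumes F: "is_borel F" and f: "f \<in> sqint (rm a b c d)" and C: "0 <= C"
  and le: "!!y. (%x. f (x, y)) \<in> sqint (mu a b) ==> (%x. F (x, y)) \<in> sqint (mu a b) \<and>
    nrm (mu a b) (%x. F (x, y)) <= C*nrm (mu a b) (%x. f (x, y))"
 shows "nrm (rm a b c d) F <= C*nrm (rm a b c d) f"
 by (rule sqint_lift_x(2)[OF F f C]) (use le in simp)

lemma ip_Px_commute:
 assumes f: "f \<in> sqint (rm a b c d)" and g: "g \<in> sqint (rm a b c d)"
 shows "ip (rm a b c d) (Px f) g = ip (rm a b c d) f (Px g)"
proof -
 have "ip (rm a b c d) (Px f) g = 1*ip (rm a b c d) f (Px g)"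
 proof (rule ip_lift_x)
  show "AE y in mu c d. ip (mu a b) (%x. Px f (x, y)) (%x. g (x, y)) = 1*ip (mu a b) (%x. f (x, y)) (%x. Px g (x, y))"
   using sqint_slice_x[OF f] sqint_slice_x[OF g] by eventually_elim (simp add: Lx_def ip_P1_commute)
 qed (use f g Px_sqint in auto)
 then show ?thesis by simp
qed

lemma Px_pwpoly:
 assumes f: "f \<in> sqint (rm a b c d)" and pw: "!!y. pwpoly (%x. f (x, y))"
 shows "AE p in rm a b c d. Px f p = f p"
proof (rule AE_rm_eqI_x)
 show "AE y in mu c d. AE x in mu a b. Px f (x, y) = f (x, y)"
  using sqint_slice_x[OF f] by eventually_elim (use P1_pwpoly pw in "simp add: Lx_def")
qed (use sqint_borel[OF f] Px_measurable in auto)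

text \<open>The constants of the chain may depend on the line, hence a function C of the second
  coordinate; finitely many null sets of lines are discarded together.\<close>

lemma nrm_Px_residual_chain:
 fixes f :: "nat => fun2"
 assumes m: "m <= n" and H: "!!i. i \<in> {1..M} ==> X i - X (i-1) <= H"
  and f: "!!j. j <= m ==> f j \<in> sqint (rm a b c d)"
  and chain: "!!j. j < m ==> \<exists>C. AE p in rm a b c d. f j p = C (snd p) + Lx (mu a b) Ik (f (Suc j)) p"
 shows "nrm (rm a b c d) (%p. f 0 p - Px (f 0) p) <= H ^ m*nrm (rm a b c d) (f m)"
proof (rule sqint_lift_x(2))
 have H0: "0 <= H" using H[of 1] X_less[of 1] M_pos by force
 then show "0 <= H ^ m" by simp
 show "f m \<in> sqint (rm a b c d)" using f by simp
 show "is_borel (%p. f 0 p - Px (f 0) p)"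
  by (rule sqint_borel[OF Px_residual_sqint[OF f]]) simp
 have 1: "AE y in mu c d. \<forall>j\<in>{..m}. (%x. f j (x, y)) \<in> sqint (mu a b)"
  by (rule AE_finite_allI) (use f sqint_slice_x in auto)
 have 2: "AE y in mu c d. \<forall>j\<in>{..<m}. \<exists>C. AE x in mu a b. f j (x, y) = C + anti a b (%x. f (Suc j) (x, y)) x"
 proof (rule AE_finite_allI)
  fix j assume "j \<in> {..<m}"
  then obtain C where C: "AE p in rm a b c d. f j p = C (snd p) + Lx (mu a b) Ik (f (Suc j)) p"
   using chain[of j] by auto
  show "AE y in mu c d. \<exists>C. AE x in mu a b. f j (x, y) = C + anti a b (%x. f (Suc j) (x, y)) x"
   using AE_rm_x[OF C]
  proof eventually_elim
   case (elim y)
   show ?case by (rule exI[of _ "C y"]) (use elim in "simp add: Lx_def")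
  qed
 qed simp
 show "AE y in mu c d. (%x. f m (x, y)) \<in> sqint (mu a b) -->
   (%x. f 0 (x, y) - Px (f 0) (x, y)) \<in> sqint (mu a b) \<and>
   nrm (mu a b) (%x. f 0 (x, y) - Px (f 0) (x, y)) <= H ^ m*nrm (mu a b) (%x. f m (x, y))"
  using 1 2
 proof eventually_elim
  case (elim y)
  have "nrm (mu a b) (%x. f 0 (x, y) - P1 (%x. f 0 (x, y)) x) <= H ^ m*nrm (mu a b) (%x. f m (x, y))"
   by (rule nrm_P1_residual_chain[OF m H, of "%j x. f j (x, y)"]) (use elim in auto)
  moreover have "(%x. f 0 (x, y)) \<in> sqint (mu a b)" using elim by simp
  ultimately show ?case by (auto simp: Lx_def)
 qed
qed

lemma H_nonneg: "(!!i. i \<in> {1..M} ==> X i - X (i-1) <= H) ==> 0 <= H"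
 using X_less[of 1] M_pos by force

lemma nrm_Px_residual_Gx:
 assumes H: "!!i. i \<in> {1..M} ==> X i - X (i-1) <= H" and f: "f \<in> sqint (rm a b c d)"
 shows "nrm (rm a b c d) (%p. Gx a b f p - Px (Gx a b f) p) <= H*nrm (rm a b c d) (Gx' a b f)"
proof (rule sqint_lift_x(2))
 show "is_borel (%p. Gx a b f p - Px (Gx a b f) p)"
  by (rule sqint_borel[OF Px_residual_sqint[OF Gx_sqint[OF ab f]]])
 show "AE y in mu c d. (%x. Gx' a b f (x, y)) \<in> sqint (mu a b) -->
   (%x. Gx a b f (x, y) - Px (Gx a b f) (x, y)) \<in> sqint (mu a b) \<and>
   nrm (mu a b) (%x. Gx a b f (x, y) - Px (Gx a b f) (x, y)) <= H*nrm (mu a b) (%x. Gx' a b f (x, y))"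
  using sqint_slice_x[OF f]
 proof eventually_elim
  case (elim y)
  show ?case
   using nrm_P1_residual_green[OF H elim] green_sqint[OF elim] P1_sqint[OF green_sqint[OF elim]]
   by (simp add: Lx_def sqint_diff)
 qed
qed (use f Gx'_sqint[OF ab] H_nonneg[OF H] in auto)

lemma nrm_Px_residual_Gx2:
 assumes H: "!!i. i \<in> {1..M} ==> X i - X (i-1) <= H" and f: "f \<in> sqint (rm a b c d)"
 shows "nrm (rm a b c d) (%p. Gx a b f p - Px (Gx a b f) p) <= H^2*nrm (rm a b c d) f"
proof (rule lift_x[OF _ f])
 show "is_borel (%p. Gx a b f p - Px (Gx a b f) p)"
  by (rule sqint_borel[OF Px_residual_sqint[OF Gx_sqint[OF ab f]]])
 fix y assume y: "(%x. f (x, y)) \<in> sqint (mu a b)"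
 show "(%x. Gx a b f (x, y) - Px (Gx a b f) (x, y)) \<in> sqint (mu a b) \<and>
   nrm (mu a b) (%x. Gx a b f (x, y) - Px (Gx a b f) (x, y)) <= H^2*nrm (mu a b) (%x. f (x, y))"
  using nrm_P1_residual_green2[OF H y] green_sqint[OF y] P1_sqint[OF green_sqint[OF y]]
  by (simp add: Lx_def sqint_diff)
qed simp

lemma inverse_Gx':
 assumes z: "z \<in> sqint (rm a b c d)" "!!y. pwpoly (%x. z (x, y))"
  and h: "0 < h" "!!i. i \<in> {1..M} ==> h <= X i - X (i-1)"
 shows "nrm (rm a b c d) z <= inv_const (Suc n)/h*nrm (rm a b c d) (Gx' a b z)"
proof (rule sqint_lift_x(2))
 show "is_borel z" by (rule sqint_borel) fact
 show "AE y in mu c d. (%x. Gx' a b z (x, y)) \<in> sqint (mu a b) --> (%x. z (x, y)) \<in> sqint (mu a b) \<and>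
   nrm (mu a b) (%x. z (x, y)) <= inv_const (Suc n)/h*nrm (mu a b) (%x. Gx' a b z (x, y))"
  using sqint_slice_x[OF z(1)]
  by eventually_elim (use inverse_green'[OF _ z(2) h] in "simp add: Lx_def")
qed (use z h Gx'_sqint[OF ab] in auto)

lemma nrm_Gx'_residual:
 assumes H: "!!i. i \<in> {1..M} ==> X i - X (i-1) <= H" and f: "f \<in> sqint (rm a b c d)"
 shows "nrm (rm a b c d) (Gx' a b (%p. f p - Px f p)) <= H*nrm (rm a b c d) (%p. f p - Px f p)"
proof (rule sqint_lift_x(2))
 have r: "(%p. f p - Px f p) \<in> sqint (rm a b c d)" by (rule Px_residual_sqint[OF f])
 then show "is_borel (Gx' a b (%p. f p - Px f p))" 
  by (intro sqint_borel[OF Gx'_sqint[OF ab]])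
 show "(%p. f p - Px f p) \<in> sqint (rm a b c d)" by fact
 show "AE y in mu c d. (%x. f (x, y) - Px f (x, y)) \<in> sqint (mu a b) -->
   (%x. Gx' a b (%p. f p - Px f p) (x, y)) \<in> sqint (mu a b) \<and>
   nrm (mu a b) (%x. Gx' a b (%p. f p - Px f p) (x, y)) <= H*nrm (mu a b) (%x. f (x, y) - Px f (x, y))"
  using sqint_slice_x[OF f]
  by eventually_elim (use nrm_green'_residual[OF H] green'_sqint in "auto simp: Lx_def")
qed (use H_nonneg[OF H] in auto)

lemma nrm_Gx_residual:
 assumes H: "!!i. i \<in> {1..M} ==> X i - X (i-1) <= H" and f: "f \<in> sqint (rm a b c d)"
 shows "nrm (rm a b c d) (Gx a b (%p. f p - Px f p)) <= (b-a)*H*nrm (rm a b c d) (%p. f p - Px f p)"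
proof (rule sqint_lift_x(2))
 have r: "(%p. f p - Px f p) \<in> sqint (rm a b c d)" by (rule Px_residual_sqint[OF f])
 then show "is_borel (Gx a b (%p. f p - Px f p))" 
  by (intro sqint_borel[OF Gx_sqint[OF ab]])
 show "(%p. f p - Px f p) \<in> sqint (rm a b c d)" by fact
 show "AE y in mu c d. (%x. f (x, y) - Px f (x, y)) \<in> sqint (mu a b) -->
   (%x. Gx a b (%p. f p - Px f p) (x, y)) \<in> sqint (mu a b) \<and>
   nrm (mu a b) (%x. Gx a b (%p. f p - Px f p) (x, y)) <= (b-a)*H*nrm (mu a b) (%x. f (x, y) - Px f (x, y))"
  using sqint_slice_x[OF f]
  by eventually_elim (use nrm_green_residual[OF H] green_sqint in "auto simp: Lx_def")
qed (use H_nonneg[OF H] ab in auto)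

end


text \<open>H and h are bounds for the edge lengths rather than the extreme lengths themselves. Such
  a condition survives the limit of a sequence of meshes, as needed in the compactness argument, and
  suffices for all estimates.\<close>

locale mesh2 = mx: mesh1 a b M X n + my: mesh1 c d N Y n
 for a b M X c d N Y n +
 fixes H h :: real
 assumes h_pos: "0 < h"
  and hx: "!!i. i \<in> {1..M} ==> h <= X i - X (i-1)" and Hx: "!!i. i \<in> {1..M} ==> X i - X (i-1) <= H"
  and hy: "!!i. i \<in> {1..N} ==> h <= Y i - Y (i-1)" and Hy: "!!i. i \<in> {1..N} ==> Y i - Y (i-1) <= H"
begin

abbreviation R :: "(real \<times> real) measure" where "R \<equiv> rm a b c d"
abbreviation Px :: "fun2 => fun2" where "Px \<equiv> Lx (mu a b) mx.KP"
abbreviation Py :: "fun2 => fun2" where "Py \<equiv> Ly (mu c d) my.KP"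

lemmas ab = mx.ab and cd = my.ab

lemma H_pos: "0 < H"
 using h_pos hx[of 1] Hx[of 1] mx.M_pos by force

lemmas Px_sqint = mx.Px_sqint[of _ c d]
lemmas Gx_sq = Gx_sqint[OF ab, of _ c d] and Gx'_sq = Gx'_sqint[OF ab, of _ c d]
lemmas Gy_sq = Gy_sqint[OF cd, of _ a b] and Gy'_sq = Gy'_sqint[OF cd, of _ a b]

lemma Py_sw: "Py f = sw (Lx (mu c d) my.KP (sw f))"
 by (rule Ly_sw)

lemma Py_sqint: "f \<in> sqint R ==> Py f \<in> sqint R"
 unfolding Py_sw by (intro sqint_sw my.Px_sqint)

lemma nrm_sw_sq: "f \<in> sqint (rm c d a b) ==> nrm R (sw f) = nrm (rm c d a b) f"
 by (rule nrm_sw[OF sqint_borel])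

lemma nrm_sw_sq': "f \<in> sqint R ==> nrm (rm c d a b) (sw f) = nrm R f"
 by (rule nrm_sw[OF sqint_borel])

lemma nrm_Py_le: "f \<in> sqint R ==> nrm R (Py f) <= nrm R f"
 unfolding Py_sw using my.nrm_Px_le[OF sqint_sw, of f a b] 
 by (simp add: nrm_sw_sq[OF my.Px_sqint[OF sqint_sw]] nrm_sw_sq')

lemma ip_Py_commute:
 assumes "f \<in> sqint R" "g \<in> sqint R"
 shows "ip R (Py f) g = ip R f (Py g)"
proof -
 have "ip R (Py f) g = ip R (sw (Lx (mu c d) my.KP (sw f))) (sw (sw g))" by (simp add: Py_sw)
 also have "... = ip (rm c d a b) (Lx (mu c d) my.KP (sw f)) (sw g)"
  by (rule ip_sw_sqint[OF cd my.Px_sqint[OF sqint_sw[OF assms(1)]] sqint_sw[OF assms(2)]])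
 also have "... = ip (rm c d a b) (sw f) (Lx (mu c d) my.KP (sw g))"
  by (rule my.ip_Px_commute) (use assms in auto)
 also have "... = ip R (sw (sw f)) (sw (Lx (mu c d) my.KP (sw g)))"
  by (rule ip_sw_sqint[OF cd sqint_sw[OF assms(1)] my.Px_sqint[OF sqint_sw[OF assms(2)]], symmetric])
 finally show ?thesis by (simp add: Py_sw)
qed

lemma sw_diff: "sw (%p. f p - g p) = (%p. sw f p - sw g p)"
 by (simp add: sw_def)

lemma Py_residual_sqint: "f \<in> sqint R ==> (%p. f p - Py f p) \<in> sqint R"
 using Py_sqint by auto

lemma nrm_Py_residual_sw:
 assumes f: "f \<in> sqint R"
 shows "nrm R (%p. f p - Py f p) = nrm (rm c d a b) (%p. sw f p - Lx (mu c d) my.KP (sw f) p)"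
 using nrm_sw_sq'[OF Py_residual_sqint[OF f]] by (simp add: sw_diff Py_sw)

lemma Py_pwpoly:
 assumes f: "f \<in> sqint R" and pw: "!!x. my.pwpoly (%y. f (x, y))"
 shows "AE p in R. Py f p = f p"
proof -
 have "AE p in rm c d a b. Lx (mu c d) my.KP (sw f) p = sw f p"
  by (rule my.Px_pwpoly) (use f pw in "auto simp: sw_def intro: sqint_sw[unfolded sw_def]")
 from AE_sw[OF this] show ?thesis unfolding Py_sw by (simp add: sw_def)
qed

lemma nrm_Py_residual_chain:
 fixes f :: "nat => fun2"
 assumes m: "m <= n" and f: "!!j. j <= m ==> f j \<in> sqint R"
  and chain: "!!j. j < m ==> \<exists>C. AE p in R. f j p = C (fst p) + Ly (mu c d) Ik (f (Suc j)) p"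
 shows "nrm R (%p. f 0 p - Py (f 0) p) <= H ^ m*nrm R (f m)"
proof -
 have "nrm (rm c d a b) (%p. sw (f 0) p - Lx (mu c d) my.KP (sw (f 0)) p) <= H ^ m*nrm (rm c d a b) (sw (f m))"
 proof (rule my.nrm_Px_residual_chain[OF m Hy, of "%j. sw (f j)"])
  fix j assume "j < m"
  from chain[OF this] obtain C where "AE p in R. f j p = C (fst p) + Ly (mu c d) Ik (f (Suc j)) p" by blast
  from AE_sw[OF this] show "\<exists>C. AE p in rm c d a b. sw (f j) p = C (snd p) + Lx (mu c d) Ik (sw (f (Suc j))) p"
   by (intro exI[of _ C]) (simp add: Ly_sw sw_def)
 qed (use f in auto)
 then show ?thesis using f by (simp add: nrm_Py_residual_sw nrm_sw_sq')
qed

lemma nrm_Px_residual_Gx: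
 "f \<in> sqint R ==> nrm R (%p. Gx a b f p - Px (Gx a b f) p) <= H*nrm R (Gx' a b f)"
 by (rule mx.nrm_Px_residual_Gx[OF Hx])

lemma nrm_Px_residual_Gx2:
 "f \<in> sqint R ==> nrm R (%p. Gx a b f p - Px (Gx a b f) p) <= H^2*nrm R f"
 by (rule mx.nrm_Px_residual_Gx2[OF Hx])

lemma nrm_Gx'_residual:
 "f \<in> sqint R ==> nrm R (Gx' a b (%p. f p - Px f p)) <= H*nrm R (%p. f p - Px f p)"
 by (rule mx.nrm_Gx'_residual[OF Hx])

lemma nrm_Gx_residual:
 "f \<in> sqint R ==> nrm R (Gx a b (%p. f p - Px f p)) <= (b-a)*H*nrm R (%p. f p - Px f p)"
 by (rule mx.nrm_Gx_residual[OF Hx])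

lemma nrm_Py_residual_Gy:
 assumes f: "f \<in> sqint R"
 shows "nrm R (%p. Gy c d f p - Py (Gy c d f) p) <= H*nrm R (Gy' c d f)"
 using my.nrm_Px_residual_Gx[OF Hy sqint_sw[OF f]]
 unfolding nrm_Py_residual_sw[OF Gy_sq[OF f]]
 by (simp add: Ly_sw[of "mu c d" _ f] nrm_sw_sq[OF Gx'_sqint[OF cd sqint_sw[OF f]]])

lemma nrm_Py_residual_Gy2:
 assumes f: "f \<in> sqint R"
 shows "nrm R (%p. Gy c d f p - Py (Gy c d f) p) <= H^2*nrm R f"
 using my.nrm_Px_residual_Gx2[OF Hy sqint_sw[OF f]]
 unfolding nrm_Py_residual_sw[OF Gy_sq[OF f]]
 by (simp add: Ly_sw[of "mu c d" _ f] nrm_sw_sq'[OF f])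

lemma inverse_Gy':
 assumes z: "z \<in> sqint R" "!!x. my.pwpoly (%y. z (x, y))"
 shows "nrm R z <= inv_const (Suc n)/h*nrm R (Gy' c d z)"
proof -
 have "nrm (rm c d a b) (sw z) <= inv_const (Suc n)/h*nrm (rm c d a b) (Gx' c d (sw z))"
  by (rule my.inverse_Gx'[OF _ _ h_pos hy]) (use z in "auto simp: sw_def intro: sqint_sw[unfolded sw_def]")
 then show ?thesis
  using z by (simp add: nrm_sw_sq' Ly_sw[of "mu c d" _ z] nrm_sw_sq[OF Gx'_sqint[OF cd sqint_sw[OF z(1)]]])
qed

lemma inverse_Gx':
 assumes z: "z \<in> sqint R" "!!y. mx.pwpoly (%x. z (x, y))"
 shows "nrm R z <= inv_const (Suc n)/h*nrm R (Gx' a b z)"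
 using mx.inverse_Gx'[OF z h_pos hx] .

lemma sw_residual: "sw (%p. f p - Py f p) = (%p. sw f p - Lx (mu c d) my.KP (sw f) p)"
 by (simp add: sw_diff Py_sw)

lemma nrm_Gy'_residual:
 assumes f: "f \<in> sqint R"
 shows "nrm R (Gy' c d (%p. f p - Py f p)) <= H*nrm R (%p. f p - Py f p)"
proof -
 have r: "(%p. sw f p - Lx (mu c d) my.KP (sw f) p) \<in> sqint (rm c d a b)"
  by (rule my.Px_residual_sqint[OF sqint_sw[OF f]])
 show ?thesis
  using my.nrm_Gx'_residual[OF Hy sqint_sw[OF f]]
  by (simp add: Ly_sw[of "mu c d" "G1k c d"] sw_residual nrm_Py_residual_sw[OF f] nrm_sw_sq[OF Gx'_sqint[OF cd r]])
qed

lemma nrm_Gy_residual: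
 assumes f: "f \<in> sqint R"
 shows "nrm R (Gy c d (%p. f p - Py f p)) <= (d-c)*H*nrm R (%p. f p - Py f p)"
proof -
 have r: "(%p. sw f p - Lx (mu c d) my.KP (sw f) p) \<in> sqint (rm c d a b)"
  by (rule my.Px_residual_sqint[OF sqint_sw[OF f]])
 show ?thesis
  using my.nrm_Gx_residual[OF Hy sqint_sw[OF f]]
  by (simp add: Ly_sw[of "mu c d" "Gk c d"] sw_residual nrm_Py_residual_sw[OF f] nrm_sw_sq[OF Gx_sqint[OF cd r]])
qed

definition e2 :: "(nat \<times> nat) \<times> (nat \<times> nat) => fun2" where
 "e2 = (%(i, j) p. mx.e1 i (fst p)*my.e1 j (snd p))"

definition J2 :: "((nat \<times> nat) \<times> (nat \<times> nat)) set" where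
 "J2 = mx.J1 \<times> my.J1"

lemma e2_measurable: "is_borel (e2 k)"
proof -
 obtain i j where k: "k = (i, j)" by (cases k)
 have "(%p. mx.e1 i (fst p)*my.e1 j (snd p)) \<in> borel_measurable (borel \<Otimes>\<^sub>M borel)" by measurable
 then show ?thesis by (simp add: k e2_def borel_prod)
qed

lemma e2_bounded: "\<exists>B\<ge>0. \<forall>p. \<bar>e2 k p\<bar> <= B"
proof -
 obtain i j where k: "k = (i, j)" by (cases k)
 obtain B C where "0 <= B" "!!x. \<bar>mx.e1 i x\<bar> <= B" "0 <= C" "!!x. \<bar>my.e1 j x\<bar> <= C"
  using mx.e1_bounded my.e1_bounded by metis
 then show ?thesis by (intro exI[of _ "B*C"]) (auto simp: k e2_def abs_mult intro!: mult_mono)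
qed

lemma e2_sqint [simp]: "e2 k \<in> sqint R"
proof -
 obtain B where "!!p. \<bar>e2 k p\<bar> <= B" using e2_bounded by blast
 then show ?thesis by (intro rm.sqint_bounded[where B=B]) (auto simp: rm_borel e2_measurable)
qed

lemma ip_e2:
 assumes "k \<in> J2" "k' \<in> J2"
 shows "ip R (e2 k) (e2 k') = (if k = k' then 1 else 0)"
proof -
 obtain i j i' j' where k: "k = (i, j)" "k' = (i', j')" by (cases k, cases k')
 have "ip R (e2 k) (e2 k') = (LINT y|mu c d. (LINT x|mu a b. e2 k (x, y)*e2 k' (x, y)))"
  unfolding ip_def by (rule integral_rm_x[OF sqint_mult]) auto
 also have "... = (LINT y|mu c d. (my.e1 j y*my.e1 j' y)*ip (mu a b) (mx.e1 i) (mx.e1 i'))"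
  unfolding k e2_def ip_def prod.case fst_conv snd_conv integral_mult_right_zero[symmetric]
  by (simp only: mult_ac)
 also have "... = ip (mu c d) (my.e1 j) (my.e1 j')*ip (mu a b) (mx.e1 i) (mx.e1 i')"
  by (simp add: ip_def)
 also have "... = (if k = k' then 1 else 0)"
  using assms mx.ip_e1[of i i'] my.ip_e1[of j j'] by (simp add: k J2_def)
 finally show ?thesis .
qed

sublocale on2: orthonormal_family R J2 e2
 by unfold_locales (auto simp: ip_e2, simp add: J2_def)

lemma comb2_slice_x: "mx.pwpoly (%x. on2.comb cf (x, y))"
proof -
 have "(%x. on2.comb cf (x, y)) = mx.on.comb (%i. \<Sum>j\<in>my.J1. cf (i, j)*my.e1 j y)"
  unfolding on2.comb_def mx.on.comb_def sum_distrib_right unfolding J2_def e2_def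
  by (simp add: sum.cartesian_product split_beta' mult_ac)
 then show ?thesis using mx.pwpoly_comb_self by simp
qed

lemma comb2_slice_y: "my.pwpoly (%y. on2.comb cf (x, y))"
proof -
 have "(%y. on2.comb cf (x, y)) = my.on.comb (%j. \<Sum>i\<in>mx.J1. cf (i, j)*mx.e1 i x)"
  unfolding on2.comb_def my.on.comb_def sum_distrib_right unfolding J2_def e2_def
  by (subst sum.swap) (simp add: sum.cartesian_product split_beta' mult_ac)
 then show ?thesis using my.pwpoly_comb_self by simp
qed

lemma Px_comb2: "AE p in R. Px (on2.comb cf) p = on2.comb cf p"
 by (rule mx.Px_pwpoly) (simp_all add: comb2_slice_x)

lemma Py_comb2: "AE p in R. Py (on2.comb cf) p = on2.comb cf p"
 by (rule Py_pwpoly) (simp_all add: comb2_slice_y)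

text \<open>Both operators produce the same double sum over the product basis. With the commutation
  of \<open>Px\<close> and \<open>Py\<close> either order may be chosen, and each later estimate
  picks the order in which only one variable is projected at a time.\<close>

lemma proj2_eq:
 assumes f: "f \<in> sqint R"
 shows "on2.proj f = Px (Py f)"
proof -
 have "Py (Px f) p = on2.proj f p" for p
 proof -
  obtain x y where p: "p = (x, y)" by (cases p)
  \<comment> \<open>The coefficient of basis function i in x along the line at height t; its
    coefficients in y are those of f in the product basis.\<close>
  define A where "A i t = ip (mu a b) (%s. f (s, t)) (mx.e1 i)" for i t
  have fi: "integrable R (%q. f q*e2 (i, j) q)" for i j by (rule sqint_mult) (use f in auto)
  have eq: "(LINT s|mu a b. f (s, t)*e2 (i, j) (s, t)) = my.e1 j t*A i t" for i j t
   unfolding A_def ip_def integral_mult_right_zero[symmetric] by (simp add: e2_def mult_ac)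
  have Aint: "integrable (mu c d) (%t. my.e1 j t*A i t)" for i j
   using mu2.integrable_snd[of a b c d "%s t. f (s, t)*e2 (i, j) (s, t)"] fi[of i j]
   by (simp add: rm_def split_beta' eq)
  have Aip: "ip R f (e2 (i, j)) = (LINT t|mu c d. my.e1 j t*A i t)" for i j
   unfolding ip_def integral_rm_x[OF fi] by (simp add: eq)
  have Am: "(%t. A i t) \<in> borel_measurable (mu c d)" for i
  proof -
   have [measurable]: "is_borel f" by (rule sqint_borel[OF f])
   show ?thesis unfolding A_def ip_def by measurable
  qed
  have "Py (Px f) p = (LINT t|mu c d. my.KP y t*Px f (x, t))" by (simp add: Ly_def kop_def p)
  also have "... = (LINT t|mu c d. (\<Sum>j\<in>my.J1. \<Sum>i\<in>mx.J1. (my.e1 j y*mx.e1 i x)*(my.e1 j t*A i t)))"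
  proof (rule integral_cong_AE)
   show "AE t in mu c d. my.KP y t*Px f (x, t) = (\<Sum>j\<in>my.J1. \<Sum>i\<in>mx.J1. (my.e1 j y*mx.e1 i x)*(my.e1 j t*A i t))"
    using sqint_slice_x[OF f]
   proof eventually_elim
    case (elim t)
    have "Px f (x, t) = (\<Sum>i\<in>mx.J1. A i t*mx.e1 i x)"
     by (simp add: Lx_def mx.P1_eq[OF elim] mx.on.proj_def mx.on.comb_def A_def)
    then show ?case by (subst sum.swap) (simp add: my.KP_def sum_product mult_ac)
   qed
   have [measurable]: "is_borel (Px f)" by (rule mx.Px_measurable[OF sqint_borel[OF f]])
   note [measurable] = bkern_row[OF my.bkern_KP] Am
   show "(%t. my.KP y t*Px f (x, t)) \<in> borel_measurable (mu c d)" by measurable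
   show "(%t. (\<Sum>j\<in>my.J1. \<Sum>i\<in>mx.J1. (my.e1 j y*mx.e1 i x)*(my.e1 j t*A i t))) \<in> borel_measurable (mu c d)"
    by measurable
  qed
  also have "... = (\<Sum>j\<in>my.J1. \<Sum>i\<in>mx.J1. (my.e1 j y*mx.e1 i x)*ip R f (e2 (i, j)))"
   unfolding Aip using Aint by simp
  also have "... = on2.proj f p"
   unfolding on2.proj_def on2.comb_def unfolding J2_def
   by (subst sum.swap) (simp add: sum.cartesian_product split_beta' mult_ac e2_def p)
  finally show ?thesis .
 qed
 then have "Py (Px f) = on2.proj f" by blast
 moreover have "Px (Py f) = Py (Px f)"
  by (rule Lx_Ly_commute[OF mx.bkern_KP my.bkern_KP rm.sqint_int[OF f]])
 ultimately show ?thesis by simp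
qed

end

section \<open>The elliptic operator and its energy identity\<close>

lemma nrm_cong_sq: "AE p in M. f p = g p ==> f \<in> sqint M ==> g \<in> sqint M ==> nrm M f = nrm M g"
 by (rule nrm_cong_AE) (auto dest: sqint_measurable)

lemma ip_cong_sq: "AE p in M. f p = f' p ==> AE p in M. g p = g' p ==> f \<in> sqint M ==> f' \<in> sqint M ==>
  g \<in> sqint M ==> g' \<in> sqint M ==> ip M f g = ip M f' g'"
 by (rule ip_cong_AE) (auto dest: sqint_measurable)

lemma Lx_cong_sq: "AE p in rm a b c d. f p = g p ==> bkern K ==> f \<in> sqint (rm a b c d) ==>
  g \<in> sqint (rm a b c d) ==> AE p in rm a b c d. Lx (mu a b) K f p = Lx (mu a b) K g p"
 by (rule Lx_cong_AE) (auto dest: sqint_borel)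

lemma Ly_cong_sq: "AE p in rm a b c d. f p = g p ==> bkern K ==> f \<in> sqint (rm a b c d) ==>
  g \<in> sqint (rm a b c d) ==> AE p in rm a b c d. Ly (mu c d) K f p = Ly (mu c d) K g p"
 by (rule Ly_cong_AE) (auto dest: sqint_borel)

lemma quadratic_bound:
 fixes x A B :: real
 assumes "x^2 <= A*x + B^2" "0 <= A" "0 <= B"
 shows "x <= A + B"
proof (rule ccontr)
 assume "\<not> x <= A + B"
 then have x: "A + B < x" by simp
 have "B*B <= (x-A)*B" using x assms by (intro mult_right_mono) auto
 also have "... <= (x-A)*(A+B)" using x assms by (intro mult_left_mono) auto
 also have "... < (x-A)*x" using x assms by (cases "x - A = 0") (auto intro!: mult_strict_left_mono)
 finally show False using assms(1) by (simp add: algebra_simps power2_eq_square)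
qed

text \<open>With \<open>p\<close> and \<open>q\<close> the pure second derivatives of $w$, the elliptic operator applied to $w$.\<close>

definition Lop :: "real => real => real => real => real => real \<times> real => real =>
  fun2 => fun2 => fun2" where
 "Lop a b c d \<alpha> \<beta> \<gamma> p q = (%s. - (\<alpha>*(p s + q s)) + (fst \<beta>*Gx' a b p s + snd \<beta>*Gy' c d q s) + \<gamma>*Gx a b p s)"

definition Lbound :: "real => real => real => real => real => real \<times> real => real => real" where
 "Lbound a b c d \<alpha> \<beta> \<gamma> = \<alpha> + \<bar>fst \<beta>\<bar>*(b-a) + \<bar>snd \<beta>\<bar>*(d-c) + \<gamma>*(b-a)\<^sup>2"

locale pde =
 fixes a b c d \<alpha> \<gamma> :: real and \<beta> :: "real \<times> real"
 assumes ab: "a < b" and cd: "c < d" and \<alpha>: "0 < \<alpha>" and \<gamma>: "0 <= \<gamma>"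
begin

abbreviation RP :: "(real \<times> real) measure" where "RP \<equiv> rm a b c d"
abbreviation LL :: "fun2 => fun2 => fun2" where
 "LL \<equiv> Lop a b c d \<alpha> \<beta> \<gamma>"
abbreviation CL :: real where "CL \<equiv> Lbound a b c d \<alpha> \<beta> \<gamma>"

lemmas Gx_sq = Gx_sqint[OF ab, of _ c d] and Gx'_sq = Gx'_sqint[OF ab, of _ c d]
lemmas Gy_sq = Gy_sqint[OF cd, of _ a b] and Gy'_sq = Gy'_sqint[OF cd, of _ a b]

lemma CL_pos: "0 < CL"
 unfolding Lbound_def using ab cd \<alpha> \<gamma> by (intro add_pos_nonneg mult_nonneg_nonneg) auto

lemma LL_sqint: "p \<in> sqint RP ==> q \<in> sqint RP ==> LL p q \<in> sqint RP"
 unfolding Lop_def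
 by (intro sqint_add sqint_uminus sqint_cmult Gx'_sq Gy'_sq Gx_sq)

lemma nrm_LL:
 assumes p: "p \<in> sqint RP" and q: "q \<in> sqint RP"
 shows "nrm RP (LL p q) <= CL*(nrm RP p + nrm RP q)"
proof -
 note sq = p q Gx'_sq[OF p] Gy'_sq[OF q] Gx_sq[OF p]
 have "nrm RP (LL p q) <= nrm RP (%s. - (\<alpha>*(p s + q s)) + (fst \<beta>*Gx' a b p s + snd \<beta>*Gy' c d q s)) + nrm RP (%s. \<gamma>*Gx a b p s)"
  unfolding Lop_def by (rule nrm_triangle) (intro sqint_add sqint_uminus sqint_cmult sq)+
 also have "nrm RP (%s. - (\<alpha>*(p s + q s)) + (fst \<beta>*Gx' a b p s + snd \<beta>*Gy' c d q s))
   <= nrm RP (%s. - (\<alpha>*(p s + q s))) + nrm RP (%s. fst \<beta>*Gx' a b p s + snd \<beta>*Gy' c d q s)"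
  by (rule nrm_triangle) (intro sqint_add sqint_uminus sqint_cmult sq)+
 also have "nrm RP (%s. fst \<beta>*Gx' a b p s + snd \<beta>*Gy' c d q s)
   <= nrm RP (%s. fst \<beta>*Gx' a b p s) + nrm RP (%s. snd \<beta>*Gy' c d q s)"
  by (rule nrm_triangle) (intro sqint_add sqint_cmult sq)+
 finally have 1: "nrm RP (LL p q) <= \<alpha>*nrm RP (%s. p s + q s) + (\<bar>fst \<beta>\<bar>*nrm RP (Gx' a b p) + \<bar>snd \<beta>\<bar>*nrm RP (Gy' c d q)) + \<gamma>*nrm RP (Gx a b p)"
  using \<alpha> \<gamma> unfolding nrm_uminus nrm_cmult by simp
 have "\<alpha>*nrm RP (%s. p s + q s) <= \<alpha>*(nrm RP p + nrm RP q)"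
  using \<alpha> nrm_triangle[OF p q] by (intro mult_left_mono) auto
 moreover have "\<bar>fst \<beta>\<bar>*nrm RP (Gx' a b p) <= \<bar>fst \<beta>\<bar>*(b-a)*(nrm RP p + nrm RP q)"
 proof -
  have "nrm RP (Gx' a b p) <= (b-a)*(nrm RP p + nrm RP q)"
   by (rule order_trans[OF nrm_Gx'[OF ab p] mult_left_mono]) (use ab in auto)
  from mult_left_mono[OF this, of "\<bar>fst \<beta>\<bar>"] show ?thesis by (simp add: mult.assoc)
 qed
 moreover have "\<bar>snd \<beta>\<bar>*nrm RP (Gy' c d q) <= \<bar>snd \<beta>\<bar>*(d-c)*(nrm RP p + nrm RP q)"
 proof -
  have "nrm RP (Gy' c d q) <= (d-c)*(nrm RP p + nrm RP q)"
   by (rule order_trans[OF nrm_Gy'[OF cd q] mult_left_mono]) (use cd in auto)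
  from mult_left_mono[OF this, of "\<bar>snd \<beta>\<bar>"] show ?thesis by (simp add: mult.assoc)
 qed
 moreover have "\<gamma>*nrm RP (Gx a b p) <= \<gamma>*(b-a)\<^sup>2*(nrm RP p + nrm RP q)"
 proof -
  have "nrm RP (Gx a b p) <= (b-a)\<^sup>2*(nrm RP p + nrm RP q)"
   by (rule order_trans[OF nrm_Gx[OF ab p] mult_left_mono]) auto
  from mult_left_mono[OF this \<gamma>] show ?thesis by (simp add: mult.assoc)
 qed
 ultimately show ?thesis using 1 unfolding Lbound_def by (simp add: algebra_simps)
qed

lemma LL_diff:
 assumes "p \<in> sqint RP" "q \<in> sqint RP" "p' \<in> sqint RP" "q' \<in> sqint RP"
 shows "AE s in RP. LL (%s. p s - p' s) (%s. q s - q' s) s = LL p q s - LL p' q' s"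
 using Lx_diff[OF bkern_G1k[OF ab] assms(1,3)] Ly_diff[OF bkern_G1k[OF cd] assms(2,4)]
  Lx_diff[OF bkern_Gk[OF ab] assms(1,3)]
 by eventually_elim (simp add: Lop_def, simp add: algebra_simps)

text \<open>In the energy identity the convection terms drop out since the coefficients are constant.\<close>

lemma energy:
 assumes p: "p \<in> sqint RP" and q: "q \<in> sqint RP" and eq: "AE s in RP. Gx a b p s = Gy c d q s"
 shows "ip RP (LL p q) (Gx a b p) = \<alpha>*((nrm RP (Gx' a b p))^2 + (nrm RP (Gy' c d q))^2) + \<gamma>*(nrm RP (Gx a b p))^2"
proof -
 note sq = p q Gx'_sq[OF p] Gy'_sq[OF q] Gx_sq[OF p]
 let ?e = "Gx a b p"
 have 1: "ip RP p ?e = - (nrm RP (Gx' a b p))\<^sup>2" using ip_Gx_Gx'[OF ab p p] by (simp add: nrm_square)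
 \<comment> \<open>In terms that contain q the function is replaced by its representation in y, so
   that the one-dimensional identity applies there too.\<close>
 have "ip RP q ?e = ip RP q (Gy c d q)" by (rule ip_cong_sq) (use eq sq Gy_sq[OF q] in auto)
 then have 2: "ip RP q ?e = - (nrm RP (Gy' c d q))\<^sup>2" using ip_Gy_Gy'[OF cd q q] by (simp add: nrm_square)
 have 3: "ip RP (Gx' a b p) ?e = 0" using ip_Gx'_Gx[OF ab p p] unfolding ip_commute[of RP ?e "Gx' a b p"] by linarith
 have "ip RP (Gy' c d q) ?e = ip RP (Gy' c d q) (Gy c d q)" by (rule ip_cong_sq) (use eq sq Gy_sq[OF q] in auto)
 then have 4: "ip RP (Gy' c d q) ?e = 0"
  using ip_Gy'_Gy[OF cd q q] unfolding ip_commute[of RP "Gy c d q" "Gy' c d q"] by linarith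
 have "LL p q = (%s. (- \<alpha>)*(p s + q s) + (fst \<beta>*Gx' a b p s + snd \<beta>*Gy' c d q s) + \<gamma> * ?e s)"
  by (simp add: Lop_def fun_eq_iff)
 then have "ip RP (LL p q) ?e = (- \<alpha>)*(ip RP p ?e + ip RP q ?e) + (fst \<beta>*ip RP (Gx' a b p) ?e + snd \<beta>*ip RP (Gy' c d q) ?e) + \<gamma>*ip RP ?e ?e"
  by (simp only: ip_add_left ip_cmult_left sq sqint_add sqint_cmult)
 then show ?thesis by (simp add: 1 2 3 4 nrm_square[of RP ?e] algebra_simps)
qed

text \<open>A Poincare inequality: on almost every line the function is the antiderivative of its
  x-derivative, starting from 0 at the boundary.\<close>

lemma poincare_x:
 assumes p: "p \<in> sqint RP"
 shows "nrm RP (Gx a b p) <= (b-a)*nrm RP (Gx' a b p)"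
proof (rule sqint_lift_x(2))
 show "AE y in mu c d. (%x. Gx' a b p (x, y)) \<in> sqint (mu a b) --> (%x. Gx a b p (x, y)) \<in> sqint (mu a b) \<and>
   nrm (mu a b) (%x. Gx a b p (x, y)) <= (b-a)*nrm (mu a b) (%x. Gx' a b p (x, y))"
  using sqint_slice_x[OF p]
 proof eventually_elim
  case (elim y)
  let ?f = "%x. p (x, y)"
  have G': "green' a b ?f \<in> sqint (mu a b)"
   using kop_nrm(1)[OF less_imp_le[OF ab] bkern_G1k[OF ab] G1k_bound[OF ab] elim] .
  have G: "green a b ?f \<in> sqint (mu a b)"
   using kop_nrm(1)[OF less_imp_le[OF ab] bkern_Gk[OF ab] Gk_bound[OF ab] elim] .
  have A: "anti a b (green' a b ?f) \<in> sqint (mu a b)"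
   by (rule kop_nrm(1)[OF less_imp_le[OF ab] bkern_Ik _ G', of 1]) (auto simp: Ik_def)
  have "nrm (mu a b) (green a b ?f) = nrm (mu a b) (anti a b (green' a b ?f))"
   by (rule nrm_cong_sq[OF _ G A])
     (use AE_anti_green'[OF ab mu.sqint_int[OF elim]] in "auto elim: eventually_mono")
  also have "... <= 1*(b-a)*nrm (mu a b) (green' a b ?f)"
   by (rule kop_nrm(2)[OF less_imp_le[OF ab] bkern_Ik _ G']) (auto simp: Ik_def)
  finally show ?case using G by (simp add: Lx_def)
 qed
qed (use ab p Gx'_sq in "auto intro!: sqint_borel[OF Gx_sq]")

text \<open>Second derivatives move across symmetrically and first derivatives antisymmetrically, so
  with constant coefficients the adjoint differs by the sign of \<beta>. For terms in y both
  functions switch to their representations through \<open>q\<close> and \<open>q'\<close>.\<close>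

lemma adjoint:
 assumes p: "p \<in> sqint RP" and q: "q \<in> sqint RP" and eq: "AE s in RP. Gx a b p s = Gy c d q s"
  and p': "p' \<in> sqint RP" and q': "q' \<in> sqint RP" and eq': "AE s in RP. Gx a b p' s = Gy c d q' s"
 shows "ip RP (Lop a b c d \<alpha> (- \<beta>) \<gamma> p' q') (Gx a b p) = ip RP (Gx a b p') (LL p q)"
proof -
 let ?e = "Gx a b p" and ?\<phi> = "Gx a b p'"
 note sq = p q Gx'_sq[OF p] Gy'_sq[OF q] Gx_sq[OF p] p' q' Gx'_sq[OF p'] Gy'_sq[OF q'] Gx_sq[OF p'] Gy_sq[OF q] Gy_sq[OF q']
 have 1: "ip RP p' ?e = ip RP ?\<phi> p" by (rule ip_Gx_sym[OF ab p' p])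
 have "ip RP q' ?e = ip RP q' (Gy c d q)" by (rule ip_cong_sq) (use eq sq in auto)
 also have "... = ip RP (Gy c d q') q" by (rule ip_Gy_sym[OF cd q' q])
 also have "... = ip RP ?\<phi> q" by (rule ip_cong_sq) (use eq' sq in auto)
 finally have 2: "ip RP q' ?e = ip RP ?\<phi> q" .
 have 3: "ip RP (Gx' a b p') ?e = - ip RP ?\<phi> (Gx' a b p)" by (rule ip_Gx'_Gx[OF ab p' p])
 have "ip RP (Gy' c d q') ?e = ip RP (Gy' c d q') (Gy c d q)" by (rule ip_cong_sq) (use eq sq in auto)
 also have "... = - ip RP (Gy c d q') (Gy' c d q)" by (rule ip_Gy'_Gy[OF cd q' q])
 also have "ip RP (Gy c d q') (Gy' c d q) = ip RP ?\<phi> (Gy' c d q)" by (rule ip_cong_sq) (use eq' sq in auto)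
 finally have 4: "ip RP (Gy' c d q') ?e = - ip RP ?\<phi> (Gy' c d q)" .
 have "Lop a b c d \<alpha> (- \<beta>) \<gamma> p' q' = (%s. (- \<alpha>)*(p' s + q' s) + ((- fst \<beta>)*Gx' a b p' s + (- snd \<beta>)*Gy' c d q' s) + \<gamma> * ?\<phi> s)"
  by (simp add: Lop_def fun_eq_iff)
 then have "ip RP (Lop a b c d \<alpha> (- \<beta>) \<gamma> p' q') ?e = (- \<alpha>)*(ip RP p' ?e + ip RP q' ?e) + ((- fst \<beta>)*ip RP (Gx' a b p') ?e + (- snd \<beta>)*ip RP (Gy' c d q') ?e) + \<gamma>*ip RP ?\<phi> ?e"
  by (simp only: ip_add_left ip_cmult_left sq sqint_add sqint_cmult)
 also have "... = (- \<alpha>)*(ip RP ?\<phi> p + ip RP ?\<phi> q) + (fst \<beta>*ip RP ?\<phi> (Gx' a b p) + snd \<beta>*ip RP ?\<phi> (Gy' c d q)) + \<gamma>*ip RP ?\<phi> ?e"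
  by (simp add: 1 2 3 4)
 also have "... = ip RP ?\<phi> (%s. (- \<alpha>)*(p s + q s) + (fst \<beta>*Gx' a b p s + snd \<beta>*Gy' c d q s) + \<gamma> * ?e s)"
  by (simp only: ip_add_right ip_cmult_right sq sqint_add sqint_cmult)
 also have "(%s. (- \<alpha>)*(p s + q s) + (fst \<beta>*Gx' a b p s + snd \<beta>*Gy' c d q s) + \<gamma> * ?e s) = LL p q"
  by (simp add: Lop_def fun_eq_iff)
 finally show ?thesis .
qed

end

section \<open>Stability on fine meshes and duality\<close>

context mesh2
begin

abbreviation PP :: "fun2 => fun2" where "PP \<equiv> on2.proj"

text \<open>The ratio H/h is all that the mesh contributes: an inverse estimate costs 1/h and an
  approximation estimate returns H.\<close>

definition stab_const :: real where
 "stab_const = 1 + inv_const (Suc n)*H/h"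

lemma stab_const_ge: "1 <= stab_const"
 unfolding stab_const_def using H_pos h_pos by simp

lemma PP_sq: "PP f \<in> sqint R"
 by simp

lemma ip_PP_PP: "f \<in> sqint R ==> g \<in> sqint R ==> ip R (PP f) (PP g) = ip R (PP f) g"
 using on2.ip_proj_commute[of "PP f" g] by (simp add: on2.proj_idem)

lemma kernels: "bkern (Gk a b)" "bkern (G1k a b)" "bkern (Gk c d)" "bkern (G1k c d)"
  "bkern mx.KP" "bkern my.KP"
 using bkern_Gk bkern_G1k ab cd mx.bkern_KP my.bkern_KP by auto

lemma commute: "bkern K ==> bkern L ==> f \<in> sqint R ==>
  Lx (mu a b) K (Ly (mu c d) L f) = Ly (mu c d) L (Lx (mu a b) K f)"
 by (rule Lx_Ly_commute[OF _ _ rm.sqint_int])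

text \<open>For w = \<open>Gx a b (Gy c d z)\<close> with z in $W_h$ one has $w_{xx}$ =
  \<open>Gy c d z\<close> and $w_{yy}$ = \<open>Gx a b z\<close>. The operator acts in y alone, so
  $w_{xx}$ remains in x a piecewise polynomial of degree below n, and P reduces on it to
  \<open>Py\<close>.\<close>

lemma Px_Gy_comb: "AE s in R. Px (Gy c d (on2.comb cf)) s = Gy c d (on2.comb cf) s"
 unfolding commute[OF kernels(5,3) on2.comb_sqint]
 by (rule Ly_cong_sq[OF Px_comb2 kernels(3)]) (auto intro: Px_sqint)

lemma Py_Gx_comb: "AE s in R. Py (Gx a b (on2.comb cf)) s = Gx a b (on2.comb cf) s"
 unfolding commute[OF kernels(1,6) on2.comb_sqint, symmetric]
 by (rule Lx_cong_sq[OF Py_comb2 kernels(1)]) (auto intro: Py_sqint)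

lemma PP_Gy_comb: "AE s in R. PP (Gy c d (on2.comb cf)) s = Py (Gy c d (on2.comb cf)) s"
proof -
 have sq: "Gy c d (on2.comb cf) \<in> sqint R" by (intro Gy_sq) simp
 show ?thesis
  unfolding proj2_eq[OF sq] commute[OF kernels(5,6) sq]
  by (rule Ly_cong_sq[OF Px_Gy_comb kernels(6)]) (auto intro: Px_sqint sq)
qed

lemma PP_Gx_comb: "AE s in R. PP (Gx a b (on2.comb cf)) s = Px (Gx a b (on2.comb cf)) s"
proof -
 have sq: "Gx a b (on2.comb cf) \<in> sqint R" by (intro Gx_sq) simp
 show ?thesis
  unfolding proj2_eq[OF sq]
  by (rule Lx_cong_sq[OF Py_Gx_comb kernels(5)]) (auto intro: Py_sqint sq)
qed

text \<open>Integrating by parts once in each variable turns the cross term into the mixed derivative.\<close>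

lemma ip_mixed:
 assumes z: "z \<in> sqint R"
 shows "ip R (Gy c d z) (Gx a b z) = (nrm R (Gx' a b (Gy' c d z)))^2"
proof -
 have Z: "Gx' a b z \<in> sqint R" by (rule Gx'_sq[OF z])
 have "ip R (Gy c d z) (Gx a b z) = - ip R (Gx' a b (Gy c d z)) (Gx' a b z)"
  by (rule ip_Gx_Gx'[OF ab Gy_sq[OF z] z])
 also have "Gx' a b (Gy c d z) = Gy c d (Gx' a b z)" by (rule commute[OF kernels(2,3) z])
 also have "ip R (Gy c d (Gx' a b z)) (Gx' a b z) = - (nrm R (Gy' c d (Gx' a b z)))\<^sup>2"
  unfolding ip_commute[of R "Gy c d (Gx' a b z)"] ip_Gy_Gy'[OF cd Z Z] by (simp add: nrm_square)
 finally show ?thesis by (simp add: commute[OF kernels(2,4) z])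
qed

text \<open>On $w_{xx}$ the projection is \<open>Py\<close>; being symmetric it passes to $w_{yy}$,
  which is already a piecewise polynomial in y and is left unchanged. So projecting both factors
  does not change the cross term.\<close>

lemma ip_PP_mixed:
 "ip R (PP (Gy c d (on2.comb cf))) (PP (Gx a b (on2.comb cf))) = ip R (Gy c d (on2.comb cf)) (Gx a b (on2.comb cf))"
proof -
 let ?p = "Gy c d (on2.comb cf)" and ?q = "Gx a b (on2.comb cf)"
 have p: "?p \<in> sqint R" and q: "?q \<in> sqint R" by (intro Gy_sq Gx_sq on2.comb_sqint)+
 have "ip R (PP ?p) (PP ?q) = ip R (PP ?p) ?q" by (rule ip_PP_PP[OF p q])
 also have "... = ip R (Py ?p) ?q" by (rule ip_cong_sq) (use PP_Gy_comb p q Py_sqint in auto)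
 also have "... = ip R ?p (Py ?q)" by (rule ip_Py_commute[OF p q])
 also have "... = ip R ?p ?q" by (rule ip_cong_sq) (use Py_Gx_comb p q Py_sqint in auto)
 finally show ?thesis .
qed

lemma inverse_comb_y: "nrm R (on2.comb cf) <= inv_const (Suc n)/h*nrm R (Gy' c d (on2.comb cf))"
 by (rule inverse_Gy') (auto simp: comb2_slice_y)

lemma inverse_comb_x: "nrm R (on2.comb cf) <= inv_const (Suc n)/h*nrm R (Gx' a b (on2.comb cf))"
 by (rule inverse_Gx') (auto simp: comb2_slice_x)

lemma le_of_square_le:
 fixes s t u :: real
 assumes "s^2 <= t*u" "u <= k * s" "0 <= t" "0 <= s" "0 <= k"
 shows "s <= k*t"
proof (cases "s = 0")
 case False
 have "s * s <= t*(k * s)" using assms mult_left_mono[OF assms(2,3)] by (simp add: power2_eq_square)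
 also have "t*(k * s) = (k*t) * s" by simp
 finally show ?thesis by (rule mult_right_le_imp_le) (use False assms(4) in simp)
qed (use assms in simp)

text \<open>As z lies in $W_h$, $||w_{xxy}||^2 = -(w_{xx}, z) = -(P w_{xx}, z)$. The inverse
  estimate bounds ||z|| by ||w_{xxy}|| / h, and one factor cancels.\<close>

lemma nrm_Gy'_comb: "nrm R (Gy' c d (on2.comb cf)) <= inv_const (Suc n)/h*nrm R (PP (Gy c d (on2.comb cf)))"
proof (rule le_of_square_le)
 let ?z = "on2.comb cf"
 have z: "?z \<in> sqint R" by simp
 have "(nrm R (Gy' c d ?z))\<^sup>2 = - ip R (Gy c d ?z) ?z"
  using ip_Gy_Gy'[OF cd z z] by (simp add: nrm_square ip_commute)
 also have "ip R (Gy c d ?z) ?z = ip R (PP (Gy c d ?z)) ?z"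
  using on2.ip_proj_commute[OF Gy_sq[OF z] z] by (simp add: on2.proj_comb)
 also have "- ip R (PP (Gy c d ?z)) ?z <= nrm R (PP (Gy c d ?z))*nrm R ?z"
  using ip_Cauchy_Schwarz[OF PP_sq z, of "Gy c d ?z"] by linarith
 finally show "(nrm R (Gy' c d ?z))^2 <= nrm R (PP (Gy c d ?z))*nrm R ?z" .
 show "0 <= inv_const (Suc n)/h" using h_pos by simp
qed (rule inverse_comb_y, simp_all)

lemma nrm_Gx'_comb: "nrm R (Gx' a b (on2.comb cf)) <= inv_const (Suc n)/h*nrm R (PP (Gx a b (on2.comb cf)))"
proof (rule le_of_square_le)
 let ?z = "on2.comb cf"
 have z: "?z \<in> sqint R" by simp
 have "(nrm R (Gx' a b ?z))\<^sup>2 = - ip R (Gx a b ?z) ?z"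
  using ip_Gx_Gx'[OF ab z z] by (simp add: nrm_square ip_commute)
 also have "ip R (Gx a b ?z) ?z = ip R (PP (Gx a b ?z)) ?z"
  using on2.ip_proj_commute[OF Gx_sq[OF z] z] by (simp add: on2.proj_comb)
 also have "- ip R (PP (Gx a b ?z)) ?z <= nrm R (PP (Gx a b ?z))*nrm R ?z"
  using ip_Cauchy_Schwarz[OF PP_sq z, of "Gx a b ?z"] by linarith
 finally show "(nrm R (Gx' a b ?z))^2 <= nrm R (PP (Gx a b ?z))*nrm R ?z" .
 show "0 <= inv_const (Suc n)/h" using h_pos by simp
qed (rule inverse_comb_x, simp_all)

text \<open>The part of $w_{xx}$ that the projection removes is of size $H ||w_{xxy}||$, and
  \<open>nrm_Gy'_comb\<close> turns this into a multiple of H/h times the part that remains.\<close>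

lemma nrm_Gy_comb: "nrm R (Gy c d (on2.comb cf)) <= stab_const*nrm R (PP (Gy c d (on2.comb cf)))"
proof -
 let ?z = "on2.comb cf" and ?p = "Gy c d (on2.comb cf)"
 have z: "?z \<in> sqint R" by simp
 have p: "?p \<in> sqint R" by (rule Gy_sq[OF z])
 have Pe: "nrm R (Py ?p) = nrm R (PP ?p)"
  by (rule nrm_cong_sq[OF _ PP_sq Py_sqint[OF p], symmetric]) (rule PP_Gy_comb)
 have "nrm R (%s. Py ?p s + (?p s - Py ?p s)) <= nrm R (Py ?p) + nrm R (%s. ?p s - Py ?p s)"
  by (rule nrm_triangle) (use p Py_sqint in auto)
 also have "nrm R (%s. ?p s - Py ?p s) <= H*nrm R (Gy' c d ?z)" by (rule nrm_Py_residual_Gy[OF z])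
 also have "... <= H*(inv_const (Suc n)/h*nrm R (PP ?p))"
  by (rule mult_left_mono[OF nrm_Gy'_comb]) (use H_pos in simp)
 finally show ?thesis by (simp add: Pe stab_const_def algebra_simps)
qed

lemma nrm_Gx_comb: "nrm R (Gx a b (on2.comb cf)) <= stab_const*nrm R (PP (Gx a b (on2.comb cf)))"
proof -
 let ?z = "on2.comb cf" and ?p = "Gx a b (on2.comb cf)"
 have z: "?z \<in> sqint R" by simp
 have p: "?p \<in> sqint R" by (rule Gx_sq[OF z])
 have Pe: "nrm R (Px ?p) = nrm R (PP ?p)"
  by (rule nrm_cong_sq[OF _ PP_sq Px_sqint[OF p], symmetric]) (rule PP_Gx_comb)
 have "nrm R (%s. Px ?p s + (?p s - Px ?p s)) <= nrm R (Px ?p) + nrm R (%s. ?p s - Px ?p s)"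
  by (rule nrm_triangle) (use p Px_sqint in auto)
 also have "nrm R (%s. ?p s - Px ?p s) <= H*nrm R (Gx' a b ?z)" by (rule nrm_Px_residual_Gx[OF z])
 also have "... <= H*(inv_const (Suc n)/h*nrm R (PP ?p))"
  by (rule mult_left_mono[OF nrm_Gx'_comb]) (use H_pos in simp)
 finally show ?thesis by (simp add: Pe stab_const_def algebra_simps)
qed

text \<open>The three second derivatives xx, yy and xy of the trial function with coefficients
  \<open>cf\<close> of its fourth derivative.\<close>

definition size2 :: "((nat \<times> nat) \<times> (nat \<times> nat) => real) => real" where
 "size2 cf = nrm R (Gy c d (on2.comb cf)) + nrm R (Gx a b (on2.comb cf)) + nrm R (Gx' a b (Gy' c d (on2.comb cf)))"

text \<open>The square of $||P w_{xx} + P w_{yy}||$ expands into three squares because the cross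
  term is $||w_{xy}||^2$. Each of them is then bounded, and the two projections are removed at the
  cost of \<open>stab_const\<close>.\<close>

lemma laplace_stable:
 "size2 cf <= 3 * stab_const*nrm R (PP (%s. Gy c d (on2.comb cf) s + Gx a b (on2.comb cf) s))"
proof -
 let ?z = "on2.comb cf" and ?p = "Gy c d (on2.comb cf)" and ?q = "Gx a b (on2.comb cf)"
 let ?N = "nrm R (PP (%s. ?p s + ?q s))" and ?m = "nrm R (Gx' a b (Gy' c d ?z))"
 have z: "?z \<in> sqint R" by simp
 have p: "?p \<in> sqint R" and q: "?q \<in> sqint R" by (intro Gy_sq Gx_sq z)+
 have "?N^2 = (nrm R (PP ?p))^2 + (nrm R (PP ?q))^2 + 2 * ?m^2"
  unfolding on2.proj_add[OF p q] nrm_add_square[OF PP_sq PP_sq] ip_PP_mixed ip_mixed[OF z] ..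
 then have "(nrm R (PP ?p))^2 <= ?N^2" "(nrm R (PP ?q))^2 <= ?N^2" "?m^2 <= ?N^2" by simp_all
 then have le: "nrm R (PP ?p) <= ?N" "nrm R (PP ?q) <= ?N" "?m <= ?N"
  by (auto dest!: power2_le_imp_le)
 have "nrm R ?p <= stab_const * ?N" "nrm R ?q <= stab_const * ?N" "?m <= stab_const * ?N"
  using order_trans[OF nrm_Gy_comb mult_left_mono[OF le(1)]] order_trans[OF nrm_Gx_comb mult_left_mono[OF le(2)]]
   order_trans[OF le(3), of "stab_const * ?N"] mult_right_mono[OF stab_const_ge, of ?N] stab_const_ge
  by auto
 then show ?thesis by (simp add: size2_def)
qed

text \<open>The negative powers of h are harmless: the bound serves to conclude that the
  coefficients vanish when the second derivatives do.\<close>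

lemma nrm_comb_le_size2: "nrm R (on2.comb cf) <= (inv_const (Suc n)/h)\<^sup>2 * size2 cf"
proof -
 let ?k = "inv_const (Suc n)/h"
 have k: "0 <= ?k" using h_pos by simp
 have "nrm R (PP (Gy c d (on2.comb cf))) <= nrm R (Gy c d (on2.comb cf))"
  by (intro on2.nrm_proj_le Gy_sq on2.comb_sqint)
 also have "... <= size2 cf" by (simp add: size2_def)
 finally have "nrm R (on2.comb cf) <= ?k*(?k * size2 cf)"
  by (intro order_trans[OF inverse_comb_y] mult_left_mono[OF order_trans[OF nrm_Gy'_comb] k] mult_left_mono k)
 then show ?thesis by (simp add: power2_eq_square)
qed

text \<open>Split e - P e into (e - Py e) + Py (e - Px e). Each bracket concerns one variable, where
  e has two derivatives and zero boundary values; p and q are $e_{xx}$ and $e_{yy}$.\<close>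

lemma PP_residual:
 assumes p: "p \<in> sqint R" and q: "q \<in> sqint R" and eq: "AE s in R. Gx a b p s = Gy c d q s"
 shows "nrm R (%s. Gx a b p s - PP (Gx a b p) s) <= H^2*(nrm R p + nrm R q)"
proof -
 let ?e = "Gx a b p" and ?f = "Gy c d q"
 have e: "?e \<in> sqint R" and f: "?f \<in> sqint R" using p q by (auto intro: Gx_sq Gy_sq)
 have r: "(%s. ?e s - Px ?e s) \<in> sqint R" and r': "(%s. ?e s - Py ?e s) \<in> sqint R"
  using e Px_sqint Py_sqint by auto
 have "nrm R (%s. ?e s - PP ?e s) = nrm R (%s. (?e s - Py ?e s) + Py (%s. ?e s - Px ?e s) s)"
 proof (rule nrm_cong_sq)
  show "AE s in R. ?e s - PP ?e s = (?e s - Py ?e s) + Py (%s. ?e s - Px ?e s) s"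
   using Ly_diff[OF kernels(6) e Px_sqint[OF e]]
   unfolding proj2_eq[OF e] commute[OF kernels(5,6) e]
   by eventually_elim simp
  show "(%s. ?e s - PP ?e s) \<in> sqint R" by (rule sqint_diff[OF e PP_sq])
  show "(%s. (?e s - Py ?e s) + Py (%s. ?e s - Px ?e s) s) \<in> sqint R"
   by (rule sqint_add[OF r' Py_sqint[OF r]])
 qed
 also have "... <= nrm R (%s. ?e s - Py ?e s) + nrm R (Py (%s. ?e s - Px ?e s))"
  by (rule nrm_triangle[OF r' Py_sqint[OF r]])
 also have "nrm R (Py (%s. ?e s - Px ?e s)) <= nrm R (%s. ?e s - Px ?e s)" by (rule nrm_Py_le[OF r])
 also have "... <= H^2*nrm R p" by (rule nrm_Px_residual_Gx2[OF p])
 also have "nrm R (%s. ?e s - Py ?e s) = nrm R (%s. ?f s - Py ?f s)"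
 proof (rule nrm_cong_sq)
  show "AE s in R. ?e s - Py ?e s = ?f s - Py ?f s"
   using eq Ly_cong_sq[OF eq kernels(6) e f] by eventually_elim simp
 qed (rule r' sqint_diff[OF f Py_sqint[OF f]])+
 also have "... <= H^2*nrm R q" by (rule nrm_Py_residual_Gy2[OF q])
 finally show ?thesis by (simp add: algebra_simps)
qed

end

section \<open>Square linear systems\<close>

lemma finite_system_solvable:
 fixes A :: "'k => 'i => real"
 assumes "finite I" "finite K" "card I = card K"
  and "!!u. (\<forall>k\<in>K. (\<Sum>i\<in>I. A k i*u i) = 0) ==> (\<forall>i\<in>I. u i = 0)"
 shows "\<exists>u. \<forall>k\<in>K. (\<Sum>i\<in>I. A k i*u i) = g k"
 using assms
proof (induction "card I" arbitrary: I K A g)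
 case 0
 then show ?case by simp
next
 case (Suc m)
 note fI = Suc.prems(1) and fK = Suc.prems(2) and cc = Suc.prems(3) and inj = Suc.prems(4)
 obtain i0 where i0: "i0 \<in> I" using Suc.hyps(2) by (metis card.empty equals0I nat.distinct(1))
 have "\<exists>k\<in>K. A k i0 \<noteq> 0"
 proof (rule ccontr)
  assume no: "\<not> ?thesis"
  have "(\<Sum>i\<in>I. A k i*(if i = i0 then 1 else 0)) = A k i0" for k
   using fI i0 by (simp add: if_distrib cong: if_cong)
  then have "\<forall>i\<in>I. (if i = i0 then 1 else 0 :: real) = 0"
   by (intro inj) (use no in auto)
  then show False using i0 by auto
 qed
 then obtain k0 where k0: "k0 \<in> K" "A k0 i0 \<noteq> 0" by blast
 \<comment> \<open>One step of Gaussian elimination with the pivot in row k0 and column i0; the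
   Schur complement inherits injectivity.\<close>
 define B where "B k i = A k i - A k i0*A k0 i/A k0 i0" for k i
 have splitI: "(\<Sum>i\<in>I. A k i*u i) = A k i0*u i0 + (\<Sum>i\<in>I - {i0}. A k i*u i)" for k u
  using fI i0 by (simp add: sum.remove)
 have BA: "(\<Sum>i\<in>I - {i0}. B k i*u i) = (\<Sum>i\<in>I - {i0}. A k i*u i) - A k i0/A k0 i0*(\<Sum>i\<in>I - {i0}. A k0 i*u i)" for k u
  by (simp add: B_def left_diff_distrib sum_subtractf sum_distrib_left mult.assoc)
 have injB: "\<forall>i\<in>I - {i0}. u i = 0" if u: "\<forall>k\<in>K - {k0}. (\<Sum>i\<in>I - {i0}. B k i*u i) = 0" for u
 proof -
  \<comment> \<open>The value at i0 is chosen so that equation k0 holds with right-hand side 0; the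
    remaining equations are then those of the reduced system.\<close>
  let ?v = "u(i0 := - (\<Sum>i\<in>I - {i0}. A k0 i*u i)/A k0 i0)"
  have eq: "(\<Sum>i\<in>I. A k i * ?v i) = (\<Sum>i\<in>I - {i0}. A k i*u i) - A k i0/A k0 i0*(\<Sum>i\<in>I - {i0}. A k0 i*u i)" for k
  proof -
   have "(\<Sum>i\<in>I - {i0}. A k i * ?v i) = (\<Sum>i\<in>I - {i0}. A k i*u i)" by (rule sum.cong) auto
   then show ?thesis unfolding splitI[of k ?v] by simp
  qed
  have "\<forall>i\<in>I. ?v i = 0"
  proof (rule inj, rule ballI)
   fix k assume "k \<in> K"
   then show "(\<Sum>i\<in>I. A k i * ?v i) = 0"
    using u BA[of k u] k0 unfolding eq by (cases "k = k0") auto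
  qed
  then show ?thesis by (auto split: if_splits)
 qed
 have "\<exists>u. \<forall>k\<in>K - {k0}. (\<Sum>i\<in>I - {i0}. B k i*u i) = g k - A k i0/A k0 i0*g k0"
  by (rule Suc.hyps(1)) (use Suc.hyps(2) fI fK cc i0 k0 injB in auto)
 then obtain u where u: "!!k. k \<in> K - {k0} ==> (\<Sum>i\<in>I - {i0}. B k i*u i) = g k - A k i0/A k0 i0*g k0"
  by blast
 let ?w = "u(i0 := (g k0 - (\<Sum>i\<in>I - {i0}. A k0 i*u i))/A k0 i0)"
 have eq: "(\<Sum>i\<in>I. A k i * ?w i) = A k i0*((g k0 - (\<Sum>i\<in>I - {i0}. A k0 i*u i))/A k0 i0) + (\<Sum>i\<in>I - {i0}. A k i*u i)" for k
 proof -
  have "(\<Sum>i\<in>I - {i0}. A k i * ?w i) = (\<Sum>i\<in>I - {i0}. A k i*u i)" by (rule sum.cong) auto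
  then show ?thesis unfolding splitI[of k ?w] by simp
 qed
 have "(\<Sum>i\<in>I. A k i * ?w i) = g k" if "k \<in> K" for k
 proof (cases "k = k0")
  case True
  then show ?thesis using k0 unfolding eq by simp
 next
  case False
  then have "(\<Sum>i\<in>I - {i0}. A k i*u i) - A k i0/A k0 i0*(\<Sum>i\<in>I - {i0}. A k0 i*u i) = g k - A k i0/A k0 i0*g k0"
   using u[of k] that BA[of k u] by simp
  then show ?thesis using k0 unfolding eq by (simp add: field_simps)
 qed
 then show ?case by blast
qed

lemma linear_matrix:
 fixes F :: "('i => real) => 'i => real"
 assumes fin: "finite J" and k: "k \<in> J"
  and add: "!!u v. F (%i. u i + v i) k = F u k + F v k"
  and cmult: "!!r u. F (%i. r*u i) k = r*F u k"
  and cong: "!!u v. (\<forall>i\<in>J. u i = v i) ==> F u k = F v k"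
 shows "F u k = (\<Sum>i\<in>J. F (%j. if j = i then 1 else 0) k*u i)"
proof -
 let ?\<delta> = "%i j. if j = i then 1 else (0 :: real)"
 have "F (%j. \<Sum>i\<in>I. u i * ?\<delta> i j) k = (\<Sum>i\<in>I. F (?\<delta> i) k*u i)" if "finite I" for I
  using that
 proof (induction I rule: finite_induct)
  case empty
  show ?case using cmult[of 0 "%_. 0"] by simp
 next
  case (insert i I)
  have "F (%j. \<Sum>i\<in>insert i I. u i * ?\<delta> i j) k = F (%j. u i * ?\<delta> i j + (\<Sum>i\<in>I. u i * ?\<delta> i j)) k"
   using insert by simp
  also have "... = u i*F (?\<delta> i) k + (\<Sum>i\<in>I. F (?\<delta> i) k*u i)" unfolding add cmult insert.IH ..
  finally show ?case using insert by (simp add: mult.commute)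
 qed
 from this[OF fin] show ?thesis
  using cong[of u "%j. \<Sum>i\<in>J. u i * ?\<delta> i j"] fin by (simp add: if_distrib cong: if_cong)
qed

lemma matrix_surj_inj:
 fixes A :: "'i => 'i => real"
 assumes fin: "finite J" and surj: "!!g. \<exists>u. \<forall>k\<in>J. (\<Sum>i\<in>J. A k i*u i) = g k"
  and u: "\<forall>k\<in>J. (\<Sum>i\<in>J. A k i*u i) = 0"
 shows "\<forall>i\<in>J. u i = 0"
proof -
 have sw: "(\<Sum>k\<in>J. w k*(\<Sum>i\<in>J. A k i * v i)) = (\<Sum>i\<in>J. v i*(\<Sum>k\<in>J. A k i*w k))" for v w
  by (simp add: sum_distrib_left mult_ac) (rule sum.swap)
 have z: "\<forall>i\<in>J. v i = 0" if "(\<Sum>i\<in>J. v i * v i) = 0" for v :: "'i => real"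
  using that fin by (simp add: sum_nonneg_eq_0_iff)
 have "\<exists>w. \<forall>i\<in>J. (\<Sum>k\<in>J. A k i*w k) = u i"
 proof (rule finite_system_solvable[OF fin fin refl])
  fix w assume w: "\<forall>i\<in>J. (\<Sum>k\<in>J. A k i*w k) = 0"
  obtain v where v: "\<forall>k\<in>J. (\<Sum>i\<in>J. A k i * v i) = w k" using surj by blast
  have "(\<Sum>k\<in>J. w k*w k) = (\<Sum>k\<in>J. w k*(\<Sum>i\<in>J. A k i * v i))" using v by (intro sum.cong) auto
  also have "... = 0" unfolding sw using w by (intro sum.neutral) auto
  finally show "\<forall>k\<in>J. w k = 0" by (rule z)
 qed
 then obtain w where w: "\<forall>i\<in>J. (\<Sum>k\<in>J. A k i*w k) = u i" by blast
 have "(\<Sum>i\<in>J. u i*u i) = (\<Sum>i\<in>J. u i*(\<Sum>k\<in>J. A k i*w k))" using w by (intro sum.cong) auto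
 also have "... = 0" unfolding sw[symmetric] using u by (intro sum.neutral) auto
 finally show ?thesis by (rule z)
qed

locale scheme = pde a b c d \<alpha> \<gamma> \<beta> + mesh2 a b M X c d N Y n H h
 for a b c d \<alpha> \<gamma> \<beta> M X N Y n H h
begin

abbreviation Lh :: "((nat \<times> nat) \<times> (nat \<times> nat) => real) => fun2" where
 "Lh cf \<equiv> LL (Gy c d (on2.comb cf)) (Gx a b (on2.comb cf))"

lemma comb_sq: "Gy c d (on2.comb cf) \<in> sqint R" "Gx a b (on2.comb cf) \<in> sqint R"
 by (intro Gy_sq Gx_sq on2.comb_sqint)+

lemma comb_eq: "AE s in R. Gx a b (Gy c d (on2.comb cf)) s = Gy c d (Gx a b (on2.comb cf)) s"
 by (simp add: commute[OF kernels(1,3)])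

text \<open>In the energy (L e, e) the second factor is split into P e and e - P e. The first part
  sees only the projection of L e, and the second is of order $H^2$, so second derivatives enter
  only with the factor $H^2$.\<close>

lemma energy_le:
 assumes p: "p \<in> sqint R" and q: "q \<in> sqint R" and eq: "AE s in R. Gx a b p s = Gy c d q s"
 shows "\<alpha>/2*(nrm R (Gx' a b p) + nrm R (Gy' c d q))^2
  <= nrm R (PP (LL p q))*nrm R (Gx a b p) + CL*H^2*(nrm R p + nrm R q)\<^sup>2"
proof -
 let ?e = "Gx a b p" and ?x = "nrm R (Gx' a b p)" and ?y = "nrm R (Gy' c d q)" and ?T = "nrm R p + nrm R q"
 note e = Gx_sq[OF p] and L = LL_sqint[OF p q]
 have r: "(%s. ?e s - PP ?e s) \<in> sqint R" by (rule sqint_diff[OF e PP_sq])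
 have "0 <= (?x - ?y)\<^sup>2" by simp
 then have "(?x + ?y)\<^sup>2 <= 2*(?x^2 + ?y^2)" by (simp add: power2_sum power2_diff)
 then have "\<alpha>/2*(?x + ?y)\<^sup>2 <= \<alpha>*(?x^2 + ?y^2)"
  using \<alpha> mult_left_mono[of "(?x + ?y)\<^sup>2" "2*(?x^2 + ?y^2)" "\<alpha>/2"] by simp
 also have "... <= ip R (LL p q) ?e" using energy[OF p q eq] \<gamma> by simp
 also have "... = ip R (PP (LL p q)) ?e + ip R (LL p q) (%s. ?e s - PP ?e s)"
  using on2.ip_proj_commute[OF L e] by (simp add: ip_diff_right[OF e PP_sq L])
 also have "... <= nrm R (PP (LL p q))*nrm R ?e + nrm R (LL p q)*nrm R (%s. ?e s - PP ?e s)"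
  by (intro add_mono ip_le_nrm PP_sq e L r)
 also have "nrm R (LL p q)*nrm R (%s. ?e s - PP ?e s) <= (CL * ?T)*(H^2 * ?T)"
  using CL_pos by (intro mult_mono nrm_LL[OF p q] PP_residual[OF p q eq]) auto
 finally show ?thesis by (simp add: power2_eq_square mult_ac)
qed

text \<open>For a Galerkin error the projected residual vanishes, and half the quadratic remainder
  of \<open>energy_le\<close> is the square of H times second derivatives.\<close>

lemma galerkin_h1:
 assumes p: "p \<in> sqint R" and q: "q \<in> sqint R" and eq: "AE s in R. Gx a b p s = Gy c d q s"
  and orth: "PP (LL p q) = (%_. 0)"
 shows "nrm R (Gx' a b p) + nrm R (Gy' c d q) <= sqrt (2*CL/\<alpha>)*H*(nrm R p + nrm R q)"
proof (rule power2_le_imp_le)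
 let ?E = "nrm R (Gx' a b p) + nrm R (Gy' c d q)" and ?T = "nrm R p + nrm R q"
 have "\<alpha>/2 * ?E^2 <= CL*H^2 * ?T^2" using energy_le[OF p q eq] orth by simp
 then have "?E^2 <= 2*CL/\<alpha>*(H^2 * ?T^2)" using \<alpha> by (simp add: field_simps)
 then show "?E^2 <= (sqrt (2*CL/\<alpha>)*H * ?T)\<^sup>2"
  using \<alpha> CL_pos by (simp add: power_mult_distrib mult.assoc)
qed (use H_pos CL_pos \<alpha> in auto)

text \<open>The projected Laplacian equals the lower order terms minus the projected operator, up to
  \<alpha>. The lower order terms are bounded by first derivatives, which the energy inequality
  bounds by the residual plus H times the second derivatives; for small H the latter are
  absorbed.\<close>

lemma fine_stable:
 assumes Cs: "stab_const <= Cs"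
  and B: "B = \<bar>fst \<beta>\<bar> + \<bar>snd \<beta>\<bar> + \<gamma>*(b-a)"
  and small: "3*Cs/\<alpha>*B * sqrt (2*CL/\<alpha>)*H <= 1/2"
 shows "size2 cf <= 6*Cs/\<alpha>*(1 + B*(2*(b-a)/\<alpha>))*nrm R (PP (Lh cf))"
proof -
 let ?p = "Gy c d (on2.comb cf)" and ?q = "Gx a b (on2.comb cf)"
 let ?e = "Gx a b ?p" and ?R = "nrm R (PP (Lh cf))" and ?S = "size2 cf"
 let ?x = "nrm R (Gx' a b ?p)" and ?y = "nrm R (Gy' c d ?q)"
 note p = comb_sq(1)[of cf] and q = comb_sq(2)[of cf]
 note e = Gx_sq[OF p] and x = Gx'_sq[OF p] and y = Gy'_sq[OF q]
 define K where "K = sqrt (2*CL/\<alpha>)"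
 have K: "0 <= K" "K^2 = 2*CL/\<alpha>" unfolding K_def using CL_pos \<alpha> by auto
 have B0: "0 <= B" unfolding B using \<gamma> ab by simp
 have Cs1: "1 <= Cs" using Cs stab_const_ge by simp
 have T: "nrm R ?p + nrm R ?q <= ?S" by (simp add: size2_def)
 have S0: "0 <= ?S" by (simp add: size2_def)
 have ne: "nrm R ?e <= (b-a) * ?x" by (rule poincare_x[OF p])
 also have "... <= (b-a)*(?x + ?y)" using ab by (intro mult_left_mono) auto
 finally have ne': "nrm R ?e <= (b-a)*(?x + ?y)" .
 \<comment> \<open>The energy inequality is quadratic in the first derivatives;
   \<open>quadratic_bound\<close> solves it and turns the term of order $H^2$ into one linear in
   H.\<close>
 have E: "?x + ?y <= 2*(b-a)/\<alpha> * ?R + K*H * ?S"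
 proof (rule quadratic_bound)
  have "\<alpha>/2*(?x + ?y)\<^sup>2 <= ?R*nrm R ?e + CL*H^2*(nrm R ?p + nrm R ?q)\<^sup>2"
   by (rule energy_le[OF p q comb_eq])
  also have "?R*nrm R ?e <= ?R*((b-a)*(?x + ?y))" by (rule mult_left_mono[OF ne']) simp
  also have "CL*H^2*(nrm R ?p + nrm R ?q)\<^sup>2 <= CL*H^2 * ?S^2"
   using CL_pos T by (intro mult_left_mono power_mono) auto
  finally have "(?x + ?y)\<^sup>2 <= 2/\<alpha>*(?R*((b-a)*(?x + ?y)) + CL*H^2 * ?S^2)"
   using \<alpha> by (simp add: field_simps)
  then show "(?x + ?y)\<^sup>2 <= 2*(b-a)/\<alpha> * ?R*(?x + ?y) + (K*H * ?S)\<^sup>2"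
   unfolding power_mult_distrib K(2) using \<alpha> by (simp add: field_simps)
  show "0 <= 2*(b-a)/\<alpha> * ?R" using ab \<alpha> by simp
  show "0 <= K*H * ?S" using K H_pos S0 by simp
 qed
 have N: "\<alpha>*nrm R (PP (%s. ?p s + ?q s)) <= ?R + B*(?x + ?y)"
 proof -
  have LLeq: "Lh cf = (%s. (- \<alpha>)*(?p s + ?q s) + (fst \<beta>*Gx' a b ?p s + snd \<beta>*Gy' c d ?q s) + \<gamma> * ?e s)"
   by (simp add: Lop_def fun_eq_iff)
  have PL: "PP (Lh cf) = (%s. (- \<alpha>)*PP (%s. ?p s + ?q s) s + (fst \<beta>*PP (Gx' a b ?p) s + snd \<beta>*PP (Gy' c d ?q) s) + \<gamma>*PP ?e s)"
   unfolding LLeq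
   by (simp only: on2.proj_add on2.proj_cmult p q e x y sqint_add sqint_cmult)
  have "\<alpha>*nrm R (PP (%s. ?p s + ?q s)) = nrm R (%s. \<alpha>*PP (%s. ?p s + ?q s) s)"
   using \<alpha> by (simp add: nrm_cmult)
  also have "(%s. \<alpha>*PP (%s. ?p s + ?q s) s) = (%s. ((fst \<beta>*PP (Gx' a b ?p) s + snd \<beta>*PP (Gy' c d ?q) s) + \<gamma>*PP ?e s) - PP (Lh cf) s)"
   unfolding PL by simp
  also have "nrm R ... <= nrm R (%s. (fst \<beta>*PP (Gx' a b ?p) s + snd \<beta>*PP (Gy' c d ?q) s) + \<gamma>*PP ?e s) + ?R"
   by (rule nrm_diff_triangle) (intro sqint_add sqint_cmult PP_sq)+
  also have "nrm R (%s. (fst \<beta>*PP (Gx' a b ?p) s + snd \<beta>*PP (Gy' c d ?q) s) + \<gamma>*PP ?e s)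
    <= nrm R (%s. fst \<beta>*PP (Gx' a b ?p) s + snd \<beta>*PP (Gy' c d ?q) s) + nrm R (%s. \<gamma>*PP ?e s)"
   by (rule nrm_triangle) (intro sqint_add sqint_cmult PP_sq)+
  also have "nrm R (%s. fst \<beta>*PP (Gx' a b ?p) s + snd \<beta>*PP (Gy' c d ?q) s)
    <= nrm R (%s. fst \<beta>*PP (Gx' a b ?p) s) + nrm R (%s. snd \<beta>*PP (Gy' c d ?q) s)"
   by (rule nrm_triangle) (intro sqint_cmult PP_sq)+
  finally have 1: "\<alpha>*nrm R (PP (%s. ?p s + ?q s)) <= \<bar>fst \<beta>\<bar>*nrm R (PP (Gx' a b ?p)) + \<bar>snd \<beta>\<bar>*nrm R (PP (Gy' c d ?q)) + \<gamma>*nrm R (PP ?e) + ?R"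
   unfolding nrm_cmult using \<gamma> by simp
  have "\<bar>fst \<beta>\<bar>*nrm R (PP (Gx' a b ?p)) <= \<bar>fst \<beta>\<bar>*(?x + ?y)"
   using on2.nrm_proj_le[OF x] nrm_nonneg[of R "Gy' c d ?q"] by (intro mult_left_mono) linarith+
  moreover have "\<bar>snd \<beta>\<bar>*nrm R (PP (Gy' c d ?q)) <= \<bar>snd \<beta>\<bar>*(?x + ?y)"
   using on2.nrm_proj_le[OF y] nrm_nonneg[of R "Gx' a b ?p"] by (intro mult_left_mono) linarith+
  moreover have "\<gamma>*nrm R (PP ?e) <= \<gamma>*((b-a)*(?x + ?y))"
   using \<gamma> by (intro mult_left_mono order_trans[OF on2.nrm_proj_le[OF e] ne']) auto
  ultimately show ?thesis using 1 unfolding B by (simp add: algebra_simps)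
 qed
 have "?S <= 3 * stab_const*nrm R (PP (%s. ?p s + ?q s))" by (rule laplace_stable)
 also have "... <= 3*Cs*nrm R (PP (%s. ?p s + ?q s))" using Cs by (intro mult_right_mono) auto
 also have "... = 3*Cs/\<alpha>*(\<alpha>*nrm R (PP (%s. ?p s + ?q s)))" using \<alpha> by simp
 also have "... <= 3*Cs/\<alpha>*(?R + B*(2*(b-a)/\<alpha> * ?R + K*H * ?S))"
  by (intro mult_left_mono order_trans[OF N] add_left_mono E B0) (use Cs1 \<alpha> in auto)
 also have "... = 3*Cs/\<alpha>*(1 + B*(2*(b-a)/\<alpha>)) * ?R + (3*Cs/\<alpha>*B*K*H) * ?S"
  by (simp add: algebra_simps)
 \<comment> \<open>Exactly here the smallness of H is used; half of \<open>?S\<close> can be moved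
   to the left-hand side.\<close>
 also have "(3*Cs/\<alpha>*B*K*H) * ?S <= 1/2 * ?S"
  using small S0 unfolding K_def by (intro mult_right_mono) auto
 finally have "?S <= 3*Cs/\<alpha>*(1 + B*(2*(b-a)/\<alpha>)) * ?R + 1/2 * ?S" by simp
 moreover have "6*Cs/\<alpha>*(1 + B*(2*(b-a)/\<alpha>)) * ?R = 2*(3*Cs/\<alpha>*(1 + B*(2*(b-a)/\<alpha>)) * ?R)"
  by simp
 ultimately show ?thesis by linarith
qed

lemma PP_zero_iff: "PP f = (%_. 0) \<longleftrightarrow> (\<forall>k\<in>J2. ip R f (e2 k) = 0)"
proof
 assume 0: "PP f = (%_. 0)"
 show "\<forall>k\<in>J2. ip R f (e2 k) = 0"
 proof
  fix k assume "k \<in> J2"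
  then have "ip R (PP f) (e2 k) = ip R f (e2 k)" unfolding on2.proj_def by (rule on2.ip_comb_e)
  then show "ip R f (e2 k) = 0" unfolding 0 by simp
 qed
qed (simp add: on2.proj_def on2.comb_def)

lemma Lh_add: "AE s in R. Lh (%i. u i + v i) s = Lh u s + Lh v s"
proof -
 let ?w = "%i. u i + v i"
 have comb: "(%s. on2.comb ?w s - on2.comb v s) = on2.comb u"
  by (simp add: on2.comb_def distrib_right sum.distrib fun_eq_iff)
 have p: "AE s in R. Gy c d (on2.comb u) s = Gy c d (on2.comb ?w) s - Gy c d (on2.comb v) s"
  using Ly_diff[OF kernels(3) on2.comb_sqint on2.comb_sqint, of ?w v] by (simp add: comb)
 have q: "AE s in R. Gx a b (on2.comb u) s = Gx a b (on2.comb ?w) s - Gx a b (on2.comb v) s"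
  using Lx_diff[OF kernels(1) on2.comb_sqint on2.comb_sqint, of ?w v] by (simp add: comb)
 note sq = comb_sq[of u] comb_sq[of v] comb_sq[of ?w]
 have "AE s in R. Lh u s = LL (%s. Gy c d (on2.comb ?w) s - Gy c d (on2.comb v) s) (%s. Gx a b (on2.comb ?w) s - Gx a b (on2.comb v) s) s"
  using p q Lx_cong_sq[OF p kernels(2) sq(1) sqint_diff[OF sq(5,3)]]
   Ly_cong_sq[OF q kernels(4) sq(2) sqint_diff[OF sq(6,4)]] Lx_cong_sq[OF p kernels(1) sq(1) sqint_diff[OF sq(5,3)]]
  by eventually_elim (simp add: Lop_def)
 with LL_diff[OF sq(5,6) sq(3,4)] show ?thesis by eventually_elim simp
qed

lemma Lh_cmult: "Lh (%i. r*u i) = (%s. r*Lh u s)"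
proof -
 have "on2.comb (%i. r*u i) = (%s. r * on2.comb u s)"
  by (simp add: on2.comb_def sum_distrib_left mult.assoc fun_eq_iff)
 then show ?thesis by (simp add: Lop_def Lx_cmult Ly_cmult algebra_simps)
qed

lemma Lh_sq: "Lh u \<in> sqint R"
 by (rule LL_sqint[OF comb_sq])

definition stiff where "stiff k i = ip R (Lh (%j. if j = i then 1 else 0)) (e2 k)"

lemma Lh_matrix: "k \<in> J2 ==> (\<Sum>i\<in>J2. stiff k i*u i) = ip R (Lh u) (e2 k)"
 unfolding stiff_def
proof (rule linear_matrix[symmetric, where F="%u k. ip R (Lh u) (e2 k)", OF on2.finite_J])
 fix u v :: "(nat \<times> nat) \<times> (nat \<times> nat) => real"
 show "ip R (Lh (%i. u i + v i)) (e2 k) = ip R (Lh u) (e2 k) + ip R (Lh v) (e2 k)"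
  unfolding ip_add_left[OF Lh_sq Lh_sq e2_sqint, symmetric]
  by (rule ip_cong_sq) (intro Lh_add AE_I2 refl Lh_sq sqint_add e2_sqint)+
 show "ip R (Lh u) (e2 k) = ip R (Lh v) (e2 k)" if "\<forall>i\<in>J2. u i = v i"
 proof -
  have "on2.comb u = on2.comb v" unfolding on2.comb_def using that by (auto intro!: sum.cong)
  then show ?thesis by simp
 qed
qed (simp_all add: Lh_cmult ip_cmult_left)

lemma nrm_comb_0: "nrm R (on2.comb u) = 0 \<longleftrightarrow> (\<forall>k\<in>J2. u k = 0)"
proof -
 have "nrm R (on2.comb u) = 0 \<longleftrightarrow> (\<Sum>k\<in>J2. (u k)\<^sup>2) = 0" unfolding on2.nrm_comb_square[symmetric] by simp
 then show ?thesis by (simp add: sum_nonneg_eq_0_iff on2.finite_J)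
qed

lemma discrete_solvable:
 assumes stab: "!!cf. size2 cf <= C*nrm R (PP (Lh cf))"
 shows "\<exists>cf. PP (Lh cf) = PP f"
proof -
 have "\<exists>u. \<forall>k\<in>J2. (\<Sum>i\<in>J2. stiff k i*u i) = ip R f (e2 k)"
 proof (rule finite_system_solvable[OF on2.finite_J on2.finite_J refl])
  fix u assume "\<forall>k\<in>J2. (\<Sum>i\<in>J2. stiff k i*u i) = 0"
  then have "PP (Lh u) = (%_. 0)" unfolding PP_zero_iff by (simp add: Lh_matrix)
  then have "size2 u <= 0" using stab[of u] by simp
  then have "nrm R (on2.comb u) = 0"
   using nrm_comb_le_size2[of u] mult_left_mono[of "size2 u" 0 "(inv_const (Suc n)/h)\<^sup>2"]
    order_antisym[OF _ nrm_nonneg[of R "on2.comb u"]] by simp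
  then show "\<forall>i\<in>J2. u i = 0" by (simp add: nrm_comb_0)
 qed
 then obtain u where "\<forall>k\<in>J2. ip R (Lh u) (e2 k) = ip R f (e2 k)" by (auto simp: Lh_matrix)
 then show ?thesis unfolding on2.proj_def on2.comb_def by (intro exI[of _ u] ext sum.cong) auto
qed

lemma galerkin_l2:
 assumes p: "p \<in> sqint R" and q: "q \<in> sqint R" and eq: "AE s in R. Gx a b p s = Gy c d q s"
  and orth: "PP (LL p q) = (%_. 0)"
  and dual: "PP (Lop a b c d \<alpha> (- \<beta>) \<gamma> (Gy c d (on2.comb cf)) (Gx a b (on2.comb cf))) = PP (Gx a b p)"
  and stab: "size2 cf <= C*nrm R (PP (Lop a b c d \<alpha> (- \<beta>) \<gamma> (Gy c d (on2.comb cf)) (Gx a b (on2.comb cf))))"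
  and C: "0 <= C"
 shows "nrm R (Gx a b p) <= (2*CL*C + 1)*H^2*(nrm R p + nrm R q)"
proof -
 let ?e = "Gx a b p" and ?T = "nrm R p + nrm R q"
 let ?p = "Gy c d (on2.comb cf)" and ?q = "Gx a b (on2.comb cf)"
 let ?L = "Lop a b c d \<alpha> (- \<beta>) \<gamma> ?p ?q" and ?\<phi> = "Gx a b ?p"
 interpret dual: pde a b c d \<alpha> \<gamma> "- \<beta>" by unfold_locales (use pde_axioms pde_def in auto)
 note p' = comb_sq(1)[of cf] and q' = comb_sq(2)[of cf]
 note e = Gx_sq[OF p] and \<phi> = Gx_sq[OF p'] and LLs = LL_sqint[OF p q] and Ls = dual.LL_sqint[OF p' q']
 have CLeq: "dual.CL = CL" by (simp add: Lbound_def)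
 let ?w = "%s. ?e s - PP ?e s" and ?v = "%s. ?\<phi> s - PP ?\<phi> s"
 have w: "?w \<in> sqint R" and v: "?v \<in> sqint R" by (intro sqint_diff e \<phi> PP_sq)+
 have nw: "nrm R ?w <= H^2 * ?T" by (rule PP_residual[OF p q eq])
 have T0: "0 <= ?T" by simp
 have "nrm R ?p + nrm R ?q <= size2 cf" by (simp add: size2_def)
 also have "size2 cf <= C*nrm R (PP ?e)" using stab unfolding dual .
 also have "... <= C*nrm R ?e" by (rule mult_left_mono[OF on2.nrm_proj_le[OF e] C])
 finally have S: "nrm R ?p + nrm R ?q <= C*nrm R ?e" .
 have nv: "nrm R ?v <= H^2*(C*nrm R ?e)"
  by (rule order_trans[OF PP_residual[OF p' q' comb_eq]]) (use S in "auto intro: mult_left_mono")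
 have nL: "nrm R ?L <= CL*(C*nrm R ?e)"
  by (rule order_trans[OF dual.nrm_LL[OF p' q', unfolded CLeq] mult_left_mono[OF S]]) (use CL_pos in simp)
 have "ip R ?\<phi> (LL p q) = ip R (PP ?\<phi>) (LL p q) + ip R ?v (LL p q)"
  by (simp add: ip_diff_left[OF \<phi> PP_sq LLs])
 moreover have "ip R ?L ?e = ip R ?\<phi> (LL p q)" by (rule adjoint[OF p q eq p' q' comb_eq])
 moreover have "ip R (PP ?\<phi>) (LL p q) = 0"
  using on2.ip_proj_commute[OF \<phi> LLs] orth by (simp add: ip_def)
 moreover have "ip R ?v (LL p q) <= (H^2*(C*nrm R ?e))*(CL * ?T)"
  by (rule order_trans[OF ip_le_nrm[OF v LLs] mult_mono[OF nv nrm_LL[OF p q]]]) (simp_all add: C)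
 ultimately have 1: "ip R ?L ?e <= H^2*(C*nrm R ?e)*(CL * ?T)" by linarith
 have "\<bar>ip R ?L ?w\<bar> <= nrm R ?L*nrm R ?w" by (rule ip_Cauchy_Schwarz[OF Ls w])
 also have "... <= (CL*(C*nrm R ?e))*(H^2 * ?T)"
  by (rule mult_mono[OF nL nw]) (simp_all add: C less_imp_le[OF CL_pos])
 finally have 2: "- ip R ?L ?w <= (CL*(C*nrm R ?e))*(H\<^sup>2 * ?T)" by linarith
 have "ip R (PP ?e) ?e = ip R (PP ?L) ?e" unfolding dual ..
 also have "... = ip R ?L ?e - ip R ?L ?w"
  using on2.ip_proj_commute[OF Ls e] by (simp add: ip_diff_right[OF e PP_sq Ls])
 also have "... <= 2*CL*C*H^2 * ?T*nrm R ?e" using 1 2 by (simp add: algebra_simps)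
 finally have 3: "ip R (PP ?e) ?e <= 2*CL*C*H^2 * ?T*nrm R ?e" .
 have "ip R ?w ?e <= nrm R ?w*nrm R ?e" by (rule ip_le_nrm[OF w e])
 also have "... <= H^2 * ?T*nrm R ?e" by (rule mult_right_mono[OF nw]) simp
 finally have 4: "ip R ?w ?e <= H^2 * ?T*nrm R ?e" .
 have "nrm R ?e*nrm R ?e = ip R (PP ?e) ?e + ip R ?w ?e"
  using nrm_square[of R ?e] by (simp add: ip_diff_left[OF e PP_sq e] power2_eq_square)
 also have "... <= ((2*CL*C + 1)*H^2 * ?T)*nrm R ?e" using 3 4 by (simp add: algebra_simps)
 finally have "nrm R ?e*nrm R ?e <= ((2*CL*C + 1)*H^2 * ?T)*nrm R ?e" .
 show ?thesis
 proof (cases "nrm R ?e = 0")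
  case True
  then show ?thesis using C CL_pos T0 by simp
 next
  case False
  then have "0 < nrm R ?e" using nrm_nonneg[of R ?e] by linarith
  with \<open>nrm R ?e * nrm R ?e \<le> _\<close> show ?thesis by (rule mult_right_le_imp_le)
 qed
qed

text \<open>Quasi-optimality. The difference of the discrete solution and an arbitrary trial
  function \<xi> solves the discrete problem with the error of \<xi> as data, so stability bounds it
  by D. The second claim also yields the mixed derivative of this difference.\<close>

lemma error_stable:
 assumes stab: "!!cf. size2 cf <= C*nrm R (PP (Lh cf))" and C: "0 <= C"
  and p: "p \<in> sqint R" and q: "q \<in> sqint R"
  and gal: "PP (LL p q) = PP (Lh cf)"
  and D: "nrm R (%s. p s - Gy c d (on2.comb \<xi>) s) + nrm R (%s. q s - Gx a b (on2.comb \<xi>) s) <= D"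
 shows "nrm R (%s. p s - Gy c d (on2.comb cf) s) + nrm R (%s. q s - Gx a b (on2.comb cf) s) <= (1 + C*CL)*D"
  and "size2 (%i. cf i - \<xi> i) <= C*CL*D"
proof -
 let ?\<omega> = "%i. cf i - \<xi> i"
 let ?P = "%s. p s - Gy c d (on2.comb \<xi>) s" and ?Q = "%s. q s - Gx a b (on2.comb \<xi>) s"
 have P: "?P \<in> sqint R" and Q: "?Q \<in> sqint R" by (intro sqint_diff p q comb_sq)+
 have "PP (LL ?P ?Q) = PP (%s. LL p q s - Lh \<xi> s)"
  by (rule on2.proj_cong_AE[OF LL_diff[OF p q comb_sq]])
    (intro sqint_measurable LL_sqint P Q sqint_diff p q Lh_sq)+
 also have "... = (%s. PP (Lh cf) s - PP (Lh \<xi>) s)"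
  by (simp add: on2.proj_diff[OF LL_sqint[OF p q] Lh_sq] gal)
 also have "... = PP (%s. Lh cf s - Lh \<xi> s)" by (simp add: on2.proj_diff[OF Lh_sq Lh_sq])
 also have "... = PP (Lh ?\<omega>)"
 proof (rule on2.proj_cong_AE)
  show "AE s in R. Lh cf s - Lh \<xi> s = Lh ?\<omega> s" using Lh_add[of ?\<omega> \<xi>] by eventually_elim simp
 qed (intro sqint_measurable sqint_diff Lh_sq)+
 finally have eq: "PP (LL ?P ?Q) = PP (Lh ?\<omega>)" .
 have "size2 ?\<omega> <= C*nrm R (PP (LL ?P ?Q))" using stab[of ?\<omega>] unfolding eq .
 also have "... <= C*(CL*D)"
  using CL_pos by (intro mult_left_mono[OF _ C] order_trans[OF on2.nrm_proj_le[OF LL_sqint[OF P Q]]]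
   order_trans[OF nrm_LL[OF P Q]] mult_left_mono D) auto
 finally show S: "size2 ?\<omega> <= C*CL*D" by simp
 have comb: "(%s. on2.comb cf s - on2.comb \<xi> s) = on2.comb ?\<omega>"
  by (simp add: on2.comb_def left_diff_distrib sum_subtractf fun_eq_iff)
 have 1: "nrm R (%s. p s - Gy c d (on2.comb cf) s) <= nrm R ?P + nrm R (Gy c d (on2.comb ?\<omega>))"
 proof -
  have "nrm R (%s. p s - Gy c d (on2.comb cf) s) = nrm R (%s. ?P s - Gy c d (on2.comb ?\<omega>) s)"
  proof (rule nrm_cong_sq)
   show "AE s in R. p s - Gy c d (on2.comb cf) s = ?P s - Gy c d (on2.comb ?\<omega>) s"
    using Ly_diff[OF kernels(3) on2.comb_sqint on2.comb_sqint, of cf \<xi>] unfolding comb by eventually_elim simp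
  qed (intro sqint_diff p comb_sq)+
  also have "... <= nrm R ?P + nrm R (Gy c d (on2.comb ?\<omega>))" by (rule nrm_diff_triangle[OF P comb_sq(1)])
  finally show ?thesis .
 qed
 have 2: "nrm R (%s. q s - Gx a b (on2.comb cf) s) <= nrm R ?Q + nrm R (Gx a b (on2.comb ?\<omega>))"
 proof -
  have "nrm R (%s. q s - Gx a b (on2.comb cf) s) = nrm R (%s. ?Q s - Gx a b (on2.comb ?\<omega>) s)"
  proof (rule nrm_cong_sq)
   show "AE s in R. q s - Gx a b (on2.comb cf) s = ?Q s - Gx a b (on2.comb ?\<omega>) s"
    using Lx_diff[OF kernels(1) on2.comb_sqint on2.comb_sqint, of cf \<xi>] unfolding comb by eventually_elim simp
  qed (intro sqint_diff q comb_sq)+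
  also have "... <= nrm R ?Q + nrm R (Gx a b (on2.comb ?\<omega>))" by (rule nrm_diff_triangle[OF Q comb_sq(2)])
  finally show ?thesis .
 qed
 have "nrm R (Gy c d (on2.comb ?\<omega>)) + nrm R (Gx a b (on2.comb ?\<omega>)) <= size2 ?\<omega>" by (simp add: size2_def)
 with 1 2 S D show "nrm R (%s. p s - Gy c d (on2.comb cf) s) + nrm R (%s. q s - Gx a b (on2.comb cf) s) <= (1 + C*CL)*D"
  by (simp add: distrib_right)
qed

end


section \<open>Integrals of the projection error of a fourth derivative\<close>

context mesh2
begin

text \<open>Two splittings of the same error. The choice decides which variable is projected first,
  so that the smoothness of u in the other variable is not lost.\<close>

lemma split_residual:
 assumes g: "g \<in> sqint R"
 shows "AE s in R. g s - PP g s = (g s - Px g s) + Px (%s. g s - Py g s) s"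
  and "AE s in R. g s - PP g s = (g s - Py g s) + Py (%s. g s - Px g s) s"
proof -
 show "AE s in R. g s - PP g s = (g s - Px g s) + Px (%s. g s - Py g s) s"
  using Lx_diff[OF kernels(5) g Py_sqint[OF g]] unfolding proj2_eq[OF g] by eventually_elim simp
 show "AE s in R. g s - PP g s = (g s - Py g s) + Py (%s. g s - Px g s) s"
  using Ly_diff[OF kernels(6) g Px_sqint[OF g]] unfolding proj2_eq[OF g] commute[OF kernels(5,6) g]
  by eventually_elim simp
qed

lemma Lx_add:
 assumes "bkern K" "f \<in> sqint R" "g \<in> sqint R"
 shows "AE s in R. Lx (mu a b) K (%s. f s + g s) s = Lx (mu a b) K f s + Lx (mu a b) K g s"
 using Lx_diff[OF assms(1) sqint_add[OF assms(2,3)] assms(3)] by eventually_elim simp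

lemma Ly_add:
 assumes "bkern K" "f \<in> sqint R" "g \<in> sqint R"
 shows "AE s in R. Ly (mu c d) K (%s. f s + g s) s = Ly (mu c d) K f s + Ly (mu c d) K g s"
 using Ly_diff[OF assms(1) sqint_add[OF assms(2,3)] assms(3)] by eventually_elim simp

lemma residual_sq: "g \<in> sqint R ==> (%s. g s - Px g s) \<in> sqint R" "g \<in> sqint R ==> (%s. g s - Py g s) \<in> sqint R"
  "g \<in> sqint R ==> (%s. g s - PP g s) \<in> sqint R"
 by (auto intro!: sqint_diff Px_sqint Py_sqint)

text \<open>With g = $u_{xxyy}$ the first term is the x-error of $u_{xx}$ itself. In the second the
  y-error of g is integrated in y, which gains a power of H to make up for the higher
  derivative.\<close>

lemma approx_yy:
 assumes g: "g \<in> sqint R"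
 shows "nrm R (Gy c d (%s. g s - PP g s)) <= nrm R (%s. Gy c d g s - Px (Gy c d g) s) + (d-c)*H*nrm R (%s. g s - Py g s)"
proof -
 let ?r = "%s. g s - Px g s" and ?t = "%s. g s - Py g s"
 note r = residual_sq(1)[OF g] and t = residual_sq(2)[OF g]
 note Pt = Px_sqint[OF t]
 have "nrm R (Gy c d (%s. g s - PP g s)) = nrm R (%s. (Gy c d g s - Px (Gy c d g) s) + Px (Gy c d ?t) s)"
 proof (rule nrm_cong_sq)
  show "AE s in R. Gy c d (%s. g s - PP g s) s = (Gy c d g s - Px (Gy c d g) s) + Px (Gy c d ?t) s"
   using Ly_cong_sq[OF split_residual(1)[OF g] kernels(3) residual_sq(3)[OF g] sqint_add[OF r Pt]]
    Ly_add[OF kernels(3) r Pt] Ly_diff[OF kernels(3) g Px_sqint[OF g]]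
   unfolding commute[OF kernels(5,3) t] commute[OF kernels(5,3) g]
   by eventually_elim simp
 qed (rule Gy_sq residual_sq(3) sqint_add residual_sq(1) Px_sqint g t)+
 also have "... <= nrm R (%s. Gy c d g s - Px (Gy c d g) s) + nrm R (Px (Gy c d ?t))"
  by (rule nrm_triangle[OF residual_sq(1)[OF Gy_sq[OF g]] Px_sqint[OF Gy_sq[OF t]]])
 finally show ?thesis
  using mx.nrm_Px_le[OF Gy_sq[OF t]] nrm_Gy_residual[OF g] by linarith
qed

lemma approx_xx:
 assumes g: "g \<in> sqint R"
 shows "nrm R (Gx a b (%s. g s - PP g s)) <= nrm R (%s. Gx a b g s - Py (Gx a b g) s) + (b-a)*H*nrm R (%s. g s - Px g s)"
proof -
 let ?r = "%s. g s - Px g s" and ?t = "%s. g s - Py g s"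
 note r = residual_sq(1)[OF g] and t = residual_sq(2)[OF g]
 note Pr = Py_sqint[OF r]
 have "nrm R (Gx a b (%s. g s - PP g s)) = nrm R (%s. (Gx a b g s - Py (Gx a b g) s) + Py (Gx a b ?r) s)"
 proof (rule nrm_cong_sq)
  show "AE s in R. Gx a b (%s. g s - PP g s) s = (Gx a b g s - Py (Gx a b g) s) + Py (Gx a b ?r) s"
   using Lx_cong_sq[OF split_residual(2)[OF g] kernels(1) residual_sq(3)[OF g] sqint_add[OF t Pr]]
    Lx_add[OF kernels(1) t Pr] Lx_diff[OF kernels(1) g Py_sqint[OF g]]
   unfolding commute[OF kernels(1,6) r] commute[OF kernels(1,6) g]
   by eventually_elim simp
 qed (rule Gx_sq residual_sq(3) sqint_add residual_sq(2) Py_sqint g r)+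
 also have "... <= nrm R (%s. Gx a b g s - Py (Gx a b g) s) + nrm R (Py (Gx a b ?r))"
  by (rule nrm_triangle[OF residual_sq(2)[OF Gx_sq[OF g]] Py_sqint[OF Gx_sq[OF r]]])
 finally show ?thesis
  using nrm_Py_le[OF Gx_sq[OF r]] nrm_Gx_residual[OF g] by linarith
qed

text \<open>Each one-variable error of g is integrated in its own variable and gains H there; the
  integration in the other variable costs only a length.\<close>

lemma approx_xy:
 assumes g: "g \<in> sqint R"
 shows "nrm R (Gx' a b (Gy' c d (%s. g s - PP g s)))
  <= (d-c)*H*nrm R (%s. g s - Px g s) + (b-a)*H*nrm R (%s. g s - Py g s)"
proof -
 let ?r = "%s. g s - Px g s" and ?t = "%s. g s - Py g s"
 note r = residual_sq(1)[OF g] and t = residual_sq(2)[OF g]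
 note Pt = Px_sqint[OF t]
 have "nrm R (Gx' a b (Gy' c d (%s. g s - PP g s))) = nrm R (%s. Gy' c d (Gx' a b ?r) s + Gx' a b (Px (Gy' c d ?t)) s)"
 proof (rule nrm_cong_sq)
  have 1: "AE s in R. Gy' c d (%s. g s - PP g s) s = Gy' c d ?r s + Gy' c d (Px ?t) s"
   using Ly_cong_sq[OF split_residual(1)[OF g] kernels(4) residual_sq(3)[OF g] sqint_add[OF r Pt]]
    Ly_add[OF kernels(4) r Pt] by eventually_elim simp
  show "AE s in R. Gx' a b (Gy' c d (%s. g s - PP g s)) s = Gy' c d (Gx' a b ?r) s + Gx' a b (Px (Gy' c d ?t)) s"
   using Lx_cong_sq[OF 1 kernels(2) Gy'_sq[OF residual_sq(3)[OF g]] sqint_add[OF Gy'_sq[OF r] Gy'_sq[OF Pt]]]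
    Lx_add[OF kernels(2) Gy'_sq[OF r] Gy'_sq[OF Pt]]
   unfolding commute[OF kernels(5,4) t] commute[OF kernels(2,4) r, symmetric]
   by eventually_elim simp
 qed (rule Gx'_sq Gy'_sq residual_sq(3) sqint_add Px_sqint g t r)+
 also have "... <= nrm R (Gy' c d (Gx' a b ?r)) + nrm R (Gx' a b (Px (Gy' c d ?t)))"
  by (rule nrm_triangle[OF Gy'_sq[OF Gx'_sq[OF r]] Gx'_sq[OF Px_sqint[OF Gy'_sq[OF t]]]])
 also have "nrm R (Gy' c d (Gx' a b ?r)) <= (d-c)*(H*nrm R ?r)"
  by (rule order_trans[OF nrm_Gy'[OF cd Gx'_sq[OF r]] mult_left_mono[OF nrm_Gx'_residual[OF g]]]) (use cd in simp)
 also have "nrm R (Gx' a b (Px (Gy' c d ?t))) <= (b-a)*(H*nrm R ?t)"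
  by (rule order_trans[OF nrm_Gx'[OF ab Px_sqint[OF Gy'_sq[OF t]]] mult_left_mono[OF order_trans[OF mx.nrm_Px_le[OF Gy'_sq[OF t]] nrm_Gy'_residual[OF g]]]])
    (use ab in simp)
 finally show ?thesis by (simp add: mult.assoc)
qed

end

section \<open>Smooth test functions\<close>

text \<open>The derivative is asserted to exist rather than named, so closure under sums and
  products is a plain induction; \<open>smooth1_deriv\<close> later identifies it with
  \<open>deriv\<close>.\<close>

primrec cd1 :: "nat => (real => real) => bool" where
 "cd1 0 f \<longleftrightarrow> continuous_on UNIV f"
| "cd1 (Suc n) f \<longleftrightarrow> (\<exists>f'. (\<forall>x. (f has_real_derivative f' x) (at x)) \<and> cd1 n f')"

definition smooth1 :: "(real => real) => bool" where
 "smooth1 f \<longleftrightarrow> (\<forall>n. cd1 n f)"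

lemma cd1_continuous: "cd1 n f ==> continuous_on UNIV f"
proof (cases n)
 case (Suc m)
 assume "cd1 n f"
 then obtain f' where "!!x. (f has_real_derivative f' x) (at x)" using Suc by auto
 then show ?thesis by (blast intro: continuous_at_imp_continuous_on DERIV_isCont)
qed simp

lemma cd1_SucD: "cd1 (Suc n) f ==> cd1 n f"
proof (induction n arbitrary: f)
 case 0
 then show ?case using cd1_continuous[of "Suc 0" f] by simp
next
 case (Suc n)
 then obtain f' where "!!x. (f has_real_derivative f' x) (at x)" "cd1 (Suc n) f'" by (auto simp del: cd1.simps(2) simp: cd1.simps(2)[of "Suc n"])
 with Suc.IH[of f'] show ?case by (auto simp: cd1.simps(2)[of n f])
qed

lemma cd1_add: "cd1 n f ==> cd1 n g ==> cd1 n (%x. f x + g x)"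
proof (induction n arbitrary: f g)
 case (Suc n)
 then obtain f' g' where "!!x. (f has_real_derivative f' x) (at x)" "cd1 n f'"
  "!!x. (g has_real_derivative g' x) (at x)" "cd1 n g'" by auto
 then show ?case using Suc.IH[of f' g'] by (auto intro!: exI[of _ "%x. f' x + g' x"] derivative_eq_intros)
qed (auto intro: continuous_intros)

lemma cd1_cmult: "cd1 n f ==> cd1 n (%x. r*f x)"
proof (induction n arbitrary: f)
 case (Suc n)
 then obtain f' where "!!x. (f has_real_derivative f' x) (at x)" "cd1 n f'" by auto
 then show ?case using Suc.IH[of f'] by (auto intro!: exI[of _ "%x. r*f' x"] derivative_eq_intros)
qed (auto intro: continuous_intros)

lemma cd1_mult: "cd1 n f ==> cd1 n g ==> cd1 n (%x. f x*g x)"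
proof (induction n arbitrary: f g)
 case (Suc n)
 then obtain f' g' where *: "!!x. (f has_real_derivative f' x) (at x)" "cd1 n f'"
  "!!x. (g has_real_derivative g' x) (at x)" "cd1 n g'" by auto
 have "cd1 n (%x. f' x*g x + f x*g' x)"
  by (rule cd1_add[OF Suc.IH[OF *(2) cd1_SucD[OF Suc.prems(2)]] Suc.IH[OF cd1_SucD[OF Suc.prems(1)] *(4)]])
 moreover have "((%x. f x*g x) has_real_derivative f' x*g x + f x*g' x) (at x)" for x
  by (rule DERIV_cong[OF DERIV_mult[OF *(1) *(3)]]) (simp add: mult.commute)
 ultimately show ?case by (auto intro!: exI[of _ "%x. f' x*g x + f x*g' x"])
qed (auto intro: continuous_intros)

lemma cd1_affine: "cd1 n f ==> cd1 n (%x. f (r*x + s))"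
proof (induction n arbitrary: f)
 case 0
 then show ?case by (auto intro!: continuous_on_compose2[of UNIV f] continuous_intros)
next
 case (Suc n)
 then obtain f' where *: "!!x. (f has_real_derivative f' x) (at x)" "cd1 n f'" by auto
 have d: "((%x. f (r*x + s)) has_real_derivative r*f' (r*x + s)) (at x)" for x
 proof -
  have "((%x. r*x + s) has_real_derivative r) (at x)" by (auto intro!: derivative_eq_intros)
  from DERIV_chain2[OF *(1) this] show ?thesis by (simp add: mult.commute)
 qed
 have c: "cd1 n (%x. r*f' (r*x + s))" by (intro cd1_cmult Suc.IH *)
 show ?case unfolding cd1.simps(2) by (intro exI[of _ "%x. r*f' (r*x + s)"] conjI allI d c)
qed

lemma smooth1_mult: "smooth1 f ==> smooth1 g ==> smooth1 (%x. f x*g x)"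
 by (simp add: smooth1_def cd1_mult)

lemma smooth1_cmult: "smooth1 f ==> smooth1 (%x. r*f x)"
 by (simp add: smooth1_def cd1_cmult)

lemma smooth1_add: "smooth1 f ==> smooth1 g ==> smooth1 (%x. f x + g x)"
 by (simp add: smooth1_def cd1_add)

lemma smooth1_affine: "smooth1 f ==> smooth1 (%x. f (r*x + s))"
 by (simp add: smooth1_def cd1_affine)

lemma smooth1_continuous: "smooth1 f ==> continuous_on UNIV f"
 by (metis smooth1_def cd1.simps(1))

lemma smooth1_deriv:
 assumes "smooth1 f"
 shows "(f has_real_derivative deriv f x) (at x)" and "smooth1 (deriv f)"
proof -
 have *: "\<exists>f'. (\<forall>x. (f has_real_derivative f' x) (at x)) \<and> cd1 n f'" for n
  using assms cd1.simps(2) unfolding smooth1_def by blast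
 then show "(f has_real_derivative deriv f x) (at x)" 
 proof -
  obtain f' where "\<forall>x. (f has_real_derivative f' x) (at x)" using *[of 0] by blast
  then show ?thesis using DERIV_imp_deriv by metis
 qed
 have "cd1 n (deriv f)" for n
 proof -
  obtain f' where f': "\<forall>x. (f has_real_derivative f' x) (at x)" "cd1 n f'" using *[of n] by blast
  have "f' x = deriv f x" for x using f'(1) DERIV_imp_deriv[of f "f' x" x] by simp
  then have "f' = deriv f" by blast
  then show ?thesis using f' by simp
 qed
 then show "smooth1 (deriv f)" by (simp add: smooth1_def)
qed

lemma smooth1I_antideriv:
 assumes "!!x. (f has_real_derivative f' x) (at x)" "smooth1 f'"
 shows "smooth1 f"
 unfolding smooth1_def
proof
 fix n
 show "cd1 n f"
 proof (cases n)
  case 0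
  then show ?thesis using assms(1) by (auto intro!: continuous_at_imp_continuous_on DERIV_isCont)
 next
  case (Suc m)
  then show ?thesis using assms unfolding smooth1_def by auto
 qed
qed

text \<open>The derivatives of $e^{-1/x}$ are polynomials in $1/x$ times this function.\<close>

definition flat :: "real poly => real => real" where
 "flat p x = (if 0 < x then poly p (1/x)*exp (- (1/x)) else 0)"

lemma poly_exp_tendsto_0: "((%t. poly p t*exp (- t)) \<longlongrightarrow> (0::real)) at_top"
proof -
 have "((%t. \<Sum>i\<le>degree p. coeff p i*(t ^ i/exp t)) \<longlongrightarrow> (\<Sum>i\<le>degree p. coeff p i*0)) at_top"
  by (intro tendsto_intros tendsto_power_div_exp_0)
 then show ?thesis
  by (simp add: poly_altdef sum_distrib_right exp_minus divide_inverse mult.assoc)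
qed

text \<open>With t = 1/x the derivative replaces the polynomial p(t) by $t^2 (p - p')(t)$, so the
  family is closed under differentiation. The only delicate point is x = 0.\<close>

lemma flat_deriv: "(flat p has_real_derivative flat (monom 1 2*(p - pderiv p)) x) (at x)"
proof -
 consider "x < 0" | "x = 0" | "0 < x" by linarith
 then show ?thesis
 proof cases
  case 1
  have "((%_. 0) has_real_derivative 0) (at x)" by simp
  moreover have "\<forall>\<^sub>F y in nhds x. flat p y = 0"
   using eventually_nhds_in_open[of "{..<0}" x] 1 by (auto simp: flat_def elim!: eventually_mono)
  ultimately have "(flat p has_real_derivative 0) (at x)"
   by (subst DERIV_cong_ev[OF refl _ refl])
  then show ?thesis using 1 by (simp add: flat_def)
 next
  case 2
  \<comment> \<open>From the right the difference quotient at 0 is t p(t) exp(-t) with t = 1/h,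
    which tends to 0 as t grows.\<close>
  let ?q = "pCons 0 p"
  have "((%t. poly ?q (inverse t)*exp (- inverse t)) \<longlongrightarrow> 0) (at_right (0::real))"
   by (rule filterlim_compose[OF poly_exp_tendsto_0 filterlim_inverse_at_top_right])
  moreover have "\<forall>\<^sub>F h in at_right 0. poly ?q (inverse h)*exp (- inverse h) = (flat p (0+h) - flat p 0)/h"
   using eventually_at_right_less[of "0::real"]
   by eventually_elim (simp add: flat_def inverse_eq_divide)
  ultimately have r: "((%h. (flat p (0+h) - flat p 0)/h) \<longlongrightarrow> 0) (at_right 0)"
   by (rule Lim_transform_eventually)
  have l: "((%h. (flat p (0+h) - flat p 0)/h) \<longlongrightarrow> 0) (at_left 0)"
  proof (rule Lim_transform_eventually[OF tendsto_const])
   show "\<forall>\<^sub>F h in at_left 0. 0 = (flat p (0+h) - flat p 0)/h"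
    by (auto simp: eventually_at_filter flat_def intro!: always_eventually)
  qed
  have "((%h. (flat p (0+h) - flat p 0)/h) \<longlongrightarrow> 0) (at 0)"
   using filterlim_split_at[OF l r] .
  then show ?thesis using 2 by (simp add: DERIV_def flat_def)
 next
  case 3
  have d: "((%x. 1/x) has_real_derivative - (1/x^2)) (at x)"
   using 3 by (auto intro!: derivative_eq_intros simp: power2_eq_square)
  have "((%x. poly p (1/x)*exp (- (1/x))) has_real_derivative
    (poly (pderiv p) (1/x)*- (1/x\<^sup>2))*exp (- (1/x)) + (exp (- (1/x))*- (- (1/x\<^sup>2)))*poly p (1/x)) (at x)"
   by (intro DERIV_mult DERIV_chain2[OF poly_DERIV d] DERIV_chain2[OF DERIV_exp] DERIV_minus d)
  moreover have "(poly (pderiv p) (1/x)*- (1/x\<^sup>2))*exp (- (1/x)) + (exp (- (1/x))*- (- (1/x\<^sup>2)))*poly p (1/x)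
    = flat (monom 1 2*(p - pderiv p)) x"
   using 3 by (simp add: flat_def poly_monom power_one_over algebra_simps)
  ultimately have "((%x. poly p (1/x)*exp (- (1/x))) has_real_derivative flat (monom 1 2*(p - pderiv p)) x) (at x)"
   by simp
  moreover have "\<forall>\<^sub>F y in nhds x. flat p y = poly p (1/y)*exp (- (1/y))"
   using eventually_nhds_in_open[of "{0<..}" x] 3 by (auto simp: flat_def elim!: eventually_mono)
  ultimately show ?thesis by (subst DERIV_cong_ev[OF refl _ refl])
 qed
qed

lemma smooth1_flat: "smooth1 (flat p)"
proof -
 have "cd1 n (flat p)" for n
 proof (induction n arbitrary: p)
  case 0
  show ?case using flat_deriv by (auto intro!: continuous_at_imp_continuous_on DERIV_isCont)
 next
  case (Suc n)
  then show ?case using flat_deriv[of p] by auto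
 qed
 then show ?thesis by (simp add: smooth1_def)
qed

definition test1 :: "real => real => (real => real) => bool" where
 "test1 a b \<phi> \<longleftrightarrow> smooth1 \<phi> \<and> (\<exists>p q. a < p \<and> q < b \<and> (\<forall>x. x \<notin> {p..q} --> \<phi> x = 0))"

text \<open>A bump supported in [p, q], bounded by 1. Growing m steepens both flanks, and in the
  limit the indicator of the open interval (p, q) appears.\<close>

definition chi :: "real => real => real => real => real" where
 "chi p q m x = flat 1 (m*x + - (m*p))*flat 1 ((- m)*x + m*q)"

lemma chi_nonzero: "0 < m ==> chi p q m x \<noteq> 0 \<longleftrightarrow> p < x \<and> x < q"
 by (auto simp: chi_def flat_def)

lemma chi_eq: "0 < m ==> p < x ==> x < q ==> chi p q m x = exp (- (1/(m*(x-p))))*exp (- (1/(m*(q-x))))"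
 by (simp add: chi_def flat_def algebra_simps)

lemma chi_bounds: "0 <= chi p q m x" "chi p q m x <= 1"
proof -
 have "0 <= flat 1 y" "flat 1 y <= 1" for y by (auto simp: flat_def)
 then show "0 <= chi p q m x" "chi p q m x <= 1" unfolding chi_def by (simp_all add: mult_le_one)
qed

lemma smooth1_chi: "smooth1 (chi p q m)"
 unfolding chi_def[abs_def] by (intro smooth1_mult smooth1_affine smooth1_flat)

lemma test1_chi: "a < p ==> q < b ==> 0 < m ==> test1 a b (chi p q m)"
proof -
 assume *: "a < p" "q < b" "0 < m"
 have "chi p q m x = 0" if "x \<notin> {p..q}" for x using chi_nonzero[OF *(3), of p q x] that by auto
 with * smooth1_chi show ?thesis unfolding test1_def by blast
qed

lemma chi_tendsto: "(%n. chi p q (real (Suc n)) x) \<longlonglongrightarrow> indicator {p<..<q} x"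
proof (cases "p < x \<and> x < q")
 case True
 have lim: "(%n. exp (- (1/(real (Suc n)*y)))) \<longlonglongrightarrow> exp 0" if "0 < y" for y :: real
 proof (intro tendsto_exp)
  have "(%n. - (inverse (real (Suc n))*(1/y))) \<longlonglongrightarrow> - (0*(1/y))"
   by (intro tendsto_intros LIMSEQ_inverse_real_of_nat)
  then show "(%n. - (1/(real (Suc n)*y))) \<longlonglongrightarrow> 0" by (simp add: divide_inverse)
 qed
 have "(%n. exp (- (1/(real (Suc n)*(x-p))))*exp (- (1/(real (Suc n)*(q-x))))) \<longlonglongrightarrow> exp 0*exp 0"
  by (intro tendsto_mult lim) (use True in auto)
 then show ?thesis using True by (simp add: chi_eq)
next
 case False
 then have "chi p q (real (Suc n)) x = 0" for n using chi_nonzero[of "real (Suc n)" p q x] by auto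
 then show ?thesis using False by (auto simp: indicator_def)
qed

lemma test1_deriv: "test1 a b \<phi> ==> test1 a b (deriv \<phi>)"
proof -
 assume "test1 a b \<phi>"
 then obtain p q where s: "smooth1 \<phi>" and pq: "a < p" "q < b" "!!x. x \<notin> {p..q} ==> \<phi> x = 0"
  unfolding test1_def by blast
 have "deriv \<phi> x = 0" if x: "x \<notin> {p..q}" for x
 proof -
  have "\<forall>\<^sub>F y in nhds x. \<phi> y = 0"
  proof -
   have "open (- {p..q})" by (simp add: open_Compl)
   from eventually_nhds_in_open[OF this, of x] x show ?thesis
    by (auto elim!: eventually_mono intro: pq(3))
  qed
  then have "(\<phi> has_real_derivative 0) (at x)" by (subst DERIV_cong_ev[OF refl _ refl]) auto
  then show ?thesis by (rule DERIV_imp_deriv)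
 qed
 then show ?thesis using smooth1_deriv(2)[OF s] pq unfolding test1_def by blast
qed

lemma test1_funpow_deriv: "test1 a b \<phi> ==> test1 a b ((deriv ^^ i) \<phi>)"
 by (induction i) (auto intro: test1_deriv)

lemma test1_measurable: "test1 a b \<phi> ==> is_borel \<phi>"
 using smooth1_continuous by (auto simp: test1_def intro: borel_measurable_continuous_onI)

lemma test1_bounded:
 assumes "test1 a b \<phi>" obtains B where "0 <= B" "!!x. \<bar>\<phi> x\<bar> <= B"
proof -
 obtain p q where pq: "smooth1 \<phi>" "!!x. x \<notin> {p..q} ==> \<phi> x = 0"
  using assms unfolding test1_def by blast
 have "bounded (\<phi> ` {p..q})"
  by (intro compact_imp_bounded compact_continuous_image continuous_on_subset[OF smooth1_continuous[OF pq(1)]]) auto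
 then obtain B where "\<forall>y\<in>\<phi> ` {p..q}. norm y <= B" by (auto simp: bounded_iff)
 then have "!!x. x \<in> {p..q} ==> \<bar>\<phi> x\<bar> <= B" by simp
 then have "!!x. \<bar>\<phi> x\<bar> <= max 0 B" using pq(2) by (metis abs_zero max.coboundedI1 max.coboundedI2 order_refl)
 then show thesis by (intro that[of "max 0 B"]) auto
qed

lemma test1_integrable:
 assumes "test1 a b \<phi>" shows "integrable (mu a' b') \<phi>"
proof -
 obtain B where "!!x. \<bar>\<phi> x\<bar> <= B" using test1_bounded[OF assms] by blast
 then show ?thesis
  by (intro mu.integrable_const_bound[of _ B]) (auto simp: mu_borel test1_measurable[OF assms])
qed

text \<open>Products of test functions in one variable are enough to identify a weak derivative, and
  repeated partial derivatives of a product reduce to derivatives of its factors.\<close>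

definition tensor :: "(real => real) => (real => real) => fun2" where
 "tensor \<phi> \<psi> = (%p. \<phi> (fst p)*\<psi> (snd p))"

lemma tensor_has_derivative:
 assumes "smooth1 \<phi>" "smooth1 \<psi>"
 shows "(tensor \<phi> \<psi> has_derivative (%v. deriv \<phi> (fst p)*fst v * \<psi> (snd p) + \<phi> (fst p)*(deriv \<psi> (snd p) * snd v))) (at p)"
proof -
 have 1: "((%p. \<phi> (fst p)) has_derivative (%v. deriv \<phi> (fst p)*fst v)) (at p)"
  by (rule has_derivative_compose[OF has_derivative_fst[OF has_derivative_ident] smooth1_deriv(1)[OF assms(1), of "fst p", unfolded has_field_derivative_def]])
 have 2: "((%p. \<psi> (snd p)) has_derivative (%v. deriv \<psi> (snd p) * snd v)) (at p)"
  by (rule has_derivative_compose[OF has_derivative_snd[OF has_derivative_ident] smooth1_deriv(1)[OF assms(2), of "snd p", unfolded has_field_derivative_def]])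
 show ?thesis unfolding tensor_def
  by (rule has_derivative_eq_rhs[OF has_derivative_mult[OF 1 2]]) (simp add: fun_eq_iff)
qed

lemma partial_tensor:
 assumes "smooth1 \<phi>" "smooth1 \<psi>"
 shows "partial_dx (tensor \<phi> \<psi>) = tensor (deriv \<phi>) \<psi>" "partial_dy (tensor \<phi> \<psi>) = tensor \<phi> (deriv \<psi>)"
 unfolding fun_eq_iff partial_dx_def partial_dy_def frechet_derivative_at[OF tensor_has_derivative[OF assms], symmetric]
 by (simp_all add: tensor_def)

lemma cont_diff_tensor:
 assumes "smooth1 \<phi>" "smooth1 \<psi>"
 shows "cont_diff_on n UNIV (tensor \<phi> \<psi>)"
 using assms
proof (induction n arbitrary: \<phi> \<psi>)
 case 0
 have "continuous_on UNIV (%p :: real \<times> real. \<phi> (fst p))" "continuous_on UNIV (%p :: real \<times> real. \<psi> (snd p))"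
  by (rule continuous_on_compose2[OF smooth1_continuous[OF 0(1)] continuous_on_fst[OF continuous_on_id]], simp,
    rule continuous_on_compose2[OF smooth1_continuous[OF 0(2)] continuous_on_snd[OF continuous_on_id]], simp)
 then show ?case unfolding tensor_def cont_diff_on.simps by (rule continuous_on_mult)
next
 case (Suc n)
 then show ?case
  using tensor_has_derivative[OF Suc.prems] Suc.IH smooth1_deriv(2)
  by (simp add: partial_tensor) (blast intro: differentiableI)
qed

lemma test_tensor:
 assumes "test1 a b \<phi>" "test1 c d \<psi>"
 shows "test_function (rect a b c d) (tensor \<phi> \<psi>)"
proof -
 obtain p q p' q' where *: "a < p" "q < b" "!!x. x \<notin> {p..q} ==> \<phi> x = 0"
   "c < p'" "q' < d" "!!x. x \<notin> {p'..q'} ==> \<psi> x = 0"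
  using assms unfolding test1_def by blast
 have "compact ({p..q} \<times> {p'..q'})" by (intro compact_Times) auto
 moreover have "{p..q} \<times> {p'..q'} \<subseteq> rect a b c d" using * by (auto simp: rect_def)
 moreover have "\<forall>r. r \<notin> {p..q} \<times> {p'..q'} --> tensor \<phi> \<psi> r = 0"
  using *(3,6) by (auto simp: tensor_def mem_Times_iff)
 ultimately show ?thesis
  unfolding test_function_def using cont_diff_tensor[of \<phi> \<psi>] assms by (auto simp: test1_def)
qed

lemma partial_funpow_tensor:
 assumes "test1 a b \<phi>" "test1 c d \<psi>"
 shows "(partial_dx ^^ i) ((partial_dy ^^ j) (tensor \<phi> \<psi>)) = tensor ((deriv ^^ i) \<phi>) ((deriv ^^ j) \<psi>)"
proof -
 have s: "smooth1 ((deriv ^^ k) \<phi>)" "smooth1 ((deriv ^^ k) \<psi>)" for k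
  using test1_funpow_deriv[OF assms(1)] test1_funpow_deriv[OF assms(2)] by (auto simp: test1_def)
 have "(partial_dy ^^ j) (tensor \<phi> \<psi>) = tensor \<phi> ((deriv ^^ j) \<psi>)"
  using s(1)[of 0] s(2) by (induction j) (auto simp: partial_tensor)
 moreover have "(partial_dx ^^ i) (tensor \<phi> ((deriv ^^ j) \<psi>)) = tensor ((deriv ^^ i) \<phi>) ((deriv ^^ j) \<psi>)"
  using s by (induction i) (auto simp: partial_tensor)
 ultimately show ?thesis by simp
qed

section \<open>Lebesgue measure on the rectangle and Borel representatives\<close>

lemma rect_borel [measurable, simp]: "rect a b c d \<in> sets borel"
 unfolding rect_def by (intro borel_open open_Times) auto

lemma rm_density: "rm a b c d = density lborel (%p. ennreal (indicator (rect a b c d) p))"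
proof -
 have sf: "sigma_finite_measure (density lborel (%x. ennreal (indicator {c<..<d} x)))"
  using finite_measure.axioms(1)[OF fin_mu[of c d]] by (simp add: mu_def)
 have "rm a b c d = density (lborel \<Otimes>\<^sub>M lborel) (%(x, y). ennreal (indicator {a<..<b} x)*ennreal (indicator {c<..<d} y))"
  unfolding rm_def mu_def by (rule pair_measure_density[OF _ _ _ sf]) (auto intro: lborel.sigma_finite_measure_axioms)
 also have "... = density lborel (%p. ennreal (indicator (rect a b c d) p))"
  unfolding lborel_prod
  by (rule arg_cong[where f="density lborel"]) (auto simp: fun_eq_iff rect_def indicator_def)
 finally show ?thesis .
qed

lemma AE_rm_iff: "(AE p in rm a b c d. P p) \<longleftrightarrow> (AE p in lborel. p \<in> rect a b c d --> P p)"
 unfolding rm_density by (subst AE_density) (auto simp: indicator_def)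

lemma AE_leb_iff: "(AE p in lebesgue_on (rect a b c d). P p) \<longleftrightarrow> (AE p in rm a b c d. P p)"
 unfolding AE_rm_iff by (subst AE_restrict_space_iff) (auto simp: AE_completion_iff)

lemma leb_measurable:
 fixes f :: "fun2"
 assumes "is_borel f'" "AE p in rm a b c d. f p = f' p"
 shows "f \<in> borel_measurable (lebesgue_on (rect a b c d))"
proof -
 let ?\<Omega> = "rect a b c d"
 have 1: "(%p. if p \<in> ?\<Omega> then f' p else 0) \<in> borel_measurable lebesgue"
  using assms(1) by (intro measurable_completion) auto
 have "AE p in lebesgue. (if p \<in> ?\<Omega> then f' p else 0) = (if p \<in> ?\<Omega> then f p else 0)"
  using assms(2) unfolding AE_rm_iff AE_completion_iff by eventually_elim auto
 from borel_measurable_AE[OF 1 this] show ?thesis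
  using borel_measurable_if[of ?\<Omega> f] by simp
qed

lemma leb_integral:
 fixes f :: "fun2"
 assumes f': "is_borel f'" and eq: "AE p in rm a b c d. f p = f' p"
 shows "(LINT p|lebesgue_on (rect a b c d). f p) = (LINT p|rm a b c d. f' p)"
  and "integrable (lebesgue_on (rect a b c d)) f \<longleftrightarrow> integrable (rm a b c d) f'"
proof -
 let ?\<Omega> = "rect a b c d"
 note m = leb_measurable[OF f' eq] leb_measurable[OF f' AE_I2[OF refl], of a b c d]
 have eqL: "AE p in lebesgue_on ?\<Omega>. f p = f' p" using eq by (simp add: AE_leb_iff)
 have "(LINT p|lebesgue_on ?\<Omega>. f p) = (LINT p|lebesgue_on ?\<Omega>. f' p)"
  by (rule integral_cong_AE[OF m eqL])
 also have "... = (LINT p|lebesgue. indicator ?\<Omega> p *\<^sub>R f' p)" by (subst integral_restrict_space) auto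
 also have "... = (LINT p|lborel. indicator ?\<Omega> p *\<^sub>R f' p)" using f' by (subst integral_completion) auto
 also have "... = (LINT p|rm a b c d. f' p)"
  unfolding rm_density using f' by (intro integral_density[symmetric]) auto
 finally show "(LINT p|lebesgue_on ?\<Omega>. f p) = (LINT p|rm a b c d. f' p)" .
 have "integrable (lebesgue_on ?\<Omega>) f \<longleftrightarrow> integrable (lebesgue_on ?\<Omega>) f'"
  by (rule integrable_cong_AE[OF m eqL])
 also have "... \<longleftrightarrow> integrable lebesgue (%p. indicator ?\<Omega> p *\<^sub>R f' p)" by (subst integrable_restrict_space) auto
 also have "... \<longleftrightarrow> integrable lborel (%p. indicator ?\<Omega> p *\<^sub>R f' p)" using f' by (subst integrable_completion) auto
 also have "... \<longleftrightarrow> integrable (rm a b c d) f'"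
  unfolding rm_density using f' by (intro integrable_density[symmetric]) auto
 finally show "integrable (lebesgue_on ?\<Omega>) f \<longleftrightarrow> integrable (rm a b c d) f'" .
qed

text \<open>A Lebesgue measurable function is traded for a Borel one that agrees with it almost
  everywhere, because kernel operators and slices are formed with Borel functions on the product
  measure.\<close>

definition brep :: "real => real => real => real => fun2 => fun2 => bool" where
 "brep a b c d u u' \<longleftrightarrow> u' \<in> sqint (rm a b c d) \<and> (AE p in rm a b c d. u p = u' p)"

lemma brep_exists:
 assumes "u \<in> L2 (rect a b c d)"
 obtains u' where "brep a b c d u u'"
proof -
 let ?\<Omega> = "rect a b c d"
 have "(%p. if p \<in> ?\<Omega> then u p else 0) \<in> borel_measurable lebesgue"
  using assms borel_measurable_if[of ?\<Omega> u] by (simp add: L2_def)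
 from completion_ex_borel_measurable_real[OF this] obtain u' where
  u': "u' \<in> borel_measurable lborel" "AE p in lborel. (if p \<in> ?\<Omega> then u p else 0) = u' p" by blast
 have eq: "AE p in rm a b c d. u p = u' p"
  unfolding AE_rm_iff using u'(2) by eventually_elim auto
 have "integrable (rm a b c d) (%p. (u' p)\<^sup>2)"
 proof (subst leb_integral(2)[symmetric])
  show "AE p in rm a b c d. (u p)\<^sup>2 = (u' p)\<^sup>2" using eq by eventually_elim simp
  show "integrable (lebesgue_on ?\<Omega>) (%p. (u p)\<^sup>2)" using assms by (simp add: L2_def)
 qed (use u'(1) in auto)
 then show thesis using u' eq by (intro that[of u']) (auto simp: brep_def sqint_def rm_borel)
qed

lemma brep_L2:
 assumes "brep a b c d u u'" shows "u \<in> L2 (rect a b c d)"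
proof -
 have u': "is_borel u'" and eq: "AE p in rm a b c d. u p = u' p"
  using assms sqint_borel by (auto simp: brep_def)
 have "AE p in rm a b c d. (u p)\<^sup>2 = (u' p)\<^sup>2" using eq by eventually_elim simp
 then show ?thesis
  using assms u' leb_measurable[OF u' eq] leb_integral(2)[where f'="%p. (u' p)\<^sup>2" and f="%p. (u p)\<^sup>2", of a b c d] sqint_square
  by (auto simp: L2_def brep_def)
qed

lemma brep_self: "u' \<in> sqint (rm a b c d) ==> brep a b c d u' u'"
 by (simp add: brep_def)

lemma brep_sq: "brep a b c d u u' ==> u' \<in> sqint (rm a b c d)"
 by (simp add: brep_def)

lemma brep_integral_mult:
 assumes "brep a b c d u u'" "is_borel g"
 shows "(LINT p|lebesgue_on (rect a b c d). u p*g p) = (LINT p|rm a b c d. u' p*g p)"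
proof (rule leb_integral(1))
 show "AE p in rm a b c d. u p*g p = u' p*g p"
  using assms(1) unfolding brep_def by (auto elim: eventually_mono)
 show "is_borel (%p. u' p*g p)"
  using assms sqint_borel by (auto simp: brep_def)
qed

lemma brep_nrm:
 assumes "brep a b c d u u'"
 shows "(LINT p|lebesgue_on (rect a b c d). (u p)\<^sup>2) = (nrm (rm a b c d) u')\<^sup>2"
 unfolding nrm_square_integral
proof (rule leb_integral(1))
 show "AE p in rm a b c d. (u p)\<^sup>2 = (u' p)\<^sup>2"
  using assms unfolding brep_def by (auto elim: eventually_mono)
 show "is_borel (%p. (u' p)\<^sup>2)"
  using assms sqint_borel by (auto simp: brep_def)
qed

lemma box_Pair: "box (p, p') (q, q') = {p<..<q} \<times> {p'<..<q' :: real}" for p q :: real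
 by (auto simp: mem_box Basis_prod_def)

lemma tensor_measurable:
 assumes "is_borel \<phi>" "is_borel \<psi>"
 shows "is_borel (tensor \<phi> \<psi>)"
proof -
 have "(%p. \<phi> (fst p)*\<psi> (snd p)) \<in> borel_measurable (borel \<Otimes>\<^sub>M borel)"
  using assms by measurable
 then show ?thesis by (simp add: tensor_def borel_prod)
qed

lemma integral_box_zero:
 assumes g: "integrable (rm a b c d) g"
  and zero: "!!\<phi> \<psi>. test1 a b \<phi> ==> test1 c d \<psi> ==> (LINT p|rm a b c d. g p*tensor \<phi> \<psi> p) = 0"
 shows "(LINT s|rm a b c d. indicator ({p<..<q} \<times> {p'<..<q'}) s*g s) = 0"
proof -
 have [measurable]: "is_borel g" using g rm_borel by blast
 have bm: "{p<..<q} \<times> {p'<..<q'} \<in> sets borel" for p q p' q' :: real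
  by (intro borel_open open_Times) auto
 \<comment> \<open>For a box whose closure lies inside the rectangle, its indicator is a dominated
   limit of products of bumps that are admissible test functions.\<close>
 have inner: "(LINT s|rm a b c d. indicator ({p<..<q} \<times> {p'<..<q'}) s*g s) = 0"
  if "a < p" "q < b" "c < p'" "q' < d" for p q p' q'
 proof -
  let ?t = "%n. tensor (chi p q (real (Suc n))) (chi p' q' (real (Suc n)))"
  have tm: "is_borel (?t n)" for n
   by (intro tensor_measurable borel_measurable_continuous_onI smooth1_continuous smooth1_chi)
  have "(%n. LINT s|rm a b c d. ?t n s*g s) \<longlonglongrightarrow> (LINT s|rm a b c d. indicator ({p<..<q} \<times> {p'<..<q'}) s*g s)"
  proof (rule integral_dominated_convergence)
   show "integrable (rm a b c d) (%s. \<bar>g s\<bar>)" using g by simp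
   show "AE s in rm a b c d. (%n. ?t n s*g s) \<longlonglongrightarrow> indicator ({p<..<q} \<times> {p'<..<q'}) s*g s"
   proof (rule AE_I2)
    fix s :: "real \<times> real"
    have "(%n. ?t n s*g s) \<longlonglongrightarrow> (indicator {p<..<q} (fst s)*indicator {p'<..<q'} (snd s))*g s"
     unfolding tensor_def by (intro tendsto_mult chi_tendsto tendsto_const)
    also have "indicator {p<..<q} (fst s)*indicator {p'<..<q'} (snd s) = (indicator ({p<..<q} \<times> {p'<..<q'}) s :: real)"
     by (cases s) (simp add: indicator_times)
    finally show "(%n. ?t n s*g s) \<longlonglongrightarrow> indicator ({p<..<q} \<times> {p'<..<q'}) s*g s" .
   qed
   have "\<bar>?t n s\<bar> <= 1" for n s
    using chi_bounds[of p q "real (Suc n)" "fst s"] chi_bounds[of p' q' "real (Suc n)" "snd s"]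
    by (simp add: tensor_def abs_mult mult_le_one)
   then show "AE s in rm a b c d. norm (?t n s*g s) <= \<bar>g s\<bar>" for n
    by (auto simp: abs_mult intro!: mult_left_le_one_le)
  qed (use tm bm in "auto simp: rm_borel")
  moreover have "(LINT s|rm a b c d. ?t n s*g s) = 0" for n
   using zero[OF test1_chi test1_chi, of p q "real (Suc n)" p' q' "real (Suc n)"] that by (simp add: mult.commute)
  ultimately show ?thesis by (simp add: LIMSEQ_const_iff)
 qed
 \<comment> \<open>An arbitrary box is exhausted by its parts at distance at least 1/(n+1) from the
   boundary of the rectangle, to which \<open>inner\<close> applies.\<close>
 let ?e = "%n. inverse (real (Suc n))"
 let ?B = "%n. {max p (a + ?e n)<..<min q (b - ?e n)} \<times> {max p' (c + ?e n)<..<min q' (d - ?e n)}"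
 have "(%n. LINT s|rm a b c d. indicator (?B n) s*g s) \<longlonglongrightarrow> (LINT s|rm a b c d. indicator ({p<..<q} \<times> {p'<..<q'}) s*g s)"
 proof (rule integral_dominated_convergence)
  show "integrable (rm a b c d) (%s. \<bar>g s\<bar>)" using g by simp
  have "AE s in rm a b c d. s \<in> rect a b c d" by (simp add: AE_rm_iff)
  then show "AE s in rm a b c d. (%n. indicator (?B n) s*g s) \<longlonglongrightarrow> indicator ({p<..<q} \<times> {p'<..<q'}) s*g s"
  proof eventually_elim
   case (elim s)
   obtain x y where s: "s = (x, y)" by (cases s)
   have "\<forall>\<^sub>F n in sequentially. ?e n < min (min (x-a) (b-x)) (min (y-c) (d-y))"
    using elim by (intro order_tendstoD(2)[OF LIMSEQ_inverse_real_of_nat]) (auto simp: s rect_def)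
   then have "\<forall>\<^sub>F n in sequentially. indicator (?B n) s*g s = indicator ({p<..<q} \<times> {p'<..<q'}) s*g s"
    by eventually_elim (auto simp: s indicator_def)
   then show ?case by (rule tendsto_eventually)
  qed
  show "AE s in rm a b c d. norm (indicator (?B n) s*g s) <= \<bar>g s\<bar>" for n
   by (auto simp: indicator_def)
 qed (use bm in "auto simp: rm_borel")
 moreover have "(LINT s|rm a b c d. indicator (?B n) s*g s) = 0" for n
 proof (rule inner)
  have "0 < ?e n" by simp
  then show "a < max p (a + ?e n)" "min q (b - ?e n) < b" "c < max p' (c + ?e n)" "min q' (d - ?e n) < d"
   by (simp_all only: less_max_iff_disj min_less_iff_disj) auto
 qed
 ultimately show ?thesis by (simp add: LIMSEQ_const_iff)
qed

text \<open>The sets over which g integrates to 0 contain all boxes, an intersection-stable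
  generator of the Borel sets, and are closed under complement and disjoint union. A density whose
  integral over every Borel set is 0 vanishes almost everywhere.\<close>

lemma fundamental_lemma:
 assumes g: "integrable (rm a b c d) g"
  and zero: "!!\<phi> \<psi>. test1 a b \<phi> ==> test1 c d \<psi> ==> (LINT p|rm a b c d. g p*tensor \<phi> \<psi> p) = 0"
 shows "AE p in rm a b c d. g p = 0"
proof -
 let ?R = "rm a b c d"
 have [measurable]: "is_borel g" using g rm_borel by blast
 have gA: "integrable ?R (%s. indicator A s*g s)" if "A \<in> sets borel" for A
  using integrable_mult_indicator[OF _ g, of A] that by simp
 let ?G = "range (%(p, q). box p q :: (real \<times> real) set)"
 have Pow: "?G \<subseteq> Pow UNIV" by simp
 have Int: "Int_stable ?G"
 proof (rule Int_stableI)
  fix A B assume "A \<in> ?G" "B \<in> ?G"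
  then obtain p q r s where "A = box p q" "B = box r s" by auto
  moreover obtain p1 p2 q1 q2 r1 r2 s1 s2 where "p = (p1, p2)" "q = (q1, q2)" "r = (r1, r2)" "s = (s1, s2)"
   by (metis surj_pair)
  ultimately have "A \<inter> B = box (max p1 r1, max p2 r2) (min q1 s1, min q2 s2)"
   by (auto simp: box_Pair)
  then show "A \<inter> B \<in> ?G" by auto
 qed
 have all: "(LINT s|?R. indicator A s*g s) = 0" if "A \<in> sigma_sets UNIV ?G" for A
  using Int Pow that
 proof (induction rule: sigma_sets_induct_disjoint)
  case (basic A)
  then obtain p q where "A = box p q" by auto
  then show ?case using integral_box_zero[OF g zero] box_Pair by (metis surj_pair)
 next
  case empty
  show ?case by simp
 next
  case (compl A)
  have A: "A \<in> sets borel" using compl(1) by (simp add: borel_eq_box sets_measure_of)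
  have "(LINT s|?R. g s) = 0"
  proof -
   have "AE s in ?R. indicator ({a<..<b} \<times> {c<..<d}) s*g s = g s"
    by (simp add: AE_rm_iff rect_def[symmetric])
   moreover have "{a<..<b} \<times> {c<..<d} \<in> sets borel" by (intro borel_open open_Times) auto
   ultimately have "(LINT s|?R. g s) = (LINT s|?R. indicator ({a<..<b} \<times> {c<..<d}) s*g s)"
    by (intro integral_cong_AE) (auto simp: rm_borel)
   then show ?thesis using integral_box_zero[OF g zero] by simp
  qed
  moreover have "(%s. indicator (UNIV-A) s*g s) = (%s. g s - indicator A s*g s)"
   by (auto simp: indicator_def fun_eq_iff)
  ultimately show ?case using compl(2) g gA[OF A] by simp
 next
  case (union A)
  have A: "A i \<in> sets borel" for i using union(2) by (auto simp: borel_eq_box sets_measure_of)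
  have "(LINT s|?R. indicator (\<Union>i. A i) s *\<^sub>R g s) = (\<Sum>i. LINT s|?R. indicator (A i) s *\<^sub>R g s)"
   unfolding set_lebesgue_integral_def[symmetric]
   by (rule lebesgue_integral_countable_add)
     (use A union(1) gA[of "\<Union>i. A i"] in "auto simp: disjoint_family_on_def set_integrable_def")
  then show ?case using union(3) by simp
 qed
 have "AE p in ?R. g p = (%_. 0) p"
 proof (rule density_unique_real[OF g])
  fix A assume "A \<in> sets ?R"
  then have "A \<in> sigma_sets UNIV ?G" by (simp add: borel_eq_box sets_measure_of)
  from all[OF this] show "(\<integral>x \<in> A. g x \<partial>?R) = (\<integral>x \<in> A. 0 \<partial>?R)"
   by (simp add: set_lebesgue_integral_def)
 qed simp
 then show ?thesis by simp
qed

section \<open>Weak derivatives through Green operators\<close>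

text \<open>D is the x-derivative of \<phi>, and \<phi> vanishes at both ends, expressed through
  integrals. No smoothness in y is asked for, so the notion also covers a test function in x times a
  bounded Borel function of y.\<close>

definition xpair :: "real => real => fun2 => fun2 => bool" where
 "xpair a b \<phi> D \<longleftrightarrow> \<phi> \<in> borel_measurable borel \<and> D \<in> borel_measurable borel \<and> (\<exists>B. \<forall>p. \<bar>\<phi> p\<bar> <= B \<and> \<bar>D p\<bar> <= B) \<and>
   (\<forall>y. (\<forall>x\<in>{a..b}. \<phi> (x, y) = anti a b (%s. D (s, y)) x) \<and> (LINT s|mu a b. D (s, y)) = 0)"

lemma xpair_sqint:
 assumes "xpair a b \<phi> D"
 shows "\<phi> \<in> sqint (rm a' b' c d)" "D \<in> sqint (rm a' b' c d)"
proof -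
 obtain B where "is_borel \<phi>" "is_borel D" "!!p. \<bar>\<phi> p\<bar> <= B" "!!p. \<bar>D p\<bar> <= B"
  using assms unfolding xpair_def by blast
 then show "\<phi> \<in> sqint (rm a' b' c d)" "D \<in> sqint (rm a' b' c d)"
  by (auto intro!: rm.sqint_bounded[where B=B] simp: rm_borel)
qed

lemma xpair_slice:
 assumes "xpair a b \<phi> D"
 shows "integrable (mu a b) (%s. D (s, y))" "integrable (mu a b) (%s. \<phi> (s, y))"
  "AE x in mu a b. \<phi> (x, y) = anti a b (%s. D (s, y)) x" "(LINT s|mu a b. D (s, y)) = 0"
proof -
 obtain B where *: "is_borel \<phi>" "is_borel D" "!!p. \<bar>\<phi> p\<bar> <= B" "!!p. \<bar>D p\<bar> <= B"
  using assms unfolding xpair_def by blast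
 note [measurable] = *(1,2)
 have "is_borel (%s. D (s, y))" "is_borel (%s. \<phi> (s, y))" by measurable
 then show "integrable (mu a b) (%s. D (s, y))" "integrable (mu a b) (%s. \<phi> (s, y))"
  using * by (auto intro!: mu.integrable_const_bound[where B=B] simp: mu_borel)
 show "AE x in mu a b. \<phi> (x, y) = anti a b (%s. D (s, y)) x"
  using AE_mu_Ioo[of a b] by eventually_elim (use assms in "auto simp: xpair_def")
 show "(LINT s|mu a b. D (s, y)) = 0" using assms by (simp add: xpair_def)
qed

lemma integral_xpair:
 assumes xp: "xpair a b \<phi> D" and g: "integrable (mu a b) g"
 shows "(LINT x|mu a b. anti a b g x*D (x, y)) = - (LINT x|mu a b. g x*\<phi> (x, y))"
proof -
 note s = xpair_slice[OF xp, of y]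
 have "(LINT x|mu a b. g x*\<phi> (x, y)) = (LINT x|mu a b. g x*anti a b (%s. D (s, y)) x)"
 proof (rule integral_cong_AE)
  show "(%x. g x*\<phi> (x, y)) \<in> borel_measurable (mu a b)" using g s(2) by auto
  show "(%x. g x*anti a b (%s. D (s, y)) x) \<in> borel_measurable (mu a b)"
   using integrable_mult_kop[OF fin_mu _ bkern_Ik s(1) _ g] by auto
  show "AE x in mu a b. g x*\<phi> (x, y) = g x*anti a b (%s. D (s, y)) x" using s(3) by eventually_elim simp
 qed
 then show ?thesis using integral_anti_by_parts[OF s(1) g] s(4) by (simp add: mult.commute)
qed

lemma ip_xpair_anti:
 assumes ab: "a < b" and xp: "xpair a b \<phi> D" and g: "g \<in> sqint (rm a b c d)"
 shows "ip (rm a b c d) (Lx (mu a b) Ik g) D = - ip (rm a b c d) g \<phi>"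
proof -
 have "ip (rm a b c d) (Lx (mu a b) Ik g) D = -1*ip (rm a b c d) g \<phi>"
 proof (rule ip_lift_x)
  show "AE y in mu c d. ip (mu a b) (%x. Lx (mu a b) Ik g (x, y)) (%x. D (x, y)) = -1*ip (mu a b) (%x. g (x, y)) (%x. \<phi> (x, y))"
   using sqint_slice_x[OF g]
   by eventually_elim (use integral_xpair[OF xp mu.sqint_int] in "simp add: ip_def Lx_def")
 qed (use g xpair_sqint[OF xp] Lx_sqint[OF less_imp_le[OF ab] bkern_Ik g] in auto)
 then show ?thesis by simp
qed

lemma ip_xpair_const:
 assumes xp: "xpair a b \<phi> D" and C: "(%p. C (snd p)) \<in> sqint (rm a b c d)"
 shows "ip (rm a b c d) (%p. C (snd p)) D = 0"
proof -
 have "ip (rm a b c d) (%p. C (snd p)) D = 0*ip (rm a b c d) D D"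
  by (rule ip_lift_x) (use C xpair_sqint[OF xp] xpair_slice(4)[OF xp] in "auto simp: ip_def")
 then show ?thesis by simp
qed

lemma ip_xpair_Gx:
 assumes ab: "a < b" and xp: "xpair a b \<phi> D" and g: "g \<in> sqint (rm a b c d)"
 shows "ip (rm a b c d) (Gx a b g) D = - ip (rm a b c d) (Gx' a b g) \<phi>"
proof -
 have G': "Gx' a b g \<in> sqint (rm a b c d)" by (rule Gx'_sqint[OF ab g])
 have "AE p in rm a b c d. Gx a b g p = Lx (mu a b) Ik (Gx' a b g) p"
 proof (rule AE_rm_eqI_x)
  show "AE y in mu c d. AE x in mu a b. Gx a b g (x, y) = Lx (mu a b) Ik (Gx' a b g) (x, y)"
   using sqint_slice_x[OF g]
  proof eventually_elim
   case (elim y)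
   show ?case using AE_anti_green'[OF ab mu.sqint_int[OF elim]] by eventually_elim (simp add: Lx_def)
  qed
 qed (use sqint_borel[OF Gx_sqint[OF ab g]] sqint_borel[OF Lx_sqint[OF less_imp_le[OF ab] bkern_Ik G']] in auto)
 then have "ip (rm a b c d) (Gx a b g) D = ip (rm a b c d) (Lx (mu a b) Ik (Gx' a b g)) D"
  by (rule ip_cong_sq[OF _ AE_I2[OF refl]])
    (intro Gx_sqint[OF ab g] Lx_sqint[OF less_imp_le[OF ab] bkern_Ik G'] xpair_sqint[OF xp])+
 then show ?thesis using ip_xpair_anti[OF ab xp G'] by simp
qed

lemma ip_xpair_Gx':
 assumes ab: "a < b" and xp: "xpair a b \<phi> D" and g: "g \<in> sqint (rm a b c d)"
 shows "ip (rm a b c d) (Gx' a b g) D = - ip (rm a b c d) g \<phi>"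
proof -
 have "ip (rm a b c d) (Gx' a b g) D = -1*ip (rm a b c d) g \<phi>"
 proof (rule ip_lift_x)
  show "AE y in mu c d. ip (mu a b) (%x. Gx' a b g (x, y)) (%x. D (x, y)) = -1*ip (mu a b) (%x. g (x, y)) (%x. \<phi> (x, y))"
   using sqint_slice_x[OF g]
  proof eventually_elim
   case (elim y)
   note gi = mu.sqint_int[OF elim] and s = xpair_slice[OF xp, of y]
   let ?\<kappa> = "(LINT s|mu a b. (b-s)*g (s, y))/(b-a)"
   have "(LINT x|mu a b. green' a b (%x. g (x, y)) x*D (x, y))
     = (LINT x|mu a b. D (x, y)*anti a b (%x. g (x, y)) x - ?\<kappa>*D (x, y))"
    by (simp add: green'_eq[OF ab gi] algebra_simps)
   also have "... = (LINT x|mu a b. D (x, y)*anti a b (%x. g (x, y)) x)"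
    using integrable_mult_kop[OF fin_mu _ bkern_Ik gi _ s(1)] s(1,4) by simp
   finally show ?case using integral_xpair[OF xp gi, of y] by (simp add: ip_def Lx_def mult.commute)
  qed
 qed (use g xpair_sqint[OF xp] Gx'_sqint[OF ab g] in auto)
 then show ?thesis by simp
qed

text \<open>Outside the compact support the function is 0 on an open set, so its derivatives have
  the same support.\<close>

lemma test_fun_partial:
 assumes "test_function \<Omega> \<phi>"
 shows "test_function \<Omega> (partial_dx \<phi>)" "test_function \<Omega> (partial_dy \<phi>)"
proof -
 obtain K where K: "compact K" "K \<subseteq> \<Omega>" "!!p. p \<notin> K ==> \<phi> p = 0"
  and s: "!!n. cont_diff_on n UNIV \<phi>" using assms unfolding test_function_def by blast
 have "frechet_derivative \<phi> (at p) = (%_. 0)" if "p \<notin> K" for p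
 proof -
  have "open (- K)" using K(1) by (simp add: compact_imp_closed open_Compl)
  have "((%_. 0) has_derivative (%_. 0)) (at p)" by simp
  then have "(\<phi> has_derivative (%_. 0)) (at p)"
   by (rule has_derivative_transform_within_open[OF _ \<open>open (- K)\<close>]) (use that K(3) in auto)
  from frechet_derivative_at[OF this] show ?thesis by simp
 qed
 then have "\<forall>p. p \<notin> K --> partial_dx \<phi> p = 0" "\<forall>p. p \<notin> K --> partial_dy \<phi> p = 0"
  by (simp_all add: partial_dx_def partial_dy_def)
 moreover have "cont_diff_on n UNIV (partial_dx \<phi>)" "cont_diff_on n UNIV (partial_dy \<phi>)" for n
  using s[of "Suc n"] by simp_all
 ultimately show "test_function \<Omega> (partial_dx \<phi>)" "test_function \<Omega> (partial_dy \<phi>)"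
  unfolding test_function_def using K by blast+
qed

lemma test_function_bounded:
 assumes "test_function \<Omega> \<phi>"
 shows "continuous_on UNIV \<phi>" "\<exists>B. \<forall>p. \<bar>\<phi> p\<bar> <= B"
proof -
 show c: "continuous_on UNIV \<phi>" using assms unfolding test_function_def by (metis cont_diff_on.simps(1))
 obtain K where K: "compact K" "!!p. p \<notin> K ==> \<phi> p = 0" using assms unfolding test_function_def by blast
 have "bounded (\<phi> ` K)" by (intro compact_imp_bounded compact_continuous_image continuous_on_subset[OF c] K) auto
 then obtain B where B: "\<forall>y\<in>\<phi> ` K. norm y <= B" by (auto simp: bounded_iff)
 have "\<bar>\<phi> p\<bar> <= max 0 B" for p
  using B K(2)[of p] by (cases "p \<in> K") (auto simp: max.coboundedI2)
 then show "\<exists>B. \<forall>p. \<bar>\<phi> p\<bar> <= B" by blast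
qed

lemma xpairI:
 assumes ab: "a < b" and m: "is_borel \<phi>" "is_borel D"
  and B: "!!p. \<bar>\<phi> p\<bar> <= B" "!!p. \<bar>D p\<bar> <= B'"
  and D: "!!x y. ((%x. \<phi> (x, y)) has_real_derivative D (x, y)) (at x)" and zero: "!!y. \<phi> (a, y) = 0" "!!y. \<phi> (b, y) = 0"
 shows "xpair a b \<phi> D"
proof -
 have "(\<forall>x\<in>{a..b}. \<phi> (x, y) = anti a b (%s. D (s, y)) x) \<and> (LINT s|mu a b. D (s, y)) = 0" for y
 proof -
  have "is_borel (%s. D (s, y))" using m(2) by measurable
  then have int: "integrable (mu a b) (%s. D (s, y))"
   using B(2) by (intro mu.integrable_const_bound[where B=B']) (auto simp: mu_borel)
  have "anti a b (%s. D (s, y)) x = \<phi> (x, y) - \<phi> (a, y)" if "x \<in> {a..b}" for x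
   by (rule anti_of_deriv[OF _ int _ _ that, of "{}" "%x. \<phi> (x, y)"])
     (use D in "auto intro!: continuous_at_imp_continuous_on DERIV_isCont")
  then show ?thesis using integral_eq_anti_right[OF int] zero ab by simp
 qed
 moreover have "\<bar>\<phi> p\<bar> <= max B B' \<and> \<bar>D p\<bar> <= max B B'" for p
  using B(1)[of p] B(2)[of p] by (auto simp: max.coboundedI1 max.coboundedI2)
 ultimately show ?thesis unfolding xpair_def using m by blast
qed

lemma slice_DERIV:
 assumes "w differentiable at (x, y)"
 shows "((%s. w (s, y)) has_real_derivative partial_dx w (x, y)) (at x)"
  "((%t. w (x, t)) has_real_derivative partial_dy w (x, y)) (at y)"
proof -
 let ?D = "frechet_derivative w (at (x, y))"
 have D: "(w has_derivative ?D) (at (x, y))" using assms frechet_derivative_works by blast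
 have l: "?D (h *\<^sub>R v) = h * ?D v" for h v using linear_scale[OF has_derivative_linear[OF D]] by simp
 have "((%s. (s, y)) has_derivative (%h. (h, 0))) (at x)" "((%t. (x, t)) has_derivative (%h. (0, h))) (at y)"
  by (auto intro!: derivative_eq_intros)
 note this[THEN has_derivative_compose, OF D]
 moreover have "?D (h, 0) = partial_dx w (x, y)*h" "?D (0, h) = partial_dy w (x, y)*h" for h
  using l[of h "(1, 0)"] l[of h "(0, 1)"] by (simp_all add: partial_dx_def partial_dy_def)
 ultimately show "((%s. w (s, y)) has_real_derivative partial_dx w (x, y)) (at x)"
  "((%t. w (x, t)) has_real_derivative partial_dy w (x, y)) (at y)"
  by (simp_all add: has_field_derivative_def)
qed

lemma xpair_test:
 assumes ab: "a < b" and t: "test_function (rect a b c d) \<phi>"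
 shows "xpair a b \<phi> (partial_dx \<phi>)"
proof -
 note t' = test_fun_partial(1)[OF t]
 obtain B B' where B: "!!p. \<bar>\<phi> p\<bar> <= B" "!!p. \<bar>partial_dx \<phi> p\<bar> <= B'"
  using test_function_bounded(2)[OF t] test_function_bounded(2)[OF t'] by blast
 have d: "\<phi> differentiable (at p)" for p
  using t unfolding test_function_def by (metis UNIV_I cont_diff_on.simps(2))
 have "\<phi> p = 0" if "p \<notin> rect a b c d" for p using t that unfolding test_function_def by blast
 then show ?thesis
  using test_function_bounded(1)[OF t] test_function_bounded(1)[OF t']
  by (intro xpairI[OF ab _ _ B slice_DERIV(1)[OF d]] borel_measurable_continuous_onI) (auto simp: rect_def)
qed

lemma sw_test:
 assumes "test_function (rect a b c d) \<phi>"
 shows "test_function (rect c d a b) (sw \<phi>)" "partial_dx (sw \<phi>) = sw (partial_dy \<phi>)"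
proof -
 have pd: "partial_dx (sw f) = sw (partial_dy f)" "partial_dy (sw f) = sw (partial_dx f)" "!!p. sw f differentiable (at p)"
  if d: "!!p. f differentiable (at p)" for f :: "fun2"
 proof -
  have hd: "(sw f has_derivative (%h. frechet_derivative f (at (snd p, fst p)) (snd h, fst h))) (at p)" for p
  proof -
   have "((%p. (snd p, fst p)) has_derivative (%h. (snd h, fst h))) (at p)"
    by (auto intro!: derivative_eq_intros)
   from has_derivative_compose[OF this, of f, OF frechet_derivative_works[THEN iffD1, OF d]]
   show ?thesis by (simp add: sw_def)
  qed
  show "partial_dx (sw f) = sw (partial_dy f)" "partial_dy (sw f) = sw (partial_dx f)"
   unfolding fun_eq_iff partial_dx_def partial_dy_def frechet_derivative_at[OF hd, symmetric]
   by (simp_all add: sw_def partial_dx_def partial_dy_def)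
  show "sw f differentiable (at p)" for p using hd by (rule differentiableI)
 qed
 have cd: "cont_diff_on n UNIV (sw f)" if "cont_diff_on n UNIV f" for n f
  using that
 proof (induction n arbitrary: f)
  case 0
  have "continuous_on UNIV (%p. f (snd p, fst p))"
   by (rule continuous_on_compose2[OF 0[simplified] continuous_on_Pair[OF continuous_on_snd[OF continuous_on_id] continuous_on_fst[OF continuous_on_id]]]) simp
  then show ?case by (simp add: sw_def)
 next
  case (Suc n)
  have d: "f differentiable (at p)" for p using Suc.prems by (metis UNIV_I cont_diff_on.simps(2))
  show ?case using Suc pd(1,2)[OF d] pd(3)[OF d] by simp
 qed
 obtain K where K: "compact K" "K \<subseteq> rect a b c d" "!!p. p \<notin> K ==> \<phi> p = 0"
  and s: "!!n. cont_diff_on n UNIV \<phi>" using assms unfolding test_function_def by blast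
 have "compact ((%p. (snd p, fst p)) ` K)"
  by (intro compact_continuous_image K continuous_on_Pair continuous_on_snd continuous_on_fst continuous_on_id)
 moreover have "(%p. (snd p, fst p)) ` K \<subseteq> rect c d a b" using K(2) by (force simp: rect_def)
 moreover have "sw \<phi> p = 0" if "p \<notin> (%p. (snd p, fst p)) ` K" for p
 proof -
  have "(snd p, fst p) \<notin> K"
  proof
   assume "(snd p, fst p) \<in> K"
   then have "p \<in> (%p. (snd p, fst p)) ` K" by (intro image_eqI[of _ _ "(snd p, fst p)"]) simp_all
   then show False using that by contradiction
  qed
  then show ?thesis using K(3) by (simp add: sw_def)
 qed
 ultimately show "test_function (rect c d a b) (sw \<phi>)"
  unfolding test_function_def using cd s by blast
 show "partial_dx (sw \<phi>) = sw (partial_dy \<phi>)"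
 proof (rule pd(1))
  show "\<phi> differentiable (at p)" for p using s[of "Suc 0"] by (metis UNIV_I cont_diff_on.simps(2))
 qed
qed

lemma ypair_test:
 assumes "c < d" "test_function (rect a b c d) \<phi>"
 shows "xpair c d (sw \<phi>) (sw (partial_dy \<phi>))"
 using xpair_test[OF assms(1) sw_test(1)[OF assms(2)]] sw_test(2)[OF assms(2)] by simp

lemma ip_sw_swap:
 "f \<in> sqint (rm c d a b) ==> g \<in> sqint (rm a b c d) ==> ip (rm a b c d) (sw f) g = ip (rm c d a b) f (sw g)"
 using ip_sw[OF sqint_borel measurable_sw[OF sqint_borel], of f c d a b g a b c d a b c d] by simp

lemma ip_ypair_Gy:
 assumes cd: "c < d" and xp: "xpair c d (sw \<phi>) (sw D)" and g: "g \<in> sqint (rm a b c d)"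
 shows "ip (rm a b c d) (Gy c d g) D = - ip (rm a b c d) (Gy' c d g) \<phi>"
proof -
 have s: "\<phi> \<in> sqint (rm a b c d)" "D \<in> sqint (rm a b c d)" using sqint_sw[OF xpair_sqint(1)[OF xp]] sqint_sw[OF xpair_sqint(2)[OF xp]] by simp_all
 show ?thesis
  using ip_xpair_Gx[OF cd xp sqint_sw[OF g]]
  by (simp add: Ly_sw ip_sw_swap s Gx_sqint[OF cd sqint_sw[OF g]] Gx'_sqint[OF cd sqint_sw[OF g]])
qed

lemma ip_ypair_Gy':
 assumes cd: "c < d" and xp: "xpair c d (sw \<phi>) (sw D)" and g: "g \<in> sqint (rm a b c d)"
 shows "ip (rm a b c d) (Gy' c d g) D = - ip (rm a b c d) g \<phi>"
proof -
 have s: "\<phi> \<in> sqint (rm a b c d)" "D \<in> sqint (rm a b c d)" using sqint_sw[OF xpair_sqint(1)[OF xp]] sqint_sw[OF xpair_sqint(2)[OF xp]] by simp_all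
 show ?thesis
  using ip_xpair_Gx'[OF cd xp sqint_sw[OF g]] ip_sw_swap[OF sqint_sw[OF g] s(1)]
  by (simp add: Ly_sw ip_sw_swap s Gx'_sqint[OF cd sqint_sw[OF g]])
qed


lemma test_function_funpow:
 "test_function \<Omega> \<phi> ==> test_function \<Omega> ((partial_dx ^^ i) ((partial_dy ^^ j) \<phi>))"
proof -
 assume t: "test_function \<Omega> \<phi>"
 have "test_function \<Omega> ((partial_dy ^^ j) \<phi>)"
  by (induction j) (use t test_fun_partial(2) in auto)
 then show ?thesis by (induction i) (use test_fun_partial(1) in auto)
qed

lemma test_function_sqint:
 assumes "test_function \<Omega> \<phi>" shows "\<phi> \<in> sqint (rm a b c d)"
proof -
 obtain B where "!!p. \<bar>\<phi> p\<bar> <= B" using test_function_bounded(2)[OF assms] by blast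
 then show ?thesis
  using test_function_bounded(1)[OF assms]
  by (intro rm.sqint_bounded[where B=B]) (auto simp: rm_borel intro: borel_measurable_continuous_onI)
qed

lemma test_fun_borel: "test_function \<Omega> \<phi> ==> is_borel \<phi>"
 using test_function_bounded(1) by (rule borel_measurable_continuous_onI)

lemma has_weak_pd_iff:
 assumes u: "brep a b c d u u'" and g: "brep a b c d g g'"
 shows "has_weak_pd (rect a b c d) i j u g \<longleftrightarrow> (\<forall>\<phi>. test_function (rect a b c d) \<phi> -->
  ip (rm a b c d) u' ((partial_dx ^^ i) ((partial_dy ^^ j) \<phi>)) = (-1) ^ (i+j)*ip (rm a b c d) g' \<phi>)"
proof -
 have "(LINT p|lebesgue_on (rect a b c d). u p*(partial_dx ^^ i) ((partial_dy ^^ j) \<phi>) p) = ip (rm a b c d) u' ((partial_dx ^^ i) ((partial_dy ^^ j) \<phi>))"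
  "(LINT p|lebesgue_on (rect a b c d). g p*\<phi> p) = ip (rm a b c d) g' \<phi>"
  if "test_function (rect a b c d) \<phi>" for \<phi>
  unfolding ip_def
  by (rule brep_integral_mult[OF u test_fun_borel[OF test_function_funpow[OF that]]],
    rule brep_integral_mult[OF g test_fun_borel[OF that]])
 then show ?thesis unfolding has_weak_pd_def using brep_L2[OF u] brep_L2[OF g] by simp
qed

lemma has_weak_pd_brep:
 assumes "has_weak_pd (rect a b c d) i j u g"
 obtains u' g' where "brep a b c d u u'" "brep a b c d g g'"
 using assms brep_exists[of u a b c d] brep_exists[of g a b c d] unfolding has_weak_pd_def by metis

lemma brep_change: "brep a b c d u u' ==> AE p in rm a b c d. u' p = v p ==> v \<in> sqint (rm a b c d) ==> brep a b c d u v"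
 unfolding brep_def by (auto elim: eventually_elim2)

lemma brep_diff: "brep a b c d u u' ==> brep a b c d v v' ==> brep a b c d (%p. u p - v p) (%p. u' p - v' p)"
 unfolding brep_def by (auto elim: eventually_elim2)

lemma has_weak_pd_diff:
 assumes "has_weak_pd (rect a b c d) i j u g" "has_weak_pd (rect a b c d) i j v h"
 shows "has_weak_pd (rect a b c d) i j (%p. u p - v p) (%p. g p - h p)"
proof -
 obtain u' g' where u: "brep a b c d u u'" "brep a b c d g g'" using has_weak_pd_brep[OF assms(1)] .
 obtain v' h' where v: "brep a b c d v v'" "brep a b c d h h'" using has_weak_pd_brep[OF assms(2)] .
 note sq = brep_sq[OF u(1)] brep_sq[OF u(2)] brep_sq[OF v(1)] brep_sq[OF v(2)]
 show ?thesis
  unfolding has_weak_pd_iff[OF brep_diff[OF u(1) v(1)] brep_diff[OF u(2) v(2)]]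
 proof (intro allI impI)
  fix \<phi> assume t: "test_function (rect a b c d) \<phi>"
  let ?D = "(partial_dx ^^ i) ((partial_dy ^^ j) \<phi>)"
  have "ip (rm a b c d) u' ?D = (-1) ^ (i+j)*ip (rm a b c d) g' \<phi>"
   "ip (rm a b c d) v' ?D = (-1) ^ (i+j)*ip (rm a b c d) h' \<phi>"
   using assms t unfolding has_weak_pd_iff[OF u] has_weak_pd_iff[OF v] by blast+
  then show "ip (rm a b c d) (%p. u' p - v' p) ?D = (-1) ^ (i+j)*ip (rm a b c d) (%p. g' p - h' p) \<phi>"
   by (simp add: ip_diff_left sq test_function_sqint[OF t] test_function_sqint[OF test_function_funpow[OF t]] right_diff_distrib)
 qed
qed

section \<open>Weak derivatives tested with products\<close>

definition twd :: "real => real => real => real => nat => nat => fun2 => fun2 => bool" where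
 "twd a b c d i j u g \<longleftrightarrow> u \<in> sqint (rm a b c d) \<and> g \<in> sqint (rm a b c d) \<and>
  (\<forall>\<phi> \<psi>. test1 a b \<phi> --> test1 c d \<psi> -->
   ip (rm a b c d) u (tensor ((deriv ^^ i) \<phi>) ((deriv ^^ j) \<psi>)) = (-1) ^ (i+j)*ip (rm a b c d) g (tensor \<phi> \<psi>))"

lemma has_weak_pd_twd:
 assumes "has_weak_pd (rect a b c d) i j u g" "brep a b c d u u'" "brep a b c d g g'"
 shows "twd a b c d i j u' g'"
 unfolding twd_def
proof (intro conjI allI impI)
 fix \<phi> \<psi> assume t: "test1 a b \<phi>" "test1 c d \<psi>"
 show "ip (rm a b c d) u' (tensor ((deriv ^^ i) \<phi>) ((deriv ^^ j) \<psi>)) = (-1) ^ (i+j)*ip (rm a b c d) g' (tensor \<phi> \<psi>)"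
  using assms(1) test_tensor[OF t] unfolding has_weak_pd_iff[OF assms(2,3)] partial_funpow_tensor[OF t, symmetric] by blast
qed (use assms brep_sq in auto)

lemma tensor_sqint: "test1 a b \<phi> ==> test1 c d \<psi> ==> tensor \<phi> \<psi> \<in> sqint (rm a b c d)"
 by (rule test_function_sqint[OF test_tensor])

lemma twd_unique:
 assumes "twd a b c d i j u g" "twd a b c d i j u h"
 shows "AE p in rm a b c d. g p = h p"
proof -
 have g: "g \<in> sqint (rm a b c d)" and h: "h \<in> sqint (rm a b c d)" using assms by (auto simp: twd_def)
 have "AE p in rm a b c d. g p - h p = 0"
 proof (rule fundamental_lemma)
  show "integrable (rm a b c d) (%p. g p - h p)" using g h by (intro rm.sqint_int sqint_diff)
  fix \<phi> \<psi> assume t: "test1 a b \<phi>" "test1 c d \<psi>"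
  have "(-1) ^ (i+j)*ip (rm a b c d) g (tensor \<phi> \<psi>) = (-1) ^ (i+j)*ip (rm a b c d) h (tensor \<phi> \<psi>)"
   using assms t unfolding twd_def by metis
  then have "ip (rm a b c d) (%p. g p - h p) (tensor \<phi> \<psi>) = 0"
   by (simp add: ip_diff_left[OF g h tensor_sqint[OF t]])
  then show "(LINT p|rm a b c d. (g p - h p)*tensor \<phi> \<psi> p) = 0" by (simp add: ip_def)
 qed
 then show ?thesis by eventually_elim simp
qed

text \<open>A derivative of a product of test functions is again such a product, so it may serve as
  the test function for the lower derivative. With products the order of differentiation raises no
  question of commuting partial derivatives.\<close>

lemma twd_step_x:
 assumes "twd a b c d i j u g" "twd a b c d (i+m) j u h"
 shows "twd a b c d m 0 g h"
 unfolding twd_def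
proof (intro conjI allI impI)
 fix \<phi> \<psi> assume t: "test1 a b \<phi>" "test1 c d \<psi>"
 have "(-1) ^ (i+j)*ip (rm a b c d) g (tensor ((deriv ^^ m) \<phi>) \<psi>) = ip (rm a b c d) u (tensor ((deriv ^^ i) ((deriv ^^ m) \<phi>)) ((deriv ^^ j) \<psi>))"
  using assms(1) test1_funpow_deriv[OF t(1)] t(2) unfolding twd_def by metis
 also have "(deriv ^^ i) ((deriv ^^ m) \<phi>) = (deriv ^^ (i+m)) \<phi>" by (simp add: funpow_add)
 also have "ip (rm a b c d) u (tensor ((deriv ^^ (i+m)) \<phi>) ((deriv ^^ j) \<psi>)) = (-1) ^ (i + m + j)*ip (rm a b c d) h (tensor \<phi> \<psi>)"
  using assms(2) t unfolding twd_def by blast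
 finally have "(-1) ^ (i+j)*ip (rm a b c d) g (tensor ((deriv ^^ m) \<phi>) \<psi>) = (-1) ^ (i+j)*((-1) ^ m*ip (rm a b c d) h (tensor \<phi> \<psi>))"
  by (simp add: power_add mult_ac)
 then show "ip (rm a b c d) g (tensor ((deriv ^^ m) \<phi>) ((deriv ^^ 0) \<psi>)) = (-1) ^ (m+0)*ip (rm a b c d) h (tensor \<phi> \<psi>)"
  by simp
qed (use assms in "auto simp: twd_def")

lemma sw_tensor: "sw (tensor \<phi> \<psi>) = tensor \<psi> \<phi>"
 by (simp add: sw_def tensor_def mult.commute)

lemma twd_sw:
 assumes "twd a b c d i j u g" shows "twd c d a b j i (sw u) (sw g)"
proof -
 have sq: "u \<in> sqint (rm a b c d)" "g \<in> sqint (rm a b c d)" using assms by (auto simp: twd_def)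
 show ?thesis
  unfolding twd_def
 proof (intro conjI allI impI)
  fix \<psi> \<phi> assume t: "test1 c d \<psi>" "test1 a b \<phi>"
  have "ip (rm a b c d) u (tensor ((deriv ^^ i) \<phi>) ((deriv ^^ j) \<psi>)) = (-1) ^ (i+j)*ip (rm a b c d) g (tensor \<phi> \<psi>)"
   using assms t unfolding twd_def by blast
  moreover have "ip (rm c d a b) (sw u) (tensor ((deriv ^^ j) \<psi>) ((deriv ^^ i) \<phi>)) = ip (rm a b c d) u (tensor ((deriv ^^ i) \<phi>) ((deriv ^^ j) \<psi>))"
   using ip_sw_swap[OF sq(1) tensor_sqint[OF test1_funpow_deriv[OF t(1)] test1_funpow_deriv[OF t(2)]]] by (simp add: sw_tensor)
  moreover have "ip (rm c d a b) (sw g) (tensor \<psi> \<phi>) = ip (rm a b c d) g (tensor \<phi> \<psi>)"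
   using ip_sw_swap[OF sq(2) tensor_sqint[OF t]] by (simp add: sw_tensor)
  ultimately show "ip (rm c d a b) (sw u) (tensor ((deriv ^^ j) \<psi>) ((deriv ^^ i) \<phi>)) = (-1) ^ (j+i)*ip (rm c d a b) (sw g) (tensor \<psi> \<phi>)"
   by (simp add: add.commute)
 qed (use sq in auto)
qed

text \<open>Mean zero is what makes the antiderivative vanish again to the right of the
  support.\<close>

lemma test1_antideriv:
 assumes ab: "a < b" and f: "test1 a b f" and zero: "(LINT x|mu a b. f x) = 0"
 obtains \<Phi> where "test1 a b \<Phi>" "deriv \<Phi> = f"
proof -
 obtain p q where s: "smooth1 f" and pq: "a < p" "q < b" "!!x. x \<notin> {p..q} ==> f x = 0"
  using f unfolding test1_def by blast
 note c = smooth1_continuous[OF s]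
 define \<Phi> where "\<Phi> x = integral {a..x} f" for x
 have low: "\<Phi> x = 0" if "x < p" for x
 proof -
  have "integral {a..x} f = integral {a..x} (%_. 0)"
   by (rule integral_cong) (use that pq in auto)
  then show ?thesis by (simp add: \<Phi>_def)
 qed
 have D: "(\<Phi> has_real_derivative f x) (at x)" for x
 proof (cases "x < p")
  case True
  have "\<forall>\<^sub>F y in nhds x. \<Phi> y = 0"
   using eventually_nhds_in_open[of "{..<p}" x] True low by (auto elim!: eventually_mono)
  then have "(\<Phi> has_real_derivative 0) (at x)" by (subst DERIV_cong_ev[OF refl _ refl]) auto
  then show ?thesis using pq(3)[of x] True by simp
 next
  case False
  then have x: "x \<in> {a..x + 1}" "x \<in> interior {a..x + 1}" using pq(1) by auto
  have "((%u. integral {a..u} f) has_real_derivative f x) (at x within {a..x + 1})"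
   by (rule integral_has_real_derivative[OF continuous_on_subset[OF c] x(1)]) simp
  then show ?thesis using at_within_interior[OF x(2)] by (simp add: \<Phi>_def[abs_def])
 qed
 note fi = test1_integrable[OF f, of a b]
 have "\<Phi> b = 0"
 proof -
  have "anti a b f b = \<Phi> b - \<Phi> a"
   by (rule anti_of_deriv[OF _ fi, of "{}"]) (use ab D in "auto intro!: continuous_at_imp_continuous_on DERIV_isCont")
  then show ?thesis using zero integral_eq_anti_right[OF fi] low[OF pq(1)] by simp
 qed
 have high: "\<Phi> x = 0" if "q < x" for x
 proof (cases x b rule: linorder_cases)
  case less
  obtain z where "x < z" "z < b" "\<Phi> b - \<Phi> x = (b-x)*f z" using MVT2[OF less, of \<Phi> f] D by blast
  then show ?thesis using pq(3)[of z] that \<open>\<Phi> b = 0\<close> by simp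
 next
  case greater
  obtain z where "b < z" "z < x" "\<Phi> x - \<Phi> b = (x-b)*f z" using MVT2[OF greater, of \<Phi> f] D by blast
  then show ?thesis using pq(3)[of z] pq(2) \<open>\<Phi> b = 0\<close> by simp
 qed (use \<open>\<Phi> b = 0\<close> in simp)
 have "test1 a b \<Phi>"
  unfolding test1_def
  using smooth1I_antideriv[OF D s] pq(1,2) low high by (metis atLeastAtMost_iff not_le)
 moreover have "deriv \<Phi> = f" using D by (intro ext DERIV_imp_deriv)
 ultimately show thesis by (rule that)
qed

lemma test1_unit:
 assumes ab: "a < b"
 obtains \<kappa> where "test1 a b \<kappa>" "(LINT x|mu a b. \<kappa> x) = 1"
proof -
 define p q where "p = a + (b-a)/3" and "q = b - (b-a)/3"
 have pq: "a < p" "q < b" "p < q" using ab by (auto simp: p_def q_def field_simps)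
 let ?f = "chi p q 1"
 have t: "test1 a b ?f" by (rule test1_chi) (use pq in auto)
 note fi = test1_integrable[OF t, of a b]
 have "(LINT x|mu a b. ?f x) \<noteq> 0"
 proof
  assume "(LINT x|mu a b. ?f x) = 0"
  then have "AE x in mu a b. ?f x = 0"
   using integral_nonneg_eq_0_iff_AE[OF fi] chi_bounds(1) by auto
  then have "AE x in mu p q. ?f x = 0" by (rule AE_mu_subset) (use pq in auto)
  from AE_mu_ex[OF pq(3) this, of "{}"] chi_nonzero[of 1 p q] show False by auto
 qed
 moreover have "test1 a b (%x. inverse (LINT x|mu a b. ?f x) * ?f x)"
  using t smooth1_cmult[of ?f "inverse (LINT x|mu a b. ?f x)"] unfolding test1_def by auto
 ultimately show thesis by (intro that[of "%x. inverse (LINT x|mu a b. ?f x) * ?f x"]) auto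
qed

lemma ip_tensor:
 assumes "F \<in> sqint (rm a b c d)" "test1 a b \<phi>" "test1 c d \<psi>"
 shows "ip (rm a b c d) F (tensor \<phi> \<psi>) = (LINT y|mu c d. (LINT x|mu a b. F (x, y)*\<phi> x)*\<psi> y)"
proof -
 have "ip (rm a b c d) F (tensor \<phi> \<psi>) = (LINT y|mu c d. (LINT x|mu a b. F (x, y)*tensor \<phi> \<psi> (x, y)))"
  unfolding ip_def by (rule integral_rm_x[OF sqint_mult[OF assms(1) tensor_sqint[OF assms(2,3)]]])
 then show ?thesis by (simp add: tensor_def mult.assoc[symmetric])
qed

text \<open>The lemma of du Bois-Reymond on lines parallel to the \<open>x\<close>-axis.\<close>

lemma weak_x:
 assumes ab: "a < b" and cd: "c < d" and tw: "twd a b c d 1 0 u g"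
 shows "\<exists>C. (%p. C (snd p)) \<in> sqint (rm a b c d) \<and> (AE p in rm a b c d. u p = C (snd p) + Lx (mu a b) Ik g p)"
proof -
 let ?R = "rm a b c d"
 have u: "u \<in> sqint ?R" and g: "g \<in> sqint ?R" using tw by (auto simp: twd_def)
 have Ig: "Lx (mu a b) Ik g \<in> sqint ?R" by (rule Lx_sqint[OF less_imp_le[OF ab] bkern_Ik g])
 define U where "U = (%p. u p - Lx (mu a b) Ik g p)"
 have U: "U \<in> sqint ?R" unfolding U_def using u Ig by auto
 have U0: "ip ?R U (tensor (deriv \<phi>) \<psi>) = 0" if t: "test1 a b \<phi>" "test1 c d \<psi>" for \<phi> \<psi>
 proof -
  have s: "smooth1 \<phi>" "smooth1 \<psi>" using t by (auto simp: test1_def)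
  have "ip ?R u (tensor (deriv \<phi>) \<psi>) = - ip ?R g (tensor \<phi> \<psi>)"
  proof -
   have "ip ?R u (tensor ((deriv ^^ 1) \<phi>) ((deriv ^^ 0) \<psi>)) = (- 1) ^ (1+0)*ip ?R g (tensor \<phi> \<psi>)"
    using tw t unfolding twd_def by blast
   then show ?thesis by simp
  qed
  moreover have "ip ?R (Lx (mu a b) Ik g) (tensor (deriv \<phi>) \<psi>) = - ip ?R g (tensor \<phi> \<psi>)"
   using ip_xpair_anti[OF ab xpair_test[OF ab test_tensor[OF t]] g] by (simp add: partial_tensor[OF s])
  ultimately show ?thesis
   unfolding U_def by (simp add: ip_diff_left[OF u Ig tensor_sqint[OF test1_deriv[OF t(1)] t(2)]])
 qed
 obtain \<kappa> where \<kappa>: "test1 a b \<kappa>" "(LINT x|mu a b. \<kappa> x) = 1" using test1_unit[OF ab] .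
 let ?K = "%x s :: real. \<kappa> s"
 have K: "bkern ?K"
 proof -
  obtain B where "!!x. \<bar>\<kappa> x\<bar> <= B" using test1_bounded[OF \<kappa>(1)] by blast
  then show ?thesis using test1_measurable[OF \<kappa>(1)] by (intro bounded_kernelI[where B=B]) auto
 qed
 \<comment> \<open>On each line C is the mean of U with weight \<kappa>. If U is constant along the
   lines, this is its value, and as a kernel operator it is measurable and square integrable at
   once.\<close>
 define C where "C y = (LINT s|mu a b. U (s, y)*\<kappa> s)" for y
 have CL: "Lx (mu a b) ?K U = (%p. C (snd p))"
  by (simp add: Lx_def kop_def C_def mult.commute)
 have Csq: "(%p. C (snd p)) \<in> sqint ?R"
  using Lx_sqint[OF less_imp_le[OF ab] K U] unfolding CL .
 have "AE p in ?R. U p - C (snd p) = 0"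
 proof (rule fundamental_lemma)
  show "integrable ?R (%p. U p - C (snd p))" using U Csq by (intro rm.sqint_int sqint_diff)
  fix \<phi> \<psi> assume t: "test1 a b \<phi>" "test1 c d \<psi>"
  \<comment> \<open>Subtracting m \<kappa> from \<phi> removes its mean; the result is the
    derivative of a test function, against which U integrates to 0.\<close>
  define m where "m = (LINT x|mu a b. \<phi> x)"
  have t': "test1 a b (%x. \<phi> x + (- m)*\<kappa> x)"
  proof -
   obtain p q where 1: "a < p" "q < b" "!!x. x \<notin> {p..q} ==> \<phi> x = 0" using t(1) unfolding test1_def by blast
   obtain p' q' where 2: "a < p'" "q' < b" "!!x. x \<notin> {p'..q'} ==> \<kappa> x = 0" using \<kappa>(1) unfolding test1_def by blast
   have "\<phi> x + (- m)*\<kappa> x = 0" if "x \<notin> {min p p'..max q q'}" for x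
   proof -
    have "x \<notin> {p..q}" "x \<notin> {p'..q'}" using that by auto
    then show ?thesis using 1(3)[of x] 2(3)[of x] by simp
   qed
   moreover have "smooth1 (%x. \<phi> x + (- m)*\<kappa> x)"
    using t(1) \<kappa>(1) by (intro smooth1_add smooth1_cmult) (auto simp: test1_def)
   moreover have "a < min p p'" "max q q' < b" using 1 2 by auto
   ultimately show ?thesis unfolding test1_def by blast
  qed
  have "(LINT x|mu a b. \<phi> x + (- m)*\<kappa> x) = 0"
   using test1_integrable[OF t(1)] test1_integrable[OF \<kappa>(1)] \<kappa>(2) by (simp add: m_def)
  from test1_antideriv[OF ab t' this] obtain \<Phi> where \<Phi>: "test1 a b \<Phi>" "deriv \<Phi> = (%x. \<phi> x + (- m)*\<kappa> x)" .
  have "tensor (deriv \<Phi>) \<psi> = (%p. tensor \<phi> \<psi> p - m*tensor \<kappa> \<psi> p)"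
   unfolding \<Phi>(2) by (simp add: tensor_def fun_eq_iff algebra_simps)
  then have "0 = ip ?R U (tensor \<phi> \<psi>) - m*ip ?R U (tensor \<kappa> \<psi>)"
   using U0[OF \<Phi>(1) t(2)] by (simp add: ip_diff_right[OF tensor_sqint[OF t] sqint_cmult[OF tensor_sqint[OF \<kappa>(1) t(2)]] U] ip_cmult_right)
  moreover have "ip ?R (%p. C (snd p)) (tensor \<phi> \<psi>) = m*ip ?R U (tensor \<kappa> \<psi>)"
  proof -
   have "(%y. (LINT x|mu a b. C (snd (x, y))*\<phi> x)*\<psi> y) = (%y. m*(C y*\<psi> y))"
    by (simp add: m_def fun_eq_iff)
   then show ?thesis unfolding ip_tensor[OF Csq t] ip_tensor[OF U \<kappa>(1) t(2)]
    by (simp only: integral_mult_right_zero C_def)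
  qed
  ultimately have "ip ?R (%p. U p - C (snd p)) (tensor \<phi> \<psi>) = 0"
   by (simp add: ip_diff_left[OF U Csq tensor_sqint[OF t]])
  then show "(LINT p|?R. (U p - C (snd p))*tensor \<phi> \<psi> p) = 0" by (simp add: ip_def)
 qed
 then have "AE p in ?R. u p = C (snd p) + Lx (mu a b) Ik g p" by eventually_elim (simp add: U_def)
 then show ?thesis using Csq by blast
qed

section \<open>Zero boundary values and Green representation\<close>

definition approx10 :: "real => real => real => real => fun2 => fun2 => bool" where
 "approx10 a b c d u g \<longleftrightarrow> (\<forall>\<epsilon>>0. \<exists>\<phi>. test_function (rect a b c d) \<phi> \<and>
   nrm (rm a b c d) (%p. u p - \<phi> p) < \<epsilon> \<and> nrm (rm a b c d) (%p. g p - partial_dx \<phi> p) < \<epsilon>)"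

lemma nrm_zero_of_le:
 assumes "f \<in> sqint M" "0 <= K" "!!\<epsilon>. 0 < \<epsilon> ==> nrm M f <= K*\<epsilon>"
 shows "AE p in M. f p = 0"
proof -
 have "nrm M f <= 0"
 proof (rule field_le_epsilon)
  fix e :: real assume "0 < e"
  then have "nrm M f <= K*(e/(K+1))" using assms by (intro assms(3)) auto
  also have "... <= e" using assms(2) \<open>0 < e\<close> by (simp add: field_simps)
  finally show "nrm M f <= 0 + e" by simp
 qed
 then show ?thesis using nrm_eq_0_iff[OF assms(1)] nrm_nonneg[of M f] by simp
qed

text \<open>For a test function both claims are the fundamental theorem of calculus along lines.
  They involve bounded operators only and pass to the limit in $L^2$. No traces have to be
  defined.\<close>

lemma approx10_anti:
 assumes ab: "a < b" and u: "u \<in> sqint (rm a b c d)" and g: "g \<in> sqint (rm a b c d)" and ap: "approx10 a b c d u g"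
 shows "AE p in rm a b c d. u p = Lx (mu a b) Ik g p" and "AE y in mu c d. (LINT s|mu a b. g (s, y)) = 0"
proof -
 let ?R = "rm a b c d"
 let ?K = "%x s :: real. 1 :: real"
 have K: "bkern ?K" by (rule bounded_kernelI[where B=1]) auto
 have le: "a <= b" using ab by simp
 have Ig: "Lx (mu a b) Ik g \<in> sqint ?R" and Kg: "Lx (mu a b) ?K g \<in> sqint ?R"
  using Lx_sqint[OF le bkern_Ik g] Lx_sqint[OF le K g] by auto
 have main: "nrm ?R (%p. u p - Lx (mu a b) Ik g p) <= (1 + (b-a))*\<epsilon> \<and> nrm ?R (Lx (mu a b) ?K g) <= (b-a)*\<epsilon>" if e: "0 < \<epsilon>" for \<epsilon>
 proof -
  obtain \<phi> where t: "test_function (rect a b c d) \<phi>" and n: "nrm ?R (%p. u p - \<phi> p) < \<epsilon>" "nrm ?R (%p. g p - partial_dx \<phi> p) < \<epsilon>"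
   using ap e unfolding approx10_def by blast
  note xp = xpair_test[OF ab t]
  have \<phi>: "\<phi> \<in> sqint ?R" and D: "partial_dx \<phi> \<in> sqint ?R" using xpair_sqint[OF xp] by auto
  have gD: "(%p. g p - partial_dx \<phi> p) \<in> sqint ?R" using g D by auto
  have ID: "Lx (mu a b) L (%p. g p - partial_dx \<phi> p) \<in> sqint ?R" if "bkern L" for L
   by (rule Lx_sqint[OF le that gD])
  have eq1: "AE p in ?R. u p - Lx (mu a b) Ik g p = (u p - \<phi> p) - Lx (mu a b) Ik (%p. g p - partial_dx \<phi> p) p"
  proof -
   have "AE p in ?R. p \<in> rect a b c d" by (simp add: AE_rm_iff)
   then have "AE p in ?R. \<phi> p = Lx (mu a b) Ik (partial_dx \<phi>) p"
   proof eventually_elim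
    case (elim p)
    then show ?case using xp unfolding xpair_def by (cases p) (auto simp: rect_def Lx_def)
   qed
   then show ?thesis using Lx_diff[OF bkern_Ik g D] by eventually_elim simp
  qed
  have "nrm ?R (%p. u p - Lx (mu a b) Ik g p) = nrm ?R (%p. (u p - \<phi> p) - Lx (mu a b) Ik (%p. g p - partial_dx \<phi> p) p)"
   by (rule nrm_cong_sq[OF eq1]) (intro sqint_diff u Ig \<phi> ID bkern_Ik)+
  also have "... <= nrm ?R (%p. u p - \<phi> p) + nrm ?R (Lx (mu a b) Ik (%p. g p - partial_dx \<phi> p))"
   by (rule nrm_diff_triangle[OF sqint_diff[OF u \<phi>] ID[OF bkern_Ik]])
  also have "nrm ?R (Lx (mu a b) Ik (%p. g p - partial_dx \<phi> p)) <= 1*(b-a)*nrm ?R (%p. g p - partial_dx \<phi> p)"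
   by (rule Lx_bound(2)[OF le bkern_Ik _ gD]) (auto simp: Ik_def)
  also have "... <= (b-a)*\<epsilon>" using n(2) ab by (simp add: mult_left_mono)
  finally have 1: "nrm ?R (%p. u p - Lx (mu a b) Ik g p) <= (1 + (b-a))*\<epsilon>" using n(1) by (simp add: distrib_right)
  have eq2: "AE p in ?R. Lx (mu a b) ?K g p = Lx (mu a b) ?K (%p. g p - partial_dx \<phi> p) p"
  proof -
   have 0: "Lx (mu a b) ?K (partial_dx \<phi>) p = 0" for p
    using xpair_slice(4)[OF xp] by (simp add: Lx_def kop_def)
   from Lx_diff[OF K g D] show ?thesis by eventually_elim (simp add: 0)
  qed
  have "nrm ?R (Lx (mu a b) ?K g) = nrm ?R (Lx (mu a b) ?K (%p. g p - partial_dx \<phi> p))"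
   by (rule nrm_cong_sq[OF eq2 Kg ID[OF K]])
  also have "... <= 1*(b-a)*nrm ?R (%p. g p - partial_dx \<phi> p)"
   by (rule Lx_bound(2)[OF le K _ gD]) auto
  also have "... <= (b-a)*\<epsilon>" using n(2) ab by (simp add: mult_left_mono)
  finally show ?thesis using 1 by blast
 qed
 have "AE p in ?R. u p - Lx (mu a b) Ik g p = 0"
  by (rule nrm_zero_of_le[OF sqint_diff[OF u Ig], of "1 + (b-a)"]) (use main ab in auto)
 then show "AE p in ?R. u p = Lx (mu a b) Ik g p" by eventually_elim simp
 have "AE p in ?R. Lx (mu a b) ?K g p = 0"
  by (rule nrm_zero_of_le[OF Kg, of "b - a"]) (use main ab in auto)
 from AE_rm_x[OF this] show "AE y in mu c d. (LINT s|mu a b. g (s, y)) = 0"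
 proof eventually_elim
  case (elim y)
  from AE_mu_ex[OF ab this, of "{}"] show ?case by (auto simp: Lx_def kop_def)
 qed
qed

text \<open>On almost every line \<open>weak_x\<close> shows that g is a constant plus the
  antiderivative of p, and the boundary values show that g has mean zero.
  \<open>green_unique\<close> then identifies g and its antiderivative.\<close>

lemma green_repr:
 assumes ab: "a < b" and cd: "c < d" and u: "u \<in> sqint (rm a b c d)" and ap: "approx10 a b c d u g"
  and tw: "twd a b c d 1 0 g p"
 shows "AE s in rm a b c d. u s = Gx a b p s" and "AE s in rm a b c d. g s = Gx' a b p s"
proof -
 let ?R = "rm a b c d"
 have g: "g \<in> sqint ?R" and p: "p \<in> sqint ?R" using tw by (auto simp: twd_def)
 obtain C where C: "AE s in ?R. g s = C (snd s) + Lx (mu a b) Ik p s" using weak_x[OF ab cd tw] by blast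
 have slices: "AE y in mu c d. (AE x in mu a b. g (x, y) = green' a b (%s. p (s, y)) x) \<and>
   (\<forall>x\<in>{a..b}. anti a b (%s. g (s, y)) x = green a b (%s. p (s, y)) x)"
  using AE_rm_x[OF C] approx10_anti(2)[OF ab u g ap] sqint_slice_x[OF g] sqint_slice_x[OF p]
 proof eventually_elim
  case (elim y)
  have "AE x in mu a b. g (x, y) = C y + anti a b (%s. p (s, y)) x" using elim(1) by (simp add: Lx_def)
  from green_unique[OF ab mu.sqint_int[OF elim(4)] mu.sqint_int[OF elim(3)] this elim(2)]
  show ?case by blast
 qed
 show "AE s in ?R. g s = Gx' a b p s"
 proof (rule AE_rm_eqI_x)
  show "AE y in mu c d. AE x in mu a b. g (x, y) = Gx' a b p (x, y)"
   using slices by eventually_elim (simp add: Lx_def)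
 qed (use sqint_borel[OF g] sqint_borel[OF Gx'_sqint[OF ab p]] in auto)
 have "AE s in ?R. Lx (mu a b) Ik g s = Gx a b p s"
 proof (rule AE_rm_eqI_x)
  show "AE y in mu c d. AE x in mu a b. Lx (mu a b) Ik g (x, y) = Gx a b p (x, y)"
   using slices
  proof eventually_elim
   case (elim y)
   from AE_mu_Ioo[of a b] show ?case by eventually_elim (use elim in "auto simp: Lx_def")
  qed
 qed (use sqint_borel[OF Lx_sqint[OF less_imp_le[OF ab] bkern_Ik g]] sqint_borel[OF Gx_sqint[OF ab p]] in auto)
 then show "AE s in ?R. u s = Gx a b p s"
  using approx10_anti(1)[OF ab u g ap] by eventually_elim simp
qed

text \<open>One Borel representative of each derivative of order at most m is fixed. Relations
  between derivatives become relations between fixed functions, and no property of the chosen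
  \<open>weak_pd\<close> is needed in estimates.\<close>

locale weak_derivs =
 fixes a b c d :: real and m :: nat and U :: "nat => nat => fun2"
 assumes ab: "a < b" and cd: "c < d" and m: "2 <= m"
  and U: "i + j <= m ==> twd a b c d i j (U 0 0) (U i j)"
  and apx: "approx10 a b c d (U 0 0) (U 1 0)"
  and apy: "approx10 c d a b (sw (U 0 0)) (sw (U 0 1))"
begin

abbreviation R where "R \<equiv> rm a b c d"

text \<open>The assumptions are symmetric in the coordinates, so each statement on y below is the
  one on x for the swapped family.\<close>

lemma swapped: "weak_derivs c d a b m (%i j. sw (U j i))"
proof
 show "twd c d a b i j (sw (U 0 0)) (sw (U j i))" if "i + j <= m" for i j
  using twd_sw[OF U[of j i]] that by simp
 show "approx10 a b c d (sw (sw (U 0 0))) (sw (sw (U 1 0)))" using apx by simp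
qed (use ab cd m apy in auto)

lemma U_sq: "i + j <= m ==> U i j \<in> sqint R"
 using U[of i j] by (simp add: twd_def)

lemma step_x: "i + j < m ==> twd a b c d 1 0 (U i j) (U (Suc i) j)"
 using twd_step_x[OF U[of i j], of 1 "U (Suc i) j"] U[of "Suc i" j] by simp

lemma chain_x: "i + j < m ==> \<exists>C. AE p in R. U i j p = C (snd p) + Lx (mu a b) Ik (U (Suc i) j) p"
 using weak_x[OF ab cd step_x] by blast

lemma repr_x: "AE s in R. U 0 0 s = Gx a b (U 2 0) s" "AE s in R. U 1 0 s = Gx' a b (U 2 0) s"
proof -
 have "twd a b c d 1 0 (U 1 0) (U 2 0)" using step_x[of 1 0] m by (simp add: numeral_2_eq_2)
 from green_repr[OF ab cd U_sq apx this] 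
 show "AE s in R. U 0 0 s = Gx a b (U 2 0) s" "AE s in R. U 1 0 s = Gx' a b (U 2 0) s" by auto
qed

lemma chain_y:
 assumes "i + j < m"
 shows "\<exists>C. AE p in R. U i j p = C (fst p) + Ly (mu c d) Ik (U i (Suc j)) p"
proof -
 have "j + i < m" using assms by simp
 from weak_derivs.chain_x[OF swapped this] obtain C where "AE p in rm c d a b. sw (U i j) p = C (snd p) + Lx (mu c d) Ik (sw (U i (Suc j))) p" by blast
 from AE_sw[OF this] show ?thesis by (auto simp: Ly_sw sw_def)
qed

lemma repr_y: "AE s in R. U 0 0 s = Gy c d (U 0 2) s" "AE s in R. U 0 1 s = Gy' c d (U 0 2) s"
 using AE_sw[OF weak_derivs.repr_x(1)[OF swapped]] AE_sw[OF weak_derivs.repr_x(2)[OF swapped]] by (simp_all add: Ly_sw sw_def)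

end

text \<open>The second factor need not vanish on the boundary or be smooth; in
  \<open>mixed_x\<close> it is a Green potential.\<close>

lemma xpair_tensor:
 assumes ab: "a < b" and \<phi>: "test1 a b \<phi>" and \<eta>: "is_borel \<eta>" "!!y. \<bar>\<eta> y\<bar> <= B"
 shows "xpair a b (tensor \<phi> \<eta>) (tensor (deriv \<phi>) \<eta>)"
proof -
 note \<phi>' = test1_deriv[OF \<phi>]
 obtain B1 where B1: "0 <= B1" "!!x. \<bar>\<phi> x\<bar> <= B1" using test1_bounded[OF \<phi>] by blast
 obtain B2 where B2: "0 <= B2" "!!x. \<bar>deriv \<phi> x\<bar> <= B2" using test1_bounded[OF \<phi>'] by blast
 have bd: "\<bar>tensor \<phi> \<eta> p\<bar> <= B1*B" "\<bar>tensor (deriv \<phi>) \<eta> p\<bar> <= B2*B" for p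
  unfolding tensor_def abs_mult using B1 B2 \<eta>(2) by (intro mult_mono; simp)+
 have D: "((%x. tensor \<phi> \<eta> (x, y)) has_real_derivative tensor (deriv \<phi>) \<eta> (x, y)) (at x)" for x y
  unfolding tensor_def fst_conv snd_conv using \<phi> smooth1_deriv(1) by (intro DERIV_cmult_right) (auto simp: test1_def)
 have "\<phi> a = 0" "\<phi> b = 0" using \<phi> unfolding test1_def by force+
 then show ?thesis
  by (intro xpairI[OF ab tensor_measurable[OF test1_measurable[OF \<phi>] \<eta>(1)] tensor_measurable[OF test1_measurable[OF \<phi>'] \<eta>(1)] bd D]) (simp_all add: tensor_def)
qed

lemma Ly_tensor: "Ly m K (tensor \<phi> \<psi>) = tensor \<phi> (kop m K \<psi>)"
 by (simp add: Ly_def tensor_def kop_def fun_eq_iff mult.left_commute[of _ "\<phi> _"])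

context weak_derivs
begin

lemma ip_deriv_x:
 assumes "i + j < m" "xpair a b \<phi> D"
 shows "ip R (U i j) D = - ip R (U (Suc i) j) \<phi>"
proof -
 obtain C where C: "(%p. C (snd p)) \<in> sqint R" "AE p in R. U i j p = C (snd p) + Lx (mu a b) Ik (U (Suc i) j) p"
  using weak_x[OF ab cd step_x[OF assms(1)]] by blast
 have g: "U (Suc i) j \<in> sqint R" and u: "U i j \<in> sqint R" using U_sq assms(1) by auto
 note Ig = Lx_sqint[OF less_imp_le[OF ab] bkern_Ik g]
 note D = xpair_sqint(2)[OF assms(2)]
 have "ip R (U i j) D = ip R (%p. C (snd p) + Lx (mu a b) Ik (U (Suc i) j) p) D"
  by (rule ip_cong_sq[OF C(2) _ u _ D D]) (use C(1) Ig in auto)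
 then show ?thesis
  using ip_xpair_const[OF assms(2) C(1)] ip_xpair_anti[OF ab assms(2) g] by (simp add: ip_add_left[OF C(1) Ig D])
qed

text \<open>The point is that $u_{xx}$ again has zero boundary values in y. This is inherited from
  u: the x-derivatives are put on the test function, u is replaced by \<open>Gy\<close> of $u_{yy}$,
  the symmetric operator moves to \<psi>, and the x-derivatives return to $u_{yy}$.\<close>

lemma mixed_x:
 assumes m4: "4 <= m"
 shows "AE s in R. U 2 0 s = Gy c d (U 2 2) s"
proof -
 have sq: "U 2 0 \<in> sqint R" "U 2 2 \<in> sqint R" "U 0 0 \<in> sqint R" "U 0 2 \<in> sqint R" using U_sq m4 by auto
 note Gsq = Gy_sqint[OF cd sq(2)] Gy_sqint[OF cd sq(4)]
 have "AE s in R. U 2 0 s - Gy c d (U 2 2) s = 0"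
 proof (rule fundamental_lemma)
  show "integrable R (%s. U 2 0 s - Gy c d (U 2 2) s)" using sq Gsq by (intro rm.sqint_int sqint_diff)
  fix \<phi> \<psi> assume t: "test1 a b \<phi>" "test1 c d \<psi>"
  note \<phi>1 = test1_deriv[OF t(1)]
  note \<phi>2 = test1_deriv[OF \<phi>1]
  note T = tensor_sqint[OF _ t(2)]
  \<comment> \<open>The Green potential of \<psi>. It lacks compact support, but only \<phi> is
    differentiated from here on, so \<open>xpair_tensor\<close> is applicable.\<close>
  define \<eta> where "\<eta> = green c d \<psi>"
  note \<psi>i = test1_integrable[OF t(2), of c d]
  obtain B2 where B2: "!!x s. \<bar>Gk c d x s\<bar> <= B2" using bkern_Gk[OF cd] unfolding bkern_def by blast
  have \<eta>: "is_borel \<eta>" "\<exists>B. \<forall>y. \<bar>\<eta> y\<bar> <= B"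
   unfolding \<eta>_def
   using kop_measurable[OF fin_mu sets_mu bkern_Gk[OF cd] borel_measurable_integrable[OF \<psi>i]]
    kop_bound[OF fin_mu sets_mu bkern_Gk[OF cd] \<psi>i B2] by blast+
  from \<eta>(2) obtain B' where B': "!!y. \<bar>\<eta> y\<bar> <= B'" by blast
  have G: "Gy c d (tensor f \<psi>) = tensor f \<eta>" for f by (simp add: Ly_tensor \<eta>_def)
  note xp = xpair_tensor[OF ab t(1) \<eta>(1) B'] xpair_tensor[OF ab \<phi>1 \<eta>(1) B']
  have "ip R (U 2 0) (tensor \<phi> \<psi>) = ip R (U 0 0) (tensor (deriv (deriv \<phi>)) \<psi>)"
   using U[of 2 0] m4 t unfolding twd_def by (auto simp: numeral_2_eq_2)
  also have "... = ip R (Gy c d (U 0 2)) (tensor (deriv (deriv \<phi>)) \<psi>)"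
   by (rule ip_cong_sq[OF repr_y(1) _ sq(3) Gsq(2) T[OF \<phi>2] T[OF \<phi>2]]) simp
  also have "... = ip R (U 0 2) (tensor (deriv (deriv \<phi>)) \<eta>)"
   using ip_Gy_sym[OF cd sq(4) T[OF \<phi>2]] by (simp add: G)
  also have "... = - ip R (U 1 2) (tensor (deriv \<phi>) \<eta>)" using ip_deriv_x[OF _ xp(2), of 0 2] m4 by simp
  also have "... = ip R (U 2 2) (tensor \<phi> \<eta>)" using ip_deriv_x[OF _ xp(1), of 1 2] m4 by (simp add: numeral_2_eq_2)
  also have "... = ip R (Gy c d (U 2 2)) (tensor \<phi> \<psi>)"
   using ip_Gy_sym[OF cd sq(2) T[OF t(1)]] by (simp add: G)
  finally have "ip R (%s. U 2 0 s - Gy c d (U 2 2) s) (tensor \<phi> \<psi>) = 0"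
   by (simp add: ip_diff_left[OF sq(1) Gsq(1) T[OF t(1)]])
  then show "(LINT p|R. (U 2 0 p - Gy c d (U 2 2) p)*tensor \<phi> \<psi> p) = 0" by (simp add: ip_def)
 qed
 then show ?thesis by eventually_elim simp
qed

lemma mixed_y: "4 <= m ==> AE s in R. U 0 2 s = Gx a b (U 2 2) s"
 using AE_sw[OF weak_derivs.mixed_x[OF swapped]] by (simp add: Ly_sw sw_def)

end

lemma has_weak_pd_weak_pd: "has_weak_pd \<Omega> i j u g ==> has_weak_pd \<Omega> i j u (weak_pd \<Omega> i j u)"
 unfolding weak_pd_def by (rule someI[of "%g. has_weak_pd \<Omega> i j u g"])

text \<open>The derivative picked by choice may be exchanged for any known one, as weak derivatives
  are unique almost everywhere.\<close>

lemma brep_weak_pd: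
 assumes "has_weak_pd (rect a b c d) i j u g" "brep a b c d g g'"
 shows "brep a b c d (weak_pd (rect a b c d) i j u) g'"
proof -
 note w = has_weak_pd_weak_pd[OF assms(1)]
 obtain u' w' where b: "brep a b c d u u'" "brep a b c d (weak_pd (rect a b c d) i j u) w'" using has_weak_pd_brep[OF w] .
 have "AE p in rm a b c d. w' p = g' p"
  by (rule twd_unique[OF has_weak_pd_twd[OF w b] has_weak_pd_twd[OF assms(1) b(1) assms(2)]])
 then show ?thesis by (rule brep_change[OF b(2) _ brep_sq[OF assms(2)]])
qed

lemma finite_multi_indices: "finite {(i, j). i + j <= (m :: nat)}"
 by (rule finite_subset[of _ "{..m} \<times> {..m}"]) auto

lemma sobolev_norm_ge:
 assumes "has_weak_pd (rect a b c d) i j v g" "brep a b c d g g'" "i + j <= m"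
 shows "nrm (rm a b c d) g' <= sobolev_norm (rect a b c d) m v"
proof -
 let ?I = "%(i, j). \<integral>p. (weak_pd (rect a b c d) i j v p)\<^sup>2 \<partial>lebesgue_on (rect a b c d)"
 have "(nrm (rm a b c d) g')\<^sup>2 = ?I (i, j)" using brep_nrm[OF brep_weak_pd[OF assms(1,2)]] by simp
 also have "... <= sum ?I {(i, j). i + j <= m}"
  using assms(3) by (intro member_le_sum finite_multi_indices) auto
 finally show ?thesis unfolding sobolev_norm_def by (rule real_le_rsqrt)
qed

lemma sobolev_norm_le:
 assumes "!!i j. i + j <= m ==> has_weak_pd (rect a b c d) i j v (g i j) \<and> g i j \<in> sqint (rm a b c d)"
 shows "sobolev_norm (rect a b c d) m v <= (\<Sum>(i, j)\<in>{(i, j). i + j <= m}. nrm (rm a b c d) (g i j))"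
proof -
 have eq: "(LINT p|lebesgue_on (rect a b c d). (weak_pd (rect a b c d) i j v p)\<^sup>2) = (nrm (rm a b c d) (g i j))^2" if "i + j <= m" for i j
  using brep_nrm[OF brep_weak_pd[OF _ brep_self]] assms[OF that] by blast
 have "sobolev_norm (rect a b c d) m v = L2_set (%(i, j). nrm (rm a b c d) (g i j)) {(i, j). i + j <= m}"
  unfolding sobolev_norm_def L2_set_def using eq
  by (intro arg_cong[where f=sqrt] sum.cong) auto
 also have "... <= (\<Sum>(i, j)\<in>{(i, j). i + j <= m}. nrm (rm a b c d) (g i j))"
  by (rule L2_set_le_sum) (auto simp: nrm_nonneg)
 finally show ?thesis .
qed

lemma has_weak_pd_00: "brep a b c d u u' ==> brep a b c d g u' ==> has_weak_pd (rect a b c d) 0 0 u g"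
 using has_weak_pd_iff[of a b c d u u' g u' 0 0] by simp

lemma has_weak_pd_test:
 assumes "a < b" "c < d" and t: "test_function (rect a b c d) \<phi>"
 shows "has_weak_pd (rect a b c d) 1 0 \<phi> (partial_dx \<phi>)" "has_weak_pd (rect a b c d) 0 1 \<phi> (partial_dy \<phi>)"
proof -
 have x: "ip (rm a b c d) \<phi> (partial_dx \<psi>) = - ip (rm a b c d) (partial_dx \<phi>) \<psi>"
  if "a < b" and t: "test_function (rect a b c d) \<phi>" and s: "test_function (rect a b c d) \<psi>" for a b c d \<phi> \<psi>
 proof -
  note xp = xpair_test[OF \<open>a < b\<close> t]
  note D = xpair_sqint[OF xp]
  have "AE p in rm a b c d. p \<in> rect a b c d" by (simp add: AE_rm_iff)
  then have eq: "AE p in rm a b c d. \<phi> p = Lx (mu a b) Ik (partial_dx \<phi>) p"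
  proof eventually_elim
   case (elim p)
   then show ?case using xp unfolding xpair_def by (cases p) (auto simp: rect_def Lx_def)
  qed
  note D' = xpair_sqint[OF xpair_test[OF \<open>a < b\<close> s]]
  have "ip (rm a b c d) \<phi> (partial_dx \<psi>) = ip (rm a b c d) (Lx (mu a b) Ik (partial_dx \<phi>)) (partial_dx \<psi>)"
   using \<open>a < b\<close> by (intro ip_cong_sq[OF eq] D D' Lx_sqint) auto
  then show ?thesis using ip_xpair_anti[OF \<open>a < b\<close> xpair_test[OF \<open>a < b\<close> s] D(2)] by simp
 qed
 note sq = test_function_sqint[OF t] test_function_sqint[OF test_fun_partial(1)[OF t]] test_function_sqint[OF test_fun_partial(2)[OF t]]
 show "has_weak_pd (rect a b c d) 1 0 \<phi> (partial_dx \<phi>)"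
  unfolding has_weak_pd_iff[OF brep_self[OF sq(1)] brep_self[OF sq(2)]] using x[OF assms(1) t] by simp
 have "ip (rm a b c d) \<phi> (partial_dy \<psi>) = - ip (rm a b c d) (partial_dy \<phi>) \<psi>" if s: "test_function (rect a b c d) \<psi>" for \<psi>
  using x[OF assms(2) sw_test(1)[OF t] sw_test(1)[OF s]] unfolding sw_test(2)[OF t] sw_test(2)[OF s]
  by (simp add: ip_sw test_fun_borel[OF t] test_fun_borel[OF s]
    test_fun_borel[OF test_fun_partial(2)[OF t]] test_fun_borel[OF test_fun_partial(2)[OF s]])
 then show "has_weak_pd (rect a b c d) 0 1 \<phi> (partial_dy \<phi>)"
  unfolding has_weak_pd_iff[OF brep_self[OF sq(1)] brep_self[OF sq(3)]] by simp
qed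

lemma approx10_sobolev10:
 assumes ab: "a < b" and cd: "c < d" and u: "u \<in> sobolev10 (rect a b c d)" and bu: "brep a b c d u u'"
 shows "has_weak_pd (rect a b c d) 1 0 u g ==> brep a b c d g g' ==> approx10 a b c d u' g'"
  and "has_weak_pd (rect a b c d) 0 1 u g ==> brep a b c d g g' ==> approx10 c d a b (sw u') (sw g')"
proof -
 have *: "\<exists>\<phi>. test_function (rect a b c d) \<phi> \<and> nrm (rm a b c d) (%p. u' p - \<phi> p) < \<epsilon> \<and>
   nrm (rm a b c d) (%p. g' p - D \<phi> p) < \<epsilon>"
  if e: "0 < \<epsilon>" and g: "has_weak_pd (rect a b c d) i j u g" "brep a b c d g g'" and ij: "i + j <= 1"
   and D: "!!\<phi>. test_function (rect a b c d) \<phi> ==> has_weak_pd (rect a b c d) i j \<phi> (D \<phi>) \<and> test_function (rect a b c d) (D \<phi>)" for \<epsilon> i j D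
 proof -
  obtain \<phi> where t: "test_function (rect a b c d) \<phi>" "sobolev_norm (rect a b c d) 1 (%p. u p - \<phi> p) < \<epsilon>"
   using u e unfolding sobolev10_def by blast
  have b\<phi>: "brep a b c d \<phi> \<phi>" "brep a b c d (D \<phi>) (D \<phi>)" using test_function_sqint brep_self t D by blast+
  note b = brep_diff[OF bu b\<phi>(1)] 
  have "nrm (rm a b c d) (%p. u' p - \<phi> p) <= sobolev_norm (rect a b c d) 1 (%p. u p - \<phi> p)"
   by (rule sobolev_norm_ge[OF has_weak_pd_00[OF b b] b]) simp
  moreover have "nrm (rm a b c d) (%p. g' p - D \<phi> p) <= sobolev_norm (rect a b c d) 1 (%p. u p - \<phi> p)"
   by (rule sobolev_norm_ge[OF has_weak_pd_diff[OF g(1) conjunct1[OF D[OF t(1)]]] brep_diff[OF g(2) b\<phi>(2)] ij])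
  ultimately show ?thesis using t by (intro exI[of _ \<phi>]) auto
 qed
 show "approx10 a b c d u' g'" if "has_weak_pd (rect a b c d) 1 0 u g" "brep a b c d g g'"
  unfolding approx10_def using *[OF _ that, of _ partial_dx] has_weak_pd_test(1)[OF ab cd] test_fun_partial(1) by simp
 show "approx10 c d a b (sw u') (sw g')" if g: "has_weak_pd (rect a b c d) 0 1 u g" "brep a b c d g g'"
  unfolding approx10_def
 proof (intro allI impI)
  fix \<epsilon> :: real assume e: "0 < \<epsilon>"
  obtain \<phi> where \<phi>: "test_function (rect a b c d) \<phi>" "nrm (rm a b c d) (%p. u' p - \<phi> p) < \<epsilon>"
   "nrm (rm a b c d) (%p. g' p - partial_dy \<phi> p) < \<epsilon>"
   using *[OF e g, of partial_dy] has_weak_pd_test(2)[OF ab cd] test_fun_partial(2) by auto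
  have m: "is_borel u'" "is_borel g'" "is_borel \<phi>" "is_borel (partial_dy \<phi>)"
   using brep_sq[OF bu] brep_sq[OF g(2)] sqint_borel test_fun_borel \<phi>(1) test_fun_partial(2) by blast+
  have "nrm (rm c d a b) (%p. sw u' p - sw \<phi> p) < \<epsilon>" "nrm (rm c d a b) (%p. sw g' p - sw (partial_dy \<phi>) p) < \<epsilon>"
   using nrm_sw[of "%p. u' p - \<phi> p" c d a b] nrm_sw[of "%p. g' p - partial_dy \<phi> p" c d a b] \<phi>(2,3) m by (auto simp: sw_def)
  then show "\<exists>\<phi>. test_function (rect c d a b) \<phi> \<and> nrm (rm c d a b) (%p. sw u' p - \<phi> p) < \<epsilon> \<and>
    nrm (rm c d a b) (%p. sw g' p - partial_dx \<phi> p) < \<epsilon>"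
   using sw_test[OF \<phi>(1)] by (intro exI[of _ "sw \<phi>"]) simp
 qed
qed

lemma sobolev_weak_derivs:
 assumes ab: "a < b" and cd: "c < d" and m: "2 <= m" and u: "u \<in> sobolev (rect a b c d) m" and u0: "u \<in> sobolev10 (rect a b c d)"
 obtains U where "weak_derivs a b c d m U" "brep a b c d u (U 0 0)"
  "!!i j. i + j <= m ==> has_weak_pd (rect a b c d) i j u (U i j)"
  "!!i j. i + j <= m ==> brep a b c d (weak_pd (rect a b c d) i j u) (U i j)"
  "!!i j. i + j <= m ==> nrm (rm a b c d) (U i j) <= sobolev_norm (rect a b c d) m u"
proof -
 obtain u' where u': "brep a b c d u u'" using u brep_exists[of u a b c d] unfolding sobolev_def by blast
 have w: "has_weak_pd (rect a b c d) i j u (weak_pd (rect a b c d) i j u)" if "i + j <= m" for i j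
  using u that has_weak_pd_weak_pd unfolding sobolev_def by blast
 \<comment> \<open>At index (0, 0) a representative of u itself is taken instead of the chosen
   derivative of order 0, so that the boundary values and the equation refer to the same
   function.\<close>
 define U where "U i j = (if i = 0 \<and> j = 0 then u' else SOME g. brep a b c d (weak_pd (rect a b c d) i j u) g)" for i j
 have b: "brep a b c d (weak_pd (rect a b c d) i j u) (U i j)" if ij: "i + j <= m" for i j
 proof (cases "i = 0 \<and> j = 0")
  case True
  then show ?thesis using brep_weak_pd[OF has_weak_pd_00[OF u' u'] u'] by (simp add: U_def)
 next
  case False
  have "\<exists>g. brep a b c d (weak_pd (rect a b c d) i j u) g"
   using w[OF ij] brep_exists unfolding has_weak_pd_def by blast
  from someI_ex[OF this] False show ?thesis by (auto simp: U_def)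
 qed
 have u00: "brep a b c d u (U 0 0)" using u' by (simp add: U_def)
 have wU: "has_weak_pd (rect a b c d) i j u (U i j)" if "i + j <= m" for i j
  using w[OF that] unfolding has_weak_pd_iff[OF u' b[OF that]] has_weak_pd_iff[OF u' brep_self[OF brep_sq[OF b[OF that]]]] .
 show thesis
 proof (rule that[of U])
  show "weak_derivs a b c d m U"
  proof
   show "twd a b c d i j (U 0 0) (U i j)" if "i + j <= m" for i j by (rule has_weak_pd_twd[OF w[OF that] u00 b[OF that]])
   show "approx10 a b c d (U 0 0) (U 1 0)" using approx10_sobolev10(1)[OF ab cd u0 u00 w[of 1 0] b[of 1 0]] m by simp
   show "approx10 c d a b (sw (U 0 0)) (sw (U 0 1))" using approx10_sobolev10(2)[OF ab cd u0 u00 w[of 0 1] b[of 0 1]] m by simp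
  qed (use ab cd m in auto)
  show "nrm (rm a b c d) (U i j) <= sobolev_norm (rect a b c d) m u" if "i + j <= m" for i j
   by (rule sobolev_norm_ge[OF w[OF that] b[OF that] that])
 qed (use u00 b wU in auto)
qed

lemma (in weak_derivs) ip_deriv_test:
 assumes "i + j < m" and t: "test_function (rect a b c d) \<phi>"
 shows "ip R (U i j) (partial_dx \<phi>) = - ip R (U (Suc i) j) \<phi>"
  and "ip R (U i j) (partial_dy \<phi>) = - ip R (U i (Suc j)) \<phi>"
proof -
 show "ip R (U i j) (partial_dx \<phi>) = - ip R (U (Suc i) j) \<phi>" by (rule ip_deriv_x[OF assms(1) xpair_test[OF ab t]])
 have "j + i < m" using assms(1) by simp
 from weak_derivs.ip_deriv_x[OF swapped this xpair_test[OF cd sw_test(1)[OF t]]]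
 show "ip R (U i j) (partial_dy \<phi>) = - ip R (U i (Suc j)) \<phi>"
  unfolding sw_test(2)[OF t]
  using assms(1) U_sq sqint_borel test_fun_borel[OF t] test_fun_borel[OF test_fun_partial(2)[OF t]]
  by (simp add: ip_sw)
qed

text \<open>In the equation a weak derivative is taken of \<alpha> times a chosen weak derivative.
  The iterated choice is identified with \<alpha> times the second derivative of the family by
  testing.\<close>

lemma bvp_rhs:
 assumes wd: "weak_derivs a b c d m U" and bu: "brep a b c d u (U 0 0)"
  and b: "!!i j. i + j <= m ==> brep a b c d (weak_pd (rect a b c d) i j u) (U i j)"
  and f: "solves_bvp (rect a b c d) \<alpha> \<beta> \<gamma> f u"
 shows "AE p in rm a b c d. f p = Lop a b c d \<alpha> \<beta> \<gamma> (U 2 0) (U 0 2) p"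
proof -
 interpret weak_derivs a b c d m U by (rule wd)
 let ?d = "weak_pd (rect a b c d)"
 have *: "brep a b c d (?d i j (%q. \<alpha> * ?d i j u q)) (%p. \<alpha>*V p)"
  if "i + j = 1" "V \<in> sqint R" and ip: "!!\<phi>. test_function (rect a b c d) \<phi> ==> ip R (U i j) ((partial_dx ^^ i) ((partial_dy ^^ j) \<phi>)) = - ip R V \<phi>" for i j V
 proof (rule brep_weak_pd[OF _ brep_self])
  show sq: "(%p. \<alpha>*V p) \<in> sqint R" using that by auto
  have "brep a b c d (%q. \<alpha> * ?d i j u q) (%p. \<alpha>*U i j p)"
   using b[of i j] m that(1) unfolding brep_def by auto
  note iff = has_weak_pd_iff[OF this brep_self[OF sq]]
  show "has_weak_pd (rect a b c d) i j (%q. \<alpha> * ?d i j u q) (%p. \<alpha>*V p)"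
   unfolding iff using ip that(1) by (simp add: ip_cmult_left)
 qed
 have x: "brep a b c d (?d 1 0 (%q. \<alpha> * ?d 1 0 u q)) (%p. \<alpha>*U 2 0 p)"
  by (rule *) (use U_sq[of 2 0] m ip_deriv_test(1)[of 1 0] in "auto simp: numeral_2_eq_2")
 have y: "brep a b c d (?d 0 1 (%q. \<alpha> * ?d 0 1 u q)) (%p. \<alpha>*U 0 2 p)"
  by (rule *) (use U_sq[of 0 2] m ip_deriv_test(2)[of 0 1] in "auto simp: numeral_2_eq_2")
 have "AE p in R. elliptic_op (weak_pd (rect a b c d) 1 0) (weak_pd (rect a b c d) 0 1) \<alpha> \<beta> \<gamma> u p = f p"
  using f unfolding solves_bvp_def AE_leb_iff by blast
 moreover have "AE p in R. weak_pd (rect a b c d) 1 0 u p = U 1 0 p" "AE p in R. weak_pd (rect a b c d) 0 1 u p = U 0 1 p"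
  using b[of 1 0] b[of 0 1] m by (auto simp: brep_def)
 moreover note x[unfolded brep_def, THEN conjunct2] y[unfolded brep_def, THEN conjunct2] bu[unfolded brep_def, THEN conjunct2]
  repr_x repr_y(2)
 ultimately show ?thesis
  by eventually_elim (simp add: elliptic_op_def Lop_def distrib_left)
qed

text \<open>Weak derivatives of trial functions come from integration by parts with the Green
  kernels, without summing boundary terms over elements.\<close>

lemma has_weak_pd_GG:
 assumes ab: "a < b" and cd: "c < d" and z: "z \<in> sqint (rm a b c d)" and w: "brep a b c d w (Gx a b (Gy c d z))"
 shows "has_weak_pd (rect a b c d) 0 0 w (Gx a b (Gy c d z))" "has_weak_pd (rect a b c d) 1 0 w (Gx' a b (Gy c d z))"
  "has_weak_pd (rect a b c d) 0 1 w (Gy' c d (Gx a b z))" "has_weak_pd (rect a b c d) 2 0 w (Gy c d z)"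
  "has_weak_pd (rect a b c d) 0 2 w (Gx a b z)" "has_weak_pd (rect a b c d) 1 1 w (Gx' a b (Gy' c d z))"
proof -
 let ?R = "rm a b c d"
 note k = bkern_Gk[OF ab] bkern_Gk[OF cd] bkern_G1k[OF ab] bkern_G1k[OF cd]
 note zi = rm.sqint_int[OF z]
 have c1: "Gx a b (Gy c d z) = Gy c d (Gx a b z)" by (rule Lx_Ly_commute[OF k(1,2) zi])
 have c2: "Gx' a b (Gy c d z) = Gy c d (Gx' a b z)" by (rule Lx_Ly_commute[OF k(3,2) zi])
 have c3: "Gx' a b (Gy' c d z) = Gy' c d (Gx' a b z)" by (rule Lx_Ly_commute[OF k(3,4) zi])
 note sq = Gx_sqint[OF ab] Gx'_sqint[OF ab] Gy_sqint[OF cd] Gy'_sqint[OF cd] z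
 note wi = has_weak_pd_iff[OF w brep_self]
 note xp = xpair_test[OF ab] and yp = ypair_test[OF cd] and t = test_fun_partial
 have x1: "ip ?R (Gx a b g) (partial_dx \<phi>) = - ip ?R (Gx' a b g) \<phi>"
  "ip ?R (Gx' a b g) (partial_dx \<phi>) = - ip ?R g \<phi>"
  "ip ?R (Gy c d g) (partial_dy \<phi>) = - ip ?R (Gy' c d g) \<phi>"
  "ip ?R (Gy' c d g) (partial_dy \<phi>) = - ip ?R g \<phi>"
  if "g \<in> sqint ?R" "test_function (rect a b c d) \<phi>" for g \<phi>
  using ip_xpair_Gx[OF ab xp[OF that(2)] that(1)] ip_xpair_Gx'[OF ab xp[OF that(2)] that(1)]
   ip_ypair_Gy[OF cd yp[OF that(2)] that(1)] ip_ypair_Gy'[OF cd yp[OF that(2)] that(1)] .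
 show "has_weak_pd (rect a b c d) 0 0 w (Gx a b (Gy c d z))" by (rule has_weak_pd_00[OF w brep_self]) (intro sq)
 show "has_weak_pd (rect a b c d) 1 0 w (Gx' a b (Gy c d z))" by (subst wi) (simp_all add: x1 sq)
 show "has_weak_pd (rect a b c d) 0 1 w (Gy' c d (Gx a b z))" by (subst wi) (simp_all add: x1 sq c1)
 show "has_weak_pd (rect a b c d) 2 0 w (Gy c d z)" by (subst wi) (simp_all add: x1 sq t  numeral_2_eq_2)
 show "has_weak_pd (rect a b c d) 0 2 w (Gx a b z)" by (subst wi) (simp_all add: x1 sq t c1  numeral_2_eq_2)
 show "has_weak_pd (rect a b c d) 1 1 w (Gx' a b (Gy' c d z))" by (subst wi) (simp_all add: x1 sq t c2 c3 numeral_2_eq_2)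
qed

section \<open>The finite element spaces\<close>

text \<open>Interpolation turns a polynomial into a linear function of its values at card A points;
  see \<open>V1_samples\<close>.\<close>

lemma lagrange_exists:
 assumes A: "finite (A :: real set)"
 shows "\<exists>L. \<forall>p. degree p < card A --> p = (\<Sum>t\<in>A. smult (poly p t) (L t))"
proof -
 define L where "L t = smult (inverse (\<Prod>s\<in>A - {t}. t - s)) (\<Prod>s\<in>A - {t}. [:- s, 1:])" for t
 have Lv: "poly (L t) s = (if s = t then 1 else 0)" if "t \<in> A" "s \<in> A" for s t
 proof (cases "s = t")
  case True
  then show ?thesis using A by (simp add: L_def poly_prod)
 next
  case False
  then have "(\<Prod>r\<in>A - {t}. s - r) = 0" using that A by auto
  then show ?thesis using False by (simp add: L_def poly_prod)
 qed
 have Ld: "degree (L t) < card A" if "t \<in> A" for t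
 proof -
  have "degree (\<Prod>s\<in>A - {t}. [:- s, 1:]) <= (\<Sum>s\<in>A - {t}. 1)"
   by (rule order_trans[OF degree_prod_sum_le]) (use A in auto)
  also have "... = card A - 1" using that A by simp
  finally have "degree (\<Prod>s\<in>A - {t}. [:- s, 1:]) <= card A - 1" .
  moreover have "0 < card A" using that A by (auto simp: card_gt_0_iff)
  moreover have "degree (L t) <= degree (\<Prod>s\<in>A - {t}. [:- s, 1:])" unfolding L_def by (rule degree_smult_le)
  ultimately show ?thesis by simp
 qed
 have "p = (\<Sum>t\<in>A. smult (poly p t) (L t))" if "degree p < card A" for p
 proof (rule poly_eqI_degree[of A])
  show "poly p s = poly (\<Sum>t\<in>A. smult (poly p t) (L t)) s" if "s \<in> A" for s
  proof -
   have "poly (\<Sum>t\<in>A. smult (poly p t) (L t)) s = (\<Sum>t\<in>A. if s = t then poly p t else 0)"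
    unfolding poly_sum by (intro sum.cong) (use Lv that in auto)
   then show ?thesis using that A by simp
  qed
  show "degree (\<Sum>t\<in>A. smult (poly p t) (L t)) < card A"
   using Ld \<open>degree p < card A\<close> by (intro degree_sum_less) (auto intro: le_less_trans[OF degree_smult_le])
 qed (use that in auto)
 then show ?thesis by blast
qed

lemma kop_sum:
 assumes K: "bkern K" and e: "!!i. i \<in> I ==> integrable (mu a b) (e i)"
 shows "kop (mu a b) K (%s. \<Sum>i\<in>I. c i*e i s) x = (\<Sum>i\<in>I. c i*kop (mu a b) K (e i) x)"
proof -
 have "integrable (mu a b) (%s. K x s*e i s)" if "i \<in> I" for i
  using integrable_kmult[OF fin_mu sets_mu K e[OF that]] .
 then have "(LINT s|mu a b. (\<Sum>i\<in>I. c i*(K x s*e i s))) = (\<Sum>i\<in>I. c i*kop (mu a b) K (e i) x)"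
  unfolding kop_def by (simp add: integral_sum)
 then show ?thesis by (simp add: kop_def sum_distrib_left mult.left_commute)
qed

context mesh1
begin

abbreviation ccell :: "nat => real set" where "ccell i \<equiv> {X (i-1)..X i}"

lemma ccell_cover: "{a..b} = (\<Union>i\<in>{1..M}. ccell i)"
proof
 show "{a..b} \<subseteq> (\<Union>i\<in>{1..M}. ccell i)"
 proof
  fix x assume x: "x \<in> {a..b}"
  show "x \<in> (\<Union>i\<in>{1..M}. ccell i)"
  proof (cases "x \<in> X ` {..M}")
   case True
   then obtain j where j: "j <= M" "x = X j" by auto
   show ?thesis
   proof (cases "j = 0")
    case True
    then show ?thesis using X_less[of 1] M_pos j by (intro UN_I[of 1]) auto
   next
    case False
    then show ?thesis using X_less[of j] j by (intro UN_I[of j]) auto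
   qed
  next
   case False
   moreover have "x \<noteq> a" "x \<noteq> b" using False X_0 X_M by force+
   ultimately show ?thesis using cell_exists[of x] x by force
  qed
 qed
 show "(\<Union>i\<in>{1..M}. ccell i) \<subseteq> {a..b}" using cell_bounds by force
qed

lemma continuous_on_ccells:
 assumes "!!i x. i \<in> {1..M} ==> x \<in> ccell i ==> f x = poly (P i) x"
 shows "continuous_on {a..b} f"
 unfolding ccell_cover
proof (rule continuous_on_closed_Union)
 fix i assume i: "i \<in> {1..M}"
 show "continuous_on (ccell i) f"
  by (rule continuous_on_eq[of _ "poly (P i)"]) (use assms[OF i] in "auto intro!: continuous_intros")
qed auto

lemma ccell_left: "i \<in> {1..M} ==> a \<in> ccell i ==> i = 1"
 using X_mono[of 1 "i - 1"] X_less[of 1] X_0 M_pos by (cases "i = 1") force+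

lemma ccell_right: "i \<in> {1..M} ==> b \<in> ccell i ==> i = M"
 using X_mono[of i "M - 1"] X_less[of M] X_M M_pos by (cases "i = M") force+

text \<open>The trial space in one variable: the restrictions of a function of $V_h^0$ to interior
  coordinate lines are of this kind. Differentiability at the mesh points excludes kinks.\<close>

definition V1 :: "(real => real) => bool" where
 "V1 g \<longleftrightarrow> (\<forall>i\<in>{1..M}. \<exists>P. degree P <= Suc n \<and> (\<forall>x\<in>ccell i. g x = poly P x)) \<and>
   (\<forall>x. a < x --> x < b --> (\<exists>D. (g has_real_derivative D) (at x))) \<and> g a = 0 \<and> g b = 0"

text \<open>The derivative of g is continuous and, off the mesh points, an antiderivative of the
  piecewise second derivative g2. The boundary values give it mean zero, and
  \<open>green_unique\<close> applies.\<close>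

lemma V1_green:
 assumes P: "!!i x. i \<in> {1..M} ==> x \<in> ccell i ==> g x = poly (P i) x"
  and D: "!!x. a < x ==> x < b ==> \<exists>D. (g has_real_derivative D) (at x)" and z: "g a = 0" "g b = 0"
  and g2: "integrable (mu a b) g2" "!!i x. i \<in> {1..M} ==> x \<in> cell i ==> g2 x = poly (pderiv (pderiv (P i))) x"
  and x: "x \<in> {a..b}"
 shows "g x = green a b g2 x"
proof -
 \<comment> \<open>The derivative, continued to the end points by the outermost polynomials to be
   continuous on [a, b], and by 0 outside to be Borel measurable.\<close>
 define g1 where "g1 x = (if x \<notin> {a..b} then 0 else if x = a then poly (pderiv (P 1)) a else if x = b then poly (pderiv (P M)) b else deriv g x)" for x
 have Dg: "(g has_real_derivative g1 x) (at x)" if "a < x" "x < b" for x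
  using D[OF that] that by (auto simp: g1_def DERIV_imp_deriv)
 have g1: "g1 x = poly (pderiv (P i)) x" if i: "i \<in> {1..M}" and x: "x \<in> ccell i" for i x
 proof -
  consider "x = a" | "x = b" | "a < x" "x < b" using ccell_cover i x by force
  then show ?thesis
  proof cases
   case 1
   then show ?thesis using ccell_left i x ab by (auto simp: g1_def)
  next
   case 2
   then show ?thesis using ccell_right[OF i] x ab by (auto simp: g1_def)
  next
   case 3
   \<comment> \<open>At a mesh point the derivative of g restricts to the one-sided derivative of
     either neighbouring polynomial, since derivatives within a nondegenerate closed interval are
     unique. One g1 therefore fits both cells.\<close>
   have 1: "(g has_vector_derivative g1 x) (at x within cbox (X (i-1)) (X i))"
    using has_field_derivative_at_within[OF Dg[OF 3]] has_real_derivative_iff_has_vector_derivative by blast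
   have "(poly (P i) has_vector_derivative poly (pderiv (P i)) x) (at x within ccell i)"
    using has_field_derivative_at_within[OF poly_DERIV] has_real_derivative_iff_has_vector_derivative by blast
   then have 2: "(g has_vector_derivative poly (pderiv (P i)) x) (at x within cbox (X (i-1)) (X i))"
    unfolding cbox_interval by (rule has_vector_derivative_transform[OF x, rotated]) (use P i in auto)
   show ?thesis using vector_derivative_unique_within_closed_interval[OF X_less[OF i] _ 1 2] x by simp
  qed
 qed
 have cg: "continuous_on {a..b} g"
  by (rule continuous_on_ccells) (rule P)
 have cg1: "continuous_on {a..b} g1"
  by (rule continuous_on_ccells) (rule g1)
 obtain B where B: "!!x. x \<in> {a..b} ==> \<bar>g1 x\<bar> <= B"
  using compact_imp_bounded[OF compact_continuous_image[OF cg1 compact_Icc]] unfolding bounded_iff by force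
 have g1i: "integrable (mu a b) g1"
 proof (rule mu.integrable_const_bound)
  have "is_borel (%x. indicator {a..b} x *\<^sub>R g1 x)"
   by (rule borel_measurable_continuous_on_indicator[OF _ cg1]) simp
  moreover have "(%x. indicator {a..b} x *\<^sub>R g1 x) = g1" by (auto simp: fun_eq_iff g1_def indicator_def)
  ultimately show "g1 \<in> borel_measurable (mu a b)" by (simp add: mu_borel)
  show "AE x in mu a b. norm (g1 x) <= B" using AE_mu_Ioo by eventually_elim (use B in auto)
 qed
 have a1: "anti a b g1 x = g x" if "x \<in> {a..b}" for x
  using anti_of_deriv[OF finite.emptyI g1i cg _ that] Dg z by simp
 have a2: "anti a b g2 x = g1 x - g1 a" if "x \<in> {a..b}" for x
 proof (rule anti_of_deriv[OF _ g2(1) cg1 _ that])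
  show "finite (X ` {..M})" by simp
  fix x assume "x \<in> {a<..<b} - X ` {..M}"
  then obtain i where i: "i \<in> {1..M}" "x \<in> cell i" using cell_exists[of x] by auto
  have ev: "\<forall>\<^sub>F y in nhds x. g1 y = poly (pderiv (P i)) y"
   using eventually_nhds_in_open[OF open_greaterThanLessThan i(2)] by eventually_elim (use g1[OF i(1)] in auto)
  show "(g1 has_real_derivative g2 x) (at x)"
   unfolding g2(2)[OF i] by (subst DERIV_cong_ev[OF refl ev refl]) (rule poly_DERIV)
 qed
 have "anti a b g1 x = green a b g2 x"
 proof (rule green_unique(2)[OF ab g2(1) g1i _ _ x])
  show "AE x in mu a b. g1 x = g1 a + anti a b g2 x" using AE_mu_Ioo by eventually_elim (simp add: a2)
  show "(LINT x|mu a b. g1 x) = 0" using a1[of b] ab z by (simp add: integral_eq_anti_right[OF g1i])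
 qed
 then show ?thesis using a1[OF x] by simp
qed

lemma kop_comb: "bkern K ==> kop (mu a b) K (on.comb c) x = (\<Sum>J\<in>J1. c J*kop (mu a b) K (e1 J) x)"
 unfolding on.comb_def by (rule kop_sum) (use mu.sqint_int[OF e1_sqint] in auto)

text \<open>The coefficients of g'' in the orthonormal basis are fixed linear combinations of
  finitely many values of g. In two variables this allows expanding in x with coefficients that are
  values w(s, y), which are themselves trial functions of y.\<close>

lemma V1_samples:
 "\<exists>S \<nu>. finite S \<and> S \<subseteq> {a<..<b} \<and>
  (\<forall>g. V1 g --> (\<forall>x\<in>{a..b}. g x = (\<Sum>J\<in>J1. (\<Sum>t\<in>S. \<nu> J t*g t)*green a b (e1 J) x)))"
proof -
 \<comment> \<open>A polynomial of degree at most n + 1 is determined by n + 2 values. The points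
   lie inside the cell, hence off the boundary of the interval.\<close>
 have "\<forall>i\<in>{1..M}. \<exists>A. finite A \<and> card A = Suc (Suc n) \<and> A \<subseteq> cell i"
  using infinite_arbitrarily_large[OF infinite_Ioo[OF X_less]] by blast
 from bchoice[OF this] obtain A where A: "!!i. i \<in> {1..M} ==> finite (A i)" "!!i. i \<in> {1..M} ==> card (A i) = Suc (Suc n)"
  "!!i. i \<in> {1..M} ==> A i \<subseteq> cell i" by blast
 have "\<forall>i\<in>{1..M}. \<exists>L. \<forall>p. degree p <= Suc n --> p = (\<Sum>t\<in>A i. smult (poly p t) (L t))"
  using lagrange_exists[OF A(1)] A(2) by (simp add: less_Suc_eq_le)
 from bchoice[OF this] obtain L where L: "!!i p. i \<in> {1..M} ==> degree p <= Suc n ==> p = (\<Sum>t\<in>A i. smult (poly p t) (L i t))" by blast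
 define S where "S = (\<Union>i\<in>{1..M}. A i)"
 define \<Phi> where "\<Phi> J q = ip (mu a b) (%x. indicator (cell (fst J)) x*poly q x) (e1 J)" for J q
 \<comment> \<open>The coefficient that the second derivative of the Lagrange polynomial at t has on
   basis function J; sample points of other cells do not contribute.\<close>
 define \<nu> where "\<nu> J t = (if t \<in> A (fst J) then \<Phi> J (pderiv (pderiv (L (fst J) t))) else 0)" for J t
 have sq: "(%x. indicator (cell i) x*poly q x) \<in> sqint (mu a b)" for i q
 proof -
  obtain B where "\<forall>x. a <= x --> x <= b --> \<bar>poly q x\<bar> <= B" using poly_bounded_Icc by blast
  then show ?thesis by (intro bounded_sqint_mu[where B=B]) (auto simp: indicator_def intro: order_trans[OF abs_ge_zero])
 qed
 have main: "g x = (\<Sum>J\<in>J1. (\<Sum>t\<in>S. \<nu> J t*g t)*green a b (e1 J) x)" if g: "V1 g" and x: "x \<in> {a..b}" for g x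
 proof -
  have "\<forall>i\<in>{1..M}. \<exists>P. degree P <= Suc n \<and> (\<forall>x\<in>ccell i. g x = poly P x)" using g unfolding V1_def by (rule conjunct1)
  from bchoice[OF this] obtain P where P0: "\<forall>i\<in>{1..M}. degree (P i) <= Suc n \<and> (\<forall>x\<in>ccell i. g x = poly (P i) x)" by (rule exE)
  have P: "!!i. i \<in> {1..M} ==> degree (P i) <= Suc n" "!!i x. i \<in> {1..M} ==> x \<in> ccell i ==> g x = poly (P i) x"
   by (drule bspec[OF P0], erule conjunct1) (drule bspec[OF P0], drule conjunct2, erule bspec)
  define g2 where "g2 x = (\<Sum>i\<in>{1..M}. indicator (cell i) x*poly (pderiv (pderiv (P i))) x)" for x
  have g2: "g2 x = poly (pderiv (pderiv (P i))) x" if "i \<in> {1..M}" "x \<in> cell i" for i x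
  proof -
   have "g2 x = (\<Sum>i'\<in>{1..M}. if i' = i then poly (pderiv (pderiv (P i))) x else 0)"
    unfolding g2_def
   proof (rule sum.cong[OF refl])
    fix i' assume i': "i' \<in> {1..M}"
    have "x \<notin> cell i'" if "i' \<noteq> i" using cell_unique[OF i' \<open>i \<in> {1..M}\<close> _ \<open>x \<in> cell i\<close>] that by blast
    then show "indicator (cell i') x*poly (pderiv (pderiv (P i'))) x = (if i' = i then poly (pderiv (pderiv (P i))) x else 0)"
     using \<open>x \<in> cell i\<close> by (cases "i' = i") simp_all
   qed
   then show ?thesis using that by simp
  qed
  have g2sq: "g2 \<in> sqint (mu a b)" unfolding g2_def[abs_def] by (rule sqint_sum) (rule sq)
  have "pwpoly g2" unfolding pwpoly_def
  proof
   fix i assume i: "i \<in> {1..M}"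
   have "degree (pderiv (pderiv (P i))) < n" using P(1)[OF i] n_ge by (simp add: degree_pderiv)
   then show "\<exists>q. degree q < n \<and> (\<forall>x\<in>cell i. g2 x = poly q x)" using g2[OF i] by blast
  qed
  from AE_pwpoly_comb[OF this] obtain c where c: "AE x in mu a b. g2 x = on.comb c x" by blast
  have cJ: "c J = (\<Sum>t\<in>S. \<nu> J t*g t)" if J: "J \<in> J1" for J
  proof -
   let ?i = "fst J"
   have i: "?i \<in> {1..M}" using J by (auto simp: J1_def)
   have "c J = ip (mu a b) g2 (e1 J)"
    using ip_cong_sq[OF c _ g2sq on.comb_sqint on.e_sqint[OF J] on.e_sqint[OF J]] on.ip_comb_e[OF J, of c] by simp
   also have "... = \<Phi> J (pderiv (pderiv (P ?i)))"
    unfolding \<Phi>_def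
   proof (unfold ip_def, rule Bochner_Integration.integral_cong[OF refl])
    fix x
    show "g2 x*e1 J x = indicator (cell ?i) x*poly (pderiv (pderiv (P ?i))) x*e1 J x"
     using g2[OF i] by (cases "x \<in> cell ?i") (auto simp: e1_def split_beta)
   qed
   also have "P ?i = (\<Sum>t\<in>A ?i. smult (g t) (L ?i t))"
    using L[OF i P(1)[OF i]] P(2)[OF i] A(3)[OF i] by (smt (verit) greaterThanLessThan_subseteq_atLeastAtMost_iff order_refl subsetD sum.cong)
   also have "\<Phi> J (pderiv (pderiv (\<Sum>t\<in>A ?i. smult (g t) (L ?i t)))) = (\<Sum>t\<in>A ?i. \<nu> J t*g t)"
   proof -
    have "(%x. indicator (cell ?i) x*poly (pderiv (pderiv (\<Sum>t\<in>A ?i. smult (g t) (L ?i t)))) x) =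
      (%x. \<Sum>t\<in>A ?i. g t*(indicator (cell ?i) x*poly (pderiv (pderiv (L ?i t))) x))"
     by (simp add: fun_eq_iff pderiv_sum pderiv_smult poly_sum sum_distrib_left mult.left_commute)
    moreover have "ip (mu a b) (%x. \<Sum>t\<in>A ?i. g t*(indicator (cell ?i) x*poly (pderiv (pderiv (L ?i t))) x)) (e1 J) =
      (\<Sum>t\<in>A ?i. ip (mu a b) (%x. g t*(indicator (cell ?i) x*poly (pderiv (pderiv (L ?i t))) x)) (e1 J))"
     by (rule ip_sum_left) (intro sqint_cmult sq e1_sqint)+
    ultimately show ?thesis by (simp add: \<Phi>_def \<nu>_def ip_cmult_left mult.commute)
   qed
   also have "... = (\<Sum>t\<in>S. \<nu> J t*g t)"
    by (rule sum.mono_neutral_left) (use A(1) i in \<open>auto simp: S_def \<nu>_def\<close>)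
   finally show ?thesis .
  qed
  have "g x = green a b g2 x"
  proof (rule V1_green[OF P(2) _ _ _ _ g2 x])
   show "integrable (mu a b) g2" by (rule mu.sqint_int[OF g2sq])
  qed (use g in "auto simp: V1_def")
  also have "... = green a b (on.comb c) x"
   by (rule kop_cong_AE[OF c]) (use sqint_measurable[OF g2sq] sqint_measurable[OF on.comb_sqint] bkern_Gk[OF ab] in "auto simp: mu_borel")
  also have "... = (\<Sum>J\<in>J1. (\<Sum>t\<in>S. \<nu> J t*g t)*green a b (e1 J) x)"
   unfolding kop_comb[OF bkern_Gk[OF ab]] using cJ by simp
  finally show ?thesis .
 qed
 have "finite S" "S \<subseteq> {a<..<b}" using A(1,3) cell_bounds by (fastforce simp: S_def)+
 then show ?thesis using main by blast
qed

lemma anti_ccell: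
 assumes f: "integrable (mu a b) f" and i: "i \<in> {1..M}" and q: "!!x. x \<in> cell i ==> f x = poly q x"
 shows "\<exists>Q. pderiv Q = q \<and> degree Q <= Suc (degree q) \<and> (\<forall>x\<in>ccell i. anti a b f x = poly Q x)"
proof -
 obtain Q where Q: "pderiv Q = q" "degree Q <= Suc (degree q)" using pderiv_surj by blast
 define C where "C = anti a b f (X (i-1)) - poly Q (X (i-1))"
 have "anti a b f x = poly (Q + [:C:]) x" if x: "x \<in> ccell i" for x
 proof -
  have "anti (X (i-1)) (X i) f x = anti (X (i-1)) (X i) (poly q) x"
  proof (rule kop_cong_AE)
   show "AE s in mu (X (i-1)) (X i). f s = poly q s" using AE_mu_Ioo by eventually_elim (simp add: q)
  qed (use f borel_measurable_integrable mu_borel in auto)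
  then show ?thesis using anti_split[OF f cell_bounds[OF i] x] anti_poly[OF Q(1) x] by (simp add: C_def)
 qed
 moreover have "pderiv (Q + [:C:]) = q" using Q by (simp add: pderiv_add)
 moreover have "degree (Q + [:C:]) <= Suc (degree q)" using Q by (intro degree_add_le) auto
 ultimately show ?thesis by blast
qed

lemma e1_pwpoly: "J \<in> J1 ==> pwpoly (e1 J)"
 using pwpoly_comb_self[of "%J'. if J' = J then 1 else 0"]
 by (simp add: on.comb_def if_distrib[of "%c. c*_"] cong: if_cong)

text \<open>Twice integrating a basis function gives one polynomial on each closed cell, and the
  same polynomial describes its Green potential with both derivatives.\<close>

lemma green_e1:
 assumes J: "J \<in> J1"
 obtains B where "!!i. i \<in> {1..M} ==> degree (B i) <= Suc n"
  "!!i x. i \<in> {1..M} ==> x \<in> ccell i ==> green a b (e1 J) x = poly (B i) x"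
  "!!i x. i \<in> {1..M} ==> x \<in> ccell i ==> green' a b (e1 J) x = poly (pderiv (B i)) x"
  "!!i x. i \<in> {1..M} ==> x \<in> cell i ==> e1 J x = poly (pderiv (pderiv (B i))) x"
proof -
 note fi = mu.sqint_int[OF e1_sqint[of J a b]]
 have "\<exists>B. degree B <= Suc n \<and> (\<forall>x\<in>ccell i. green a b (e1 J) x = poly B x) \<and>
   (\<forall>x\<in>ccell i. green' a b (e1 J) x = poly (pderiv B) x) \<and> (\<forall>x\<in>cell i. e1 J x = poly (pderiv (pderiv B)) x)"
  if i: "i \<in> {1..M}" for i
 proof -
  obtain q where q: "degree q < n" "!!x. x \<in> cell i ==> e1 J x = poly q x"
   using e1_pwpoly[OF J] i unfolding pwpoly_def by blast
  obtain Q where Q: "pderiv Q = q" "degree Q <= Suc (degree q)" "!!x. x \<in> ccell i ==> anti a b (e1 J) x = poly Q x"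
   using anti_ccell[OF fi i q(2)] by blast
  define Q' where "Q' = Q - [:(LINT s|mu a b. (b-s)*e1 J s)/(b-a):]"
  have Q': "green' a b (e1 J) x = poly Q' x" if "x \<in> ccell i" for x
   using Q(3)[OF that] green'_eq[OF ab fi] by (simp add: Q'_def)
  have pQ': "pderiv Q' = q" using Q(1) by (simp add: Q'_def pderiv_diff)
  have dQ': "degree Q' <= n" using Q(2) q(1) unfolding Q'_def by (intro degree_diff_le) auto
  obtain B where B: "pderiv B = Q'" "degree B <= Suc (degree Q')" "!!x. x \<in> ccell i ==> anti a b (green' a b (e1 J)) x = poly B x"
   using anti_ccell[OF integrable_kop[OF bkern_G1k[OF ab] fi] i, of Q'] Q' by auto
  have "green a b (e1 J) x = poly B x" if "x \<in> ccell i" for x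
   using B(3)[OF that] anti_green'[OF ab fi, of x] that cell_bounds[OF i] by auto
  then show ?thesis using B(1,2) Q' pQ' dQ' q(2) by (intro exI[of _ B]) auto
 qed
 then have "\<forall>i\<in>{1..M}. \<exists>B. degree B <= Suc n \<and> (\<forall>x\<in>ccell i. green a b (e1 J) x = poly B x) \<and>
   (\<forall>x\<in>ccell i. green' a b (e1 J) x = poly (pderiv B) x) \<and> (\<forall>x\<in>cell i. e1 J x = poly (pderiv (pderiv B)) x)" by (rule ballI)
 from bchoice[OF this] obtain B where B: "\<forall>i\<in>{1..M}. degree (B i) <= Suc n \<and> (\<forall>x\<in>ccell i. green a b (e1 J) x = poly (B i) x) \<and>
   (\<forall>x\<in>ccell i. green' a b (e1 J) x = poly (pderiv (B i)) x) \<and> (\<forall>x\<in>cell i. e1 J x = poly (pderiv (pderiv (B i))) x)" by (rule exE)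
 show thesis by (rule that[of B]; (drule bspec[OF B], elim conjE)) (assumption | erule bspec)+
qed

lemma continuous_green'_e1: "J \<in> J1 ==> continuous_on {a..b} (green' a b (e1 J))"
 by (erule green_e1) (rule continuous_on_ccells)

lemma DERIV_green_e1:
 assumes J: "J \<in> J1" and x: "a < x" "x < b"
 shows "(green a b (e1 J) has_real_derivative green' a b (e1 J) x) (at x)"
proof -
 note fi = mu.sqint_int[OF e1_sqint[of J a b]]
 obtain G where G: "!!x. x \<in> {a..b} ==> (G has_vector_derivative green' a b (e1 J) x) (at x within {a..b})"
  using antiderivative_continuous[OF continuous_green'_e1[OF J]] by blast
 have D: "(G has_real_derivative green' a b (e1 J) x) (at x)" if "a < x" "x < b" for x
 proof -
  have "at x within {a..b} = at x" by (rule at_within_interior) (use that in auto)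
  then show ?thesis using G[of x] that by (simp add: has_real_derivative_iff_has_vector_derivative)
 qed
 have eq: "green a b (e1 J) y = G y - G a" if "y \<in> {a..b}" for y
 proof -
  have "anti a b (green' a b (e1 J)) y = G y - G a"
  proof (rule anti_of_deriv[OF finite.emptyI _ _ _ that])
   show "integrable (mu a b) (green' a b (e1 J))" by (rule integrable_kop[OF bkern_G1k[OF ab] fi])
   show "continuous_on {a..b} G"
    using G has_vector_derivative_continuous continuous_on_eq_continuous_within by blast
  qed (use D in auto)
  then show ?thesis using anti_green'[OF ab fi that] by simp
 qed
 have ev: "\<forall>\<^sub>F y in nhds x. green a b (e1 J) y = G y - G a"
  using eventually_nhds_in_open[of "{a<..<b}" x] x eq by (auto elim!: eventually_mono)
 show ?thesis by (subst DERIV_cong_ev[OF refl ev refl]) (use D[OF x] in "auto intro!: derivative_eq_intros")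
qed

lemma DERIV_green'_e1:
 assumes J: "J \<in> J1" and i: "i \<in> {1..M}" and x: "x \<in> cell i"
 shows "(green' a b (e1 J) has_real_derivative e1 J x) (at x)"
proof -
 obtain B where B: "!!x. x \<in> ccell i ==> green' a b (e1 J) x = poly (pderiv (B i)) x" "e1 J x = poly (pderiv (pderiv (B i))) x"
  using green_e1[OF J] i x by metis
 have ev: "\<forall>\<^sub>F y in nhds x. green' a b (e1 J) y = poly (pderiv (B i)) y"
  using eventually_nhds_in_open[OF open_greaterThanLessThan x] by eventually_elim (use B(1) in auto)
 show ?thesis unfolding B(2) by (subst DERIV_cong_ev[OF refl ev refl]) (rule poly_DERIV)
qed

end

lemma poly_le: "degree p <= r ==> poly p (x::real) = (\<Sum>i\<le>r. coeff p i*x ^ i)"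
 unfolding poly_altdef by (rule sum.mono_neutral_left) (auto simp: coeff_eq_0)

lemma Qpoly_prod: "degree P <= r ==> degree Q <= r ==> (%p. poly P (fst p)*poly Q (snd p)) \<in> Qpoly r"
 unfolding Qpoly_def
 by (auto simp: poly_le[of _ r] sum_product mult_ac intro!: exI[of _ "%i j. coeff P i*coeff Q j"])

lemma Qpoly_slice:
 assumes "q \<in> Qpoly r"
 shows "\<exists>P. degree P <= r \<and> (\<forall>x. q (x, y) = poly P x)" "\<exists>P. degree P <= r \<and> (\<forall>y. q (x, y) = poly P y)"
proof -
 obtain c where c: "!!x y. q (x, y) = (\<Sum>i\<le>r. \<Sum>j\<le>r. c i j*x ^ i*y ^ j)" using assms unfolding Qpoly_def by blast
 have "degree (\<Sum>i\<le>r. monom (\<Sum>j\<le>r. c i j*y ^ j) i) <= r"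
  by (intro degree_sum_le) (auto intro: order_trans[OF degree_monom_le])
 moreover have "q (x, y) = poly (\<Sum>i\<le>r. monom (\<Sum>j\<le>r. c i j*y ^ j) i) x" for x
  by (simp add: c poly_sum poly_monom sum_distrib_right sum_distrib_left mult_ac)
 ultimately show "\<exists>P. degree P <= r \<and> (\<forall>x. q (x, y) = poly P x)" by blast
 have "degree (\<Sum>j\<le>r. monom (\<Sum>i\<le>r. c i j*x ^ i) j) <= r"
  by (intro degree_sum_le) (auto intro: order_trans[OF degree_monom_le])
 moreover have "q (x, y) = poly (\<Sum>j\<le>r. monom (\<Sum>i\<le>r. c i j*x ^ i) j) y" for y
  unfolding c by (subst sum.swap) (simp add: poly_sum poly_monom sum_distrib_right sum_distrib_left mult_ac)
 ultimately show "\<exists>P. degree P <= r \<and> (\<forall>y. q (x, y) = poly P y)" by blast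
qed

lemma partial_cong:
 assumes "open S" "p \<in> S" "!!q. q \<in> S ==> f q = g q"
 shows "partial_dx f p = partial_dx g p" "partial_dy f p = partial_dy g p" "f differentiable at p \<longleftrightarrow> g differentiable at p"
proof -
 have *: "(f has_derivative D) (at p) \<longleftrightarrow> (g has_derivative D) (at p)" for D
  using has_derivative_transform_within_open[OF _ assms(1,2)] assms(3) by metis
 show "partial_dx f p = partial_dx g p" "partial_dy f p = partial_dy g p" "f differentiable at p \<longleftrightarrow> g differentiable at p"
  by (simp_all add: partial_dx_def partial_dy_def frechet_derivative_def differentiable_def *)
qed

lemma tensor_sum_deriv:
 fixes f g :: "'k => real => real" and z :: "'k => real"
 assumes "!!k. k \<in> K ==> (f k has_real_derivative f' k) (at (fst p))" "!!k. k \<in> K ==> (g k has_real_derivative g' k) (at (snd p))"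
 defines "W \<equiv> %p. \<Sum>k\<in>K. z k*(f k (fst p)*g k (snd p))"
 shows "W differentiable at p" "partial_dx W p = (\<Sum>k\<in>K. z k*(f' k*g k (snd p)))"
  "partial_dy W p = (\<Sum>k\<in>K. z k*(f k (fst p)*g' k))"
proof -
 have "((%p. f k (fst p)) has_derivative (%v. f' k*fst v)) (at p)"
  "((%p. g k (snd p)) has_derivative (%v. g' k * snd v)) (at p)" if "k \<in> K" for k
  using has_derivative_compose[OF has_derivative_fst[OF has_derivative_ident] assms(1)[OF that, unfolded has_field_derivative_def]]
   has_derivative_compose[OF has_derivative_snd[OF has_derivative_ident] assms(2)[OF that, unfolded has_field_derivative_def]] .
 then have D: "(W has_derivative (%v. \<Sum>k\<in>K. z k*(f k (fst p)*(g' k * snd v) + f' k*fst v * g k (snd p)))) (at p)"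
  unfolding W_def by (intro has_derivative_sum has_derivative_mult_right has_derivative_mult)
 then show "W differentiable at p" unfolding differentiable_def by blast
 show "partial_dx W p = (\<Sum>k\<in>K. z k*(f' k*g k (snd p)))" "partial_dy W p = (\<Sum>k\<in>K. z k*(f k (fst p)*g' k))"
  unfolding partial_dx_def partial_dy_def frechet_derivative_at[OF D, symmetric] by simp_all
qed

lemma closure_rect: "a < b ==> c < d ==> closure (rect a b c d) = {a..b} \<times> {c..d}"
 by (simp add: rect_def closure_Times)

lemma open_rect: "open (rect a b c d)"
 by (simp add: rect_def open_Times)

lemma frontier_rect: "a < b ==> c < d ==> frontier (rect a b c d) = {a..b} \<times> {c..d} - rect a b c d"
 by (simp add: frontier_def closure_rect interior_open[OF open_rect])

section \<open>Trial functions as Green potentials of piecewise polynomials\<close>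

context mesh2
begin

abbreviation TT where "TT \<equiv> Mesh M X N Y"
abbreviation Dom where "Dom \<equiv> rect a b c d"
abbreviation gx where "gx \<equiv> %k. green a b (mx.e1 (fst k))"
abbreviation gx' where "gx' \<equiv> %k. green' a b (mx.e1 (fst k))"
abbreviation ex where "ex \<equiv> %k. mx.e1 (fst k)"
abbreviation gy where "gy \<equiv> %k. green c d (my.e1 (snd k))"
abbreviation gy' where "gy' \<equiv> %k. green' c d (my.e1 (snd k))"
abbreviation ey where "ey \<equiv> %k. my.e1 (snd k)"

text \<open>Sums of products with fixed coefficients. Exchanging the families of factors between
  basis functions, \<open>green'\<close> and \<open>green\<close> gives every derivative of a trial
  function in the same form.\<close>

definition ts :: "((nat \<times> nat) \<times> (nat \<times> nat) => real => real) => ((nat \<times> nat) \<times> (nat \<times> nat) => real => real) =>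
  ((nat \<times> nat) \<times> (nat \<times> nat) => real) => fun2" where
 "ts f g cf = (%p. \<Sum>k\<in>J2. cf k*(f k (fst p)*g k (snd p)))"

lemma finite_J2: "finite J2"
 by (simp add: J2_def)

lemma comb_ts: "on2.comb cf = ts ex ey cf"
proof -
 have "e2 k p = ex k (fst p)*ey k (snd p)" for k p by (simp add: e2_def split_beta)
 then show ?thesis by (simp add: on2.comb_def ts_def)
qed

lemma Ly_ts:
 assumes "bkern K"
 shows "Ly (mu c d) K (ts f ey cf) = ts f (%k. kop (mu c d) K (my.e1 (snd k))) cf"
proof
 fix p
 have "Ly (mu c d) K (ts f ey cf) p = kop (mu c d) K (%t. \<Sum>k\<in>J2. (cf k*f k (fst p))*ey k t) (snd p)"
  by (simp add: Ly_def ts_def mult.assoc)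
 also have "... = ts f (%k. kop (mu c d) K (my.e1 (snd k))) cf p"
  by (subst kop_sum[OF assms]) (auto simp: ts_def mult.assoc mu.sqint_int)
 finally show "Ly (mu c d) K (ts f ey cf) p = ts f (%k. kop (mu c d) K (my.e1 (snd k))) cf p" .
qed

lemma Lx_ts:
 assumes "bkern K"
 shows "Lx (mu a b) K (ts ex g cf) = ts (%k. kop (mu a b) K (mx.e1 (fst k))) g cf"
proof
 fix p
 have "Lx (mu a b) K (ts ex g cf) p = kop (mu a b) K (%t. \<Sum>k\<in>J2. (cf k*g k (snd p))*ex k t) (fst p)"
  by (simp add: Lx_def ts_def mult_ac)
 also have "... = ts (%k. kop (mu a b) K (mx.e1 (fst k))) g cf p"
  by (subst kop_sum[OF assms]) (auto simp: ts_def mult_ac mu.sqint_int)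
 finally show "Lx (mu a b) K (ts ex g cf) p = ts (%k. kop (mu a b) K (mx.e1 (fst k))) g cf p" .
qed

lemmas ts_eqs = comb_ts Ly_ts[OF kernels(3)] Ly_ts[OF kernels(4)] Lx_ts[OF kernels(1)] Lx_ts[OF kernels(2)]

lemma cells_TT: "cells TT = {mx.ccell i \<times> my.ccell j | i j. i \<in> {1..M} \<and> j \<in> {1..N}}"
 by (simp add: cells_def)

lemma Vh_slices:
 assumes w: "w \<in> Vh Dom TT k"
 shows "y \<in> {c..d} ==> \<forall>i\<in>{1..M}. \<exists>P. degree P <= k \<and> (\<forall>x\<in>mx.ccell i. w (x, y) = poly P x)"
  and "x \<in> {a..b} ==> \<forall>j\<in>{1..N}. \<exists>P. degree P <= k \<and> (\<forall>y\<in>my.ccell j. w (x, y) = poly P y)"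
proof -
 have q: "\<exists>q\<in>Qpoly k. \<forall>x\<in>mx.ccell i. \<forall>y\<in>my.ccell j. w (x, y) = q (x, y)" if "i \<in> {1..M}" "j \<in> {1..N}" for i j
 proof -
  have "mx.ccell i \<times> my.ccell j \<in> cells TT" using that unfolding cells_TT by blast
  then obtain q where "q \<in> Qpoly k" "\<forall>p\<in>mx.ccell i \<times> my.ccell j. w p = q p" using w unfolding Vh_def by blast
  then show ?thesis by (intro bexI[of _ q]) auto
 qed
 show "\<forall>i\<in>{1..M}. \<exists>P. degree P <= k \<and> (\<forall>x\<in>mx.ccell i. w (x, y) = poly P x)" if y: "y \<in> {c..d}"
 proof
  fix i assume i: "i \<in> {1..M}"
  obtain j where j: "j \<in> {1..N}" "y \<in> my.ccell j" using y unfolding my.ccell_cover by blast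
  from q[OF i j(1)] show "\<exists>P. degree P <= k \<and> (\<forall>x\<in>mx.ccell i. w (x, y) = poly P x)"
   using Qpoly_slice(1)[of _ k y] j(2) by fastforce
 qed
 show "\<forall>j\<in>{1..N}. \<exists>P. degree P <= k \<and> (\<forall>y\<in>my.ccell j. w (x, y) = poly P y)" if x: "x \<in> {a..b}"
 proof
  fix j assume j: "j \<in> {1..N}"
  obtain i where i: "i \<in> {1..M}" "x \<in> mx.ccell i" using x unfolding mx.ccell_cover by blast
  from q[OF i(1) j] show "\<exists>P. degree P <= k \<and> (\<forall>y\<in>my.ccell j. w (x, y) = poly P y)"
   using Qpoly_slice(2)[of _ k x] i(2) by fastforce
 qed
qed

text \<open>Sample first in x, then each w(s, .) in y. The coefficients of the fourth derivative
  become combinations of values of w at a grid of interior points, and no mixed derivative of w has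
  to be formed.\<close>

lemma Vh0_repr:
 assumes w: "w \<in> Vh0 Dom TT (Suc n)"
 shows "\<exists>cf. \<forall>p\<in>Dom. w p = Gx a b (Gy c d (on2.comb cf)) p"
proof -
 have wV: "w \<in> Vh Dom TT (Suc n)" using w unfolding Vh0_def by auto
 have diff: "w differentiable at p" if "p \<in> Dom" for p using wV that unfolding Vh_def by simp
 have fr: "w p = 0" if "p \<in> {a..b} \<times> {c..d}" "p \<notin> Dom" for p
  using w that unfolding Vh0_def frontier_rect[OF mx.ab my.ab] by blast
 have Vx: "mx.V1 (%x. w (x, y))" if y: "c < y" "y < d" for y
  unfolding mx.V1_def using Vh_slices(1)[OF wV, of y] y slice_DERIV(1)[OF diff] mx.ab
  by (auto intro!: fr exI simp: rect_def)
 have Vy: "my.V1 (%y. w (x, y))" if x: "a < x" "x < b" for x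
  unfolding my.V1_def using Vh_slices(2)[OF wV, of x] x slice_DERIV(2)[OF diff] my.ab
  by (auto intro!: fr exI simp: rect_def)
 obtain S \<nu> where S: "finite S" "S \<subseteq> {a<..<b}" and
  1: "!!g x. mx.V1 g ==> x \<in> {a..b} ==> g x = (\<Sum>I\<in>mx.J1. (\<Sum>t\<in>S. \<nu> I t*g t)*green a b (mx.e1 I) x)"
  using mx.V1_samples by blast
 obtain S' \<nu>' where S': "finite S'" "S' \<subseteq> {c<..<d}" and
  2: "!!g x. my.V1 g ==> x \<in> {c..d} ==> g x = (\<Sum>I\<in>my.J1. (\<Sum>t\<in>S'. \<nu>' I t*g t)*green c d (my.e1 I) x)"
  using my.V1_samples by blast
 define w' where "w' J s = (\<Sum>t\<in>S'. \<nu>' J t*w (s, t))" for J s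
 define cf where "cf k = (\<Sum>s\<in>S. \<nu> (fst k) s*w' (snd k) s)" for k
 have "w p = Gx a b (Gy c d (on2.comb cf)) p" if p': "p \<in> Dom" for p
 proof -
  obtain x y where p: "p = (x, y)" "a < x" "x < b" "c < y" "y < d" using p' by (auto simp: rect_def)
  have "w (x, y) = (\<Sum>I\<in>mx.J1. (\<Sum>s\<in>S. \<nu> I s*w (s, y))*green a b (mx.e1 I) x)"
   using 1[OF Vx[OF p(4,5)], of x] p by simp
  also have "... = (\<Sum>I\<in>mx.J1. \<Sum>J\<in>my.J1. cf (I, J)*(green a b (mx.e1 I) x*green c d (my.e1 J) y))"
  proof (rule sum.cong[OF refl])
   fix I
   have "(\<Sum>s\<in>S. \<nu> I s*w (s, y)) = (\<Sum>s\<in>S. \<Sum>J\<in>my.J1. \<nu> I s*w' J s*green c d (my.e1 J) y)"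
    using 2[OF Vy, of _ y] S(2) p by (intro sum.cong[OF refl]) (auto simp: w'_def[symmetric] sum_distrib_left mult.assoc)
   also have "... = (\<Sum>J\<in>my.J1. cf (I, J)*green c d (my.e1 J) y)"
    by (subst sum.swap) (simp add: cf_def sum_distrib_right)
   finally show "(\<Sum>s\<in>S. \<nu> I s*w (s, y))*green a b (mx.e1 I) x = (\<Sum>J\<in>my.J1. cf (I, J)*(green a b (mx.e1 I) x*green c d (my.e1 J) y))"
    by (simp add: sum_distrib_left mult.left_commute mult.commute[of _ "green a b (mx.e1 I) x"])
  qed
  also have "... = ts gx gy cf p"
   unfolding ts_def J2_def by (subst sum.cartesian_product) (simp add: p split_beta)
  finally show ?thesis by (simp add: p ts_eqs)
 qed
 then show ?thesis by blast
qed

lemma GG_ts: "Gx a b (Gy c d (on2.comb cf)) = ts gx gy cf"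
 by (simp add: ts_eqs)

lemma ts_deriv:
 assumes "p \<in> Dom"
 shows "ts gx gy cf differentiable at p" "partial_dx (ts gx gy cf) p = ts gx' gy cf p" "partial_dy (ts gx gy cf) p = ts gx gy' cf p"
proof -
 have f: "(gx k has_real_derivative gx' k (fst p)) (at (fst p))" "(gy k has_real_derivative gy' k (snd p)) (at (snd p))" if "k \<in> J2" for k
  using mx.DERIV_green_e1[of "fst k" "fst p"] my.DERIV_green_e1[of "snd k" "snd p"] that assms by (auto simp: J2_def rect_def)
 note D = tensor_sum_deriv[where f=gx and g=gy and K=J2 and z=cf and p=p and f'="%k. gx' k (fst p)" and g'="%k. gy' k (snd p)"]
 show "ts gx gy cf differentiable at p" unfolding ts_def by (rule D(1)) (rule f, assumption)+
 show "partial_dx (ts gx gy cf) p = ts gx' gy cf p" unfolding ts_def by (rule D(2)) (rule f, assumption)+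
 show "partial_dy (ts gx gy cf) p = ts gx gy' cf p" unfolding ts_def by (rule D(3)) (rule f, assumption)+
qed

text \<open>Inside a cell the classical derivatives of the product sums are those of the factors;
  first derivatives are known on all of the rectangle, the second ones only where the basis
  functions are polynomials.\<close>

lemma elliptic_op_GG:
 assumes w: "!!p. p \<in> Dom ==> w p = Gx a b (Gy c d (on2.comb cf)) p"
  and i: "i \<in> {1..M}" "fst p \<in> mx.cell i" and j: "j \<in> {1..N}" "snd p \<in> my.cell j"
 shows "elliptic_op partial_dx partial_dy \<alpha> \<beta> \<gamma> w p = Lop a b c d \<alpha> \<beta> \<gamma> (Gy c d (on2.comb cf)) (Gx a b (on2.comb cf)) p"
proof -
 have p: "p \<in> Dom" using i j mx.cell_bounds[OF i(1)] my.cell_bounds[OF j(1)] by (cases p) (auto simp: rect_def)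
 note w' = w[unfolded GG_ts]
 have wx: "partial_dx w q = ts gx' gy cf q" "partial_dy w q = ts gx gy' cf q" if "q \<in> Dom" for q
  using partial_cong[OF open_rect that w'] ts_deriv[OF that] by simp_all
 have k: "fst k \<in> mx.J1" "snd k \<in> my.J1" if "k \<in> J2" for k using that by (auto simp: J2_def)
 have pq: "a < fst p" "fst p < b" "c < snd p" "snd p < d" using p by (auto simp: rect_def)
 have "partial_dx (%q. \<alpha>*partial_dx w q) p = partial_dx (%q. \<Sum>k\<in>J2. (\<alpha>*cf k)*(gx' k (fst q)*gy k (snd q))) p"
  by (rule partial_cong(1)[OF open_rect p]) (simp add: wx ts_def sum_distrib_left mult.assoc)
 also have "... = (\<Sum>k\<in>J2. (\<alpha>*cf k)*(ex k (fst p)*gy k (snd p)))"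
  by (rule tensor_sum_deriv(2)[where g'="%k. gy' k (snd p)"]) (use k mx.DERIV_green'_e1[OF _ i] my.DERIV_green_e1[OF _ pq(3,4)] in auto)
 also have "... = \<alpha>*ts ex gy cf p" by (simp add: ts_def sum_distrib_left mult.assoc)
 finally have xx: "partial_dx (%q. \<alpha>*partial_dx w q) p = \<alpha>*ts ex gy cf p" .
 have "partial_dy (%q. \<alpha>*partial_dy w q) p = partial_dy (%q. \<Sum>k\<in>J2. (\<alpha>*cf k)*(gx k (fst q)*gy' k (snd q))) p"
  by (rule partial_cong(2)[OF open_rect p]) (simp add: wx ts_def sum_distrib_left mult.assoc)
 also have "... = (\<Sum>k\<in>J2. (\<alpha>*cf k)*(gx k (fst p)*ey k (snd p)))"
  by (rule tensor_sum_deriv(3)[where f'="%k. gx' k (fst p)"]) (use k my.DERIV_green'_e1[OF _ j] mx.DERIV_green_e1[OF _ pq(1,2)] in auto)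
 also have "... = \<alpha>*ts gx ey cf p" by (simp add: ts_def sum_distrib_left mult.assoc)
 finally show ?thesis
  unfolding elliptic_op_def Lop_def ts_eqs using xx wx[OF p] w'[OF p] by (simp add: distrib_left)
qed

end

section \<open>Integrals over elements and over the rectangle\<close>

lemma AE_rm_fst_notin: "finite E ==> AE p in rm a b c d. fst p \<notin> E"
proof -
 assume E: "finite E"
 have "AE p in rm a b c d. indicator E (fst p) = (0 :: real)"
 proof (rule AE_rm_eqI_x)
  have "E \<in> sets borel" using E by (simp add: finite_imp_closed)
  then have "is_borel (indicator E :: real => real)" by simp
  have "fst \<in> borel_measurable (borel :: (real \<times> real) measure)" by (intro borel_measurable_continuous_onI continuous_intros)
  from measurable_compose[OF this \<open>(indicator E :: real \<Rightarrow> real) \<in> borel_measurable borel\<close>] show "is_borel (%p :: real \<times> real. indicator E (fst p) :: real)" .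
  have "AE x in mu a b. x \<notin> E"
   unfolding AE_mu_iff using AE_not_in[OF finite_imp_null_set_lborel[OF E]] by eventually_elim simp
  then have "AE x in mu a b. indicator E (fst (x, y)) = (0 :: real)" for y :: real by eventually_elim simp
  then show "AE y in mu c d. AE x in mu a b. indicator E (fst (x, y)) = (0 :: real)" by simp
 qed auto
 then show ?thesis by eventually_elim (auto simp: indicator_def split: if_splits)
qed

lemma AE_lebesgue_box: "AE p in lebesgue. p \<in> {x0..x1} \<times> {y0..y1 :: real} \<longleftrightarrow> p \<in> rect x0 x1 y0 (y1 :: real)"
 for x0 x1 :: real
proof -
 have "cbox (x0, y0) (x1, y1) - box (x0, y0) (x1, y1) \<in> null_sets lebesgue"
  using negligible_frontier_interval by (simp add: negligible_iff_null_sets)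
 from AE_not_in[OF this] show ?thesis
  by eventually_elim (auto simp: cbox_Pair_eq box_Pair rect_def)
qed

lemma AE_leb_closed_iff: "(AE p in lebesgue_on ({x0..x1} \<times> {y0..y1 :: real}). P p) \<longleftrightarrow> (AE p in rm x0 x1 y0 y1. P p)"
 for x0 x1 :: real
proof -
 have "{x0..x1} \<times> {y0..y1} \<in> sets (borel :: (real \<times> real) measure)" by (intro borel_closed closed_Times) auto
 then have "(AE p in lebesgue_on ({x0..x1} \<times> {y0..y1}). P p) \<longleftrightarrow> (AE p in lebesgue. p \<in> {x0..x1} \<times> {y0..y1} --> P p)"
  by (subst AE_restrict_space_iff) auto
 also have "... \<longleftrightarrow> (AE p in lebesgue. p \<in> rect x0 x1 y0 y1 --> P p)"
 proof
  assume "AE p in lebesgue. p \<in> {x0..x1} \<times> {y0..y1} --> P p"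
  then show "AE p in lebesgue. p \<in> rect x0 x1 y0 y1 --> P p"
   using AE_lebesgue_box[of x0 x1 y0 y1] by eventually_elim blast
 next
  assume "AE p in lebesgue. p \<in> rect x0 x1 y0 y1 --> P p"
  then show "AE p in lebesgue. p \<in> {x0..x1} \<times> {y0..y1} --> P p"
   using AE_lebesgue_box[of x0 x1 y0 y1] by eventually_elim blast
 qed
 also have "... \<longleftrightarrow> (AE p in rm x0 x1 y0 y1. P p)" unfolding AE_rm_iff AE_completion_iff ..
 finally show ?thesis .
qed

lemma leb_integral_closed:
 fixes f :: "fun2"
 assumes f': "is_borel f'" and eq: "AE p in rm x0 x1 y0 y1. f p = f' p"
 shows "(LINT p|lebesgue_on ({x0..x1} \<times> {y0..y1}). f p) = (LINT p|rm x0 x1 y0 y1. f' p)"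
proof -
 let ?B = "{x0..x1} \<times> {y0..y1}" and ?\<Omega> = "rect x0 x1 y0 y1"
 have B: "?B \<in> sets (borel :: (real \<times> real) measure)" by (intro borel_closed closed_Times) auto
 have m: "(%p. indicator ?\<Omega> p *\<^sub>R f' p) \<in> borel_measurable lebesgue"
  using f' by (intro measurable_completion) auto
 have "AE p in lebesgue. p \<in> ?\<Omega> --> f p = f' p" using eq unfolding AE_rm_iff AE_completion_iff .
 then have ae: "AE p in lebesgue. indicator ?\<Omega> p *\<^sub>R f' p = indicator ?B p *\<^sub>R f p"
  using AE_lebesgue_box[of x0 x1 y0 y1] by eventually_elim (auto simp: indicator_def)
 have m': "(%p. indicator ?B p *\<^sub>R f p) \<in> borel_measurable lebesgue" by (rule borel_measurable_AE[OF m ae])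
 have "(LINT p|lebesgue_on ?B. f p) = (LINT p|lebesgue. indicator ?B p *\<^sub>R f p)"
  using B by (subst integral_restrict_space) auto
 also have "... = (LINT p|lebesgue. indicator ?\<Omega> p *\<^sub>R f' p)"
  by (rule integral_cong_AE[OF m' m]) (use ae in eventually_elim, simp)
 also have "... = (LINT p|lborel. indicator ?\<Omega> p *\<^sub>R f' p)" using f' by (subst integral_completion) auto
 also have "... = (LINT p|rm x0 x1 y0 y1. f' p)"
  unfolding rm_density using f' by (intro integral_density[symmetric]) auto
 finally show ?thesis .
qed

lemma AE_rm_subset:
 assumes "AE p in rm a b c d. P p" "a <= x0" "x1 <= b" "c <= y0" "y1 <= d"
 shows "AE p in rm x0 x1 y0 y1. P p"
 using assms(1) unfolding AE_rm_iff by eventually_elim (use assms in "auto simp: rect_def")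

lemma integral_rm_subset:
 fixes f :: "fun2"
 assumes "is_borel f" "a <= x0" "x1 <= b" "c <= y0" "y1 <= d"
 shows "(LINT p|rm x0 x1 y0 y1. f p) = (LINT p|rm a b c d. indicator (rect x0 x1 y0 y1) p*f p)"
proof -
 have "(LINT p|rm x0 x1 y0 y1. f p) = (LINT p|lborel. indicator (rect x0 x1 y0 y1) p*f p)"
  unfolding rm_density using assms(1) by (subst integral_density) auto
 also have "... = (LINT p|lborel. indicator (rect a b c d) p*(indicator (rect x0 x1 y0 y1) p*f p))"
  by (rule Bochner_Integration.integral_cong) (use assms in "auto simp: rect_def indicator_def")
 also have "... = (LINT p|rm a b c d. indicator (rect x0 x1 y0 y1) p*f p)"
  unfolding rm_density using assms(1) by (subst integral_density) auto
 finally show ?thesis .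
qed

context mesh2
begin

lemma AE_cells: "AE p in R. \<exists>i\<in>{1..M}. \<exists>j\<in>{1..N}. fst p \<in> mx.cell i \<and> snd p \<in> my.cell j"
proof -
 have "AE p in R. p \<in> Dom" by (simp add: AE_rm_iff)
 moreover have "AE p in R. fst p \<notin> X ` {..M}" by (rule AE_rm_fst_notin) simp
 moreover have "AE p in R. snd p \<notin> Y ` {..N}" using AE_sw[OF AE_rm_fst_notin[of "Y ` {..N}" c d a b]] by simp
 ultimately show ?thesis
 proof eventually_elim
  case (elim p)
  then show ?case using mx.cell_exists[of "fst p"] my.cell_exists[of "snd p"] by (cases p) (auto simp: rect_def)
 qed
qed

text \<open>The cells overlap only in mesh lines, a null set, so the integrals over them add up to
  one over the rectangle. The sum runs over the set of cells, hence different index pairs must be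
  shown to give different cells.\<close>

lemma inner_h_ip:
 assumes f: "brep a b c d f f'" and v: "brep a b c d v v'"
 shows "inner_h TT f v = ip R f' v'"
proof -
 define \<tau> where "\<tau> = (%(i, j). mx.ccell i \<times> my.ccell j)"
 define \<rho> where "\<rho> = (%(i, j). rect (X (i-1)) (X i) (Y (j-1)) (Y j))"
 let ?I = "{1..M} \<times> {1..N}"
 have cells: "cells TT = \<tau> ` ?I"
 proof (intro set_eqI iffI)
  fix t assume "t \<in> cells TT"
  then obtain i j where "t = mx.ccell i \<times> my.ccell j" "i \<in> {1..M}" "j \<in> {1..N}" unfolding cells_TT by blast
  then show "t \<in> \<tau> ` ?I" by (intro image_eqI[of _ _ "(i, j)"]) (auto simp: \<tau>_def)
 next
  fix t assume "t \<in> \<tau> ` ?I"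
  then obtain i j where "t = mx.ccell i \<times> my.ccell j" "i \<in> {1..M}" "j \<in> {1..N}" by (auto simp: \<tau>_def)
  then show "t \<in> cells TT" unfolding cells_TT by blast
 qed
 have inj: "inj_on \<tau> ?I"
 proof (rule inj_onI)
  fix p q assume p: "p \<in> ?I" and q: "q \<in> ?I" and eq: "\<tau> p = \<tau> q"
  obtain i j i' j' where ij: "p = (i, j)" "q = (i', j')" by (cases p, cases q)
  note I = p[unfolded ij] q[unfolded ij]
  have lt: "X (i-1) < X i" "X (i'-1) < X i'" "Y (j-1) < Y j" "Y (j'-1) < Y j'"
   using I mx.X_less my.X_less by auto
  have "mx.ccell i = mx.ccell i'" "my.ccell j = my.ccell j'"
   using eq lt unfolding ij \<tau>_def prod.case by (auto simp only: times_eq_iff atLeastatMost_empty_iff)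
  then have "X (i-1) = X (i'-1) \<and> X i = X i'" "Y (j-1) = Y (j'-1) \<and> Y j = Y j'"
   using lt by (auto simp only: Icc_eq_Icc)
  moreover have "(X (i-1) + X i)/2 \<in> mx.cell i" "(Y (j-1) + Y j)/2 \<in> my.cell j" using lt by auto
  ultimately have "i = i'" "j = j'"
   using mx.cell_unique[of i i' "(X (i-1) + X i)/2"] my.cell_unique[of j j' "(Y (j-1) + Y j)/2"] I by auto
  then show "p = q" by (simp add: ij)
 qed
 have fv: "f' \<in> sqint R" "v' \<in> sqint R" using f v brep_sq by auto
 have m: "is_borel (%p. f' p * v' p)" using fv sqint_borel by (intro borel_measurable_times) auto
 have int: "integrable R (%p. f' p * v' p)" by (rule sqint_mult[OF fv])
 have ae: "AE p in R. f p * v p = f' p * v' p" using f v unfolding brep_def by (auto elim: eventually_elim2)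
 have cell: "(LINT p|lebesgue_on (\<tau> k). f p * v p) = (LINT p|R. indicator (\<rho> k) p*(f' p * v' p))" if k: "k \<in> ?I" for k
 proof -
  obtain i j where ij: "k = (i, j)" by (cases k)
  then have I: "i \<in> {1..M}" "j \<in> {1..N}" using k by auto
  note b = mx.cell_bounds[OF I(1)] my.cell_bounds[OF I(2)]
  show ?thesis
   unfolding ij \<tau>_def \<rho>_def prod.case
   by (subst leb_integral_closed[OF m AE_rm_subset[OF ae b]], rule integral_rm_subset[OF m b])
 qed
 have "inner_h TT f v = (\<Sum>k\<in>?I. LINT p|R. indicator (\<rho> k) p*(f' p * v' p))"
  unfolding inner_h_def cells sum.reindex[OF inj] using cell by (simp add: o_def)
 also have "... = (LINT p|R. (\<Sum>k\<in>?I. indicator (\<rho> k) p*(f' p * v' p)))"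
 proof (rule Bochner_Integration.integral_sum[symmetric])
  fix k
  show "integrable R (%p. indicator (\<rho> k) p*(f' p * v' p))"
   by (rule integrable_real_mult_indicator[OF _ int, simplified mult.commute]) (auto simp: \<rho>_def split_beta)
 qed
 also have "... = (LINT p|R. f' p * v' p)"
 proof (rule integral_cong_AE)
  show "AE p in R. (\<Sum>k\<in>?I. indicator (\<rho> k) p*(f' p * v' p)) = f' p * v' p"
   using AE_cells
  proof eventually_elim
   case (elim p)
   then obtain i j where ij: "i \<in> {1..M}" "j \<in> {1..N}" "fst p \<in> mx.cell i" "snd p \<in> my.cell j" by blast
   have "(\<Sum>k\<in>?I. indicator (\<rho> k) p*(f' p * v' p)) = (\<Sum>k\<in>?I. if k = (i, j) then f' p * v' p else 0)"
   proof (rule sum.cong[OF refl])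
    fix k assume "k \<in> ?I"
    then obtain i' j' where k: "k = (i', j')" "i' \<in> {1..M}" "j' \<in> {1..N}" by auto
    have "p \<in> \<rho> k \<longleftrightarrow> k = (i, j)"
     using mx.cell_unique[OF k(2) ij(1) _ ij(3)] my.cell_unique[OF k(3) ij(2) _ ij(4)] ij(3,4)
     unfolding k \<rho>_def rect_def prod.case by (cases p) auto
    then show "indicator (\<rho> k) p*(f' p * v' p) = (if k = (i, j) then f' p * v' p else 0)" by (simp add: indicator_def)
   qed
   then show ?case using ij by simp
  qed
  have "\<rho> k \<in> sets borel" for k by (simp add: \<rho>_def split_beta)
  then show "(%p. \<Sum>k\<in>?I. indicator (\<rho> k) p*(f' p * v' p)) \<in> borel_measurable R"
   unfolding rm_borel by (intro borel_measurable_sum borel_measurable_times[OF borel_measurable_indicator m])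
 qed (use int in auto)
 finally show ?thesis by (simp add: ip_def)
qed

lemma e2_Wh:
 assumes k: "k \<in> J2"
 shows "e2 k \<in> Wh Dom TT (Suc n)"
 unfolding Wh_def mem_Collect_eq
proof (intro conjI ballI)
 show "e2 k \<in> L2 Dom" by (rule brep_L2[OF brep_self]) simp
 fix \<tau> assume "\<tau> \<in> cells TT"
 then obtain i j where t: "\<tau> = mx.ccell i \<times> my.ccell j" "i \<in> {1..M}" "j \<in> {1..N}" unfolding cells_TT by blast
 have k': "fst k \<in> mx.J1" "snd k \<in> my.J1" using k by (auto simp: J2_def)
 obtain q q' where "degree q < n" "degree q' < n" and q: "\<forall>x\<in>mx.cell i. ex k x = poly q x" "\<forall>y\<in>my.cell j. ey k y = poly q' y"
  using mx.e1_pwpoly[OF k'(1)] my.e1_pwpoly[OF k'(2)] t(2,3) unfolding mx.pwpoly_def my.pwpoly_def by blast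
 then have d: "degree q <= Suc n - 2" "degree q' <= Suc n - 2" by auto
 have "AE p in rm (X (i-1)) (X i) (Y (j-1)) (Y j). e2 k p = poly q (fst p)*poly q' (snd p)"
  unfolding AE_rm_iff using q by (auto simp: rect_def e2_def split_beta)
 then have "AE p in lebesgue_on \<tau>. e2 k p = poly q (fst p)*poly q' (snd p)" unfolding t AE_leb_closed_iff .
 then show "\<exists>q\<in>Qpoly (Suc n - 2). AE p in lebesgue_on \<tau>. e2 k p = q p"
  using Qpoly_prod[OF d] by (intro bexI[of _ "%p. poly q (fst p)*poly q' (snd p)"]) auto
qed

end

context scheme
begin

lemma elliptic_brep:
 assumes w: "!!p. p \<in> Dom ==> w p = Gx a b (Gy c d (on2.comb cf)) p"
 shows "brep a b c d (elliptic_op partial_dx partial_dy \<alpha> \<beta> \<gamma> w) (Lh cf)"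
 unfolding brep_def
proof
 show "AE p in R. elliptic_op partial_dx partial_dy \<alpha> \<beta> \<gamma> w p = Lh cf p"
  using AE_cells
 proof eventually_elim
  case (elim p)
  then obtain i j where "i \<in> {1..M}" "fst p \<in> mx.cell i" "j \<in> {1..N}" "snd p \<in> my.cell j" by blast
  from elliptic_op_GG[OF w this] show ?case .
 qed
qed (rule Lh_sq)

lemma pg_repr:
 assumes pg: "solves_pg Dom TT (Suc n) \<alpha> \<beta> \<gamma> f uh" and f: "brep a b c d f f'"
 obtains cf where "!!p. p \<in> Dom ==> uh p = Gx a b (Gy c d (on2.comb cf)) p"
  "!!k. k \<in> J2 ==> ip R (Lh cf) (e2 k) = ip R f' (e2 k)" "PP (Lh cf) = PP f'"
proof -
 have "uh \<in> Vh0 Dom TT (Suc n)" using pg by (simp add: solves_pg_def)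
 from Vh0_repr[OF this] obtain cf where z: "!!p. p \<in> Dom ==> uh p = Gx a b (Gy c d (on2.comb cf)) p" by blast
 have eq: "ip R (Lh cf) (e2 k) = ip R f' (e2 k)" if k: "k \<in> J2" for k
 proof -
  have "a_form TT \<alpha> \<beta> \<gamma> uh (e2 k) = inner_h TT f (e2 k)"
   using pg e2_Wh[OF k] by (simp add: solves_pg_def)
  then show ?thesis
   unfolding a_form_def using inner_h_ip[OF elliptic_brep[OF z] brep_self[OF e2_sqint]] inner_h_ip[OF f brep_self[OF e2_sqint]]
   by simp
 qed
 then have "PP (Lh cf) = PP f'" unfolding on2.proj_def on2.comb_def by (intro ext sum.cong) auto
 with z eq show thesis by (rule that)
qed

text \<open>Solving the scheme for every right-hand side in $W_h$ makes the square stiffness matrix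
  surjective, and \<open>matrix_surj_inj\<close> makes it injective.\<close>

lemma pg_injective:
 assumes us: "uniquely_solvable Dom TT (Suc n) \<alpha> \<beta> \<gamma>" and zero: "PP (Lh cf) = (%_. 0)"
 shows "nrm R (on2.comb cf) = 0"
 unfolding nrm_comb_0
proof (rule matrix_surj_inj[OF on2.finite_J])
 show "\<exists>u. \<forall>k\<in>J2. (\<Sum>i\<in>J2. stiff k i*u i) = g k" for g
 proof -
  have b: "brep a b c d (on2.comb g) (on2.comb g)" by (rule brep_self) simp
  obtain uh where "solves_pg Dom TT (Suc n) \<alpha> \<beta> \<gamma> (on2.comb g) uh" using us brep_L2[OF b] unfolding uniquely_solvable_def by blast
  from this b show ?thesis
  proof (rule pg_repr)
   fix u assume "!!k. k \<in> J2 ==> ip R (Lh u) (e2 k) = ip R (on2.comb g) (e2 k)"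
   then show ?thesis by (intro exI[of _ u]) (simp add: Lh_matrix on2.ip_comb_e)
  qed
 qed
 show "\<forall>k\<in>J2. (\<Sum>i\<in>J2. stiff k i*cf i) = 0"
  using zero unfolding PP_zero_iff by (simp add: Lh_matrix)
qed

end

section \<open>Stability uniformly in the mesh\<close>

text \<open>Bolzano-Weierstrass applied successively to finitely many sequences.\<close>

lemma finite_convergent_subseq:
 fixes F :: "(nat => real) set"
 assumes "finite F" "!!f. f \<in> F ==> bounded (range f)"
 shows "\<exists>r. strict_mono (r :: nat => nat) \<and> (\<forall>f\<in>F. convergent (%m. f (r m)))"
 using assms
proof (induction F)
 case empty
 show ?case using strict_mono_id by auto
next
 case (insert f F)
 then obtain r where r: "strict_mono (r :: nat => nat)" "!!g. g \<in> F ==> convergent (%m. g (r m))" by blast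
 have "bounded (range (%m. f (r m)))"
  by (rule bounded_subset[OF insert.prems[of f]]) auto
 then obtain l s where s: "strict_mono (s :: nat => nat)" "((%m. f (r m)) \<circ> s) \<longlonglongrightarrow> l"
  using bounded_imp_convergent_subsequence by blast
 have "convergent (%m. g ((r \<circ> s) m))" if "g \<in> F" for g
  using convergent_subseq_convergent[OF r(2)[OF that] s(1)] by (simp add: o_def)
 moreover have "convergent (%m. f ((r \<circ> s) m))" using s(2) by (auto simp: o_def convergent_def)
 ultimately show ?case using strict_mono_o[OF r(1) s(1)] by blast
qed

lemma nrm_tendsto_dominated:
 assumes f: "!!m. is_borel (f m)" "is_borel f'"
  and B: "!!m p. \<bar>f m p\<bar> <= B" "!!p. \<bar>f' p\<bar> <= B"
  and lim: "AE p in rm a b c d. (%m. f m p) \<longlonglongrightarrow> f' p"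
 shows "(%m. nrm (rm a b c d) (%p. f m p - f' p)) \<longlonglongrightarrow> 0"
proof -
 have "(%m. LINT p|rm a b c d. (f m p - f' p)\<^sup>2) \<longlonglongrightarrow> (LINT p|rm a b c d. 0)"
 proof (rule integral_dominated_convergence[where w="%_. (2*B)\<^sup>2"])
  show "AE p in rm a b c d. (%m. (f m p - f' p)\<^sup>2) \<longlonglongrightarrow> 0"
   using lim by eventually_elim (auto intro!: tendsto_eq_intros)
  show "AE p in rm a b c d. norm ((f m p - f' p)\<^sup>2) <= (2*B)\<^sup>2" for m
  proof (rule AE_I2)
   fix p
   have "\<bar>f m p - f' p\<bar> <= 2*B" using B(1)[of m p] B(2)[of p] by linarith
   from power_mono[OF this, of 2] show "norm ((f m p - f' p)\<^sup>2) <= (2*B)\<^sup>2" by simp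
  qed
  show "(%p. (f m p - f' p)\<^sup>2) \<in> borel_measurable (rm a b c d)" for m
   unfolding rm_borel using f by (intro borel_measurable_power borel_measurable_diff)
 qed auto
 then have "(%m. sqrt (LINT p|rm a b c d. (f m p - f' p)\<^sup>2)) \<longlonglongrightarrow> sqrt 0" by (intro tendsto_real_sqrt) simp
 then show ?thesis by (simp add: nrm_def)
qed

lemma ip_tendsto:
 assumes sq: "!!m. f m \<in> sqint M" "!!m. g m \<in> sqint M" "f' \<in> sqint M" "g' \<in> sqint M"
  and f: "(%m. nrm M (%p. f m p - f' p)) \<longlonglongrightarrow> 0" and g: "(%m. nrm M (%p. g m p - g' p)) \<longlonglongrightarrow> 0"
 shows "(%m. ip M (f m) (g m)) \<longlonglongrightarrow> ip M f' g'"
proof -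
 define B where "B m = nrm M (%p. f m p - f' p)*nrm M (%p. g m p - g' p) + nrm M (%p. f m p - f' p)*nrm M g' + nrm M f'*nrm M (%p. g m p - g' p)" for m
 have le: "\<bar>ip M (f m) (g m) - ip M f' g'\<bar> <= B m" for m
 proof -
  have d: "(%p. f m p - f' p) \<in> sqint M" "(%p. g m p - g' p) \<in> sqint M" using sq by auto
  have "ip M (f m) (g m) - ip M f' g' = ip M (%p. f m p - f' p) (%p. g m p - g' p) + ip M (%p. f m p - f' p) g' + ip M f' (%p. g m p - g' p)"
   by (simp add: ip_diff_left ip_diff_right sq d)
  then show ?thesis
   using ip_Cauchy_Schwarz[OF d] ip_Cauchy_Schwarz[OF d(1) sq(4)] ip_Cauchy_Schwarz[OF sq(3) d(2)] unfolding B_def by linarith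
 qed
 have "B \<longlonglongrightarrow> 0*0 + 0*nrm M g' + nrm M f'*0"
  unfolding B_def[abs_def] using f g by (intro tendsto_intros)
 then have "B \<longlonglongrightarrow> 0" by simp
 then have "(%m. ip M (f m) (g m) - ip M f' g') \<longlonglongrightarrow> 0"
  by (rule Lim_null_comparison[rotated]) (use le in auto)
 then show ?thesis by (simp add: LIM_zero_iff)
qed

text \<open>A basis function as an explicit function of the end points of its cell, outside of any
  mesh locale, so that the end points can vary and converge.\<close>

definition ebase :: "nat => real => real => nat => real => real" where
 "ebase n u v l x = indicator {u<..<v} x*(1 / sqrt (v-u)*poly (refpoly n l) ((x-u)/(v-u)))"

lemma ebase_bounded: "\<exists>B. \<forall>u v x. \<delta> <= v - u --> \<bar>ebase n u v l x\<bar> <= B" if \<delta>: "0 < \<delta>"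
proof -
 obtain B where B: "!!t. 0 <= t ==> t <= 1 ==> \<bar>poly (refpoly n l) t\<bar> <= B" using poly_bounded_Icc[of 0 1] by blast
 have B0: "0 <= B" using B[of 0] by simp
 have "\<bar>ebase n u v l x\<bar> <= 1 / sqrt \<delta>*B" if d: "\<delta> <= v - u" for u v x
 proof (cases "x \<in> {u<..<v}")
  case True
  have "0 <= (x-u)/(v-u)" "(x-u)/(v-u) <= 1" using True by (auto simp: field_simps)
  from B[OF this] have "\<bar>poly (refpoly n l) ((x-u)/(v-u))\<bar> <= B" .
  moreover have "1 / sqrt (v-u) <= 1 / sqrt \<delta>" using d \<delta> by (intro divide_left_mono) auto
  ultimately have "1 / sqrt (v-u)*\<bar>poly (refpoly n l) ((x-u)/(v-u))\<bar> <= 1 / sqrt \<delta>*B"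
   using \<delta> by (intro mult_mono) auto
  then show ?thesis using True \<delta> d by (simp add: ebase_def abs_mult)
 qed (use B0 \<delta> in "simp add: ebase_def")
 then show ?thesis by blast
qed

lemma ebase_measurable: "is_borel (ebase n u v l)"
 unfolding ebase_def[abs_def] by measurable

lemma ebase_tendsto:
 assumes u: "us \<longlonglongrightarrow> u" and v: "vs \<longlonglongrightarrow> v" and uv: "u < v" and x: "x \<noteq> u" "x \<noteq> v"
 shows "(%m. ebase n (us m) (vs m) l x) \<longlonglongrightarrow> ebase n u v l x"
proof -
 have "(%m. indicator {us m<..<vs m} x :: real) \<longlonglongrightarrow> indicator {u<..<v} x"
 proof (rule tendsto_eventually)
  consider "x < u" | "v < x" | "u < x" "x < v" using x by linarith
  then show "\<forall>\<^sub>F m in sequentially. (indicator {us m<..<vs m} x :: real) = indicator {u<..<v} x"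
  proof cases
   case 1
   show ?thesis using order_tendstoD(1)[OF u 1] by eventually_elim (use 1 in auto)
  next
   case 2
   show ?thesis using order_tendstoD(2)[OF v 2] by eventually_elim (use 2 in auto)
  next
   case 3
   show ?thesis using order_tendstoD(2)[OF u 3(1)] order_tendstoD(1)[OF v 3(2)] by eventually_elim (use 3 in auto)
  qed
 qed
 moreover have "(%m. (x - us m)/(vs m - us m)) \<longlonglongrightarrow> (x-u)/(v-u)" "(%m. 1 / sqrt (vs m - us m)) \<longlonglongrightarrow> 1 / sqrt (v-u)"
  using u v uv by (auto intro!: tendsto_intros)
 moreover have "(%m. poly (refpoly n l) ((x - us m)/(vs m - us m))) \<longlonglongrightarrow> poly (refpoly n l) ((x-u)/(v-u))"
  by (rule isCont_tendsto_compose[OF poly_isCont]) (rule calculation)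
 ultimately show ?thesis unfolding ebase_def by (intro tendsto_mult)
qed

type_synonym idx = "(nat \<times> nat) \<times> (nat \<times> nat)"

definition eb2 :: "nat => (nat => real) => (nat => real) => idx => fun2" where
 "eb2 n X Y k p = ebase n (X (fst (fst k) - 1)) (X (fst (fst k))) (snd (fst k)) (fst p) *
   ebase n (Y (fst (snd k) - 1)) (Y (fst (snd k))) (snd (snd k)) (snd p)"

definition JJ :: "nat => nat => nat => idx set" where
 "JJ M N n = ({1..M} \<times> {..<n}) \<times> ({1..N} \<times> {..<n})"

text \<open>The same function as \<open>on2.comb\<close>, again with the mesh as an argument;
  likewise \<open>pnorm\<close> below for the norm of a projection.\<close>

definition zz :: "nat => nat => nat => (nat => real) => (nat => real) => (idx => real) => fun2" where
 "zz M N n X Y cf p = (\<Sum>k\<in>JJ M N n. cf k*eb2 n X Y k p)"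

lemma (in mesh1) e1_ebase: "i \<in> {1..M} ==> e1 (i, l) x = ebase n (X (i-1)) (X i) l x"
proof -
 assume i: "i \<in> {1..M}"
 let ?D = "X i - X (i-1)"
 have "- X (i-1) / ?D + x*(1 / ?D) = (x - X (i-1)) / ?D" by (simp add: diff_divide_distrib)
 then show ?thesis by (simp add: e1_def ebase_def pb_def poly_pcompose)
qed

context mesh2
begin

lemma J2_JJ: "J2 = JJ M N n"
 by (simp add: J2_def mx.J1_def my.J1_def JJ_def)

lemma e2_eb2: "k \<in> JJ M N n ==> e2 k = eb2 n X Y k"
 by (auto simp: fun_eq_iff e2_def JJ_def eb2_def mx.e1_ebase my.e1_ebase)

lemma comb_zz: "on2.comb cf = zz M N n X Y cf"
proof
 fix p
 have "on2.comb cf p = (\<Sum>k\<in>J2. cf k*e2 k p)" by (simp add: on2.comb_def)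
 also have "... = zz M N n X Y cf p" unfolding zz_def J2_JJ by (intro sum.cong) (auto simp: e2_eb2)
 finally show "on2.comb cf p = zz M N n X Y cf p" .
qed

lemma ip_le_nrm_PP: "k \<in> JJ M N n ==> \<bar>ip R f (eb2 n X Y k)\<bar> <= nrm R (PP f)"
proof -
 assume k: "k \<in> JJ M N n"
 have "(ip R f (e2 k))^2 <= (nrm R (PP f))^2"
  unfolding on2.nrm_proj_square by (rule member_le_sum) (use k finite_J2 in "auto simp: J2_JJ")
 then show ?thesis using e2_eb2[OF k] abs_le_square_iff[of "ip R f (e2 k)" "nrm R (PP f)"] by simp
qed

end

lemma eb2_measurable: "is_borel (eb2 n X Y k)"
 using tensor_measurable[OF ebase_measurable ebase_measurable] unfolding eb2_def[abs_def] tensor_def .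

lemma AE_rm_snd_notin: "finite E ==> AE p in rm a b c d. snd p \<notin> E"
 using AE_sw[OF AE_rm_fst_notin[of E c d a b]] by simp


lemma eb2_bounded:
 assumes \<delta>: "0 < \<delta>"
 shows "\<exists>B\<ge>0. \<forall>X Y k p. k \<in> JJ M N n --> (\<forall>i\<in>{1..M}. \<delta> <= X i - X (i-1)) --> (\<forall>i\<in>{1..N}. \<delta> <= Y i - Y (i-1)) --> \<bar>eb2 n X Y k p\<bar> <= B"
proof -
 obtain B where B: "!!l u v x. \<delta> <= v - u ==> \<bar>ebase n u v l x\<bar> <= B l" using ebase_bounded[OF \<delta>] by metis
 define C where "C = (\<Sum>l<n. \<bar>B l\<bar>)"
 have C: "\<bar>ebase n u v l x\<bar> <= C" if "\<delta> <= v - u" "l < n" for u v l x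
 proof -
  have "\<bar>B l\<bar> <= C" unfolding C_def by (rule member_le_sum) (use that in auto)
  then show ?thesis using B[OF that(1), of l x] by linarith
 qed
 have C0: "0 <= C" by (simp add: C_def sum_nonneg)
 have "\<bar>eb2 n X Y k p\<bar> <= C*C" if "k \<in> JJ M N n" "\<forall>i\<in>{1..M}. \<delta> <= X i - X (i-1)" "\<forall>i\<in>{1..N}. \<delta> <= Y i - Y (i-1)" for X Y k p
 proof -
  obtain i l j l' where k: "k = ((i, l), (j, l'))" by (metis prod.exhaust)
  then have I: "i \<in> {1..M}" "l < n" "j \<in> {1..N}" "l' < n" using that(1) by (auto simp: JJ_def)
  show ?thesis
   unfolding eb2_def k fst_conv snd_conv abs_mult
   by (rule mult_mono[OF C C]) (use that(2,3) I C0 in auto)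
 qed
 then show ?thesis using C0 by (intro exI[of _ "C*C"]) auto
qed

lemma zz_measurable: "is_borel (zz M N n X Y cf)"
 unfolding zz_def[abs_def] using eb2_measurable by (intro borel_measurable_sum borel_measurable_times) auto

lemma (in mesh1) X_bounds: "i <= M ==> a <= X i \<and> X i <= b"
 using X_mono[of 0 i] X_mono[of i M] X_0 X_M by auto

text \<open>The lower bound on the cell lengths persists, so cells cannot collapse in the limit and
  the limit is again a mesh.\<close>

lemma mesh1_limit:
 assumes m1: "!!m. mesh1 a b M (Xs m) n"
  and d: "!!m i. i \<in> {1..M} ==> hs m <= Xs m i - Xs m (i-1) \<and> Xs m i - Xs m (i-1) <= Hs m"
  and X': "!!i. i <= M ==> (%m. Xs m i) \<longlonglongrightarrow> X' i" and H: "Hs \<longlonglongrightarrow> H'" "hs \<longlonglongrightarrow> h'" "0 < h'"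
 shows "!!i. i \<in> {1..M} ==> h' <= X' i - X' (i-1) \<and> X' i - X' (i-1) <= H'" and "mesh1 a b M X' n"
proof -
 show d': "h' <= X' i - X' (i-1) \<and> X' i - X' (i-1) <= H'" if i: "i \<in> {1..M}" for i
 proof -
  have t: "(%m. Xs m i - Xs m (i-1)) \<longlonglongrightarrow> X' i - X' (i-1)" using i by (intro tendsto_diff X') auto
  show ?thesis using LIMSEQ_le[OF H(2) t] LIMSEQ_le[OF t H(1)] d[OF i] by blast
 qed
 have "X' 0 = a" "X' M = b"
  using X'[of 0] X'[of M] mesh1.X_0[OF m1] mesh1.X_M[OF m1] by (simp_all add: LIMSEQ_const_iff)
 moreover have "X' (i-1) < X' i" if "i \<in> {1..M}" for i using d'[OF that] H(3) by linarith
 ultimately show "mesh1 a b M X' n"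
  using mesh1.ab[OF m1] mesh1.n_ge[OF m1] unfolding mesh1_def by blast
qed

context pde
begin

abbreviation LG :: "fun2 => fun2" where
 "LG z \<equiv> LL (Gy c d z) (Gx a b z)"

lemma LG_sqint: "z \<in> sqint RP ==> LG z \<in> sqint RP"
 by (intro LL_sqint Gx_sqint[OF ab] Gy_sqint[OF cd])

lemma LG_lipschitz:
 assumes z: "z \<in> sqint RP" "z' \<in> sqint RP"
 shows "nrm RP (%s. LG z s - LG z' s) <= CL*((d-c)\<^sup>2 + (b-a)\<^sup>2)*nrm RP (%s. z s - z' s)"
proof -
 note sq = Gx_sqint[OF ab z(1)] Gx_sqint[OF ab z(2)] Gy_sqint[OF cd z(1)] Gy_sqint[OF cd z(2)]
 note d = sqint_diff[OF z] sqint_diff[OF sq(1,2)] sqint_diff[OF sq(3,4)]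
 have "AE s in RP. LG z s - LG z' s = LL (%s. Gy c d z s - Gy c d z' s) (%s. Gx a b z s - Gx a b z' s) s"
  using LL_diff[OF sq(3,1,4,2)] by eventually_elim simp
 then have "nrm RP (%s. LG z s - LG z' s) = nrm RP (LL (%s. Gy c d z s - Gy c d z' s) (%s. Gx a b z s - Gx a b z' s))"
  by (rule nrm_cong_sq) (intro sqint_diff LG_sqint z LL_sqint d)+
 also have "... <= CL*(nrm RP (%s. Gy c d z s - Gy c d z' s) + nrm RP (%s. Gx a b z s - Gx a b z' s))"
  by (rule nrm_LL[OF d(3,2)])
 also have "nrm RP (%s. Gy c d z s - Gy c d z' s) = nrm RP (Gy c d (%s. z s - z' s))"
  by (rule nrm_cong_sq[symmetric, OF Ly_diff[OF bkern_Gk[OF cd] z] Gy_sqint[OF cd d(1)] d(3)])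
 also have "nrm RP (%s. Gx a b z s - Gx a b z' s) = nrm RP (Gx a b (%s. z s - z' s))"
  by (rule nrm_cong_sq[symmetric, OF Lx_diff[OF bkern_Gk[OF ab] z] Gx_sqint[OF ab d(1)] d(2)])
 also have "CL*(nrm RP (Gy c d (%s. z s - z' s)) + nrm RP (Gx a b (%s. z s - z' s)))
   <= CL*((d-c)\<^sup>2*nrm RP (%s. z s - z' s) + (b-a)\<^sup>2*nrm RP (%s. z s - z' s))"
  using nrm_Gy[OF cd d(1)] nrm_Gx[OF ab d(1)] CL_pos by (intro mult_left_mono add_mono) auto
 finally show ?thesis by (simp add: distrib_left distrib_right mult_ac)
qed

text \<open>Compactness for fixed numbers of cells: a failing constant would give normalized
  coefficients on convergent meshes with residuals tending to 0. The limit is a nonzero kernel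
  element on a mesh that satisfies the same bounds, against unique solvability.\<close>

lemma coarse_fixed:
 assumes n: "2 <= n" and \<delta>: "0 < \<delta>"
  and us: "!!X Y H h. mesh2 a b M X c d N Y n H h ==> H <= Cq*h ==> H <= h0 ==>
    uniquely_solvable (rect a b c d) (Mesh M X N Y) (Suc n) \<alpha> \<beta> \<gamma>"
 shows "\<exists>\<kappa>>0. \<forall>X Y H h cf E. mesh2 a b M X c d N Y n H h --> \<delta> <= h --> H <= Cq*h --> H <= h0 -->
   (\<forall>k\<in>JJ M N n. \<bar>ip RP (LG (zz M N n X Y cf)) (eb2 n X Y k)\<bar> <= E) --> 0 <= E --> \<kappa>*nrm RP (zz M N n X Y cf) <= E"
proof (rule ccontr)
 assume neg: "\<not> ?thesis"
 \<comment> \<open>Counterexamples after normalization: $L^2$ norm 1 and all residual coefficients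
   at most 1/(m+1).\<close>
 define P where "P m X Y H h cf \<longleftrightarrow> mesh2 a b M X c d N Y n H h \<and> \<delta> <= h \<and> H <= Cq*h \<and> H <= h0 \<and>
   (\<forall>k. \<bar>cf k\<bar> <= 1) \<and> nrm RP (zz M N n X Y cf) = 1 \<and>
   (\<forall>k\<in>JJ M N n. \<bar>ip RP (LG (zz M N n X Y cf)) (eb2 n X Y k)\<bar> <= 1/real (Suc m))" for m X Y H h cf
 have "\<exists>X Y H h cf. P m X Y H h cf" for m
 proof -
  have "0 < 1/real (Suc m)" by simp
  with neg obtain X Y H h cf E where *: "mesh2 a b M X c d N Y n H h" "\<delta> <= h" "H <= Cq*h" "H <= h0" "0 <= E"
   "\<forall>k\<in>JJ M N n. \<bar>ip RP (LG (zz M N n X Y cf)) (eb2 n X Y k)\<bar> <= E"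
   and lt: "\<not> 1/real (Suc m)*nrm RP (zz M N n X Y cf) <= E" by metis
  interpret scheme a b c d \<alpha> \<gamma> \<beta> M X N Y n H h using *(1) pde_axioms by (simp add: scheme_def)
  define \<rho> where "\<rho> = nrm RP (zz M N n X Y cf)"
  have \<rho>: "E < 1/real (Suc m)*\<rho>" using lt by (simp add: \<rho>_def)
  then have \<rho>0: "0 < \<rho>" using *(5) by (metis less_le_trans mult_nonneg_nonpos not_le of_nat_0_le_iff zero_le_divide_1_iff)
  \<comment> \<open>Coefficients are set to 0 off the index set, so the bound 1, which follows from
    the normalization there, holds for every index.\<close>
  define cf' where "cf' k = (if k \<in> JJ M N n then inverse \<rho>*cf k else 0)" for k
  have z': "zz M N n X Y cf' = (%p. inverse \<rho>*zz M N n X Y cf p)"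
   by (simp add: fun_eq_iff zz_def cf'_def sum_distrib_left mult.assoc)
  have n1: "nrm RP (zz M N n X Y cf') = 1" unfolding z' nrm_cmult using \<rho>0 by (simp add: \<rho>_def)
  have "\<bar>cf' k\<bar> <= 1" for k
  proof (cases "k \<in> JJ M N n")
   case True
   have "(\<Sum>k\<in>JJ M N n. (cf' k)\<^sup>2) = 1" using on2.nrm_comb_square[of cf', unfolded comb_zz, unfolded n1 J2_JJ] by simp
   moreover have "(cf' k)\<^sup>2 <= (\<Sum>k\<in>JJ M N n. (cf' k)\<^sup>2)" by (rule member_le_sum) (use True finite_J2 in "auto simp: J2_JJ")
   ultimately show ?thesis by (simp add: abs_square_le_1)
  qed (simp add: cf'_def)
  moreover have "\<bar>ip RP (LG (zz M N n X Y cf')) (eb2 n X Y k)\<bar> <= 1/real (Suc m)" if "k \<in> JJ M N n" for k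
  proof -
   have "LG (zz M N n X Y cf') = (%s. inverse \<rho>*LG (zz M N n X Y cf) s)"
    unfolding z' Lx_cmult Ly_cmult Lop_def by (simp add: fun_eq_iff algebra_simps)
   then have "\<bar>ip RP (LG (zz M N n X Y cf')) (eb2 n X Y k)\<bar> = inverse \<rho>*\<bar>ip RP (LG (zz M N n X Y cf)) (eb2 n X Y k)\<bar>"
    using \<rho>0 by (simp add: ip_cmult_left abs_mult)
   also have "... <= inverse \<rho>*(1/real (Suc m)*\<rho>)"
    using *(6) that \<rho> \<rho>0 by (intro mult_left_mono) force+
   finally show ?thesis using \<rho>0 by simp
  qed
  ultimately have "P m X Y H h cf'" unfolding P_def using *(1-4) n1 by blast
  then show ?thesis by blast
 qed
 then obtain Xs Ys Hs hs cfs where Pm: "!!m. P m (Xs m) (Ys m) (Hs m) (hs m) (cfs m)" by metis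
 have mesh: "mesh2 a b M (Xs m) c d N (Ys m) n (Hs m) (hs m)" and bd: "\<delta> <= hs m" "Hs m <= Cq*hs m" "Hs m <= h0" "\<bar>cfs m k\<bar> <= 1"
  "nrm RP (zz M N n (Xs m) (Ys m) (cfs m)) = 1" for m k
  using Pm[of m] unfolding P_def by blast+
 have small: "\<bar>ip RP (LG (zz M N n (Xs m) (Ys m) (cfs m))) (eb2 n (Xs m) (Ys m) k)\<bar> <= 1/real (Suc m)" if "k \<in> JJ M N n" for m k
  using Pm[of m] that unfolding P_def by blast
 have m1: "mesh1 a b M (Xs m) n" "mesh1 c d N (Ys m) n" for m using mesh[of m] by (auto simp: mesh2_def)
 have M1: "1 <= M" "1 <= N" using mesh1.M_pos[OF m1(1)] mesh1.M_pos[OF m1(2)] .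
 note Xb = mesh1.X_bounds[OF m1(1)] and Yb = mesh1.X_bounds[OF m1(2)]
 have dX: "hs m <= Xs m i - Xs m (i-1) \<and> Xs m i - Xs m (i-1) <= Hs m" if "i \<in> {1..M}" for m i
  using mesh2.hx[OF mesh that] mesh2.Hx[OF mesh that] by simp
 have dY: "hs m <= Ys m i - Ys m (i-1) \<and> Ys m i - Ys m (i-1) <= Hs m" if "i \<in> {1..N}" for m i
  using mesh2.hy[OF mesh that] mesh2.Hy[OF mesh that] by simp
 have hH: "hs m <= Hs m" for m using dX[of 1 m] M1 by auto
 \<comment> \<open>Mesh points, coefficients and the two bounds on the edges: finitely many bounded
   real sequences describe everything that varies.\<close>
 define F where "F = (%i m. Xs m i) ` {..M} \<union> (%i m. Ys m i) ` {..N} \<union> (%k m. cfs m k) ` JJ M N n \<union> {Hs, hs}"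
 have "finite F" by (simp add: F_def JJ_def)
 moreover have "bounded (range f)" if f: "f \<in> F" for f
 proof -
  define B where "B = \<bar>a\<bar> + \<bar>b\<bar> + \<bar>c\<bar> + \<bar>d\<bar> + 1 + \<bar>h0\<bar>"
  have "\<bar>f m\<bar> <= B" for m
   using f unfolding F_def
  proof (elim UnE imageE insertE emptyE)
   fix i assume "f = (%m. Xs m i)" "i \<in> {..M}"
   then show ?thesis using Xb[of i m] unfolding B_def by force
  next
   fix i assume "f = (%m. Ys m i)" "i \<in> {..N}"
   then show ?thesis using Yb[of i m] unfolding B_def by force
  next
   fix k assume "f = (%m. cfs m k)"
   then show ?thesis using bd(4)[of m k] unfolding B_def by auto
  next
   assume "f = Hs"
   then show ?thesis using bd(1,3)[of m] hH[of m] \<delta> unfolding B_def by auto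
  next
   assume "f = hs"
   then show ?thesis using bd(1,3)[of m] hH[of m] \<delta> unfolding B_def by auto
  qed
  then show ?thesis by (auto simp: bounded_iff)
 qed
 ultimately obtain r where r: "strict_mono (r :: nat => nat)" and cv: "!!f. f \<in> F ==> convergent (%m. f (r m))"
  using finite_convergent_subseq by metis
 define X' Y' cf' H' h' where "X' i = lim (%m. Xs (r m) i)" and "Y' i = lim (%m. Ys (r m) i)" and "cf' k = lim (%m. cfs (r m) k)"
  and "H' = lim (%m. Hs (r m))" and "h' = lim (%m. hs (r m))" for i k
 have X': "(%m. Xs (r m) i) \<longlonglongrightarrow> X' i" if "i <= M" for i
  using cv[of "%m. Xs m i"] that by (simp add: F_def X'_def convergent_LIMSEQ_iff)
 have Y': "(%m. Ys (r m) i) \<longlonglongrightarrow> Y' i" if "i <= N" for i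
  using cv[of "%m. Ys m i"] that by (simp add: F_def Y'_def convergent_LIMSEQ_iff)
 have Z': "(%m. cfs (r m) k) \<longlonglongrightarrow> cf' k" if "k \<in> JJ M N n" for k
  using cv[of "%m. cfs m k"] that by (simp add: F_def cf'_def convergent_LIMSEQ_iff)
 have HH: "(%m. Hs (r m)) \<longlonglongrightarrow> H'" "(%m. hs (r m)) \<longlonglongrightarrow> h'"
  using cv[of Hs] cv[of hs] by (simp_all add: F_def H'_def h'_def convergent_LIMSEQ_iff)
 have \<delta>h: "\<delta> <= h'" by (rule LIMSEQ_le_const[OF HH(2)]) (use bd(1) in auto)
 have HC: "H' <= Cq*h'" by (rule LIMSEQ_le[OF HH(1) tendsto_mult[OF tendsto_const HH(2)]]) (use bd(2) in auto)
 have Hh0: "H' <= h0" by (rule LIMSEQ_le_const2[OF HH(1)]) (use bd(3) in auto)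
 have h'0: "0 < h'" using \<delta> \<delta>h by simp
 have limX: "h' <= X' i - X' (i-1) \<and> X' i - X' (i-1) <= H'" if "i \<in> {1..M}" for i
  by (rule mesh1_limit(1)[OF m1(1) dX X' HH h'0 that])
 have limY: "h' <= Y' i - Y' (i-1) \<and> Y' i - Y' (i-1) <= H'" if "i \<in> {1..N}" for i
  by (rule mesh1_limit(1)[OF m1(2) dY Y' HH h'0 that])
 have "mesh1 a b M X' n" "mesh1 c d N Y' n"
  by (rule mesh1_limit(2)[OF m1(1) dX X' HH h'0] mesh1_limit(2)[OF m1(2) dY Y' HH h'0]; assumption)+
 then have mesh': "mesh2 a b M X' c d N Y' n H' h'"
  unfolding mesh2_def mesh2_axioms_def using h'0 limX limY by blast
 interpret L: scheme a b c d \<alpha> \<gamma> \<beta> M X' N Y' n H' h' using mesh' pde_axioms by (simp add: scheme_def)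
 define z where "z m = zz M N n (Xs (r m)) (Ys (r m)) (cfs (r m))" for m
 define e where "e m = eb2 n (Xs (r m)) (Ys (r m))" for m
 define z' where "z' = zz M N n X' Y' cf'"
 define e' where "e' = eb2 n X' Y'"
 obtain B where B: "0 <= B" "!!X Y k p. k \<in> JJ M N n ==> \<forall>i\<in>{1..M}. \<delta> <= X i - X (i-1) ==> \<forall>i\<in>{1..N}. \<delta> <= Y i - Y (i-1) ==> \<bar>eb2 n X Y k p\<bar> <= B"
  using eb2_bounded[OF \<delta>, of M N n] by blast
 have eB: "\<bar>e m k p\<bar> <= B" if "k \<in> JJ M N n" for m k p
  unfolding e_def using dX[of _ "r m"] dY[of _ "r m"] bd(1)[of "r m"]
  by (intro B(2)[OF that] ballI) (meson order_trans)+
 have eB': "\<bar>e' k p\<bar> <= B" if "k \<in> JJ M N n" for k p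
  unfolding e'_def using limX limY \<delta>h by (intro B(2)[OF that] ballI) (meson order_trans)+
 have Z1: "\<bar>cf' k\<bar> <= 1" if "k \<in> JJ M N n" for k
  by (rule LIMSEQ_le_const2[OF tendsto_rabs[OF Z'[OF that]]]) (use bd(4) in auto)
 have zzB: "\<bar>\<Sum>k\<in>JJ M N n. u k * v k\<bar> <= real (card (JJ M N n))*B"
  if "!!k. k \<in> JJ M N n ==> \<bar>u k\<bar> <= 1" "!!k. k \<in> JJ M N n ==> \<bar>v k\<bar> <= B" for u v
 proof -
  have "\<bar>\<Sum>k\<in>JJ M N n. u k * v k\<bar> <= (\<Sum>k\<in>JJ M N n. \<bar>u k * v k\<bar>)" by (rule sum_abs)
  also have "... <= (\<Sum>k\<in>JJ M N n. 1*B)"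
   unfolding abs_mult by (intro sum_mono mult_mono that) auto
  finally show ?thesis by simp
 qed
 have zB: "\<bar>z m p\<bar> <= real (card (JJ M N n))*B" for m p
  unfolding z_def zz_def by (rule zzB[OF bd(4)]) (use eB in "simp add: e_def")
 have zB': "\<bar>z' p\<bar> <= real (card (JJ M N n))*B" for p
  unfolding z'_def zz_def by (rule zzB[OF Z1 eB'[unfolded e'_def]])
 have good: "AE p in RP. fst p \<notin> X' ` {..M} \<and> snd p \<notin> Y' ` {..N}"
  using AE_rm_fst_notin[of "X' ` {..M}" a b c d] AE_rm_snd_notin[of "Y' ` {..N}" a b c d] by simp
 \<comment> \<open>Basis functions jump at mesh points, so convergence holds off the lines of the
   limit mesh only. This is almost everywhere, and with the common bound it gives convergence in
   $L^2$.\<close>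
 have elim: "(%m. e m k p) \<longlonglongrightarrow> e' k p" if k: "k \<in> JJ M N n" and p: "fst p \<notin> X' ` {..M} \<and> snd p \<notin> Y' ` {..N}" for k p
 proof -
  obtain i l j l' where kk: "k = ((i, l), (j, l'))" by (metis prod.exhaust)
  then have I: "i \<in> {1..M}" "j \<in> {1..N}" using k by (auto simp: JJ_def)
  show ?thesis
   unfolding e_def e'_def eb2_def kk fst_conv snd_conv
   by (intro tendsto_mult ebase_tendsto X' Y') (use I p limX[OF I(1)] limY[OF I(2)] h'0 in auto)
 qed
 have zlim: "(%m. z m p) \<longlonglongrightarrow> z' p" if p: "fst p \<notin> X' ` {..M} \<and> snd p \<notin> Y' ` {..N}" for p
  unfolding z_def z'_def zz_def
  by (intro tendsto_sum tendsto_mult Z' elim[OF _ p, unfolded e_def e'_def])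
 have em: "is_borel (e m k)" "is_borel (e' k)" "is_borel (z m)" "is_borel z'" for m k
  unfolding e_def e'_def z_def z'_def by (rule eb2_measurable zz_measurable)+
 have bs: "f \<in> sqint RP" if "is_borel f" "!!p. \<bar>f p\<bar> <= C" for f C
  using that by (intro rm.sqint_bounded[where B=C] AE_I2) (auto simp: rm_borel)
 have sq: "e m k \<in> sqint RP" "e' k \<in> sqint RP" if "k \<in> JJ M N n" for m k
  by (rule bs[OF em(1) eB[OF that]]) (rule bs[OF em(2) eB'[OF that]])
 have nz: "(%m. nrm RP (%p. z m p - z' p)) \<longlonglongrightarrow> 0"
  by (rule nrm_tendsto_dominated[OF em(3,4) zB zB']) (use good in eventually_elim, rule zlim)
 have ne: "(%m. nrm RP (%p. e m k p - e' k p)) \<longlonglongrightarrow> 0" if "k \<in> JJ M N n" for k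
  by (rule nrm_tendsto_dominated[OF em(1,2) eB[OF that] eB'[OF that]]) (use good in eventually_elim, rule elim[OF that])
 have zsq: "z m \<in> sqint RP" "z' \<in> sqint RP" for m by (rule bs[OF em(3) zB]) (rule bs[OF em(4) zB'])
 have nL: "(%m. nrm RP (%s. LG (z m) s - LG z' s)) \<longlonglongrightarrow> 0"
 proof (rule Lim_null_comparison)
  show "\<forall>\<^sub>F m in sequentially. norm (nrm RP (%s. LG (z m) s - LG z' s)) <= CL*((d-c)\<^sup>2 + (b-a)\<^sup>2)*nrm RP (%p. z m p - z' p)"
   using LG_lipschitz[OF zsq] by simp
  show "(%m. CL*((d-c)\<^sup>2 + (b-a)\<^sup>2)*nrm RP (%p. z m p - z' p)) \<longlonglongrightarrow> 0"
   using tendsto_mult_left[OF nz] by simp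
 qed
 have "ip RP (LG z') (e' k) = 0" if k: "k \<in> JJ M N n" for k
 proof (rule LIMSEQ_unique)
  show "(%m. ip RP (LG (z m)) (e m k)) \<longlonglongrightarrow> ip RP (LG z') (e' k)"
   by (rule ip_tendsto[OF LG_sqint[OF zsq(1)] sq(1)[OF k] LG_sqint[OF zsq(2)] sq(2)[OF k] nL ne[OF k]])
  show "(%m. ip RP (LG (z m)) (e m k)) \<longlonglongrightarrow> 0"
  proof (rule Lim_null_comparison)
   show "(%m. 1/real (Suc m)) \<longlonglongrightarrow> 0" using LIMSEQ_inverse_real_of_nat by (simp add: divide_inverse)
   have "\<bar>ip RP (LG (z m)) (e m k)\<bar> <= 1/real (Suc m)" for m
   proof -
    have "1/real (Suc (r m)) <= 1/real (Suc m)" using seq_suble[OF r, of m] by (intro divide_left_mono) auto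
    then show ?thesis using small[OF k, of "r m"] unfolding z_def e_def by linarith
   qed
   then show "\<forall>\<^sub>F m in sequentially. norm (ip RP (LG (z m)) (e m k)) <= 1/real (Suc m)" by simp
  qed
 qed
 then have "L.PP (L.Lh cf') = (%_. 0)"
  unfolding L.PP_zero_iff L.comb_zz by (auto simp: L.J2_JJ L.e2_eb2 z'_def e'_def)
 from L.pg_injective[OF us[OF mesh' HC Hh0] this] have "nrm RP z' = 0" by (simp add: L.comb_zz z'_def)
 \<comment> \<open>The normalization survives the limit because convergence is in norm, in
   contradiction to the vanishing of the limit.\<close>
 moreover have "ip RP z' z' = 1"
 proof (rule LIMSEQ_unique)
  show "(%m. ip RP (z m) (z m)) \<longlonglongrightarrow> ip RP z' z'" by (rule ip_tendsto[OF zsq(1) zsq(1) zsq(2) zsq(2) nz nz])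
  have "ip RP (z m) (z m) = 1" for m using bd(5)[of "r m"] nrm_square[of RP "z m"] by (simp add: z_def)
  then show "(%m. ip RP (z m) (z m)) \<longlonglongrightarrow> 1" by simp
 qed
 ultimately show False using nrm_square[of RP z'] by simp
qed

end

definition pnorm :: "real => real => real => real => nat => (nat => real) => nat => (nat => real) => nat => fun2 => real" where
 "pnorm a b c d M X N Y n f = sqrt (\<Sum>k\<in>JJ M N n. (ip (rm a b c d) f (eb2 n X Y k))^2)"

definition gsize :: "real => real => real => real => fun2 => real" where
 "gsize a b c d z = nrm (rm a b c d) (Gy c d z) + nrm (rm a b c d) (Gx a b z) + nrm (rm a b c d) (Gx' a b (Gy' c d z))"

lemma (in mesh2) nrm_PP: "nrm R (PP f) = pnorm a b c d M X N Y n f"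
proof -
 have "pnorm a b c d M X N Y n f = sqrt (\<Sum>k\<in>J2. (ip R f (e2 k))^2)"
  unfolding pnorm_def J2_JJ by (intro arg_cong[where f=sqrt] sum.cong) (auto simp: e2_eb2)
 also have "... = nrm R (PP f)" unfolding on2.nrm_proj_square[symmetric] by simp
 finally show ?thesis ..
qed

lemma (in mesh2) size2_gsize: "size2 cf = gsize a b c d (zz M N n X Y cf)"
 by (simp only: size2_def gsize_def comb_zz)

lemma (in mesh1) M_le:
 assumes "!!i. i \<in> {1..M} ==> h <= X i - X (i-1)"
 shows "real M*h <= b - a"
proof -
 have "real i*h <= X i - a" if "i <= M" for i
  using that
 proof (induction i)
  case (Suc i)
  then show ?case using assms[of "Suc i"] by (simp add: distrib_right)
 qed (simp add: X_0)
 from this[of M] show ?thesis by (simp add: X_M)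
qed

context pde
begin

lemma fine_uniform:
 assumes n: "2 <= n" and Cq: "0 < Cq"
 shows "\<exists>C>0. \<exists>h1>0. \<forall>M X N Y H h cf. mesh2 a b M X c d N Y n H h --> H <= Cq*h --> H <= h1 -->
  gsize a b c d (zz M N n X Y cf) <= C*pnorm a b c d M X N Y n (LG (zz M N n X Y cf))"
proof -
 define Cs where "Cs = 1 + inv_const (Suc n)*Cq"
 define B where "B = \<bar>fst \<beta>\<bar> + \<bar>snd \<beta>\<bar> + \<gamma>*(b-a)"
 define D where "D = 3*Cs/\<alpha>*B * sqrt (2*CL/\<alpha>)"
 \<comment> \<open>Chosen so that D h1 is at most 1/2; the added 1 avoids division by 0 when there
   are no lower order terms.\<close>
 define h1 where "h1 = 1/(2*(D+1))"
 define C where "C = 6*Cs/\<alpha>*(1 + B*(2*(b-a)/\<alpha>))"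
 have Cs: "0 < Cs" using Cq by (simp add: Cs_def add_pos_nonneg)
 have B: "0 <= B" using \<gamma> ab by (simp add: B_def)
 have D: "0 <= D" using Cs B \<alpha> CL_pos by (simp add: D_def)
 have h1: "0 < h1" using D by (simp add: h1_def)
 have C: "0 < C" using Cs B \<alpha> ab unfolding C_def by (intro mult_pos_pos add_pos_nonneg) auto
 have "gsize a b c d (zz M N n X Y cf) <= C*pnorm a b c d M X N Y n (LG (zz M N n X Y cf))"
  if mesh: "mesh2 a b M X c d N Y n H h" and H: "H <= Cq*h" "H <= h1" for M X N Y H h cf
 proof -
  interpret scheme a b c d \<alpha> \<gamma> \<beta> M X N Y n H h using mesh pde_axioms by (simp add: scheme_def)
  have "H/h <= Cq" using H(1) h_pos by (simp add: pos_divide_le_eq)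
  then have "inv_const (Suc n)*(H/h) <= inv_const (Suc n)*Cq" by (rule mult_left_mono) simp
  then have st: "stab_const <= Cs" by (simp add: stab_const_def Cs_def)
  have "D*H <= D*h1" using H(2) D by (rule mult_left_mono)
  also have "... <= 1/2" using D by (simp add: h1_def field_simps)
  finally have "3*Cs/\<alpha>*B * sqrt (2*CL/\<alpha>)*H <= 1/2" by (simp add: D_def)
  from fine_stable[OF st B_def this, of cf] show ?thesis
   unfolding size2_gsize nrm_PP comb_zz C_def .
 qed
 then show ?thesis using C h1 by blast
qed

lemma gsize_le:
 assumes z: "z \<in> sqint RP"
 shows "gsize a b c d z <= ((d-c)\<^sup>2 + (b-a)\<^sup>2 + (b-a)*(d-c))*nrm RP z"
proof -
 have "nrm RP (Gx' a b (Gy' c d z)) <= (b-a)*((d-c)*nrm RP z)"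
  using nrm_Gx'[OF ab Gy'_sqint[OF cd z]] nrm_Gy'[OF cd z] ab by (meson less_imp_le diff_gt_0_iff_gt mult_left_mono order_trans)
 then show ?thesis
  unfolding gsize_def using nrm_Gx[OF ab z] nrm_Gy[OF cd z] by (simp add: distrib_right mult.assoc)
qed

text \<open>Either H is below the threshold of the fine estimate, or h is at least h1/Cq. In the
  second case the numbers of cells are bounded, and the least of finitely many constants from
  \<open>coarse_fixed\<close> serves all these meshes.\<close>

lemma uniform_stable:
 assumes n: "2 <= n" and Cq: "0 < Cq"
  and us: "!!M X N Y H h. mesh2 a b M X c d N Y n H h ==> H <= Cq*h ==> H <= h0 ==>
    uniquely_solvable (rect a b c d) (Mesh M X N Y) (Suc n) \<alpha> \<beta> \<gamma>"
 shows "\<exists>C>0. \<forall>M X N Y H h cf. mesh2 a b M X c d N Y n H h --> H <= Cq*h --> H <= h0 -->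
  gsize a b c d (zz M N n X Y cf) <= C*pnorm a b c d M X N Y n (LG (zz M N n X Y cf))"
proof -
 obtain C1 h1 where C1: "0 < C1" "0 < h1" and fine: "!!M X N Y H h cf. mesh2 a b M X c d N Y n H h ==> H <= Cq*h ==> H <= h1 ==>
  gsize a b c d (zz M N n X Y cf) <= C1*pnorm a b c d M X N Y n (LG (zz M N n X Y cf))"
  using fine_uniform[OF n Cq] by metis
 define \<delta> where "\<delta> = h1/Cq"
 have \<delta>: "0 < \<delta>" using C1 Cq by (simp add: \<delta>_def)
 have "\<forall>p. \<exists>\<kappa>>0. \<forall>X Y H h cf E. mesh2 a b (fst p) X c d (snd p) Y n H h --> \<delta> <= h --> H <= Cq*h --> H <= h0 -->
   (\<forall>k\<in>JJ (fst p) (snd p) n. \<bar>ip RP (LG (zz (fst p) (snd p) n X Y cf)) (eb2 n X Y k)\<bar> <= E) --> 0 <= E --> \<kappa>*nrm RP (zz (fst p) (snd p) n X Y cf) <= E"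
  by (rule allI, rule coarse_fixed[OF n \<delta>], rule us)
 from choice[OF this] obtain \<kappa> where \<kappa>: "!!p. 0 < \<kappa> p" and kap: "!!M N X Y H h cf E. mesh2 a b M X c d N Y n H h ==> \<delta> <= h ==> H <= Cq*h ==> H <= h0 ==>
   (\<forall>k\<in>JJ M N n. \<bar>ip RP (LG (zz M N n X Y cf)) (eb2 n X Y k)\<bar> <= E) ==> 0 <= E ==> \<kappa> (M, N)*nrm RP (zz M N n X Y cf) <= E"
  by (metis fst_conv snd_conv)
 \<comment> \<open>Cells of length at least \<delta> fit into the sides at most this many
   times.\<close>
 define K where "K = nat \<lceil>((b-a) + (d-c))/\<delta>\<rceil>"
 define k0 where "k0 = Min (\<kappa> ` ({..K} \<times> {..K}))"
 have k0: "0 < k0" unfolding k0_def using \<kappa> by (subst Min_gr_iff) auto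
 have k0_le: "k0 <= \<kappa> (M, N)" if "M <= K" "N <= K" for M N
  unfolding k0_def by (rule Min_le) (use that in auto)
 define Cz where "Cz = (d-c)\<^sup>2 + (b-a)\<^sup>2 + (b-a)*(d-c)"
 have Cz: "0 < Cz" using ab cd unfolding Cz_def by (intro add_pos_pos) auto
 define C where "C = C1 + Cz/k0"
 have C: "0 < C" "C1 <= C" "Cz/k0 <= C" using C1 Cz k0 by (auto simp: C_def add_pos_pos)
 have "gsize a b c d (zz M N n X Y cf) <= C*pnorm a b c d M X N Y n (LG (zz M N n X Y cf))"
  if mesh: "mesh2 a b M X c d N Y n H h" and H: "H <= Cq*h" "H <= h0" for M X N Y H h cf
 proof -
  interpret scheme a b c d \<alpha> \<gamma> \<beta> M X N Y n H h using mesh pde_axioms by (simp add: scheme_def)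
  let ?p = "pnorm a b c d M X N Y n (LG (zz M N n X Y cf))"
  have p: "0 <= ?p" by (simp add: pnorm_def sum_nonneg)
  show ?thesis
  proof (cases "H <= h1")
   case True
   then have "gsize a b c d (zz M N n X Y cf) <= C1 * ?p" by (rule fine[OF mesh H(1)])
   also have "... <= C * ?p" using C p by (intro mult_right_mono) auto
   finally show ?thesis .
  next
   case False
   have \<delta>h: "\<delta> <= h" unfolding \<delta>_def using False H(1) Cq by (simp add: pos_divide_le_eq mult.commute)
   have "real M*\<delta> <= b - a" "real N*\<delta> <= d - c"
    using mx.M_le[of \<delta>] my.M_le[of \<delta>] hx hy \<delta>h order_trans by blast+
   then have "real M <= ((b-a) + (d-c))/\<delta>" "real N <= ((b-a) + (d-c))/\<delta>"
    using ab cd \<delta> by (simp_all add: pos_le_divide_eq)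
   then have "M <= K" "N <= K" unfolding K_def by linarith+
   have "k0*nrm RP (zz M N n X Y cf) <= \<kappa> (M, N)*nrm RP (zz M N n X Y cf)"
    by (intro mult_right_mono k0_le \<open>M \<le> K\<close> \<open>N \<le> K\<close> nrm_nonneg)
   also have "... <= ?p"
    by (rule kap[OF mesh \<delta>h H _ p]) (use ip_le_nrm_PP nrm_PP in auto)
   finally have z: "nrm RP (zz M N n X Y cf) <= ?p/k0" using k0 by (simp add: pos_le_divide_eq mult.commute)
   have "gsize a b c d (zz M N n X Y cf) <= Cz*nrm RP (zz M N n X Y cf)"
    unfolding Cz_def by (rule gsize_le) (simp add: comb_zz[symmetric])
   also have "... <= Cz*(?p/k0)" using z Cz by (intro mult_left_mono) auto
   also have "... <= C * ?p" using mult_right_mono[OF C(3) p] by simp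
   finally show ?thesis .
  qed
 qed
 then show ?thesis using C(1) by blast
qed

end

section \<open>Error estimates\<close>

text \<open>Both functions are x-derivatives of $u_y$, once as a member of the family and once after
  writing $u_y$ through $u_{xxyy}$; weak derivatives are unique.\<close>

lemma (in weak_derivs) mixed_xy:
 assumes m4: "4 <= m"
 shows "AE s in R. U 1 1 s = Gx' a b (Gy' c d (U 2 2)) s"
proof (rule twd_unique)
 have sq: "U 2 2 \<in> sqint R" "U 0 2 \<in> sqint R" "U 0 1 \<in> sqint R" using U_sq m4 by auto
 let ?w = "Gy' c d (U 2 2)"
 have w: "?w \<in> sqint R" by (rule Gy'_sqint[OF cd sq(1)])
 have 1: "AE s in R. Gy' c d (U 0 2) s = Gy' c d (Gx a b (U 2 2)) s"
  by (rule Ly_cong_sq[OF mixed_y[OF m4] bkern_G1k[OF cd] sq(2) Gx_sqint[OF ab sq(1)]])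
 have 2: "Gy' c d (Gx a b (U 2 2)) = Gx a b ?w"
  by (rule Lx_Ly_commute[OF bkern_Gk[OF ab] bkern_G1k[OF cd] rm.sqint_int[OF sq(1)], symmetric])
 from 1 repr_y(2) have eq: "AE s in R. U 0 1 s = Gx a b ?w s" by eventually_elim (simp add: 2)
 show "twd a b c d 1 0 (U 0 1) (U 1 1)" using step_x[of 0 1] m4 by simp
 show "twd a b c d 1 0 (U 0 1) (Gx' a b ?w)"
  unfolding twd_def
 proof (intro conjI allI impI)
  fix \<phi> \<psi> assume t: "test1 a b \<phi>" "test1 c d \<psi>"
  have s: "smooth1 \<phi>" "smooth1 \<psi>" using t by (auto simp: test1_def)
  have "ip R (U 0 1) (tensor (deriv \<phi>) \<psi>) = ip R (Gx a b ?w) (tensor (deriv \<phi>) \<psi>)"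
   by (rule ip_cong_sq[OF eq _ sq(3) Gx_sqint[OF ab w]]) (auto intro!: tensor_sqint test1_deriv t)
  also have "... = - ip R (Gx' a b ?w) (tensor \<phi> \<psi>)"
   using ip_xpair_Gx[OF ab xpair_test[OF ab test_tensor[OF t]] w] by (simp add: partial_tensor[OF s])
  finally show "ip R (U 0 1) (tensor ((deriv ^^ 1) \<phi>) ((deriv ^^ 0) \<psi>)) = (- 1) ^ (1+0)*ip R (Gx' a b ?w) (tensor \<phi> \<psi>)" by simp
 qed (use sq Gx'_sqint[OF ab w] in auto)
qed

context mesh2
begin

text \<open>The errors of $u_{xx}$ and $u_{yy}$ use r derivatives in all. Those of $u_{xxyy}$ reach
  order r + 1 and still have one power of H less, which the factor H on the left supplies. The bound
  r - 2 \<le> n on the length of the chain is the restriction r \<le> k + 1.\<close>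

lemma chain_residuals:
 assumes wd: "weak_derivs a b c d m U" and r: "3 <= r" "r + 1 <= m" "r <= n + 2"
  and S: "!!i j. i + j <= m ==> nrm R (U i j) <= S"
 shows "nrm R (%s. U 2 0 s - Px (U 2 0) s) <= H ^ (r-2)*S"
  "nrm R (%s. U 0 2 s - Py (U 0 2) s) <= H ^ (r-2)*S"
  "H*nrm R (%s. U 2 2 s - Px (U 2 2) s) <= H ^ (r-2)*S"
  "H*nrm R (%s. U 2 2 s - Py (U 2 2) s) <= H ^ (r-2)*S"
proof -
 interpret W: weak_derivs a b c d m U by (rule wd)
 have x: "nrm R (%s. U i j s - Px (U i j) s) <= H ^ t*S" if "i + j + t <= m" "t <= n" for i j t
 proof -
  have "nrm R (%s. U (i+0) j s - Px (U (i+0) j) s) <= H ^ t*nrm R (U (i+t) j)"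
   by (rule mx.nrm_Px_residual_chain[OF that(2) Hx, of "%l. U (i+l) j"]) (use that W.U_sq W.chain_x in auto)
  also have "... <= H ^ t*S" using that H_pos by (intro mult_left_mono S) auto
  finally show ?thesis by simp
 qed
 have y: "nrm R (%s. U i j s - Py (U i j) s) <= H ^ t*S" if "i + j + t <= m" "t <= n" for i j t
 proof -
  have "nrm R (%s. U i (j+0) s - Py (U i (j+0)) s) <= H ^ t*nrm R (U i (j+t))"
   by (rule nrm_Py_residual_chain[OF that(2), of "%l. U i (j+l)"]) (use that W.U_sq W.chain_y in auto)
  also have "... <= H ^ t*S" using that H_pos by (intro mult_left_mono S) auto
  finally show ?thesis by simp
 qed
 have e: "H*(H ^ (r-3)*S) = H ^ (r-2)*S"
 proof -
  have "r - 2 = Suc (r-3)" using r by simp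
  then show ?thesis by simp
 qed
 show "nrm R (%s. U 2 0 s - Px (U 2 0) s) <= H ^ (r-2)*S" by (rule x) (use r in auto)
 show "nrm R (%s. U 0 2 s - Py (U 0 2) s) <= H ^ (r-2)*S" by (rule y) (use r in auto)
 have "nrm R (%s. U 2 2 s - Px (U 2 2) s) <= H ^ (r-3)*S" by (rule x) (use r in auto)
 from mult_left_mono[OF this less_imp_le[OF H_pos]] show "H*nrm R (%s. U 2 2 s - Px (U 2 2) s) <= H ^ (r-2)*S" by (simp only: e)
 have "nrm R (%s. U 2 2 s - Py (U 2 2) s) <= H ^ (r-3)*S" by (rule y) (use r in auto)
 from mult_left_mono[OF this less_imp_le[OF H_pos]] show "H*nrm R (%s. U 2 2 s - Py (U 2 2) s) <= H ^ (r-2)*S" by (simp only: e)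
qed

lemma Gxy'_diff:
 assumes "g \<in> sqint R" "g' \<in> sqint R"
 shows "AE s in R. Gx' a b (Gy' c d (%s. g s - g' s)) s = Gx' a b (Gy' c d g) s - Gx' a b (Gy' c d g') s"
proof -
 note sq = Gy'_sqint[OF my.ab assms(1)] Gy'_sqint[OF my.ab assms(2)]
 have "AE s in R. Gx' a b (Gy' c d (%s. g s - g' s)) s = Gx' a b (%s. Gy' c d g s - Gy' c d g' s) s"
  by (rule Lx_cong_sq[OF Ly_diff[OF kernels(4) assms] kernels(2) Gy'_sqint[OF my.ab sqint_diff[OF assms]] sqint_diff[OF sq]])
 then show ?thesis using Lx_diff[OF kernels(2) sq] by eventually_elim simp
qed

lemma best_approx:
 assumes wd: "weak_derivs a b c d m U" and r: "1 <= r" "r + 1 <= m" "r <= n + 2"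
  and S: "!!i j. i + j <= m ==> nrm R (U i j) <= S"
 obtains \<xi> where
  "nrm R (%s. U 2 0 s - Gy c d (on2.comb \<xi>) s) <= (1 + (b-a) + (d-c))*(H ^ (r-2)*S)"
  "nrm R (%s. U 0 2 s - Gx a b (on2.comb \<xi>) s) <= (1 + (b-a) + (d-c))*(H ^ (r-2)*S)"
  "nrm R (%s. U 1 1 s - Gx' a b (Gy' c d (on2.comb \<xi>)) s) <= (1 + (b-a) + (d-c))*(H ^ (r-2)*S)"
proof -
 interpret W: weak_derivs a b c d m U by (rule wd)
 have K: "t <= (1 + (b-a) + (d-c))*t" "t + (b-a)*t <= (1 + (b-a) + (d-c))*t"
  "t + (d-c)*t <= (1 + (b-a) + (d-c))*t" "(b-a)*t + (d-c)*t <= (1 + (b-a) + (d-c))*t" if "0 <= t" for t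
  using that mult_nonneg_nonneg[OF _ that, of "b - a"] mult_nonneg_nonneg[OF _ that, of "d - c"] mx.ab my.ab by (auto simp: distrib_right)
 have S0: "0 <= S" using S[of 0 0] nrm_nonneg[of R "U 0 0"] by linarith
 have t0: "0 <= H ^ (r-2)*S" using S0 H_pos by simp
 show thesis
 proof (cases "r <= 2")
  case True
  \<comment> \<open>For r at most 2 the exponent r - 2 is 0 as a natural number, so the zero
    function is accurate enough; $u_{xxyy}$ need not exist then.\<close>
  have c0: "on2.comb (%_. 0) = (%_. 0)" by (simp add: on2.comb_def)
  have L0: "Lx m K (%_. 0) = (%_. 0)" "Ly m K (%_. 0) = (%_. 0)" for m K by (simp_all add: Lx_def Ly_def kop_def)
  have "r - 2 = 0" using True by simp
  then show thesis
   using S[of 2 0] S[of 0 2] S[of 1 1] r K(1)[OF S0] by (intro that[of "%_. 0"]) (simp_all add: c0 L0)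
 next
  case False
  then have r3: "3 <= r" and m4: "4 <= m" using r by auto
  have sq: "U 2 2 \<in> sqint R" "U 2 0 \<in> sqint R" "U 0 2 \<in> sqint R" "U 1 1 \<in> sqint R" using W.U_sq m4 by auto
  note g = sq(1)
  \<comment> \<open>The coefficients of the projection of $u_{xxyy}$, so the comparison function has
    this projection as its fourth derivative.\<close>
  define \<xi> where "\<xi> k = ip R (U 2 2) (e2 k)" for k
  have \<xi>: "on2.comb \<xi> = PP (U 2 2)" by (simp add: on2.proj_def \<xi>_def[abs_def])
  note P = PP_sq[of "U 2 2"]
  note res = chain_residuals[OF wd r3 r(2,3) S]
  have res': "(d-c)*H*nrm R (%s. U 2 2 s - Px (U 2 2) s) <= (d-c)*(H ^ (r-2)*S)"
   "(b-a)*H*nrm R (%s. U 2 2 s - Px (U 2 2) s) <= (b-a)*(H ^ (r-2)*S)"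
   "(d-c)*H*nrm R (%s. U 2 2 s - Py (U 2 2) s) <= (d-c)*(H ^ (r-2)*S)"
   "(b-a)*H*nrm R (%s. U 2 2 s - Py (U 2 2) s) <= (b-a)*(H ^ (r-2)*S)"
   unfolding mult.assoc using mx.ab my.ab by (intro mult_left_mono[OF res(3)] mult_left_mono[OF res(4)]; simp)+
  note G = Gy_sqint[OF my.ab g] Gx_sqint[OF mx.ab g] Gy_sqint[OF my.ab P] Gx_sqint[OF mx.ab P]
  have 1: "nrm R (%s. U 2 0 s - Gy c d (PP (U 2 2)) s) <= H ^ (r-2)*S + (d-c)*(H ^ (r-2)*S)"
  proof -
   have "AE s in R. U 2 0 s - Gy c d (PP (U 2 2)) s = Gy c d (%s. U 2 2 s - PP (U 2 2) s) s"
    using W.mixed_x[OF m4] Ly_diff[OF kernels(3) g P] by eventually_elim simp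
   then have "nrm R (%s. U 2 0 s - Gy c d (PP (U 2 2)) s) = nrm R (Gy c d (%s. U 2 2 s - PP (U 2 2) s))"
    by (rule nrm_cong_sq) (intro sqint_diff sq G Gy_sqint[OF my.ab] P)+
   also have "... <= nrm R (%s. Gy c d (U 2 2) s - Px (Gy c d (U 2 2)) s) + (d-c)*H*nrm R (%s. U 2 2 s - Py (U 2 2) s)"
    by (rule approx_yy[OF g])
   also have "nrm R (%s. Gy c d (U 2 2) s - Px (Gy c d (U 2 2)) s) = nrm R (%s. U 2 0 s - Px (U 2 0) s)"
   proof (rule nrm_cong_sq)
    show "AE s in R. Gy c d (U 2 2) s - Px (Gy c d (U 2 2)) s = U 2 0 s - Px (U 2 0) s"
     using W.mixed_x[OF m4] Lx_cong_sq[OF W.mixed_x[OF m4] kernels(5) sq(2) G(1)] by eventually_elim simp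
   qed (rule residual_sq(1)[OF G(1)] residual_sq(1)[OF sq(2)])+
   finally show ?thesis using res(1) res'(3) by linarith
  qed
  have 2: "nrm R (%s. U 0 2 s - Gx a b (PP (U 2 2)) s) <= H ^ (r-2)*S + (b-a)*(H ^ (r-2)*S)"
  proof -
   have "AE s in R. U 0 2 s - Gx a b (PP (U 2 2)) s = Gx a b (%s. U 2 2 s - PP (U 2 2) s) s"
    using W.mixed_y[OF m4] Lx_diff[OF kernels(1) g P] by eventually_elim simp
   then have "nrm R (%s. U 0 2 s - Gx a b (PP (U 2 2)) s) = nrm R (Gx a b (%s. U 2 2 s - PP (U 2 2) s))"
    by (rule nrm_cong_sq) (intro sqint_diff sq G Gx_sqint[OF mx.ab] P)+
   also have "... <= nrm R (%s. Gx a b (U 2 2) s - Py (Gx a b (U 2 2)) s) + (b-a)*H*nrm R (%s. U 2 2 s - Px (U 2 2) s)"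
    by (rule approx_xx[OF g])
   also have "nrm R (%s. Gx a b (U 2 2) s - Py (Gx a b (U 2 2)) s) = nrm R (%s. U 0 2 s - Py (U 0 2) s)"
   proof (rule nrm_cong_sq)
    show "AE s in R. Gx a b (U 2 2) s - Py (Gx a b (U 2 2)) s = U 0 2 s - Py (U 0 2) s"
     using W.mixed_y[OF m4] Ly_cong_sq[OF W.mixed_y[OF m4] kernels(6) sq(3) G(2)] by eventually_elim simp
   qed (rule residual_sq(2)[OF G(2)] residual_sq(2)[OF sq(3)])+
   finally show ?thesis using res(2) res'(2) by linarith
  qed
  have 3: "nrm R (%s. U 1 1 s - Gx' a b (Gy' c d (PP (U 2 2))) s) <= (b-a)*(H ^ (r-2)*S) + (d-c)*(H ^ (r-2)*S)"
  proof -
   have "AE s in R. U 1 1 s - Gx' a b (Gy' c d (PP (U 2 2))) s = Gx' a b (Gy' c d (%s. U 2 2 s - PP (U 2 2) s)) s"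
    using W.mixed_xy[OF m4] Gxy'_diff[OF g P] by eventually_elim simp
   then have "nrm R (%s. U 1 1 s - Gx' a b (Gy' c d (PP (U 2 2))) s) = nrm R (Gx' a b (Gy' c d (%s. U 2 2 s - PP (U 2 2) s)))"
    by (rule nrm_cong_sq) (intro sqint_diff sq Gx'_sqint[OF mx.ab] Gy'_sqint[OF my.ab] P)+
   also have "... <= (d-c)*H*nrm R (%s. U 2 2 s - Px (U 2 2) s) + (b-a)*H*nrm R (%s. U 2 2 s - Py (U 2 2) s)"
    by (rule approx_xy[OF g])
   finally show ?thesis using res'(1,4) by linarith
  qed
  show thesis
   by (rule that[of \<xi>]; unfold \<xi>) (rule order_trans[OF 1 K(3)[OF t0]] order_trans[OF 2 K(2)[OF t0]] order_trans[OF 3 K(4)[OF t0]])+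
 qed
qed

end

context scheme
begin

text \<open>The xx and yy errors follow from quasi-optimality with the comparison function. The xy
  error is not part of D there; it is split at the comparison function and uses the bound on
  \<open>size2\<close>.\<close>

lemma second_order_error:
 assumes stab: "!!cf. size2 cf <= C*nrm R (PP (Lh cf))" and C: "0 <= C"
  and wd: "weak_derivs a b c d m U" and r: "1 <= r" "r + 1 <= m" "r <= n + 2"
  and S: "!!i j. i + j <= m ==> nrm R (U i j) <= S"
  and gal: "PP (LL (U 2 0) (U 0 2)) = PP (Lh cf)"
 defines "K \<equiv> 2*(1 + (b-a) + (d-c))"
 shows "nrm R (%s. U 2 0 s - Gy c d (on2.comb cf) s) + nrm R (%s. U 0 2 s - Gx a b (on2.comb cf) s)
   <= (1 + C*CL)*K*(H ^ (r-2)*S)" (is "?A <= _")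
  and "nrm R (%s. U 1 1 s - Gx' a b (Gy' c d (on2.comb cf)) s) <= (1 + C*CL)*K*(H ^ (r-2)*S)" (is "?B <= _")
proof -
 interpret W: weak_derivs a b c d m U by (rule wd)
 have sq: "U 2 0 \<in> sqint R" "U 0 2 \<in> sqint R" "U 1 1 \<in> sqint R" using W.U_sq r by auto
 obtain \<xi> where \<xi>: "nrm R (%s. U 2 0 s - Gy c d (on2.comb \<xi>) s) <= (1 + (b-a) + (d-c))*(H ^ (r-2)*S)"
  "nrm R (%s. U 0 2 s - Gx a b (on2.comb \<xi>) s) <= (1 + (b-a) + (d-c))*(H ^ (r-2)*S)"
  "nrm R (%s. U 1 1 s - Gx' a b (Gy' c d (on2.comb \<xi>)) s) <= (1 + (b-a) + (d-c))*(H ^ (r-2)*S)"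
  using best_approx[OF wd r S] by blast
 have Kt: "K*(H ^ (r-2)*S) = 2*((1 + (b-a) + (d-c))*(H ^ (r-2)*S))" unfolding K_def by (rule mult.assoc)
 have D: "nrm R (%s. U 2 0 s - Gy c d (on2.comb \<xi>) s) + nrm R (%s. U 0 2 s - Gx a b (on2.comb \<xi>) s) <= K*(H ^ (r-2)*S)"
  using Kt \<xi>(1,2) by linarith
 note es = error_stable[OF stab C sq(1,2) gal D]
 show "?A <= (1 + C*CL)*K*(H ^ (r-2)*S)" using es(1) by (simp add: mult.assoc)
 have cd: "on2.comb (%i. cf i - \<xi> i) = (%s. on2.comb cf s - on2.comb \<xi> s)"
  by (simp add: on2.comb_def fun_eq_iff left_diff_distrib sum_subtractf)
 let ?G = "%z. Gx' a b (Gy' c d z)"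
 have Gs: "?G (on2.comb u) \<in> sqint R" for u by (intro Gx'_sqint[OF mx.ab] Gy'_sqint[OF my.ab]) simp
 have "AE s in R. U 1 1 s - ?G (on2.comb cf) s = (U 1 1 s - ?G (on2.comb \<xi>) s) - ?G (on2.comb (%i. cf i - \<xi> i)) s"
  using Gxy'_diff[of "on2.comb cf" "on2.comb \<xi>", folded cd, OF on2.comb_sqint on2.comb_sqint] by eventually_elim simp
 then have "?B = nrm R (%s. (U 1 1 s - ?G (on2.comb \<xi>) s) - ?G (on2.comb (%i. cf i - \<xi> i)) s)"
  by (rule nrm_cong_sq) (intro sqint_diff sq Gs)+
 also have "... <= nrm R (%s. U 1 1 s - ?G (on2.comb \<xi>) s) + nrm R (?G (on2.comb (%i. cf i - \<xi> i)))"
  by (rule nrm_diff_triangle[OF sqint_diff[OF sq(3) Gs] Gs])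
 also have "nrm R (?G (on2.comb (%i. cf i - \<xi> i))) <= size2 (%i. cf i - \<xi> i)"
  unfolding size2_def by simp
 also note es(2)
 finally have "?B <= (1 + (b-a) + (d-c))*(H ^ (r-2)*S) + C*CL*(K*(H ^ (r-2)*S))" using \<xi>(3) by simp
 moreover have "(1 + (b-a) + (d-c))*(H ^ (r-2)*S) <= K*(H ^ (r-2)*S)"
  using Kt \<xi>(1) nrm_nonneg[of R "%s. U 2 0 s - Gy c d (on2.comb \<xi>) s"] by linarith
 ultimately show "?B <= (1 + C*CL)*K*(H ^ (r-2)*S)" by (simp add: distrib_right mult.assoc)
qed

end

context scheme
begin

text \<open>For H at most h1 these are the energy and duality estimates. For larger H the trivial
  bounds of the Green operators suffice, since H/h1 > 1 may be inserted; the dual problem is never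
  solved on those meshes.\<close>

lemma lower_order_error:
 assumes p: "p \<in> sqint R" and q: "q \<in> sqint R" and eq: "AE s in R. Gx a b p s = Gy c d q s"
  and orth: "PP (LL p q) = (%_. 0)" and h1: "0 < h1" and C1: "0 <= C1"
  and fine: "!!cf. H <= h1 ==> gsize a b c d (zz M N n X Y cf) <=
   C1*pnorm a b c d M X N Y n (Lop a b c d \<alpha> (- \<beta>) \<gamma> (Gy c d (zz M N n X Y cf)) (Gx a b (zz M N n X Y cf)))"
 shows "nrm R (Gx' a b p) + nrm R (Gy' c d q) <= (sqrt (2*CL/\<alpha>) + ((b-a) + (d-c))/h1)*(H*(nrm R p + nrm R q))"
  and "nrm R (Gx a b p) <= (2*CL*C1 + 1 + (b-a)\<^sup>2/h1^2)*(H^2*(nrm R p + nrm R q))"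
proof -
 let ?T = "nrm R p + nrm R q"
 have T: "0 <= ?T" "nrm R p <= ?T" "nrm R q <= ?T" by simp_all
 have HT: "0 <= H * ?T" "0 <= H^2 * ?T" using T H_pos by simp_all
 \<comment> \<open>A bound by y T becomes one by x y H T as soon as x H is at least 1; it is applied
   with x = 1/h1.\<close>
 have coarse: "t <= (x*y)*(H * ?T)" if "t <= y * ?T" "0 <= y" "1 <= x*H" for t x y
 proof -
  have "1*(y * ?T) <= (x*H)*(y * ?T)" using that T by (intro mult_right_mono) auto
  then show ?thesis using that(1) by (simp add: mult_ac)
 qed
 have "nrm R (Gx' a b p) + nrm R (Gy' c d q) <= ((b-a) + (d-c))/h1*(H * ?T)" if "\<not> H <= h1"
 proof -
  have "0 <= (b-a)*nrm R q" "0 <= (d-c)*nrm R p" using mx.ab my.ab by simp_all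
  then have "nrm R (Gx' a b p) <= (b-a) * ?T" "nrm R (Gy' c d q) <= (d-c) * ?T"
   using nrm_Gx'[OF mx.ab p] nrm_Gy'[OF my.ab q] unfolding distrib_left by linarith+
  then have "nrm R (Gx' a b p) + nrm R (Gy' c d q) <= ((b-a) + (d-c)) * ?T" by (simp add: distrib_right)
  from coarse[OF this, of "1/h1"] show ?thesis using that h1 mx.ab my.ab by simp
 qed
 moreover have "nrm R (Gx' a b p) + nrm R (Gy' c d q) <= sqrt (2*CL/\<alpha>)*(H * ?T)"
  using galerkin_h1[OF p q eq orth] by (simp only: mult.assoc)
 moreover have "0 <= ((b-a) + (d-c))/h1*(H * ?T)" using HT(1) h1 mx.ab my.ab by simp
 ultimately show "nrm R (Gx' a b p) + nrm R (Gy' c d q) <= (sqrt (2*CL/\<alpha>) + ((b-a) + (d-c))/h1)*(H * ?T)"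
  unfolding distrib_right[of "sqrt (2*CL/\<alpha>)"] by linarith
 have pos: "0 <= (2*CL*C1 + 1)*(H^2 * ?T)" "0 <= (b-a)\<^sup>2/h1^2*(H^2 * ?T)" using HT(2) CL_pos C1 by simp_all
 show "nrm R (Gx a b p) <= (2*CL*C1 + 1 + (b-a)\<^sup>2/h1^2)*(H^2 * ?T)"
 proof (cases "H <= h1")
  case True
  interpret D: scheme a b c d \<alpha> \<gamma> "- \<beta>" M X N Y n H h by unfold_locales
  have st: "size2 cf <= C1*nrm R (PP (D.Lh cf))" for cf
   using fine[OF True, of cf] unfolding size2_gsize nrm_PP comb_zz .
  obtain cf where cf: "PP (D.Lh cf) = PP (Gx a b p)" using D.discrete_solvable[OF st] by blast
  have "nrm R (Gx a b p) <= (2*CL*C1 + 1)*(H^2 * ?T)"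
   using galerkin_l2[OF p q eq orth cf st C1] by (simp only: mult.assoc)
  then show ?thesis using pos(2) unfolding distrib_right[of _ "(b-a)\<^sup>2/h1^2"] by linarith
 next
  case False
  have "nrm R (Gx a b p) <= (b-a)\<^sup>2 * ?T"
   using nrm_Gx[OF mx.ab p] mult_left_mono[OF T(2), of "(b-a)\<^sup>2"] by simp
  moreover have "1*((b-a)\<^sup>2 * ?T) <= (H^2/h1^2)*((b-a)\<^sup>2 * ?T)"
   using False h1 T power_mono[of h1 H 2] by (intro mult_right_mono) auto
  ultimately have "nrm R (Gx a b p) <= (b-a)\<^sup>2/h1^2*(H^2 * ?T)" by (simp add: mult_ac)
  then show ?thesis using pos(1) unfolding distrib_right[of _ "(b-a)\<^sup>2/h1^2"] by linarith
 qed
qed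

end

lemma multi_indices:
 "{(i, j). i + j <= (0::nat)} = {(0, 0)}" "{(i, j). i + j <= (1::nat)} = {(0, 0), (1, 0), (0, 1)}"
 "{(i, j). i + j <= (2::nat)} = {(0, 0), (1, 0), (0, 1), (2, 0), (1, 1), (0, 2)}"
 by (auto simp: numeral_2_eq_2 le_Suc_eq)

lemma mesh2_of_mesh:
 assumes T: "mesh_of a b c d T" and ab: "a < b" and cd: "c < d" and n: "2 <= n"
 shows "mesh2 a b (nx T) (xpt T) c d (ny T) (ypt T) n (mesh_size T) (min_edge T)"
proof -
 have M: "1 <= nx T" "1 <= ny T" using T ab cd unfolding mesh_of_def by (metis One_nat_def less_irrefl less_one not_le)+
 have x: "mesh1 a b (nx T) (xpt T) n" and y: "mesh1 c d (ny T) (ypt T) n"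
  using T ab cd n unfolding mesh_of_def mesh1_def by blast+
 have fin: "finite (edge_lengths T)" "edge_lengths T \<noteq> {}" using M by (auto simp: edge_lengths_def)
 have e: "xpt T i - xpt T (i-1) \<in> edge_lengths T" if "i \<in> {1..nx T}" for i
  using that unfolding edge_lengths_def by blast
 have e': "ypt T i - ypt T (i-1) \<in> edge_lengths T" if "i \<in> {1..ny T}" for i
  using that unfolding edge_lengths_def by blast
 have "0 < min_edge T"
  unfolding min_edge_def using fin T by (subst Min_gr_iff) (auto simp: edge_lengths_def mesh_of_def)
 then show ?thesis
  unfolding mesh2_def mesh2_axioms_def min_edge_def mesh_size_def
  using x y Min_le[OF fin(1) e] Min_le[OF fin(1) e'] Max_ge[OF fin(1) e] Max_ge[OF fin(1) e'] by blast
qed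

text \<open>The bounds H and h need not be attained, but the actual sizes are only better, so the
  solvability assumption of the theorem covers every \<open>mesh2\<close>.\<close>

lemma (in mesh2) mesh_TT: "mesh_of a b c d TT" "mesh_size TT <= H" "h <= min_edge TT"
proof -
 show "mesh_of a b c d TT"
  unfolding mesh_of_def using mx.X_0 mx.X_M mx.X_less my.X_0 my.X_M my.X_less by simp
 have fin: "finite (edge_lengths TT)" "edge_lengths TT \<noteq> {}" using mx.M_pos by (auto simp: edge_lengths_def)
 have "e <= H \<and> h <= e" if "e \<in> edge_lengths TT" for e
  using that hx Hx hy Hy unfolding edge_lengths_def by auto
 then show "mesh_size TT <= H" "h <= min_edge TT"
  unfolding mesh_size_def min_edge_def using fin by simp_all
qed

text \<open>P, Q, V are the xx, yy and xy derivatives of the error, which is both \<open>Gx\<close>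
  of P and \<open>Gy\<close> of Q. Its Sobolev norms reduce to norms of these functions, and P, Q
  satisfy the Galerkin orthogonality that the lower order estimates require.\<close>

lemma (in scheme) sobolev_error:
 assumes bu: "brep a b c d u (U 0 0)" and wu: "!!i j. i + j <= 2 ==> has_weak_pd Dom i j u (U i j)"
  and wd: "weak_derivs a b c d m U"
  and uh: "!!p. p \<in> Dom ==> uh p = Gx a b (Gy c d (on2.comb cf)) p"
  and gal: "PP (LL (U 2 0) (U 0 2)) = PP (Lh cf)"
 defines "P \<equiv> %s. U 2 0 s - Gy c d (on2.comb cf) s" and "Q \<equiv> %s. U 0 2 s - Gx a b (on2.comb cf) s"
  and "V \<equiv> %s. U 1 1 s - Gx' a b (Gy' c d (on2.comb cf)) s"
 shows "P \<in> sqint R" "Q \<in> sqint R" "AE s in R. Gx a b P s = Gy c d Q s" "PP (LL P Q) = (%_. 0)"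
  and "sobolev_norm Dom 0 (%p. u p - uh p) <= nrm R (Gx a b P)"
  and "sobolev_norm Dom 1 (%p. u p - uh p) <= nrm R (Gx a b P) + (nrm R (Gx' a b P) + nrm R (Gy' c d Q))"
  and "sobolev_norm Dom 2 (%p. u p - uh p) <= nrm R (Gx a b P) + (nrm R (Gx' a b P) + nrm R (Gy' c d Q)) + (nrm R P + nrm R Q + nrm R V)"
proof -
 interpret W: weak_derivs a b c d m U by (rule wd)
 let ?z = "on2.comb cf"
 have z: "?z \<in> sqint R" by simp
 have sq: "U 2 0 \<in> sqint R" "U 0 2 \<in> sqint R" using W.U_sq W.m by auto
 show P: "P \<in> sqint R" and Q: "Q \<in> sqint R" unfolding P_def Q_def by (intro sqint_diff sq comb_sq)+
 have dx: "AE s in R. Gx a b P s = Gx a b (U 2 0) s - Gx a b (Gy c d ?z) s" "AE s in R. Gx' a b P s = Gx' a b (U 2 0) s - Gx' a b (Gy c d ?z) s"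
  unfolding P_def by (rule Lx_diff[OF kernels(1) sq(1) comb_sq(1)]) (rule Lx_diff[OF kernels(2) sq(1) comb_sq(1)])
 have dy: "AE s in R. Gy c d Q s = Gy c d (U 0 2) s - Gy c d (Gx a b ?z) s" "AE s in R. Gy' c d Q s = Gy' c d (U 0 2) s - Gy' c d (Gx a b ?z) s"
  unfolding Q_def by (rule Ly_diff[OF kernels(3) sq(2) comb_sq(2)]) (rule Ly_diff[OF kernels(4) sq(2) comb_sq(2)])
 show "AE s in R. Gx a b P s = Gy c d Q s"
  using dx(1) dy(1) W.repr_x(1) W.repr_y(1) comb_eq[of cf] by eventually_elim simp
 have "PP (LL P Q) = PP (%s. LL (U 2 0) (U 0 2) s - Lh cf s)"
  unfolding P_def Q_def
  by (rule on2.proj_cong_AE[OF LL_diff[OF sq comb_sq]]) (intro sqint_measurable LL_sqint sqint_diff sq comb_sq Lh_sq)+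
 also have "... = (%s. PP (LL (U 2 0) (U 0 2)) s - PP (Lh cf) s)" by (rule on2.proj_diff[OF LL_sqint[OF sq] Lh_sq])
 finally show "PP (LL P Q) = (%_. 0)" by (simp add: gal)
 have bw: "brep a b c d uh (Gx a b (Gy c d ?z))"
  unfolding brep_def using uh by (auto simp: AE_rm_iff intro!: Gx_sqint[OF mx.ab] comb_sq(1))
 define w where "w i j = (if i = 0 \<and> j = 0 then Gx a b (Gy c d ?z) else if i = 1 \<and> j = 0 then Gx' a b (Gy c d ?z)
  else if i = 0 \<and> j = 1 then Gy' c d (Gx a b ?z) else if i = 2 then Gy c d ?z else if j = 2 then Gx a b ?z else Gx' a b (Gy' c d ?z))" for i j :: nat
 note GG = has_weak_pd_GG[OF mx.ab my.ab z bw]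
 have ww: "has_weak_pd Dom i j uh (w i j) \<and> w i j \<in> sqint R" if "i + j <= 2" for i j
 proof -
  have "(i, j) \<in> {(0, 0), (1, 0), (0, 1), (2, 0), (1, 1), (0, 2)}" unfolding multi_indices(3)[symmetric] using that by simp
  then show ?thesis using GG comb_sq[of cf] Gx_sqint[OF mx.ab comb_sq(1)] Gx'_sqint[OF mx.ab comb_sq(1)] Gy'_sqint[OF my.ab comb_sq(2)]
    Gx'_sqint[OF mx.ab Gy'_sqint[OF my.ab z]]
   by (auto simp: w_def)
 qed
 define E where "E i j = (%s. U i j s - w i j s)" for i j
 have E: "has_weak_pd Dom i j (%p. u p - uh p) (E i j) \<and> E i j \<in> sqint R" if "i + j <= 2" for i j
  using has_weak_pd_diff[OF wu[OF that]] ww[OF that] W.U_sq[of i j] W.m that unfolding E_def by auto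
 have n00: "nrm R (E 0 0) = nrm R (Gx a b P)"
 proof (rule nrm_cong_sq)
  show "AE s in R. E 0 0 s = Gx a b P s" using dx(1) W.repr_x(1) by eventually_elim (simp add: E_def w_def)
 qed (use E[of 0 0] Gx_sqint[OF mx.ab P] in auto)
 have n10: "nrm R (E 1 0) = nrm R (Gx' a b P)"
 proof (rule nrm_cong_sq)
  show "AE s in R. E 1 0 s = Gx' a b P s" using dx(2) W.repr_x(2) by eventually_elim (simp add: E_def w_def)
 qed (use E[of 1 0] Gx'_sqint[OF mx.ab P] in auto)
 have n01: "nrm R (E 0 1) = nrm R (Gy' c d Q)"
 proof (rule nrm_cong_sq)
  show "AE s in R. E 0 1 s = Gy' c d Q s" using dy(2) W.repr_y(2) by eventually_elim (simp add: E_def w_def)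
 qed (use E[of 0 1] Gy'_sqint[OF my.ab Q] in auto)
 have n2: "E 2 0 = P" "E 0 2 = Q" "E 1 1 = V" by (simp_all add: E_def w_def P_def Q_def V_def)
 have S: "sobolev_norm Dom m (%p. u p - uh p) <= (\<Sum>(i, j)\<in>{(i, j). i + j <= m}. nrm R (E i j))" if "m <= 2" for m
  by (rule sobolev_norm_le[OF E]) (use that in auto)
 show "sobolev_norm Dom 0 (%p. u p - uh p) <= nrm R (Gx a b P)"
  using S[of 0] unfolding multi_indices by (simp add: n00)
 show "sobolev_norm Dom 1 (%p. u p - uh p) <= nrm R (Gx a b P) + (nrm R (Gx' a b P) + nrm R (Gy' c d Q))"
  using S[of 1, unfolded multi_indices] n10 n01 by (simp add: n00)
 show "sobolev_norm Dom 2 (%p. u p - uh p) <= nrm R (Gx a b P) + (nrm R (Gx' a b P) + nrm R (Gy' c d Q)) + (nrm R P + nrm R Q + nrm R V)"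
  using S[of 2, unfolded multi_indices] n10 n01 n2 by (simp add: n00)
qed

text \<open>Here \<tau> stands for $H^{r-2}$ times the norm of u, T0 for the pure and NV for the
  mixed second derivatives of the error, e1 and e0 for its lower orders. Surplus powers of H are
  replaced by powers of h0.\<close>

lemma final_bound:
 fixes H \<tau> A K1 K2 T0 NV e0 e1 n0 n1 n2 h0 :: real
 assumes H: "0 < H" "H <= h0" and pos: "0 <= \<tau>" "0 <= K1" "0 <= K2" "0 <= A"
  and T: "T0 <= A*\<tau>" "NV <= A*\<tau>" and e: "e1 <= K1*(H*T0)" "e0 <= K2*(H^2*T0)"
  and n: "n0 <= e0" "n1 <= e0 + e1" "n2 <= e0 + e1 + (T0+NV)"
 shows "n0 + H*n1 + H^2*n2 <= A*(K2 + h0*K2 + K1 + h0^2*K2 + h0*K1 + 2)*(H^2*\<tau>)"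
proof -
 define w where "w = A*(H^2*\<tau>)"
 have w: "0 <= w" using pos by (simp add: w_def)
 have H2: "0 <= H^2" "H^2 <= h0^2" using H power_mono[of H h0 2] by auto
 have T2: "H^2*T0 <= w" "H^2*NV <= w"
  using mult_left_mono[OF T(1) H2(1)] mult_left_mono[OF T(2) H2(1)] by (simp_all add: w_def mult_ac)
 have e0: "e0 <= K2*w" using e(2) mult_left_mono[OF T2(1) pos(3)] by linarith
 have "H*e1 <= H*(K1*(H*T0))" using e(1) H(1) by simp
 also have "... = K1*(H^2*T0)" by (simp add: power2_eq_square)
 also have "... <= K1*w" using mult_left_mono[OF T2(1) pos(2)] .
 finally have e1: "H*e1 <= K1*w" .
 have K: "0 <= K2*w" "0 <= K1*w" using w pos by simp_all
 have "H*e0 <= H*(K2*w)" using e0 H(1) by simp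
 also have "... <= h0*(K2*w)" using H(2) K(1) by (rule mult_right_mono)
 finally have e0': "H*e0 <= h0*(K2*w)" .
 have "H^2*e0 <= H^2*(K2*w)" using e0 H2(1) by (rule mult_left_mono)
 also have "... <= h0^2*(K2*w)" using H2(2) K(1) by (rule mult_right_mono)
 finally have e0'': "H^2*e0 <= h0^2*(K2*w)" .
 have "H^2*e1 = H*(H*e1)" by (simp add: power2_eq_square)
 also have "... <= H*(K1*w)" using e1 H(1) by simp
 also have "... <= h0*(K1*w)" using H(2) K(2) by (rule mult_right_mono)
 finally have e1': "H^2*e1 <= h0*(K1*w)" .
 have "H*n1 <= H*(e0+e1)" "H^2*n2 <= H^2*(e0 + e1 + (T0+NV))"
  using n H(1) H2(1) by (auto intro: mult_left_mono)
 then have "n0 + H*n1 + H^2*n2 <= K2*w + h0*(K2*w) + K1*w + h0^2*(K2*w) + h0*(K1*w) + 2*w"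
  using n(1) e0 e1 e0' e0'' e1' T2 unfolding distrib_left by linarith
 also have "... = A*(K2 + h0*K2 + K1 + h0^2*K2 + h0*K1 + 2)*(H^2*\<tau>)" by (simp add: w_def algebra_simps)
 finally show ?thesis .
qed

lemma has_weak_pd_sobolev_mono: "u \<in> sobolev \<Omega> l ==> m <= l ==> u \<in> sobolev \<Omega> m"
 unfolding sobolev_def by auto

theorem theorem5p1:
  fixes a b c d \<alpha> \<gamma> Cq h0 :: real and \<beta> :: "real \<times> real" and k l r :: nat
    and \<Omega> :: "(real \<times> real) set"
  assumes "a < b" and "c < d" and "\<Omega> = rect a b c d"
    and "\<alpha> > 0" and "\<gamma> \<ge> 0" and "k \<ge> 3"
    and "h0 > 0"
    and "\<And>T. mesh_of a b c d T \<Longrightarrow> quasi_uniform Cq T \<Longrightarrow> mesh_size T \<le> h0 \<Longrightarrow>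
           uniquely_solvable \<Omega> T k \<alpha> \<beta> \<gamma>"
    and "1 \<le> r" and "r \<le> min (l - 1) (k + 1)"
  shows "\<exists>C>0. \<forall>T f u uh.
           mesh_of a b c d T \<longrightarrow> quasi_uniform Cq T \<longrightarrow> mesh_size T \<le> h0 \<longrightarrow>
           u \<in> sobolev \<Omega> l \<longrightarrow> solves_bvp \<Omega> \<alpha> \<beta> \<gamma> f u \<longrightarrow>
           solves_pg \<Omega> T k \<alpha> \<beta> \<gamma> f uh \<longrightarrow>
           sobolev_norm \<Omega> 0 (\<lambda>p. u p - uh p)
             + mesh_size T * sobolev_norm \<Omega> 1 (\<lambda>p. u p - uh p)
             + (mesh_size T)\<^sup>2 * sobolev_norm \<Omega> 2 (\<lambda>p. u p - uh p)
           \<le> C * mesh_size T ^ r * sobolev_norm \<Omega> (r + 1) u"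
proof -
 \<comment> \<open>Polynomials of degree at most k - 2 have k - 1 coefficients; the condition on r
   becomes r \<le> n + 2.\<close>
 define n where "n = k - 1"
 have n: "2 <= n" "Suc n = k" using assms(6) by (auto simp: n_def)
 have r: "1 <= r" "r + 1 <= l" "r <= n + 2" using assms(9,10) n by auto
 note mesh2 = mesh2_of_mesh[OF _ assms(1,2) n(1)]
 show ?thesis
 proof (cases "0 < Cq")
  \<comment> \<open>For Cq at most 0 no mesh is quasi-uniform, so any constant will do.\<close>
  case False
  have "\<not> quasi_uniform Cq T" if "mesh_of a b c d T" for T
  proof
   assume "quasi_uniform Cq T"
   moreover have "0 < min_edge T" "0 < mesh_size T" using mesh2.h_pos[OF mesh2[OF that]] mesh2.H_pos[OF mesh2[OF that]] .
   ultimately show False using False mult_nonpos_nonneg[of Cq "min_edge T"] unfolding quasi_uniform_def by linarith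
  qed
  then show ?thesis by (intro exI[of _ 1]) auto
 next
  case Cq: True
  interpret pde a b c d \<alpha> \<gamma> \<beta> using assms(1,2,4,5) by unfold_locales
  \<comment> \<open>The adjoint problem; from it only the estimate on fine meshes is taken.\<close>
  interpret D: pde a b c d \<alpha> \<gamma> "- \<beta>" by unfold_locales
  have us: "uniquely_solvable (rect a b c d) (Mesh M X N Y) (Suc n) \<alpha> \<beta> \<gamma>"
   if mesh: "mesh2 a b M X c d N Y n H h" and H: "H <= Cq*h" "H <= h0" for M X N Y H h
  proof -
   note TT = mesh2.mesh_TT[OF mesh]
   have "Cq*h <= Cq*min_edge (Mesh M X N Y)" using TT(3) Cq by simp
   then show ?thesis using assms(8)[OF TT(1)] TT(2) H assms(3) n(2) by (simp add: quasi_uniform_def)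
  qed
  have "\<exists>C>0. \<forall>M X N Y H h cf. mesh2 a b M X c d N Y n H h --> H <= Cq*h --> H <= h0 -->
    gsize a b c d (zz M N n X Y cf) <= C*pnorm a b c d M X N Y n (LG (zz M N n X Y cf))"
   by (rule uniform_stable[OF n(1) Cq]) (rule us)
  then obtain C where C: "0 < C" and stab: "\<forall>M X N Y H h cf. mesh2 a b M X c d N Y n H h --> H <= Cq*h --> H <= h0 -->
    gsize a b c d (zz M N n X Y cf) <= C*pnorm a b c d M X N Y n (LG (zz M N n X Y cf))"
   by (elim exE conjE)
  from D.fine_uniform[OF n(1) Cq] obtain C1 h1 where C1: "0 < C1" "0 < h1" and fine: "\<forall>M X N Y H h cf. mesh2 a b M X c d N Y n H h --> H <= Cq*h --> H <= h1 -->
    gsize a b c d (zz M N n X Y cf) <= C1*pnorm a b c d M X N Y n (D.LG (zz M N n X Y cf))"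
   by (elim exE conjE)
  define A where "A = (1 + C*CL)*(2*(1 + (b-a) + (d-c)))"
  define K1 where "K1 = sqrt (2*CL/\<alpha>) + ((b-a) + (d-c))/h1"
  define K2 where "K2 = 2*CL*C1 + 1 + (b-a)\<^sup>2/h1^2"
  define K where "K = A*(K2 + h0*K2 + K1 + h0^2*K2 + h0*K1 + 2)"
  have pos: "0 < A" "0 <= K1" "0 <= K2" using C C1 CL_pos ab cd \<alpha> by (simp_all add: A_def K1_def K2_def add_pos_pos)
  have K: "0 < K" unfolding K_def using pos assms(7) by (intro mult_pos_pos add_nonneg_pos add_nonneg_nonneg) auto
  have main: "sobolev_norm \<Omega> 0 (%p. u p - uh p) + mesh_size T * sobolev_norm \<Omega> 1 (%p. u p - uh p)
    + (mesh_size T)\<^sup>2 * sobolev_norm \<Omega> 2 (%p. u p - uh p) <= K*(1+h0)*mesh_size T ^ r * sobolev_norm \<Omega> (r+1) u"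
   if T: "mesh_of a b c d T" "quasi_uniform Cq T" "mesh_size T <= h0" and u: "u \<in> sobolev \<Omega> l"
    and bvp: "solves_bvp \<Omega> \<alpha> \<beta> \<gamma> f u" and pg: "solves_pg \<Omega> T k \<alpha> \<beta> \<gamma> f uh" for T f u uh
  proof -
   let ?H = "mesh_size T"
   note qu = T(2)[unfolded quasi_uniform_def]
   interpret scheme a b c d \<alpha> \<gamma> \<beta> "nx T" "xpt T" "ny T" "ypt T" n ?H "min_edge T"
    using mesh2[OF T(1)] pde_axioms by (simp add: scheme_def)
   have u': "u \<in> sobolev (rect a b c d) (r+1)" "u \<in> sobolev10 (rect a b c d)"
    using has_weak_pd_sobolev_mono[OF u r(2)] bvp assms(3) by (auto simp: solves_bvp_def)
   define S where "S = sobolev_norm \<Omega> (r+1) u"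
   obtain U where wd: "weak_derivs a b c d (r+1) U" and bu: "brep a b c d u (U 0 0)"
    and wu: "!!i j. i + j <= r + 1 ==> has_weak_pd Dom i j u (U i j)"
    and b: "!!i j. i + j <= r + 1 ==> brep a b c d (weak_pd Dom i j u) (U i j)"
    and S: "!!i j. i + j <= r + 1 ==> nrm R (U i j) <= S"
    using sobolev_weak_derivs[OF assms(1,2) _ u'] r(1) unfolding S_def assms(3) by auto
   have S0: "0 <= S" using S[of 0 0] nrm_nonneg[of R "U 0 0"] by linarith
   have Usq: "U 2 0 \<in> sqint R" "U 0 2 \<in> sqint R" using weak_derivs.U_sq[OF wd] r(1) by auto
   have "AE p in R. f p = LL (U 2 0) (U 0 2) p" by (rule bvp_rhs[OF wd bu b bvp[unfolded assms(3)]])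
   then have bf: "brep a b c d f (LL (U 2 0) (U 0 2))" unfolding brep_def using LL_sqint[OF Usq] by blast
   have "solves_pg Dom TT (Suc n) \<alpha> \<beta> \<gamma> f uh" using pg n(2) assms(3) by simp
   from pg_repr[OF this bf] obtain cf where uh: "!!p. p \<in> Dom ==> uh p = Gx a b (Gy c d (on2.comb cf)) p"
    and gal: "PP (LL (U 2 0) (U 0 2)) = PP (Lh cf)" by metis
   have st: "size2 cf <= C*nrm R (PP (Lh cf))" for cf
    using stab[rule_format, OF mesh2[OF T(1)] qu T(3), of cf] unfolding size2_gsize nrm_PP comb_zz .
   have "i + j <= 2 ==> has_weak_pd Dom i j u (U i j)" for i j using wu r(1) by simp
   note se = sobolev_error[OF bu this wd uh gal]
   note low = lower_order_error[OF se(1-4) C1(2) less_imp_le[OF C1(1)] fine[rule_format, OF mesh2[OF T(1)] qu]]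
   note so = second_order_error[OF st less_imp_le[OF C] wd r(1) order_refl r(3) S gal]
   have H0: "0 < ?H" by (rule H_pos)
   have "sobolev_norm \<Omega> 0 (%p. u p - uh p) + ?H * sobolev_norm \<Omega> 1 (%p. u p - uh p) + ?H^2 * sobolev_norm \<Omega> 2 (%p. u p - uh p)
     <= K*(?H^2*(?H ^ (r-2)*S))"
    unfolding K_def
   proof (rule final_bound[OF H0 T(3) _ pos(2,3) less_imp_le[OF pos(1)] so[folded A_def] low[folded K1_def K2_def]])
    show "0 <= ?H ^ (r-2)*S" using S0 H0 by simp
   qed (use se(5-7) assms(3) in auto)
   also have "... <= K*((1+h0)*(?H ^ r*S))"
   proof -
    \<comment> \<open>For r = 1 the truncated exponent r - 2 is 0, and $H^2$ has to be compared with
      H; the extra factor H is at most h0. In all other cases the powers match exactly.\<close>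
    have HS: "0 <= ?H ^ r*S" using S0 H0 by simp
    have "?H^2*(?H ^ (r-2)*S) <= (1+h0)*(?H ^ r*S)"
    proof (cases "r = 1")
     case True
     have "?H^2*(?H ^ (r-2)*S) = ?H*(?H ^ r*S)" using True by (simp add: power2_eq_square)
     also have "... <= (1+h0)*(?H ^ r*S)" using T(3) HS by (intro mult_right_mono) auto
     finally show ?thesis .
    next
     case False
     then have "r = 2 + (r-2)" using r(1) by simp
     then have "?H ^ r = ?H^2 * ?H ^ (r-2)" using power_add[of ?H 2 "r - 2"] by simp
     then have "?H^2*(?H ^ (r-2)*S) = 1*(?H ^ r*S)" by simp
     also have "... <= (1+h0)*(?H ^ r*S)" using assms(7) HS by (intro mult_right_mono) auto
     finally show ?thesis .
    qed
    then show ?thesis using K by simp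
   qed
   finally show ?thesis by (simp add: S_def mult.assoc)
  qed
  have "0 < K*(1+h0)" using K assms(7) by simp
  then show ?thesis using main by blast
 qed
qed

end
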